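(* Let $J$ be an $m\times m$ signature matrix, $n\in\mathbb N_0$, $(A_j)_{j=0}^n$ a strict $J$-Potapov sequence, and $w\in\mathbb D$. (a) Every $f\in\mathcal P_{J,0}[\mathbb D,(A_j)_{j=0}^n]$ is holomorphic at $w$ if and only if $\det\rho_{n,J}(w)\ne0$ and $\chi_{n,J}(w):=w\sqrt{R_{n+1,J}}\rho_{n,J}(w)^{-1}J\tilde\sigma_{n,J}^{[n]}(w)\sqrt{L_{n+1,J}}^{-1}$ is strictly contractive. Moreover, $\mathbb H^{(n)}:=\bigcap_{f\in\mathcal P_{J,0}[\mathbb D,(A_j)_{j=0}^n]}\mathbb H_f$ is open in $\mathbb D$ and contains a disk $\{|v|<r\}$ for some $r>0$. (b) If $w\in\mathbb H^{(n)}$, then the matrices $\Phi_{n,J}(w):=\tau_{n,J}(w)^*L_{n+1,J}^{-1}\tau_{n,J}(w)-|w|^2J\tilde\pi_{n,J}^{[n]}(w)^*R_{n+1,J}^{-1}\tilde\pi_{n,J}^{[n]}(w)J$ and $\Psi_{n,J}(w):=\rho_{n,J}(w)R_{n+1,J}^{-1}\rho_{n,J}(w)^*-|w|^2J\tilde\sigma_{n,J}^{[n]}(w)L_{n+1,J}^{-1}\tilde\sigma_{n,J}^{[n]}(w)^*J$ are positive Hermitian, and $$\{f(w):f\in\mathcal P_{J,0}[\mathbb D,(A_j)_{j=0}^n]\}=\mathfrak K\big(\mathcal M_{n,J}(w);|w|^{n+1}\sqrt{\mathcal L_{n,J}(w)},\sqrt{\mathcal R_{n,J}(w)}\big),$$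 where $\mathcal M_{n,J}(w):=\Phi_{n,J}(w)^{-1}\big(\tau_{n,J}(w)^*L_{n+1,J}^{-1}\sigma_{n,J}(w)-|w|^2J\tilde\pi_{n,J}^{[n]}(w)^*R_{n+1,J}^{-1}\tilde\rho_{n,J}^{[n]}(w)J\big)$, $\mathcal L_{n,J}(w):=\Phi_{n,J}(w)^{-1}$, $\mathcal R_{n,J}(w):=\Psi_{n,J}(w)^{-1}$. Moreover, $\mathcal M_{n,J}(w)=\big(\pi_{n,J}(w)R_{n+1,J}^{-1}\rho_{n,J}(w)^*-|w|^2J\tilde\tau_{n,J}^{[n]}(w)L_{n+1,J}^{-1}\tilde\sigma_{n,J}^{[n]}(w)^*J\big)\Psi_{n,J}(w)^{-1}$. (c) If $w\in\mathbb H^{(n)}$, then $\det\mathcal L_{n,J}(w)=\det\mathcal R_{n,J}(w)$.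
   Context: $\mathbb D=\{|z|<1\}$. An $m\times m$ signature matrix is $J\in\mathbb C^{m\times m}$ with $J^*=J$, $J^2=I_m$. $A$ is $J$-contractive if $J-A^*JA\ge0$. $\mathbb H_f$: holomorphy points of $f$. $\mathcal P_{J,0}(\mathbb D)$: $\mathbb C^{m\times m}$-valued $f$ meromorphic in $\mathbb D$ with $0\in\mathbb H_f$ and $f(w)$ $J$-contractive on $\mathbb H_f$; $\mathcal P_{J,0}[\mathbb D,(A_j)_{j=0}^n]$: those with $f^{(j)}(0)/j!=A_j$, $j\le n$. A matrix is strictly contractive if its spectral norm is $<1$. Matrix ball: $\mathfrak K(M;L,R):=\{M+LKR:K\in\mathbb C^{m\times m},\|K\|\le1\}$. For $k\in\mathbb N_0$, $S_k$ is the block lower triangular Toeplitz matrix with $(i,l)$ block $A_{i-l}$ ($i\ge l$), $0$ otherwise; $J_{[k]}:=\mathrm{diag}(J,\dots,J)$ ($k+1$ blocks). Strict $J$-Potapov: $J_{[n]}-S_n^*J_{[n]}S_n>0$. $P_{k,J}:=J_{[k]}-S_kJ_{[k]}S_k^*$, $Q_{k,J}:=J_{[k]}-S_k^*J_{[k]}S_k$, $y_k:=(A_1^*,\dots,A_k^* )^*$, $z_k:=(A_k,\dots,A_1)$. $L_{1,J}:=J-A_0JA_0^*$, $R_{1,J}:=J-A_0^*JA_0$; for $n\ge1$, $L_{n+1,J}:=J-A_0JA_0^*-z_nQ_{n-1,J}^{-1}z_n^*$, $R_{n+1,J}:=J-A_0^*JA_0-y_n^*P_{n-1,J}^{-1}y_n$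 (positive Hermitian in the strict case); $\sqrt X$ positive square root. $e_{k,m}(w):=(I_m,\dots,w^kI_m)$, $\varepsilon_{k,m}(w):=$ block column $(w^kI_m;\dots;I_m)$; $\tilde b^{[n]}(w):=\sum_{k=0}^nw^{n-k}B_k^*$ for $b(w)=\sum_{k=0}^nw^kB_k$. With $V_n:=Q_{n-1,J}^{-1}S_{n-1}^*J_{[n-1]}y_n$, $W_n:=z_nJ_{[n-1]}S_{n-1}^*P_{n-1,J}^{-1}$: $\pi_{n,J}(w)=A_0+we_{n-1,m}(w)(y_n+S_{n-1}V_n)$, $\rho_{n,J}(w)=I_m+we_{n-1,m}(w)V_n$, $\sigma_{n,J}(w)=(W_nS_{n-1}+z_n)w\varepsilon_{n-1,m}(w)+A_0$, $\tau_{n,J}(w)=W_nw\varepsilon_{n-1,m}(w)+I_m$ ($\pi_{0,J}=\sigma_{0,J}=A_0$, $\rho_{0,J}=\tau_{0,J}=I_m$). *)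

theory Defs
  imports "HOL-Analysis.Analysis" "Jordan_Normal_Form.Determinant"
begin

definition madj :: "complex mat \<Rightarrow> complex mat" where
  "madj A = mat (dim_col A) (dim_row A) (\<lambda>(i,j). cnj (A $$ (j,i)))"

definition minv :: "complex mat \<Rightarrow> complex mat" where
  "minv A = (if (\<exists>B. B \<in> carrier_mat (dim_row A) (dim_row A) \<and> A * B = 1\<^sub>m (dim_row A) \<and> B * A = 1\<^sub>m (dim_row A))
     then (THE B. B \<in> carrier_mat (dim_row A) (dim_row A) \<and> A * B = 1\<^sub>m (dim_row A) \<and> B * A = 1\<^sub>m (dim_row A))
     else 0\<^sub>m (dim_row A) (dim_row A))"

definition hermitian :: "complex mat \<Rightarrow> bool" where
  "hermitian A \<longleftrightarrow> A \<in> carrier_mat (dim_row A) (dim_row A) \<and> madj A = A"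

definition qform :: "complex mat \<Rightarrow> complex vec \<Rightarrow> complex" where
  "qform A x = (\<Sum>i<dim_row A. \<Sum>j<dim_row A. cnj (x $ i) * A $$ (i,j) * x $ j)"

definition psd :: "complex mat \<Rightarrow> bool" where
  "psd A \<longleftrightarrow> hermitian A \<and> (\<forall>x. dim_vec x = dim_row A \<longrightarrow> Re (qform A x) \<ge> 0)"

definition posdef :: "complex mat \<Rightarrow> bool" where
  "posdef A \<longleftrightarrow> hermitian A \<and> (\<forall>x. dim_vec x = dim_row A \<longrightarrow> x \<noteq> 0\<^sub>v (dim_row A) \<longrightarrow> Re (qform A x) > 0)"

definition msqrt :: "complex mat \<Rightarrow> complex mat" where
  "msqrt A = (THE S. psd S \<and> dim_row S = dim_row A \<and> S * S = A)"

definition vnorm :: "complex vec \<Rightarrow> real" where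
  "vnorm x = sqrt (\<Sum>i<dim_vec x. (cmod (x $ i))\<^sup>2)"

definition spec_norm :: "complex mat \<Rightarrow> real" where
  "spec_norm K = Sup {vnorm (K *\<^sub>v x) | x. dim_vec x = dim_col K \<and> vnorm x \<le> 1}"

definition signature_mat :: "nat \<Rightarrow> complex mat \<Rightarrow> bool" where
  "signature_mat m J \<longleftrightarrow> J \<in> carrier_mat m m \<and> madj J = J \<and> J * J = 1\<^sub>m m"

definition J_contractive :: "complex mat \<Rightarrow> complex mat \<Rightarrow> bool" where
  "J_contractive J A \<longleftrightarrow> psd (J - madj A * J * A)"

definition matrix_ball :: "nat \<Rightarrow> complex mat \<Rightarrow> complex mat \<Rightarrow> complex mat \<Rightarrow> complex mat set" where
  "matrix_ball m M L R = {M + L * K * R | K. K \<in> carrier_mat m m \<and> spec_norm K \<le> 1}"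

abbreviation unit_disk :: "complex set" where "unit_disk \<equiv> ball 0 1"

definition hol_pts :: "nat \<Rightarrow> (complex \<Rightarrow> complex mat) \<Rightarrow> complex set" where
  "hol_pts m f = {w \<in> unit_disk. \<forall>i<m. \<forall>j<m. (\<lambda>z. f z $$ (i,j)) analytic_on {w}}"

text \<open>f is meromorphic in the disk: the non-holomorphy points are isolated in the disk, and at each point
  every entry is either holomorphic or has a pole (tends to infinity). The values of f at poles are
  irrelevant.\<close>
definition mero_disk :: "nat \<Rightarrow> (complex \<Rightarrow> complex mat) \<Rightarrow> bool" where
  "mero_disk m f \<longleftrightarrow> (\<forall>z. f z \<in> carrier_mat m m) \<and>
     (\<forall>p\<in>unit_disk. \<not> p islimpt (unit_disk - hol_pts m f)) \<and>
     (\<forall>p\<in>unit_disk. \<forall>i<m. \<forall>j<m. (\<lambda>z. f z $$ (i,j)) analytic_on {p} \<or>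
          filterlim (\<lambda>z. f z $$ (i,j)) at_infinity (at p))"

definition taylor_coeff :: "nat \<Rightarrow> (complex \<Rightarrow> complex mat) \<Rightarrow> nat \<Rightarrow> complex mat" where
  "taylor_coeff m f k = mat m m (\<lambda>(i,j). (deriv ^^ k) (\<lambda>z. f z $$ (i,j)) 0 / of_nat (fact k))"

definition PJ0 :: "nat \<Rightarrow> complex mat \<Rightarrow> (complex \<Rightarrow> complex mat) set" where
  "PJ0 m J = {f. mero_disk m f \<and> 0 \<in> hol_pts m f \<and> (\<forall>w\<in>hol_pts m f. J_contractive J (f w))}"

definition PJ0_int :: "nat \<Rightarrow> complex mat \<Rightarrow> nat \<Rightarrow> (nat \<Rightarrow> complex mat) \<Rightarrow> (complex \<Rightarrow> complex mat) set" where
  "PJ0_int m J n A = {f \<in> PJ0 m J. \<forall>j\<le>n. taylor_coeff m f j = A j}"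

definition Smat :: "nat \<Rightarrow> (nat \<Rightarrow> complex mat) \<Rightarrow> nat \<Rightarrow> complex mat" where
  "Smat m A k = mat (m*(k+1)) (m*(k+1))
     (\<lambda>(r,c). if c div m \<le> r div m then A (r div m - c div m) $$ (r mod m, c mod m) else 0)"

definition Jblk :: "nat \<Rightarrow> complex mat \<Rightarrow> nat \<Rightarrow> complex mat" where
  "Jblk m J k = mat (m*(k+1)) (m*(k+1))
     (\<lambda>(r,c). if r div m = c div m then J $$ (r mod m, c mod m) else 0)"

definition strict_J_Potapov :: "nat \<Rightarrow> complex mat \<Rightarrow> nat \<Rightarrow> (nat \<Rightarrow> complex mat) \<Rightarrow> bool" where
  "strict_J_Potapov m J n A \<longleftrightarrow> (\<forall>j\<le>n. A j \<in> carrier_mat m m) \<and>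
     posdef (Jblk m J n - madj (Smat m A n) * Jblk m J n * Smat m A n)"

definition Pmat :: "nat \<Rightarrow> complex mat \<Rightarrow> (nat \<Rightarrow> complex mat) \<Rightarrow> nat \<Rightarrow> complex mat" where
  "Pmat m J A k = Jblk m J k - Smat m A k * Jblk m J k * madj (Smat m A k)"

definition Qmat :: "nat \<Rightarrow> complex mat \<Rightarrow> (nat \<Rightarrow> complex mat) \<Rightarrow> nat \<Rightarrow> complex mat" where
  "Qmat m J A k = Jblk m J k - madj (Smat m A k) * Jblk m J k * Smat m A k"

definition yvec :: "nat \<Rightarrow> (nat \<Rightarrow> complex mat) \<Rightarrow> nat \<Rightarrow> complex mat" where
  "yvec m A k = mat (m*k) m (\<lambda>(r,c). A (r div m + 1) $$ (r mod m, c))"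

definition zvec :: "nat \<Rightarrow> (nat \<Rightarrow> complex mat) \<Rightarrow> nat \<Rightarrow> complex mat" where
  "zvec m A k = mat m (m*k) (\<lambda>(r,c). A (k - c div m) $$ (r, c mod m))"

text \<open>Lmat n = L_{n+1,J}, Rmat n = R_{n+1,J}\<close>
definition Lmat :: "nat \<Rightarrow> complex mat \<Rightarrow> (nat \<Rightarrow> complex mat) \<Rightarrow> nat \<Rightarrow> complex mat" where
  "Lmat m J A n = (if n = 0 then J - A 0 * J * madj (A 0)
     else J - A 0 * J * madj (A 0) - zvec m A n * minv (Qmat m J A (n-1)) * madj (zvec m A n))"

definition Rmat :: "nat \<Rightarrow> complex mat \<Rightarrow> (nat \<Rightarrow> complex mat) \<Rightarrow> nat \<Rightarrow> complex mat" where
  "Rmat m J A n = (if n = 0 then J - madj (A 0) * J * A 0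
     else J - madj (A 0) * J * A 0 - madj (yvec m A n) * minv (Pmat m J A (n-1)) * yvec m A n)"

definition erow :: "nat \<Rightarrow> nat \<Rightarrow> complex \<Rightarrow> complex mat" where
  "erow m k w = mat m (m*(k+1)) (\<lambda>(r,c). if r = c mod m then w ^ (c div m) else 0)"

definition ecol :: "nat \<Rightarrow> nat \<Rightarrow> complex \<Rightarrow> complex mat" where
  "ecol m k w = mat (m*(k+1)) m (\<lambda>(r,c). if r mod m = c then w ^ (k - r div m) else 0)"

definition Vmat :: "nat \<Rightarrow> complex mat \<Rightarrow> (nat \<Rightarrow> complex mat) \<Rightarrow> nat \<Rightarrow> complex mat" where
  "Vmat m J A n = minv (Qmat m J A (n-1)) * madj (Smat m A (n-1)) * Jblk m J (n-1) * yvec m A n"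

definition Wmat :: "nat \<Rightarrow> complex mat \<Rightarrow> (nat \<Rightarrow> complex mat) \<Rightarrow> nat \<Rightarrow> complex mat" where
  "Wmat m J A n = zvec m A n * Jblk m J (n-1) * madj (Smat m A (n-1)) * minv (Pmat m J A (n-1))"

definition pi_fun :: "nat \<Rightarrow> complex mat \<Rightarrow> (nat \<Rightarrow> complex mat) \<Rightarrow> nat \<Rightarrow> complex \<Rightarrow> complex mat" where
  "pi_fun m J A n w = (if n = 0 then A 0 else
     A 0 + w \<cdot>\<^sub>m (erow m (n-1) w * (yvec m A n + Smat m A (n-1) * Vmat m J A n)))"

definition rho_fun :: "nat \<Rightarrow> complex mat \<Rightarrow> (nat \<Rightarrow> complex mat) \<Rightarrow> nat \<Rightarrow> complex \<Rightarrow> complex mat" where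
  "rho_fun m J A n w = (if n = 0 then 1\<^sub>m m else
     1\<^sub>m m + w \<cdot>\<^sub>m (erow m (n-1) w * Vmat m J A n))"

definition sigma_fun :: "nat \<Rightarrow> complex mat \<Rightarrow> (nat \<Rightarrow> complex mat) \<Rightarrow> nat \<Rightarrow> complex \<Rightarrow> complex mat" where
  "sigma_fun m J A n w = (if n = 0 then A 0 else
     (Wmat m J A n * Smat m A (n-1) + zvec m A n) * (w \<cdot>\<^sub>m ecol m (n-1) w) + A 0)"

definition tau_fun :: "nat \<Rightarrow> complex mat \<Rightarrow> (nat \<Rightarrow> complex mat) \<Rightarrow> nat \<Rightarrow> complex \<Rightarrow> complex mat" where
  "tau_fun m J A n w = (if n = 0 then 1\<^sub>m m else
     Wmat m J A n * (w \<cdot>\<^sub>m ecol m (n-1) w) + 1\<^sub>m m)"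

text \<open>For a matrix polynomial b(w) = sum_{k<=n} w^k B_k (B_k its Taylor coefficients at 0),
  the reciprocal polynomial tilde b^[n](w) = sum_{k<=n} w^(n-k) B_k^*.\<close>
definition tilde :: "nat \<Rightarrow> nat \<Rightarrow> (complex \<Rightarrow> complex mat) \<Rightarrow> complex \<Rightarrow> complex mat" where
  "tilde m n b w = foldr (\<lambda>k acc. w ^ (n-k) \<cdot>\<^sub>m madj (taylor_coeff m b k) + acc) [0..<Suc n] (0\<^sub>m m m)"

end

theory Submission
  imports Defs "HOL-Complex_Analysis.Complex_Analysis"
begin

text \<open>Put \<open>r = R\<^bsup>-1/2\<^esup>\<close> and \<open>l = L\<^bsup>-1/2\<^esup>\<close>. The block Toeplitz relations behind \<open>\<pi>, \<rho>, \<sigma>, \<tau>\<close> say that the polynomials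
  \<open>\<pi> r\<close>, \<open>\<rho> r\<close>, \<open>J \<tau>~ l\<close>, \<open>J \<sigma>~ l\<close> satisfy four congruences modulo \<open>w\<^bsup>n+1\<^esup>\<close> with the data \<open>\<Sum> A\<^sub>j w\<^sup>j\<close>; by degree and
  self-reciprocity these become identities which make \<open>\<Theta> = ((\<pi> r, J \<tau>~ l), (\<rho> r, J \<sigma>~ l))\<close> a resolvent matrix.
  The interpolants are exactly the transforms \<open>f = (\<pi> r + w J \<tau>~ l K) (\<rho> r + w J \<sigma>~ l K)\<^sup>-\<^sup>1\<close> of contractive analytic
  functions \<open>K\<close>. Given \<open>f\<close>, solve for \<open>K\<close> as a formal power series: the Potapov-Ginzburg transform and the Bessel
  inequality make the Toeplitz forms of \<open>f\<close> nonnegative, whence \<open>K\<close> is contractive and converges in the disk.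
  For constant \<open>K\<close> a Christoffel-Darboux formula shows that \<open>f\<close> is \<open>J\<close>-contractive, and constants already produce all
  values at a given point \<open>w\<close>.

  The transform has no pole at \<open>w\<close> for all contractive \<open>K\<close> iff \<open>\<Psi>(w) > 0\<close>, since otherwise a rank one contraction makes
  the denominator singular; factoring out \<open>\<rho> r\<close> this is strict contractivity of \<open>\<chi>(w)\<close>. Completing the square in the
  condition that the inverse transform of \<open>X\<close> is a contraction exhibits the set of values as the matrix ball. The
  determinants of \<open>\<Phi>\<close> and \<open>\<Psi>\<close> agree by Sylvester's identity and \<open>\<bar>det (l \<tau>)\<bar> = \<bar>det (\<rho> r)\<bar>\<close>.\<close>

section \<open>A ring of finite matrices\<close>

text \<open>For indefinite \<open>J\<close> an interpolant may have poles in the disk and need not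
  be bounded, so its boundary values and its full Toeplitz operator are not at hand. Only its Taylor
  series at 0 is safe. Therefore the parameter \<open>K\<close> is first found formally there, and
  finite sections of the Toeplitz form, which involve finitely many coefficients each, are enough to
  bound it. The resulting identity between \<open>f\<close> and \<open>K\<close> spreads to all
  holomorphy points because the disk minus a discrete set is connected. The nonnegativity of these
  sections needs a detour of its own: the Potapov-Ginzburg transform of \<open>f\<close> is
  contractive off a discrete set, hence extends holomorphically across the poles of
  \<open>f\<close>. The origin is exceptional. There the transform loses its parameter, so the
  pointwise analysis assumes \<open>w \<noteq> 0\<close>; at 0 every interpolant has the value
  \<open>A 0\<close> and the radius of the ball vanishes.\<close>

declare One_nat_def [simp del]

text \<open>Matrices of all sizes live in one ring, over which formal power series are available.\<close>

typedef fmat = "{x :: nat \<Rightarrow> nat \<Rightarrow> complex. \<exists>N. \<forall>i j. x i j \<noteq> 0 \<longrightarrow> i < N \<and> j < N}"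
  morphisms ent Abs_fmat
  by (rule exI[of _ "\<lambda>_ _. 0"]) auto

definition bounded_by :: "nat \<Rightarrow> fmat \<Rightarrow> bool" where
  "bounded_by N x \<longleftrightarrow> (\<forall>i j. ent x i j \<noteq> 0 \<longrightarrow> i < N \<and> j < N)"

definition bound :: "fmat \<Rightarrow> nat" where
  "bound x = (SOME N. bounded_by N x)"

lemma bounded_by_bound: "bounded_by (bound x) x"
proof -
  have "\<exists>N. bounded_by N x"
    using ent[of x] by (auto simp: bounded_by_def)
  then show ?thesis
    unfolding bound_def by (rule someI_ex)
qed

lemma bounded_by_mono: "bounded_by N x \<Longrightarrow> N \<le> M \<Longrightarrow> bounded_by M x"
  by (fastforce simp: bounded_by_def)

lemma bounded_by_zero: "bounded_by N x \<Longrightarrow> N \<le> k \<Longrightarrow> ent x i k = 0"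
  unfolding bounded_by_def using leD by blast

lemma bounded_by_max: "bounded_by (max (bound x) (bound y)) x" "bounded_by (max (bound x) (bound y)) y"
  by (rule bounded_by_mono[OF bounded_by_bound], simp)+

lemma fmat_eqI: "(\<And>i j. ent x i j = ent y i j) \<Longrightarrow> x = y"
  by (metis ent_inject ext)

lemma ent_Abs_fmat:
  assumes "\<And>i j. f i j \<noteq> 0 \<Longrightarrow> i < N \<and> j < N"
  shows "ent (Abs_fmat f) = f"
  by (rule Abs_fmat_inverse) (use assms in auto)

instantiation fmat :: ab_group_add
begin

definition "0 = Abs_fmat (\<lambda>_ _. 0)"
definition "x + y = Abs_fmat (\<lambda>i j. ent x i j + ent y i j)"
definition "x - y = Abs_fmat (\<lambda>i j. ent x i j - ent y i j)"
definition "- x = Abs_fmat (\<lambda>i j. - ent x i j)"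

lemma ent_zero [simp]: "ent 0 i j = 0"
  unfolding zero_fmat_def by (subst ent_Abs_fmat[of _ 0]) auto

lemma ent_add [simp]: "ent (x + y) i j = ent x i j + ent y i j"
proof -
  define N where "N = max (bound x) (bound y)"
  have "bounded_by N x" "bounded_by N y"
    unfolding N_def by (rule bounded_by_max)+
  then have "i < N \<and> j < N" if "ent x i j + ent y i j \<noteq> 0" for i j
    using that unfolding bounded_by_def by (cases "ent x i j = 0") auto
  then show ?thesis
    unfolding plus_fmat_def by (subst ent_Abs_fmat[of _ N]) auto
qed

lemma ent_diff [simp]: "ent (x - y) i j = ent x i j - ent y i j"
proof -
  define N where "N = max (bound x) (bound y)"
  have "bounded_by N x" "bounded_by N y"
    unfolding N_def by (rule bounded_by_max)+
  then have "i < N \<and> j < N" if "ent x i j - ent y i j \<noteq> 0" for i j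
    using that unfolding bounded_by_def by (cases "ent x i j = 0") auto
  then show ?thesis
    unfolding minus_fmat_def by (subst ent_Abs_fmat[of _ N]) auto
qed

lemma ent_minus [simp]: "ent (- x) i j = - ent x i j"
  using bounded_by_bound[of x] unfolding uminus_fmat_def
  by (subst ent_Abs_fmat[of _ "bound x"]) (auto simp: bounded_by_def)

instance
  by standard (auto intro!: fmat_eqI)

end

lemma ent_sum: "ent (sum f A) i j = (\<Sum>a\<in>A. ent (f a) i j)"
  by (induction A rule: infinite_finite_induct) auto

instantiation fmat :: ring
begin

definition "x * y = Abs_fmat (\<lambda>i j. \<Sum>k<bound x. ent x i k * ent y k j)"

text \<open>Cutting the sum at any bound of the left factor suffices, since all later summands
  vanish. Products in one computation can thus be expanded over a common range instead of over the
  arbitrary \<open>bound\<close> of each factor.\<close>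

lemma ent_mult':
  assumes "bounded_by N x"
  shows "ent (x * y) i j = (\<Sum>k<N. ent x i k * ent y k j)"
proof -
  define M where "M = max (bound x) (bound y)"
  have b: "bounded_by M x" "bounded_by M y" "bounded_by (bound x) x"
    unfolding M_def by (rule bounded_by_max bounded_by_bound)+
  have "i < M \<and> j < M" if "(\<Sum>k<bound x. ent x i k * ent y k j) \<noteq> 0" for i j
  proof -
    have "\<exists>k. ent x i k * ent y k j \<noteq> 0"
      using that by (rule contrapos_np) (auto intro!: sum.neutral)
    then show ?thesis
      using b by (auto simp: bounded_by_def)
  qed
  then have "ent (x * y) i j = (\<Sum>k<bound x. ent x i k * ent y k j)"
    unfolding times_fmat_def by (subst ent_Abs_fmat[of _ M]) auto
  also have "\<dots> = (\<Sum>k<max N (bound x). ent x i k * ent y k j)"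
    by (rule sum.mono_neutral_left) (use b(3) in \<open>auto simp: bounded_by_zero\<close>)
  also have "\<dots> = (\<Sum>k<N. ent x i k * ent y k j)"
    by (rule sum.mono_neutral_right) (use assms in \<open>auto simp: bounded_by_zero\<close>)
  finally show ?thesis .
qed

instance
proof
  fix x y z :: fmat
  \<comment> \<open>The bounds of \<open>x * y\<close> and \<open>x + y\<close> are included because
    these two also occur as left factors.\<close>
  define N where "N = Max {bound x, bound y, bound z, bound (x * y), bound (x + y)}"
  have b: "bounded_by N x" "bounded_by N y" "bounded_by N z" "bounded_by N (x * y)" "bounded_by N (x + y)"
    by (rule bounded_by_mono[OF bounded_by_bound]; simp add: N_def)+
  show "x * y * z = x * (y * z)"
    by (rule fmat_eqI)
       (simp add: ent_mult'[OF b(1)] ent_mult'[OF b(2)] ent_mult'[OF b(4)] sum_distrib_left sum_distrib_right mult.assoc, subst sum.swap, rule refl)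
  show "(x + y) * z = x * z + y * z"
    by (rule fmat_eqI) (simp add: ent_mult'[OF b(1)] ent_mult'[OF b(2)] ent_mult'[OF b(5)] algebra_simps sum.distrib)
  show "x * (y + z) = x * y + x * z"
    by (rule fmat_eqI) (simp add: ent_mult'[OF b(1)] algebra_simps sum.distrib)
qed

end

definition adj :: "fmat \<Rightarrow> fmat" where
  "adj x = Abs_fmat (\<lambda>i j. cnj (ent x j i))"

definition sc :: "complex \<Rightarrow> fmat \<Rightarrow> fmat" where
  "sc c x = Abs_fmat (\<lambda>i j. c * ent x i j)"

definition mk :: "nat \<Rightarrow> nat \<Rightarrow> (nat \<Rightarrow> nat \<Rightarrow> complex) \<Rightarrow> fmat" where
  "mk p q f = Abs_fmat (\<lambda>i j. if i < p \<and> j < q then f i j else 0)"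

definition idm :: "nat \<Rightarrow> fmat" where
  "idm m = mk m m (\<lambda>i j. if i = j then 1 else 0)"

lemma ent_adj [simp]: "ent (adj x) i j = cnj (ent x j i)"
  using bounded_by_bound[of x] unfolding adj_def
  by (subst ent_Abs_fmat[of _ "bound x"]) (auto simp: bounded_by_def)

lemma ent_sc [simp]: "ent (sc c x) i j = c * ent x i j"
  using bounded_by_bound[of x] unfolding sc_def
  by (subst ent_Abs_fmat[of _ "bound x"]) (auto simp: bounded_by_def)

lemma ent_mk [simp]: "ent (mk p q f) i j = (if i < p \<and> j < q then f i j else 0)"
  unfolding mk_def
  by (subst ent_Abs_fmat[of _ "max p q"]) (auto split: if_splits)

lemma ent_idm [simp]: "ent (idm m) i j = (if i = j \<and> i < m then 1 else 0)"
  by (auto simp: idm_def)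

lemma ent_mult_rows:
  assumes "\<And>i k. k \<ge> N \<Longrightarrow> ent x i k = 0"
  shows "ent (x * y) i j = (\<Sum>k<N. ent x i k * ent y k j)"
proof -
  define M where "M = max N (bound x)"
  have "bounded_by M x"
    by (rule bounded_by_mono[OF bounded_by_bound]) (simp add: M_def)
  from ent_mult'[OF this] have "ent (x * y) i j = (\<Sum>k<M. ent x i k * ent y k j)" .
  also have "\<dots> = (\<Sum>k<N. ent x i k * ent y k j)"
    by (rule sum.mono_neutral_right) (use assms in \<open>auto simp: M_def\<close>)
  finally show ?thesis .
qed

lemma ent_mult_cols:
  assumes "\<And>k j. k \<ge> N \<Longrightarrow> ent y k j = 0"
  shows "ent (x * y) i j = (\<Sum>k<N. ent x i k * ent y k j)"
proof -
  define M where "M = max N (bound x)"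
  have "bounded_by M x"
    by (rule bounded_by_mono[OF bounded_by_bound]) (simp add: M_def)
  from ent_mult'[OF this] have "ent (x * y) i j = (\<Sum>k<M. ent x i k * ent y k j)" .
  also have "\<dots> = (\<Sum>k<N. ent x i k * ent y k j)"
    by (rule sum.mono_neutral_right) (use assms in \<open>auto simp: M_def\<close>)
  finally show ?thesis .
qed

lemma adj_simps [simp]:
  "adj 0 = 0" "adj (x + y) = adj x + adj y" "adj (x - y) = adj x - adj y" "adj (- x) = - adj x"
  "adj (adj x) = x" "adj (sc c x) = sc (cnj c) (adj x)" "adj (idm m) = idm m"
  by (auto intro!: fmat_eqI)

lemma adj_mult [simp]: "adj (x * y) = adj y * adj x"
proof -
  define N where "N = max (bound x) (bound y)"
  have b: "bounded_by N x" "bounded_by N y"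
    unfolding N_def by (rule bounded_by_max)+
  then have "bounded_by N (adj y)"
    by (auto simp: bounded_by_def)
  from ent_mult'[OF this] ent_mult'[OF b(1)] show ?thesis
    by (auto intro!: fmat_eqI simp: mult.commute)
qed

lemma adj_sum: "adj (sum f A) = (\<Sum>a\<in>A. adj (f a))"
  by (induction A rule: infinite_finite_induct) auto

lemma adj_inject: "adj x = adj y \<longleftrightarrow> x = y"
  by (metis adj_simps(5))

lemma sc_simps [simp]:
  "sc c 0 = 0" "sc 0 x = 0" "sc 1 x = x" "sc c (sc d x) = sc (c * d) x"
  by (auto intro!: fmat_eqI)

lemma sc_add_right: "sc c (x + y) = sc c x + sc c y"
  and sc_diff_right: "sc c (x - y) = sc c x - sc c y"
  and sc_minus_right: "sc c (- x) = - sc c x"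
  by (auto intro!: fmat_eqI simp: algebra_simps)

lemma sc_mult_left: "sc c x * y = sc c (x * y)"
proof (rule fmat_eqI)
  fix i j
  have b: "bounded_by (bound x) (sc c x)" "bounded_by (bound x) x"
    using bounded_by_bound[of x] by (auto simp: bounded_by_def)
  show "ent (sc c x * y) i j = ent (sc c (x * y)) i j"
    by (simp add: ent_mult'[OF b(1)] ent_mult'[OF b(2)] sum_distrib_left mult.assoc)
qed

lemma sc_mult_right: "x * sc c y = sc c (x * y)"
proof (rule fmat_eqI)
  fix i j
  show "ent (x * sc c y) i j = ent (sc c (x * y)) i j"
    by (simp add: ent_mult'[OF bounded_by_bound] sum_distrib_left mult_ac)
qed

lemma sc_sum: "sc c (sum f A) = (\<Sum>a\<in>A. sc c (f a))"
  by (induction A rule: infinite_finite_induct) (auto simp: sc_add_right)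

lemma sc_cancel: "c \<noteq> 0 \<Longrightarrow> sc c x = sc c y \<longleftrightarrow> x = y"
  by (metis sc_simps(3) sc_simps(4) left_inverse)

lemma sc_eq_0: "sc c x = 0 \<longleftrightarrow> c = 0 \<or> x = 0"
  by (metis sc_simps(1,2) sc_cancel)

lemma idm_left: "ent (idm m * x) i j = (if i < m then ent x i j else 0)"
  by (subst ent_mult_rows[of m]) (auto simp: if_distrib[of "\<lambda>c. c * _"] cong: if_cong)

lemma idm_right: "ent (x * idm m) i j = (if j < m then ent x i j else 0)"
  by (subst ent_mult_cols[of m]) (auto simp: if_distrib[of "\<lambda>c. _ * c"] cong: if_cong)

text \<open>Rectangular matrices are corners cut out by the idempotents \<open>idm p\<close>, so that the ambient ring has no unit.\<close>

definition shaped :: "nat \<Rightarrow> nat \<Rightarrow> fmat \<Rightarrow> bool" where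
  "shaped p q x \<longleftrightarrow> idm p * x = x \<and> x * idm q = x"

lemma shaped_iff: "shaped p q x \<longleftrightarrow> (\<forall>i j. \<not> (i < p \<and> j < q) \<longrightarrow> ent x i j = 0)"
proof
  assume "shaped p q x"
  then have "ent x i j = ent (idm p * x) i j" "ent x i j = ent (x * idm q) i j" for i j
    by (auto simp: shaped_def)
  then show "\<forall>i j. \<not> (i < p \<and> j < q) \<longrightarrow> ent x i j = 0"
    by (metis idm_left idm_right)
next
  assume *: "\<forall>i j. \<not> (i < p \<and> j < q) \<longrightarrow> ent x i j = 0"
  have "ent (idm p * x) i j = ent x i j \<and> ent (x * idm q) i j = ent x i j" for i j
    using *[rule_format, of i j] by (auto simp: idm_left idm_right)
  then show "shaped p q x"
    unfolding shaped_def by (auto intro!: fmat_eqI)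
qed

lemma shaped_left: "shaped p q x \<Longrightarrow> idm p * x = x"
  and shaped_right: "shaped p q x \<Longrightarrow> x * idm q = x"
  by (auto simp: shaped_def)

lemma shaped_left_assoc: "shaped p q x \<Longrightarrow> idm p * (x * y) = x * y"
  by (simp_all add: shaped_def mult.assoc[symmetric])

lemma shaped_intros [simp, intro]:
  "shaped p q 0" "shaped p q x \<Longrightarrow> shaped p q y \<Longrightarrow> shaped p q (x + y)"
  "shaped p q x \<Longrightarrow> shaped p q y \<Longrightarrow> shaped p q (x - y)"
  "shaped p q x \<Longrightarrow> shaped p q (- x)" "shaped p q x \<Longrightarrow> shaped p q (sc c x)"
  "shaped m m (idm m)" "shaped p q (mk p q f)" "shaped p q x \<Longrightarrow> shaped q p (adj x)"
  by (auto simp: shaped_iff)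

lemma shaped_mult [intro]: "shaped p q x \<Longrightarrow> shaped q s y \<Longrightarrow> shaped p s (x * y)"
  using shaped_left_assoc[of p q x y] shaped_right[of q s y] by (simp add: shaped_def mult.assoc)

lemma shaped_sum: "(\<And>a. a \<in> A \<Longrightarrow> shaped p q (f a)) \<Longrightarrow> shaped p q (sum f A)"
  by (induction A rule: infinite_finite_induct) auto

lemma ent_mult:
  assumes "shaped p q x"
  shows "ent (x * y) i j = (\<Sum>k<q. ent x i k * ent y k j)"
  by (rule ent_mult_rows) (use assms in \<open>auto simp: shaped_iff\<close>)

lemma fmat_eq_shapedI:
  assumes "shaped p q x" "shaped p q y" "\<And>i j. i < p \<Longrightarrow> j < q \<Longrightarrow> ent x i j = ent y i j"
  shows "x = y"
  using assms by (intro fmat_eqI) (metis shaped_iff)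

section \<open>Column vectors, their inner product and norm\<close>

definition ip :: "fmat \<Rightarrow> fmat \<Rightarrow> complex" where
  "ip x y = ent (adj x * y) 0 0"

definition nrm2 :: "fmat \<Rightarrow> real" where
  "nrm2 x = Re (ip x x)"

lemma ip_simps:
  "ip (x + y) z = ip x z + ip y z" "ip x (y + z) = ip x y + ip x z"
  "ip (x - y) z = ip x z - ip y z" "ip x (y - z) = ip x y - ip x z"
  "ip (- x) z = - ip x z" "ip x (- z) = - ip x z"
  "ip 0 z = 0" "ip z 0 = 0" "ip (sc c x) z = cnj c * ip x z" "ip x (sc c z) = c * ip x z"
  by (auto simp: ip_def algebra_simps sc_mult_left sc_mult_right)

lemma ip_sum_right: "ip z (sum f A) = (\<Sum>a\<in>A. ip z (f a))"
  by (induction A rule: infinite_finite_induct) (auto simp: ip_simps)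

lemma ip_mult_left: "ip (a * x) y = ip x (adj a * y)"
  and ip_mult_right: "ip x (a * y) = ip (adj a * x) y"
  by (auto simp: ip_def mult.assoc)

lemma ip_cnj: "cnj (ip x y) = ip y x"
proof -
  have "ip y x = ent (adj (adj x * y)) 0 0" by (simp only: ip_def adj_mult adj_simps)
  then show ?thesis by (simp only: ip_def ent_adj)
qed

lemma ip_self_real: "ip x x = complex_of_real (nrm2 x)"
  by (metis ip_cnj nrm2_def Reals_cnj_iff of_real_Re)

lemma ip_eq:
  assumes "shaped m q x"
  shows "ip x y = (\<Sum>i<m. cnj (ent x i 0) * ent y i 0)"
  unfolding ip_def using assms by (subst ent_mult_rows[of m]) (auto simp: shaped_iff)

lemma nrm2_eq:
  assumes "shaped m q x"
  shows "nrm2 x = (\<Sum>i<m. (cmod (ent x i 0))\<^sup>2)"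
  unfolding nrm2_def ip_eq[OF assms] Re_sum
  by (rule sum.cong) (auto simp: cmod_power2 power2_eq_square[of "Re _"] power2_eq_square[of "Im _"])

lemma shaped_exists: "\<exists>N. shaped N N x"
  using bounded_by_bound[of x] by (auto simp: bounded_by_def shaped_iff)

lemma nrm2_nonneg [simp]: "nrm2 x \<ge> 0"
proof -
  obtain N where "shaped N N x" using shaped_exists by blast
  then show ?thesis by (simp only: nrm2_eq) (simp add: sum_nonneg)
qed

lemma nrm2_eq_0_iff:
  assumes "shaped m 1 x"
  shows "nrm2 x = 0 \<longleftrightarrow> x = 0"
proof
  assume "nrm2 x = 0"
  then have "\<forall>i<m. ent x i 0 = 0"
    unfolding nrm2_eq[OF assms] by (subst (asm) sum_nonneg_eq_0_iff) auto
  with assms show "x = 0"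
    by (intro fmat_eq_shapedI[of m 1]) auto
qed (simp add: nrm2_def ip_simps)

lemma nrm2_0 [simp]: "nrm2 0 = 0"
  by (simp add: nrm2_def ip_simps)

lemma nrm2_sc: "nrm2 (sc c x) = (cmod c)\<^sup>2 * nrm2 x"
proof -
  have "ip (sc c x) (sc c x) = (c * cnj c) * ip x x"
    by (simp add: ip_simps)
  also have "\<dots> = complex_of_real ((cmod c)\<^sup>2 * nrm2 x)"
    by (simp add: ip_self_real flip: complex_norm_square)
  finally show ?thesis
    by (simp add: nrm2_def)
qed

lemma nrm2_minus: "nrm2 (- x) = nrm2 x"
  by (simp add: nrm2_def ip_simps)

lemma nrm2_add: "nrm2 (x + y) = nrm2 x + nrm2 y + 2 * Re (ip x y)"
  by (simp add: nrm2_def ip_simps) (metis ip_cnj complex_cnj(1) cnj.simps(1))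

lemma nrm2_diff: "nrm2 (x - y) = nrm2 x + nrm2 y - 2 * Re (ip x y)"
  using nrm2_add[of x "- y"] by (simp add: ip_simps nrm2_minus)

section \<open>Positive matrices and contractions\<close>

lemma herm_ip_cnj: "adj a = a \<Longrightarrow> ip y (a * x) = cnj (ip x (a * y))"
  by (simp add: ip_cnj ip_mult_right)

definition psdf :: "nat \<Rightarrow> fmat \<Rightarrow> bool" where
  "psdf m a \<longleftrightarrow> shaped m m a \<and> adj a = a \<and> (\<forall>x. shaped m 1 x \<longrightarrow> 0 \<le> Re (ip x (a * x)))"

definition pdf :: "nat \<Rightarrow> fmat \<Rightarrow> bool" where
  "pdf m a \<longleftrightarrow> shaped m m a \<and> adj a = a \<and> (\<forall>x. shaped m 1 x \<longrightarrow> x \<noteq> 0 \<longrightarrow> 0 < Re (ip x (a * x)))"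

definition inverse_pair :: "nat \<Rightarrow> fmat \<Rightarrow> fmat \<Rightarrow> bool" where
  "inverse_pair m a b \<longleftrightarrow> shaped m m a \<and> shaped m m b \<and> a * b = idm m \<and> b * a = idm m"

definition contr :: "nat \<Rightarrow> fmat \<Rightarrow> bool" where
  "contr m k \<longleftrightarrow> shaped m m k \<and> (\<forall>x. shaped m 1 x \<longrightarrow> nrm2 (k * x) \<le> nrm2 x)"

lemma pdf_psdf: "pdf m a \<Longrightarrow> psdf m a"
  unfolding pdf_def psdf_def by (metis ip_simps(7) less_eq_real_def order_refl zero_complex.sel(1))

lemma psdf_idm: "psdf m (idm m)"
  by (auto simp: psdf_def shaped_left) (metis nrm2_def nrm2_nonneg)

text \<open>The form at \<open>x - sc s y\<close> with \<open>s = t * cnj c\<close> is a real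
  polynomial in \<open>t\<close>. Putting \<open>cnj c\<close> into \<open>s\<close> makes all cross
  terms real multiples of the squared modulus of \<open>c\<close>, so no phase has to be divided
  out.\<close>

lemma psdf_Cauchy_Schwarz:
  assumes a: "psdf m a" and x: "shaped m 1 x" and y: "shaped m 1 y"
  shows "(cmod (ip x (a * y)))\<^sup>2 \<le> Re (ip x (a * x)) * Re (ip y (a * y))"
proof -
  define c where "c = ip x (a * y)"
  define p where "p = Re (ip x (a * x))"
  define q where "q = Re (ip y (a * y))"
  have ha: "adj a = a" using a by (simp add: psdf_def)
  have im: "ip y (a * x) = cnj c" unfolding c_def by (rule herm_ip_cnj[OF ha])
  have reals: "ip y (a * y) = of_real q"
    unfolding q_def by (metis herm_ip_cnj[OF ha] Reals_cnj_iff of_real_Re)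
  have key: "0 \<le> p - 2 * t * (cmod c)\<^sup>2 + t\<^sup>2 * (cmod c)\<^sup>2 * q" for t :: real
  proof -
    define s where "s = of_real t * cnj c"
    have cc: "c * cnj c = of_real ((cmod c)\<^sup>2)" by (simp flip: complex_norm_square)
    have "shaped m 1 (x - sc s y)" using x y by auto
    then have "0 \<le> Re (ip (x - sc s y) (a * (x - sc s y)))"
      using a unfolding psdf_def by blast
    also have "ip (x - sc s y) (a * (x - sc s y)) = ip x (a * x) - s * c - cnj s * cnj c + cnj s * s * of_real q"
      by (simp add: right_diff_distrib ip_simps sc_mult_right im reals flip: c_def)
    also have "\<dots> = ip x (a * x) - of_real (2 * t * (cmod c)\<^sup>2) + of_real (t\<^sup>2 * (cmod c)\<^sup>2 * q)"
    proof -
      have "s * c = of_real (t * (cmod c)\<^sup>2)" "cnj s * cnj c = of_real (t * (cmod c)\<^sup>2)"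
        "cnj s * s = of_real (t\<^sup>2 * (cmod c)\<^sup>2)"
        using cc unfolding s_def by (simp_all add: mult_ac power2_eq_square)
      then show ?thesis by simp
    qed
    finally show ?thesis by (simp add: p_def)
  qed
  have q0: "0 \<le> q" using a y by (simp add: psdf_def q_def)
  have "(cmod c)\<^sup>2 \<le> p * q"
  proof (cases "q = 0")
    case True
    have "(cmod c)\<^sup>2 \<le> 0"
    proof (rule ccontr)
      assume "\<not> ?thesis"
      then have c: "(cmod c)\<^sup>2 > 0" by simp
      then show False
        \<comment> \<open>For \<open>q = 0\<close> the polynomial in \<open>t\<close> is affine; at
          this \<open>t\<close> its value is -1.\<close>
        using key[of "(p + 1) / (2 * (cmod c)\<^sup>2)"] True by (simp add: field_simps)
    qed
    then show ?thesis using True by simp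
  next
    case False
    then show ?thesis
      \<comment> \<open>The minimum of the quadratic polynomial.\<close>
      using key[of "1 / q"] q0 by (simp add: field_simps power2_eq_square)
  qed
  then show ?thesis by (simp add: c_def p_def q_def)
qed

lemma ip_Cauchy_Schwarz:
  assumes "shaped m 1 x" "shaped m 1 y"
  shows "(cmod (ip x y))\<^sup>2 \<le> nrm2 x * nrm2 y"
  using psdf_Cauchy_Schwarz[OF psdf_idm assms] assms by (simp add: shaped_left nrm2_def)

lemma nrm2_mult_le:
  assumes a: "shaped m m a" and x: "shaped m 1 x"
  shows "nrm2 (a * x) \<le> (\<Sum>i<m. \<Sum>k<m. (cmod (ent a i k))\<^sup>2) * nrm2 x"
proof -
  have ax: "shaped m 1 (a * x)" using a x by (rule shaped_mult)
  have "nrm2 (a * x) = (\<Sum>i<m. (cmod (ent (a * x) i 0))\<^sup>2)" by (rule nrm2_eq[OF ax])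
  also have "\<dots> \<le> (\<Sum>i<m. (\<Sum>k<m. (cmod (ent a i k))\<^sup>2) * nrm2 x)"
  proof (rule sum_mono)
    fix i
    have "cmod (ent (a * x) i 0) \<le> (\<Sum>k<m. cmod (ent a i k) * cmod (ent x k 0))"
      unfolding ent_mult[OF a] by (rule order_trans[OF norm_sum]) (simp add: norm_mult)
    then have "(cmod (ent (a * x) i 0))\<^sup>2 \<le> (\<Sum>k<m. cmod (ent a i k) * cmod (ent x k 0))\<^sup>2"
      by (rule power_mono) simp
    also have "\<dots> \<le> (\<Sum>k<m. (cmod (ent a i k))\<^sup>2) * (\<Sum>k<m. (cmod (ent x k 0))\<^sup>2)"
      by (rule Cauchy_Schwarz_ineq_sum)
    finally show "(cmod (ent (a * x) i 0))\<^sup>2 \<le> (\<Sum>k<m. (cmod (ent a i k))\<^sup>2) * nrm2 x"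
      by (simp add: nrm2_eq[OF x])
  qed
  finally show ?thesis by (simp add: sum_distrib_right)
qed

lemma nrm2_mult_bound:
  assumes a: "shaped m m a"
  obtains C where "C > 0" "\<And>x. shaped m 1 x \<Longrightarrow> nrm2 (a * x) \<le> C * nrm2 x"
proof -
  define C where "C = (\<Sum>i<m. \<Sum>k<m. (cmod (ent a i k))\<^sup>2)"
  have "nrm2 (a * x) \<le> (C + 1) * nrm2 x" if x: "shaped m 1 x" for x
    by (rule order_trans[OF nrm2_mult_le[OF a x]]) (simp add: C_def distrib_right)
  moreover have "C \<ge> 0" by (simp add: C_def sum_nonneg)
  ultimately show thesis using that[of "C + 1"] by simp
qed

section \<open>Translation between the matrices of the statement and ring elements\<close>

definition to_f :: "complex mat \<Rightarrow> fmat" where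
  "to_f A = mk (dim_row A) (dim_col A) (\<lambda>i j. A $$ (i, j))"

definition to_m :: "nat \<Rightarrow> nat \<Rightarrow> fmat \<Rightarrow> complex mat" where
  "to_m p q x = mat p q (\<lambda>(i, j). ent x i j)"

lemma ent_to_f [simp]: "ent (to_f A) i j = (if i < dim_row A \<and> j < dim_col A then A $$ (i, j) else 0)"
  by (simp add: to_f_def)

lemma shaped_to_f: "shaped (dim_row A) (dim_col A) (to_f A)"
  by (simp add: to_f_def)

lemma shaped_to_f' [intro]: "A \<in> carrier_mat p q \<Longrightarrow> shaped p q (to_f A)"
  using shaped_to_f[of A] by auto

lemma to_m_carrier [simp]: "to_m p q x \<in> carrier_mat p q"
  by (simp add: to_m_def)

lemma to_m_dim [simp]: "dim_row (to_m p q x) = p" "dim_col (to_m p q x) = q"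
  by (simp_all add: to_m_def)

lemma to_m_index [simp]: "i < p \<Longrightarrow> j < q \<Longrightarrow> to_m p q x $$ (i, j) = ent x i j"
  by (simp add: to_m_def)

lemma to_f_to_m [simp]: "shaped p q x \<Longrightarrow> to_f (to_m p q x) = x"
  by (rule fmat_eq_shapedI[of p q]) (auto intro: shaped_to_f')

lemma to_m_to_f: "A \<in> carrier_mat p q \<Longrightarrow> to_m p q (to_f A) = A"
  by (rule eq_matI) auto

lemma to_f_inject:
  assumes "A \<in> carrier_mat p q" "B \<in> carrier_mat p q" "to_f A = to_f B"
  shows "A = B"
  using assms by (metis to_m_to_f)

lemma to_f_mult:
  assumes "dim_col A = dim_row B"
  shows "to_f (A * B) = to_f A * to_f B"
proof (rule fmat_eqI)
  fix i j
  have "ent (to_f A * to_f B) i j = (\<Sum>k<dim_col A. ent (to_f A) i k * ent (to_f B) k j)"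
    by (rule ent_mult[OF shaped_to_f])
  then show "ent (to_f (A * B)) i j = ent (to_f A * to_f B) i j"
    using assms by (auto simp: scalar_prod_def lessThan_atLeast0 intro!: sum.cong)
qed

lemma to_f_add: "dim_row A = dim_row B \<Longrightarrow> dim_col A = dim_col B \<Longrightarrow> to_f (A + B) = to_f A + to_f B"
  and to_f_diff: "dim_row A = dim_row B \<Longrightarrow> dim_col A = dim_col B \<Longrightarrow> to_f (A - B) = to_f A - to_f B"
  and to_f_smult: "to_f (c \<cdot>\<^sub>m A) = sc c (to_f A)"
  and to_f_madj: "to_f (madj A) = adj (to_f A)"
  and to_f_one: "to_f (1\<^sub>m p) = idm p"
  and to_f_zero: "to_f (0\<^sub>m p q) = 0"
  by (auto intro!: fmat_eqI simp: madj_def)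

lemma to_m_mult:
  assumes "shaped p q x" "shaped q s y"
  shows "to_m p s (x * y) = to_m p q x * to_m q s y"
  by (rule to_f_inject[of _ p s]) (use assms in \<open>auto simp: to_f_mult shaped_mult\<close>)

lemma to_m_add: "to_m p q (x + y) = to_m p q x + to_m p q y"
  and to_m_sc: "to_m p q (sc c x) = c \<cdot>\<^sub>m to_m p q x"
  and to_m_idm: "to_m p p (idm p) = 1\<^sub>m p"
  and to_m_0: "to_m p q 0 = 0\<^sub>m p q"
  by (auto intro!: eq_matI)

lemma inverse_pair_unique:
  assumes "inverse_pair m a b" "inverse_pair m a c"
  shows "b = c"
proof -
  have "b * (a * c) = b" "(b * a) * c = c"
    using assms by (auto simp: inverse_pair_def shaped_def)
  then show ?thesis by (simp add: mult.assoc)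
qed

lemma inverse_pair_sym: "inverse_pair m a b \<Longrightarrow> inverse_pair m b a"
  by (auto simp: inverse_pair_def)

lemma left_inverse_imp_inverse_pair:
  assumes a: "shaped m m a" and b: "shaped m m b" and ab: "a * b = idm m"
  shows "inverse_pair m a b"
proof -
  have "to_m m m a * to_m m m b = 1\<^sub>m m"
    using assms by (simp flip: to_m_mult add: to_m_idm)
  then have "to_m m m b * to_m m m a = 1\<^sub>m m"
    by (rule mat_mult_left_right_inverse[rotated 2]) simp_all
  then have "to_m m m (b * a) = to_m m m (idm m)"
    using assms by (simp add: to_m_mult to_m_idm)
  then have "to_f (to_m m m (b * a)) = to_f (to_m m m (idm m))" by simp
  then have "b * a = idm m"
    using shaped_mult[OF b a] by simp
  then show ?thesis using assms by (simp add: inverse_pair_def)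
qed

text \<open>The adjugate formula for the inverse is recorded because it is what makes inverses
  depend holomorphically on a parameter.\<close>

lemma det_nonzero_inverse_pair:
  assumes a: "shaped m m a" and d: "det (to_m m m a) \<noteq> 0"
  obtains b where "inverse_pair m a b" "b = sc (inverse (det (to_m m m a))) (to_f (adj_mat (to_m m m a)))"
proof -
  define A where "A = to_m m m a"
  have A: "A \<in> carrier_mat m m" by (simp add: A_def)
  note ad = adj_mat[OF A]
  define b where "b = sc (inverse (det A)) (to_f (adj_mat A))"
  have sb: "shaped m m b" using ad(1) by (auto simp: b_def)
  have "to_f (A * adj_mat A) = sc (det A) (idm m)"
    by (simp add: ad(2) to_f_smult to_f_one)
  moreover have "to_f (A * adj_mat A) = a * to_f (adj_mat A)"
    using a ad(1) A by (subst to_f_mult) (auto simp: A_def)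
  ultimately have "a * to_f (adj_mat A) = sc (det A) (idm m)" by simp
  then have "a * b = idm m"
    using d by (simp add: b_def sc_mult_right A_def)
  with left_inverse_imp_inverse_pair[OF a sb this] that[of b] show thesis
    by (simp add: b_def A_def)
qed

lemma vec_to_f:
  assumes "v \<in> carrier_vec m" "shaped p m a"
  shows "a * mk m 1 (\<lambda>i _. vec_index v i) = mk p 1 (\<lambda>i _. vec_index (to_m p m a *\<^sub>v v) i)"
proof (rule fmat_eq_shapedI[of p 1])
  show "shaped p 1 (a * mk m 1 (\<lambda>i _. vec_index v i))"
    using assms by (intro shaped_mult[of p m]) auto
next
  fix i j :: nat assume "i < p" "j < 1"
  then show "ent (a * mk m 1 (\<lambda>i _. vec_index v i)) i j = ent (mk p 1 (\<lambda>i _. vec_index (to_m p m a *\<^sub>v v) i)) i j"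
    using assms(1) by (simp add: ent_mult[OF assms(2)] mult_mat_vec_def scalar_prod_def lessThan_atLeast0)
qed auto

lemma det_zero_kernel:
  assumes a: "shaped m m a" and d: "det (to_m m m a) = 0"
  obtains x where "shaped m 1 x" "x \<noteq> 0" "a * x = 0"
proof -
  obtain v where v: "v \<in> carrier_vec m" "v \<noteq> 0\<^sub>v m" "to_m m m a *\<^sub>v v = 0\<^sub>v m"
    using d det_0_iff_vec_prod_zero_field[of "to_m m m a" m] by auto
  define x where "x = mk m 1 (\<lambda>i _. vec_index v i)"
  have "a * x = 0"
    unfolding x_def vec_to_f[OF v(1) a] v(3) by (auto intro!: fmat_eqI)
  moreover have "x \<noteq> 0"
  proof
    assume "x = 0"
    then have "vec_index v i = 0" if "i < m" for i
    proof -
      have "ent x i 0 = 0" using \<open>x = 0\<close> by simp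
      then show ?thesis using that unfolding x_def by simp
    qed
    then show False using v by auto
  qed
  ultimately show thesis using that[of x] by (simp add: x_def)
qed

lemma kernel_zero_inverse_pair:
  assumes a: "shaped m m a" and k: "\<And>x. shaped m 1 x \<Longrightarrow> a * x = 0 \<Longrightarrow> x = 0"
  obtains b where "inverse_pair m a b"
proof (cases "det (to_m m m a) = 0")
  case True
  with det_zero_kernel[OF a] k show ?thesis by metis
next
  case False
  with det_nonzero_inverse_pair[OF a] that show ?thesis by metis
qed

lemma inverse_pair_det: "inverse_pair m a b \<Longrightarrow> det (to_m m m a) * det (to_m m m b) = 1"
  unfolding inverse_pair_def
  by (metis det_mult det_one to_m_carrier to_m_idm to_m_mult)

lemma minv_inverse_pair:
  assumes A: "A \<in> carrier_mat m m" and b: "inverse_pair m (to_f A) b"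
  shows "minv A \<in> carrier_mat m m \<and> to_f (minv A) = b"
proof -
  define P where "P = (\<lambda>B. B \<in> carrier_mat (dim_row A) (dim_row A) \<and> A * B = 1\<^sub>m (dim_row A) \<and> B * A = 1\<^sub>m (dim_row A))"
  have dm: "dim_row A = m" using A by simp
  have *: "B = to_m m m b" if "P B" for B
  proof -
    have "to_f (A * B) = idm m" "to_f (B * A) = idm m" "B \<in> carrier_mat m m"
      using that by (simp_all add: P_def dm to_f_one)
    then have "inverse_pair m (to_f A) (to_f B)"
      using A by (auto simp: inverse_pair_def to_f_mult)
    from inverse_pair_unique[OF this b] show ?thesis
      using \<open>B \<in> carrier_mat m m\<close> by (metis to_m_to_f)
  qed
  have "to_m m m (to_f A) * to_m m m b = to_m m m (to_f A * b)"
    "to_m m m b * to_m m m (to_f A) = to_m m m (b * to_f A)"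
    using b by (intro to_m_mult[symmetric]; simp add: inverse_pair_def)+
  note this[unfolded to_m_to_f[OF A]]
  then have "P (to_m m m b)"
    using b by (simp add: P_def dm inverse_pair_def to_m_idm)
  with * have "\<exists>B. P B" "(THE B. P B) = to_m m m b"
    by (blast intro: the_equality)+
  then have "minv A = to_m m m b"
    by (simp only: minv_def P_def[symmetric] if_True)
  then show ?thesis using b by (simp add: inverse_pair_def)
qed

lemma qform_ip:
  assumes A: "A \<in> carrier_mat m m" and x: "dim_vec x = m"
  shows "qform A x = ip (mk m 1 (\<lambda>i _. vec_index x i)) (to_f A * mk m 1 (\<lambda>i _. vec_index x i))"
proof -
  have s: "shaped m m (to_f A)" using A by auto
  have "ip (mk m 1 (\<lambda>i _. vec_index x i)) (to_f A * mk m 1 (\<lambda>i _. vec_index x i)) =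
    (\<Sum>i<m. cnj (vec_index x i) * (\<Sum>j<m. A $$ (i, j) * vec_index x j))"
    using A by (subst ip_eq[of m 1]) (auto simp: ent_mult[OF s] intro!: sum.cong)
  then show ?thesis
    using A by (simp add: qform_def sum_distrib_left mult.assoc)
qed

lemma hermitian_to_f: "A \<in> carrier_mat m m \<Longrightarrow> hermitian A \<longleftrightarrow> adj (to_f A) = to_f A"
  unfolding hermitian_def to_f_madj[symmetric]
  by (auto intro!: to_f_inject[of _ m m] simp: madj_def)

lemma vec_col_bij:
  assumes "shaped m 1 x"
  obtains v where "dim_vec v = m" "x = mk m 1 (\<lambda>i _. vec_index v i)" "x \<noteq> 0 \<Longrightarrow> v \<noteq> 0\<^sub>v m"
proof -
  define v where "v = vec m (\<lambda>i. ent x i 0)"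
  have "x = mk m 1 (\<lambda>i _. vec_index v i)"
    by (rule fmat_eq_shapedI[OF assms]) (auto simp: v_def)
  moreover from this have "x = 0" if "v = 0\<^sub>v m"
    unfolding that by (auto intro!: fmat_eqI)
  moreover have "dim_vec v = m" by (simp add: v_def)
  ultimately show thesis using that by blast
qed

lemma psd_iff:
  assumes A: "A \<in> carrier_mat m m"
  shows "psd A \<longleftrightarrow> psdf m (to_f A)"
proof
  assume p: "psd A"
  have "0 \<le> Re (ip x (to_f A * x))" if "shaped m 1 x" for x
    using vec_col_bij[OF that] p A by (metis carrier_matD(1) psd_def qform_ip)
  with p A show "psdf m (to_f A)"
    by (auto simp: psdf_def psd_def hermitian_to_f)
next
  assume p: "psdf m (to_f A)"
  then show "psd A"
    using A by (auto simp: psdf_def psd_def hermitian_to_f qform_ip)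
qed

lemma posdef_iff:
  assumes A: "A \<in> carrier_mat m m"
  shows "posdef A \<longleftrightarrow> pdf m (to_f A)"
proof
  assume p: "posdef A"
  have "0 < Re (ip x (to_f A * x))" if "shaped m 1 x" "x \<noteq> 0" for x
    using vec_col_bij[OF that(1)] that(2) p A by (metis carrier_matD(1) posdef_def qform_ip)
  with p A show "pdf m (to_f A)"
    by (auto simp: pdf_def posdef_def hermitian_to_f)
next
  assume p: "pdf m (to_f A)"
  have "mk m 1 (\<lambda>i _. vec_index x i) \<noteq> 0" if "dim_vec x = m" "x \<noteq> 0\<^sub>v m" for x
  proof
    assume *: "mk m 1 (\<lambda>i _. vec_index x i) = 0"
    have "vec_index x i = 0" if "i < m" for i
      using arg_cong[OF *, of "\<lambda>y. ent y i 0"] that by simp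
    then show False using that by (metis dim_vec eq_vecI index_zero_vec(1) index_zero_vec(2))
  qed
  with p show "posdef A"
    using A by (auto simp: pdf_def posdef_def hermitian_to_f qform_ip)
qed

text \<open>Definiteness makes the kernel trivial. The adjoint of an inverse is again an inverse of
  the Hermitian \<open>a\<close>, so \<open>b\<close> is Hermitian, and its form at \<open>x\<close>
  is the form of \<open>a\<close> at \<open>b * x\<close>.\<close>

lemma pdf_inverse:
  assumes "pdf m a"
  obtains b where "inverse_pair m a b" "pdf m b"
proof -
  have a: "shaped m m a" "adj a = a" using assms by (auto simp: pdf_def)
  obtain b where b: "inverse_pair m a b"
  proof (rule kernel_zero_inverse_pair[OF a(1)])
    fix x assume "shaped m 1 x" "a * x = 0"
    then show "x = 0"
      using assms unfolding pdf_def by (metis ip_simps(8) less_irrefl zero_complex.sel(1))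
  qed
  have sb: "shaped m m b" using b by (simp add: inverse_pair_def)
  have "inverse_pair m a (adj b)"
    using b a by (auto simp: inverse_pair_def) (metis adj_mult adj_simps(7))+
  with b have hb: "adj b = b" by (metis inverse_pair_unique)
  have "0 < Re (ip x (b * x))" if x: "shaped m 1 x" "x \<noteq> 0" for x
  proof -
    have bx: "shaped m 1 (b * x)" using sb x by auto
    have abx: "a * (b * x) = x" using b x by (simp add: inverse_pair_def shaped_left flip: mult.assoc)
    then have "b * x \<noteq> 0" using x by auto
    with bx assms have "0 < Re (ip (b * x) (a * (b * x)))" by (simp add: pdf_def)
    then show ?thesis by (simp add: abx ip_mult_left hb)
  qed
  then have "pdf m b" using sb hb by (simp add: pdf_def)
  with b that show thesis by blast
qed

text \<open>Replaces compactness of the unit sphere. Cauchy-Schwarz for the form of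
  \<open>a\<close>, applied to \<open>x\<close> and \<open>b * x\<close> with
  \<open>a * (b * x) = x\<close>, bounds the square of \<open>nrm2 x\<close> by the form at
  \<open>x\<close> times \<open>ip (b * x) x\<close>, and the latter is at most a constant times
  \<open>nrm2 x\<close>.\<close>

lemma pdf_lower_bound:
  assumes "pdf m a"
  obtains e where "e > 0" "\<And>x. shaped m 1 x \<Longrightarrow> e * nrm2 x \<le> Re (ip x (a * x))"
proof -
  obtain b where b: "inverse_pair m a b" "pdf m b" using pdf_inverse[OF assms] by metis
  have sb: "shaped m m b" and hb: "adj b = b" using b by (auto simp: pdf_def)
  obtain C where C: "C > 0" "\<And>x. shaped m 1 x \<Longrightarrow> nrm2 (b * x) \<le> C * nrm2 x"
    using nrm2_mult_bound[OF sb] by metis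
  have "inverse (sqrt C) * nrm2 x \<le> Re (ip x (a * x))" if x: "shaped m 1 x" for x
  proof (cases "x = 0")
    case False
    define q where "q = Re (ip x (a * x))"
    have bx: "shaped m 1 (b * x)" using sb x by auto
    have abx: "a * (b * x) = x" using b x by (simp add: inverse_pair_def shaped_left flip: mult.assoc)
    have n: "nrm2 x > 0" using False nrm2_eq_0_iff[OF x] nrm2_nonneg[of x] by linarith
    have q: "q > 0" using assms x False by (simp add: pdf_def q_def)
    have "(nrm2 x)\<^sup>2 = (cmod (ip x (a * (b * x))))\<^sup>2"
      by (simp add: abx ip_self_real)
    also have "\<dots> \<le> q * Re (ip (b * x) (a * (b * x)))"
      unfolding q_def by (rule psdf_Cauchy_Schwarz[OF pdf_psdf[OF assms] x bx])
    also have "Re (ip (b * x) (a * (b * x))) \<le> sqrt C * nrm2 x"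
    proof -
      have "(Re (ip (b * x) x))\<^sup>2 \<le> (cmod (ip (b * x) x))\<^sup>2"
        by (metis abs_Re_le_cmod abs_norm_cancel power2_le_iff_abs_le power2_abs abs_ge_zero)
      also have "\<dots> \<le> nrm2 (b * x) * nrm2 x" by (rule ip_Cauchy_Schwarz[OF bx x])
      also have "\<dots> \<le> C * nrm2 x * nrm2 x" using C(2)[OF x] n by simp
      also have "\<dots> = (sqrt C * nrm2 x)\<^sup>2" using C(1) by (simp add: power2_eq_square)
      finally show ?thesis
        unfolding abx using C(1) n by (meson mult_nonneg_nonneg nrm2_nonneg power2_le_imp_le real_sqrt_ge_zero less_imp_le)
    qed
    finally have "nrm2 x * nrm2 x \<le> (q * sqrt C) * nrm2 x"
      using q by (simp add: power2_eq_square mult.assoc)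
    then have "nrm2 x \<le> q * sqrt C" using n by simp
    then show ?thesis
      using C(1) by (simp add: field_simps q_def)
  qed (simp add: ip_simps)
  with C(1) that[of "inverse (sqrt C)"] show thesis by simp
qed

lemma vnorm_eq: "dim_vec x = m \<Longrightarrow> (vnorm x)\<^sup>2 = nrm2 (mk m 1 (\<lambda>i _. vec_index x i))"
  by (subst nrm2_eq[of m 1]) (auto simp: vnorm_def sum_nonneg)

lemma vnorm_nonneg: "vnorm x \<ge> 0"
  by (simp add: vnorm_def sum_nonneg)

text \<open>All later work uses the quadratic inequality on the right; the supremum is met only
  here, by scaling a nonzero vector to norm 1.\<close>

lemma spec_norm_le_iff:
  assumes K: "K \<in> carrier_mat m m" and c: "0 \<le> c"
  shows "spec_norm K \<le> c \<longleftrightarrow> (\<forall>x. shaped m 1 x \<longrightarrow> nrm2 (to_f K * x) \<le> c\<^sup>2 * nrm2 x)"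
proof -
  define k where "k = to_f K"
  have k: "shaped m m k" using K by (auto simp: k_def)
  define S where "S = {vnorm (K *\<^sub>v x) | x. dim_vec x = dim_col K \<and> vnorm x \<le> 1}"
  have vn: "(vnorm (K *\<^sub>v x))\<^sup>2 = nrm2 (k * mk m 1 (\<lambda>i _. vec_index x i))" if "dim_vec x = m" for x
  proof -
    have "to_m m m k = K" by (simp add: k_def to_m_to_f[OF K])
    moreover have "x \<in> carrier_vec m" using that by (rule carrier_vecI)
    ultimately have "k * mk m 1 (\<lambda>i _. vec_index x i) = mk m 1 (\<lambda>i _. vec_index (K *\<^sub>v x) i)"
      using vec_to_f[OF _ k, of x] by simp
    moreover have "dim_vec (K *\<^sub>v x) = m" using K by simp
    ultimately show ?thesis by (simp only: vnorm_eq)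
  qed
  have Sle: "s \<le> d" if sS: "s \<in> S" and d0: "d \<ge> 0" and d: "\<And>x. shaped m 1 x \<Longrightarrow> nrm2 (k * x) \<le> d\<^sup>2 * nrm2 x" for s d
  proof -
    obtain x where x: "s = vnorm (K *\<^sub>v x)" "dim_vec x = m" "vnorm x \<le> 1"
      using sS K by (auto simp: S_def)
    have "s\<^sup>2 \<le> d\<^sup>2 * (vnorm x)\<^sup>2"
      using d[of "mk m 1 (\<lambda>i _. vec_index x i)"] unfolding x(1) vn[OF x(2)] vnorm_eq[OF x(2)] by simp
    also have "\<dots> \<le> d\<^sup>2" using x(3) vnorm_nonneg[of x] by (simp add: mult_left_le power_le_one)
    finally show ?thesis using d0 by (rule power2_le_imp_le)
  qed
  obtain C where C: "C > 0" "\<And>x. shaped m 1 x \<Longrightarrow> nrm2 (k * x) \<le> C * nrm2 x"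
    using nrm2_mult_bound[OF k] by metis
  have bdd: "bdd_above S"
    by (rule bdd_aboveI[of _ "sqrt C"]) (rule Sle, use C in auto)
  have ne: "S \<noteq> {}"
  proof -
    have "vnorm (0\<^sub>v m) \<le> 1" by (simp add: vnorm_def)
    then show ?thesis using K unfolding S_def by (auto intro!: exI[of _ "0\<^sub>v m"])
  qed
  have sn: "spec_norm K = Sup S" by (simp add: spec_norm_def S_def)
  show ?thesis
    unfolding sn k_def[symmetric]
  proof (intro iffI allI impI)
    assume *: "Sup S \<le> c"
    fix x assume x: "shaped m 1 x"
    show "nrm2 (k * x) \<le> c\<^sup>2 * nrm2 x"
    proof (cases "x = 0")
      case False
      define t where "t = sqrt (nrm2 x)"
      have nx: "nrm2 x > 0" using False nrm2_eq_0_iff[OF x] nrm2_nonneg[of x] by linarith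
      then have n: "t > 0" "t\<^sup>2 = nrm2 x" by (simp_all add: t_def)
      have c2: "(cmod (complex_of_real (inverse t)))\<^sup>2 = inverse (nrm2 x)"
        unfolding norm_of_real power2_abs n(2)[symmetric] by (simp add: power_inverse)
      define y where "y = sc (of_real (inverse t)) x"
      have y: "shaped m 1 y" using x by (auto simp: y_def)
      have ny: "nrm2 y = 1" unfolding y_def nrm2_sc c2 using nx by simp
      obtain v where v: "dim_vec v = m" "y = mk m 1 (\<lambda>i _. vec_index v i)" using vec_col_bij[OF y] by metis
      have "(vnorm v)\<^sup>2 = 1" using v ny by (simp add: vnorm_eq)
      then have "vnorm v \<le> 1" by (simp add: power2_eq_1_iff) linarith
      then have "vnorm (K *\<^sub>v v) \<in> S" using v K by (auto simp: S_def)
      then have "vnorm (K *\<^sub>v v) \<le> c" using * bdd by (meson cSup_upper order_trans)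
      then have "nrm2 (k * y) \<le> c\<^sup>2"
        using vn[OF v(1)] v(2) vnorm_nonneg by (metis power_mono)
      moreover have "nrm2 (k * y) = nrm2 (k * x) / nrm2 x"
        unfolding y_def sc_mult_right nrm2_sc c2 by (simp add: field_simps)
      ultimately show ?thesis using nx by (simp add: pos_divide_le_eq)
    qed simp
  next
    assume "\<forall>x. shaped m 1 x \<longrightarrow> nrm2 (k * x) \<le> c\<^sup>2 * nrm2 x"
    then show "Sup S \<le> c" using Sle[OF _ c] ne by (auto intro: cSup_least)
  qed
qed

lemma spec_norm_le_1_iff: "K \<in> carrier_mat m m \<Longrightarrow> spec_norm K \<le> 1 \<longleftrightarrow> contr m (to_f K)"
  by (auto simp: spec_norm_le_iff contr_def)

text \<open>Strictness for each single vector would give only a supremum of at most 1; the uniform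
  gap comes from the lower bound of a positive definite form.\<close>

lemma spec_norm_less_1_iff:
  assumes K: "K \<in> carrier_mat m m"
  shows "spec_norm K < 1 \<longleftrightarrow> pdf m (idm m - adj (to_f K) * to_f K)"
proof -
  define k where "k = to_f K"
  have k: "shaped m m k" using K by (auto simp: k_def)
  have q: "Re (ip x ((idm m - adj k * k) * x)) = nrm2 x - nrm2 (k * x)" if "shaped m 1 x" for x
    using that by (simp add: left_diff_distrib ip_simps shaped_left mult.assoc nrm2_def ip_mult_left)
  have h: "shaped m m (idm m - adj k * k)" "adj (idm m - adj k * k) = idm m - adj k * k"
    using k by auto
  show ?thesis
    unfolding k_def[symmetric]
  proof
    assume s: "spec_norm K < 1"
    define c where "c = max 0 (spec_norm K)"
    have c: "0 \<le> c" "c < 1" "spec_norm K \<le> c" using s by (auto simp: c_def)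
    have "nrm2 (k * x) < nrm2 x" if x: "shaped m 1 x" "x \<noteq> 0" for x
    proof -
      have "nrm2 (k * x) \<le> c\<^sup>2 * nrm2 x"
        using c x spec_norm_le_iff[OF K c(1)] by (simp add: k_def)
      moreover have "nrm2 x > 0" using x nrm2_eq_0_iff[OF x(1)] nrm2_nonneg[of x] by linarith
      moreover have "c\<^sup>2 < 1" using c by (simp add: abs_square_less_1)
      ultimately show ?thesis by (smt (verit) mult_less_cancel_right2)
    qed
    then show "pdf m (idm m - adj k * k)"
      using h q by (auto simp: pdf_def)
  next
    assume "pdf m (idm m - adj k * k)"
    from pdf_lower_bound[OF this] obtain e where e: "e > 0"
      "\<And>x. shaped m 1 x \<Longrightarrow> e * nrm2 x \<le> nrm2 x - nrm2 (k * x)"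
      using q by metis
    \<comment> \<open>Capping at 1/2 keeps \<open>1 - d\<close> positive under the square
      root.\<close>
    define d where "d = min e (1/2)"
    have d: "0 < d" "d \<le> 1/2" using e by (auto simp: d_def)
    have *: "nrm2 (k * x) \<le> (sqrt (1 - d))\<^sup>2 * nrm2 x" if x: "shaped m 1 x" for x
    proof -
      have "d * nrm2 x \<le> e * nrm2 x" by (intro mult_right_mono) (auto simp: d_def)
      with e(2)[OF x] d show ?thesis by (simp add: algebra_simps)
    qed
    then have "spec_norm K \<le> sqrt (1 - d)"
      using d by (subst spec_norm_le_iff[OF K]) (auto simp: k_def)
    also have "\<dots> < 1" using d by simp
    finally show "spec_norm K < 1" .
  qed
qed

section \<open>Matrix power series\<close>

notation fps_nth (infixl "\<section>" 75)

definition fshaped :: "nat \<Rightarrow> nat \<Rightarrow> fmat fps \<Rightarrow> bool" where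
  "fshaped p q F \<longleftrightarrow> (\<forall>k. shaped p q (F \<section> k))"

definition fdeg :: "nat \<Rightarrow> fmat fps \<Rightarrow> bool" where
  "fdeg n F \<longleftrightarrow> (\<forall>k>n. F \<section> k = 0)"

text \<open>The reciprocal polynomial with adjoint coefficients; on the unit circle its value is
  \<open>z^n\<close> times the adjoint of the value of \<open>F\<close>.\<close>

definition frev :: "nat \<Rightarrow> fmat fps \<Rightarrow> fmat fps" where
  "frev n F = Abs_fps (\<lambda>k. if k \<le> n then adj (F \<section> (n - k)) else 0)"

text \<open>Multiplication by the variable. The coefficient ring has no unit, so the variable itself
  is not a series over it.\<close>

definition fsh :: "fmat fps \<Rightarrow> fmat fps" where
  "fsh F = Abs_fps (\<lambda>k. if k = 0 then 0 else F \<section> (k - 1))"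

definition fmon :: "nat \<Rightarrow> fmat \<Rightarrow> fmat fps" where
  "fmon n x = Abs_fps (\<lambda>k. if k = n then x else 0)"

text \<open>Congruence modulo the \<open>n\<close>-th power of the variable.\<close>

definition feq :: "nat \<Rightarrow> fmat fps \<Rightarrow> fmat fps \<Rightarrow> bool" where
  "feq n F G \<longleftrightarrow> (\<forall>k<n. F \<section> k = G \<section> k)"

lemma frev_nth [simp]: "frev n F \<section> k = (if k \<le> n then adj (F \<section> (n - k)) else 0)"
  by (simp add: frev_def)

lemma fsh_nth: "fsh F \<section> k = (if k = 0 then 0 else F \<section> (k - 1))"
  by (simp add: fsh_def)

lemma fsh_nth_simps [simp]: "fsh F \<section> 0 = 0" "fsh F \<section> Suc k = F \<section> k"
  by (simp_all add: fsh_nth)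

lemma fmon_nth [simp]: "fmon n x \<section> k = (if k = n then x else 0)"
  by (simp add: fmon_def)

lemma fshaped_intros [simp, intro]:
  "fshaped p q 0" "fshaped p q F \<Longrightarrow> fshaped p q G \<Longrightarrow> fshaped p q (F + G)"
  "fshaped p q F \<Longrightarrow> fshaped p q G \<Longrightarrow> fshaped p q (F - G)"
  "fshaped p q F \<Longrightarrow> fshaped q p (frev n F)" "fshaped p q F \<Longrightarrow> fshaped p q (fsh F)"
  "shaped p q x \<Longrightarrow> fshaped p q (fmon n x)" "shaped p q x \<Longrightarrow> fshaped p q (fps_const x)"
  by (auto simp: fshaped_def fsh_nth)

lemma fshaped_mult [intro]: "fshaped p q F \<Longrightarrow> fshaped q s G \<Longrightarrow> fshaped p s (F * G)"
  by (auto simp: fshaped_def fps_mult_nth intro!: shaped_sum shaped_mult)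

lemma fshaped_nth: "fshaped p q F \<Longrightarrow> shaped p q (F \<section> k)"
  by (simp add: fshaped_def)

lemma fshaped_idm_nth: "fshaped p q F \<Longrightarrow> idm p * F \<section> k = F \<section> k"
  by (simp add: fshaped_def shaped_def)

lemma fps_const_mult_nth: "(fps_const x * F) \<section> k = x * F \<section> k" for x :: fmat
  unfolding fps_mult_nth by (subst sum.remove[of _ 0]) (auto intro!: sum.neutral)

lemma mult_fps_const_nth: "(F * fps_const x) \<section> k = F \<section> k * x" for x :: fmat
  unfolding fps_mult_nth by (subst sum.remove[of _ k]) (auto intro!: sum.neutral)

lemma fmon_mult_nth: "(fmon n x * F) \<section> k = (if k < n then 0 else x * F \<section> (k - n))"
proof (cases "k < n")
  case False
  then show ?thesis
    unfolding fps_mult_nth by (subst sum.remove[of _ n]) (auto intro!: sum.neutral)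
qed (auto simp: fps_mult_nth intro!: sum.neutral)

lemma mult_fmon_nth: "(F * fmon n x) \<section> k = (if k < n then 0 else F \<section> (k - n) * x)"
proof (cases "k < n")
  case False
  then show ?thesis
    unfolding fps_mult_nth by (subst sum.remove[of _ "k - n"]) (auto intro!: sum.neutral split: if_splits)
qed (auto simp: fps_mult_nth intro!: sum.neutral)

lemma fsh_simps: "fsh (- F) = - fsh F" "fsh (F + G) = fsh F + fsh G" "fsh (F - G) = fsh F - fsh G" "fsh 0 = 0"
  by (auto simp: fps_eq_iff fsh_nth)

lemma fsh_mult_left: "fsh F * G = fsh (F * G)"
proof (rule fps_ext)
  fix k
  show "(fsh F * G) \<section> k = fsh (F * G) \<section> k"
  proof (cases k)
    case (Suc k')
    show ?thesis
      unfolding fps_mult_nth Suc fsh_nth_simps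
      by (subst sum.atLeast0_atMost_Suc_shift) simp
  qed (simp add: fps_mult_nth)
qed

lemma fsh_mult_right: "F * fsh G = fsh (F * G)"
proof (rule fps_ext)
  fix k
  show "(F * fsh G) \<section> k = fsh (F * G) \<section> k"
  proof (cases k)
    case (Suc k')
    show ?thesis
      unfolding fps_mult_nth Suc fsh_nth_simps
      by (subst sum.atLeast0_atMost_Suc) (auto intro!: sum.cong simp: Suc_diff_le)
  qed (simp add: fps_mult_nth)
qed

lemma fdeg_intros: "fdeg n 0" "fdeg n F \<Longrightarrow> fdeg n G \<Longrightarrow> fdeg n (F + G)"
  "fdeg n F \<Longrightarrow> fdeg n G \<Longrightarrow> fdeg n (F - G)" "fdeg n (frev n F)"
  "fdeg n F \<Longrightarrow> fdeg (Suc n) (fsh F)" "fdeg n (fmon n x)" "fdeg 0 (fps_const x)"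
  by (auto simp: fdeg_def fsh_nth)

lemma fdeg_mono: "fdeg n F \<Longrightarrow> n \<le> k \<Longrightarrow> fdeg k F"
  by (auto simp: fdeg_def)

text \<open>The condition \<open>i + j = r\<close> treats both indices alike, which reduces the
  index reversal in \<open>frev_mult\<close> to substitutions in a double sum.\<close>

lemma poly_mult_nth:
  assumes "fdeg a F" "fdeg b G"
  shows "(F * G) \<section> r = (\<Sum>i\<le>a. \<Sum>j\<le>b. if i + j = r then F \<section> i * G \<section> j else 0)"
proof -
  have inner: "(\<Sum>j\<le>b. if i + j = r then F \<section> i * G \<section> j else 0) = (if i \<le> r then F \<section> i * G \<section> (r - i) else 0)" for i
  proof (cases "i \<le> r \<and> r - i \<le> b")
    case True
    then have "(\<Sum>j\<le>b. if i + j = r then F \<section> i * G \<section> j else 0) = (\<Sum>j\<le>b. if j = r - i then F \<section> i * G \<section> j else 0)"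
      by (intro sum.cong) auto
    then show ?thesis using True by simp
  next
    case False
    then have "(\<Sum>j\<le>b. if i + j = r then F \<section> i * G \<section> j else 0) = 0"
      by (intro sum.neutral) auto
    then show ?thesis using False assms(2) by (auto simp: fdeg_def)
  qed
  have "(F * G) \<section> r = (\<Sum>i\<le>r. if i \<le> r then F \<section> i * G \<section> (r - i) else 0)"
    by (simp add: fps_mult_nth atLeast0AtMost)
  also have "\<dots> = (\<Sum>i\<le>max a r. if i \<le> r then F \<section> i * G \<section> (r - i) else 0)"
    by (rule sum.mono_neutral_left) auto
  also have "\<dots> = (\<Sum>i\<le>a. if i \<le> r then F \<section> i * G \<section> (r - i) else 0)"
    by (rule sum.mono_neutral_right) (use assms(1) in \<open>auto simp: fdeg_def\<close>)
  finally show ?thesis by (simp add: inner)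
qed

lemma fdeg_mult: 
  assumes "fdeg a F" "fdeg b G"
  shows "fdeg (a + b) (F * G)"
  unfolding fdeg_def poly_mult_nth[OF assms] by (auto intro!: sum.neutral)

lemma frev_add: "frev n (F + G) = frev n F + frev n G"
  and frev_diff: "frev n (F - G) = frev n F - frev n G"
  and frev_0: "frev n 0 = 0"
  and frev_Suc_fsh: "frev (Suc n) (fsh F) = frev n F"
  by (auto simp: fps_eq_iff Suc_diff_le fsh_nth le_Suc_eq)

lemma frev_Suc:
  assumes "fdeg n F"
  shows "frev (Suc n) F = fsh (frev n F)"
proof (rule fps_ext)
  fix k
  show "frev (Suc n) F \<section> k = fsh (frev n F) \<section> k"
    using assms by (cases k) (auto simp: fdeg_def)
qed

lemma frev_frev: "fdeg n F \<Longrightarrow> frev n (frev n F) = F"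
  by (auto simp: fps_eq_iff fdeg_def)

lemma frev_const: "frev 0 (fps_const x) = fps_const (adj x)"
  by (auto simp: fps_eq_iff)

lemma frev_mult:
  assumes F: "fdeg a F" and G: "fdeg b G"
  shows "frev (a + b) (F * G) = frev b G * frev a F"
proof (rule fps_ext)
  fix r
  show "frev (a + b) (F * G) \<section> r = (frev b G * frev a F) \<section> r"
  proof (cases "r \<le> a + b")
    case True
    have "(frev b G * frev a F) \<section> r =
      (\<Sum>i\<le>b. \<Sum>j\<le>a. if i + j = r then adj (G \<section> (b - i)) * adj (F \<section> (a - j)) else 0)"
      by (subst poly_mult_nth[of b _ a]) (auto simp: fdeg_intros intro!: sum.cong)
    also have "\<dots> = (\<Sum>j\<le>a. \<Sum>i\<le>b. if i + j = r then adj (G \<section> (b - i)) * adj (F \<section> (a - j)) else 0)"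
      by (rule sum.swap)
    also have "\<dots> = (\<Sum>j\<le>a. \<Sum>i\<le>b. if i + (a - j) = r then adj (G \<section> (b - i)) * adj (F \<section> j) else 0)"
      by (subst sum.atLeastAtMost_rev[of _ 0, simplified atLeast0AtMost]) (simp cong: if_cong)
    also have "\<dots> = (\<Sum>j\<le>a. \<Sum>i\<le>b. if b - i + (a - j) = r then adj (G \<section> i) * adj (F \<section> j) else 0)"
      by (subst (2) sum.atLeastAtMost_rev[of _ 0, simplified atLeast0AtMost]) (simp cong: if_cong)
    also have "\<dots> = (\<Sum>j\<le>a. \<Sum>i\<le>b. if j + i = a + b - r then adj (F \<section> j * G \<section> i) else 0)"
      using True by (intro sum.cong refl if_cong) auto
    also have "\<dots> = frev (a + b) (F * G) \<section> r"
      using True by (simp add: poly_mult_nth[OF F G] adj_sum if_distrib[of adj] cong: if_cong)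
    finally show ?thesis ..
  next
    case False
    have "fdeg (b + a) (frev b G * frev a F)" by (intro fdeg_mult fdeg_intros)
    with False show ?thesis by (simp add: fdeg_def add.commute)
  qed
qed

lemma feq_mult_left: "feq n F G \<Longrightarrow> feq n (F * H) (G * H)"
  and feq_mult_right: "feq n F G \<Longrightarrow> feq n (H * F) (H * G)"
  by (auto simp: feq_def fps_mult_nth intro!: sum.cong)

lemma feq_add: "feq n F G \<Longrightarrow> feq n F' G' \<Longrightarrow> feq n (F + F') (G + G')"
  and feq_diff: "feq n F G \<Longrightarrow> feq n F' G' \<Longrightarrow> feq n (F - F') (G - G')"
  and feq_trans: "feq n F G \<Longrightarrow> feq n G H \<Longrightarrow> feq n F H"
  and feq_sym: "feq n F G \<Longrightarrow> feq n G F"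
  and feq_refl: "feq n F F"
  and feq_mono: "feq n F G \<Longrightarrow> k \<le> n \<Longrightarrow> feq k F G"
  and feq_fsh: "feq n F G \<Longrightarrow> feq (Suc n) (fsh F) (fsh G)"
  by (auto simp: feq_def fsh_nth)

text \<open>The lowest \<open>n + 1\<close> coefficients together with the lowest \<open>n\<close>
  coefficients of the reversal account for all \<open>2n + 1\<close> coefficients. This is how
  congruences with the data are upgraded to exact identities.\<close>

lemma frev_eqI:
  assumes "fdeg (n + n) F" "fdeg (n + n) G" "frev (n + n) F = F'" "frev (n + n) G = G'"
    "feq (Suc n) F G" "feq n F' G'"
  shows "F = G"
proof (rule fps_ext)
  fix k
  consider "k \<le> n" | "n < k" "k \<le> n + n" | "n + n < k" by linarith
  then show "F \<section> k = G \<section> k"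
  proof cases
    case 1
    then show ?thesis using assms(5) by (simp add: feq_def)
  next
    case 2
    then have "F' \<section> (n + n - k) = G' \<section> (n + n - k)" using assms(6) by (simp add: feq_def)
    then show ?thesis using 2 by (simp flip: assms(3,4) add: adj_inject)
  next
    case 3
    then show ?thesis using assms(1,2) by (simp add: fdeg_def)
  qed
qed

fun fps_ldiv_coeff :: "fmat \<Rightarrow> fmat fps \<Rightarrow> fmat fps \<Rightarrow> nat \<Rightarrow> fmat" where
  "fps_ldiv_coeff b F G k = b * (G \<section> k - (\<Sum>i<k. F \<section> (k - i) * fps_ldiv_coeff b F G i))"

declare fps_ldiv_coeff.simps [simp del]

text \<open>Although the ring is noncommutative and has no unit, the coefficients of the quotient
  are determined recursively once the constant coefficient of the divisor is invertible among the
  \<open>m\<close> by \<open>m\<close> matrices.\<close>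

lemma fps_left_division:
  assumes b: "inverse_pair m (F \<section> 0) b" and F: "fshaped m m F" and G: "fshaped m q G"
  obtains H where "fshaped m q H" "F * H = G"
proof -
  define H where "H = Abs_fps (fps_ldiv_coeff b F G)"
  have Hk: "H \<section> k = b * (G \<section> k - (\<Sum>i<k. F \<section> (k - i) * H \<section> i))" for k
  proof -
    have "H \<section> i = fps_ldiv_coeff b F G i" for i by (simp add: H_def)
    then show ?thesis by (simp only: fps_ldiv_coeff.simps[of b F G k])
  qed
  have sb: "shaped m m b" and Fb: "F \<section> 0 * b = idm m" using b by (auto simp: inverse_pair_def)
  have sH: "shaped m q (H \<section> k)" for k
  proof (induction k rule: less_induct)
    case (less k)
    have "shaped m q (G \<section> k - (\<Sum>i<k. F \<section> (k - i) * H \<section> i))"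
      using F G less by (intro shaped_intros(3) shaped_sum shaped_mult[of m m]) (auto simp: fshaped_def)
    with sb show ?case by (subst Hk) (rule shaped_mult)
  qed
  have "(F * H) \<section> k = G \<section> k" for k
  proof -
    have s: "shaped m q (G \<section> k - (\<Sum>i<k. F \<section> (k - i) * H \<section> i))"
      using F G sH by (intro shaped_intros(3) shaped_sum shaped_mult[of m m]) (auto simp: fshaped_def)
    have "(F * H) \<section> k = (\<Sum>i\<le>k. F \<section> (k - i) * H \<section> i)"
      unfolding fps_mult_nth atLeast0AtMost
      by (subst sum.atLeastAtMost_rev[of _ 0, simplified atLeast0AtMost]) (auto intro!: sum.cong)
    also have "\<dots> = F \<section> 0 * H \<section> k + (\<Sum>i<k. F \<section> (k - i) * H \<section> i)"
      by (simp add: lessThan_Suc_atMost[symmetric] add.commute)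
    also have "F \<section> 0 * H \<section> k = G \<section> k - (\<Sum>i<k. F \<section> (k - i) * H \<section> i)"
      using s by (subst Hk) (simp add: Fb shaped_left flip: mult.assoc)
    finally show ?thesis by simp
  qed
  then have "F * H = G" by (rule fps_ext)
  with sH that show thesis by (auto simp: fshaped_def)
qed

lemma feq_right_cancel:
  assumes b: "inverse_pair m (D \<section> 0) b" and F: "fshaped p m F" and G: "fshaped p m G"
    and e: "feq n (F * D) (G * D)"
  shows "feq n F G"
proof -
  have "k < n \<Longrightarrow> F \<section> k = G \<section> k" for k
  proof (induction k rule: less_induct)
    case (less k)
    have "(\<Sum>i\<le>k. F \<section> i * D \<section> (k - i)) = (\<Sum>i\<le>k. G \<section> i * D \<section> (k - i))"
      using e less.prems by (simp add: feq_def fps_mult_nth atLeast0AtMost)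
    moreover have "(\<Sum>i<k. F \<section> i * D \<section> (k - i)) = (\<Sum>i<k. G \<section> i * D \<section> (k - i))"
      using less by (intro sum.cong) auto
    ultimately have "F \<section> k * D \<section> 0 = G \<section> k * D \<section> 0"
      by (simp add: lessThan_Suc_atMost[symmetric])
    then have "F \<section> k * (D \<section> 0 * b) = G \<section> k * (D \<section> 0 * b)"
      by (simp flip: mult.assoc)
    then show ?case
      using b F G by (simp add: inverse_pair_def fshaped_def shaped_def)
  qed
  then show ?thesis by (simp add: feq_def)
qed


section \<open>Evaluation of matrix power series at a point\<close>

definition fconv :: "complex \<Rightarrow> fmat fps \<Rightarrow> bool" where
  "fconv z F \<longleftrightarrow> (\<forall>i j. summable (\<lambda>k. norm (ent (F \<section> k) i j * z ^ k)))"

definition fev :: "nat \<Rightarrow> nat \<Rightarrow> complex \<Rightarrow> fmat fps \<Rightarrow> fmat" where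
  "fev p q z F = mk p q (\<lambda>i j. \<Sum>k. ent (F \<section> k) i j * z ^ k)"

lemma fev_shaped [simp, intro]: "shaped p q (fev p q z F)"
  by (simp add: fev_def)

lemma fconv_poly: "fdeg n F \<Longrightarrow> fconv z F"
  unfolding fconv_def fdeg_def by (intro allI summable_finite[of "{..n}"]) (auto simp: not_le)

lemma fev_poly:
  assumes "fdeg n F" "fshaped p q F"
  shows "fev p q z F = (\<Sum>k\<le>n. sc (z ^ k) (F \<section> k))"
proof (rule fmat_eq_shapedI[of p q])
  fix i j assume "i < p" "j < q"
  have "(\<Sum>k. ent (F \<section> k) i j * z ^ k) = (\<Sum>k\<le>n. ent (F \<section> k) i j * z ^ k)"
    using assms(1) by (intro suminf_finite) (auto simp: fdeg_def not_le)
  then show "ent (fev p q z F) i j = ent (\<Sum>k\<le>n. sc (z ^ k) (F \<section> k)) i j"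
    using \<open>i < p\<close> \<open>j < q\<close> by (simp add: fev_def ent_sum mult.commute)
next
  show "shaped p q (\<Sum>k\<le>n. sc (z ^ k) (F \<section> k))"
    using assms(2) by (intro shaped_sum) (auto simp: fshaped_def)
qed simp

lemma fconv_summable: "fconv z F \<Longrightarrow> summable (\<lambda>k. ent (F \<section> k) i j * z ^ k)"
  by (rule summable_norm_cancel) (simp add: fconv_def)

lemma fconv_add:
  assumes "fconv z F" "fconv z G"
  shows "fconv z (F + G)"
  unfolding fconv_def
proof (intro allI)
  fix i j
  from assms have *: "\<forall>i j. summable (\<lambda>k. norm (ent (F \<section> k) i j * z ^ k))" "\<forall>i j. summable (\<lambda>k. norm (ent (G \<section> k) i j * z ^ k))"
    by (auto simp: fconv_def)
  show "summable (\<lambda>k. norm (ent ((F + G) \<section> k) i j * z ^ k))"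
    by (rule summable_comparison_test'[OF summable_add[OF *(1)[rule_format, of i j] *(2)[rule_format, of i j]], of 0])
       (simp add: distrib_right norm_triangle_ineq)
qed

lemma fev_add:
  assumes "fconv z F" "fconv z G"
  shows "fev p q z (F + G) = fev p q z F + fev p q z G"
  by (rule fmat_eqI)
     (simp add: fev_def distrib_right suminf_add[OF fconv_summable[OF assms(1)] fconv_summable[OF assms(2)]])

lemma fconv_fsh:
  assumes "fconv z F"
  shows "fconv z (fsh F)"
  unfolding fconv_def
proof (intro allI)
  fix i j
  from assms have *: "\<forall>i j. summable (\<lambda>k. norm (ent (F \<section> k) i j * z ^ k))"
    by (simp add: fconv_def)
  have "summable (\<lambda>k. norm (ent (fsh F \<section> Suc k) i j * z ^ Suc k))"
    using summable_mult[OF *[rule_format, of i j], of "norm z"] by (simp add: norm_mult mult_ac)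
  then show "summable (\<lambda>k. norm (ent (fsh F \<section> k) i j * z ^ k))"
    by (rule iffD1[OF summable_Suc_iff])
qed

lemma fev_fsh:
  assumes "fconv z F"
  shows "fev p q z (fsh F) = sc z (fev p q z F)"
proof (rule fmat_eqI)
  fix i j
  have "summable (\<lambda>k. ent (fsh F \<section> k) i j * z ^ k)"
    by (rule fconv_summable[OF fconv_fsh[OF assms]])
  from suminf_split_head[OF this]
  have "(\<Sum>k. ent (fsh F \<section> k) i j * z ^ k) = (\<Sum>k. z * (ent (F \<section> k) i j * z ^ k))"
    by (simp add: mult_ac)
  also have "\<dots> = z * (\<Sum>k. ent (F \<section> k) i j * z ^ k)"
    by (rule suminf_mult[OF fconv_summable[OF assms]])
  finally show "ent (fev p q z (fsh F)) i j = ent (sc z (fev p q z F)) i j"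
    by (simp add: fev_def)
qed

text \<open>Entrywise this is the Cauchy product; absolute convergence is built into
  \<open>fconv\<close> for its sake.\<close>

lemma
  assumes sF: "fshaped p q F" and F: "fconv z F" and G: "fconv z G"
  shows fconv_mult: "fconv z (F * G)"
    and fev_mult: "fev p s z (F * G) = fev p q z F * fev q s z G"
proof -
  define a where "a = (\<lambda>i j k. ent (F \<section> k) i j * z ^ k)"
  define b where "b = (\<lambda>i j k. ent (G \<section> k) i j * z ^ k)"
  have sa: "summable (\<lambda>k. norm (a i j k))" and sb: "summable (\<lambda>k. norm (b i j k))" for i j
    using F G by (auto simp: fconv_def a_def b_def)
  have e: "ent ((F * G) \<section> k) i j * z ^ k = (\<Sum>l<q. \<Sum>t\<le>k. a i l t * b l j (k - t))" for i j k
  proof -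
    have "ent ((F * G) \<section> k) i j * z ^ k = (\<Sum>t\<le>k. \<Sum>l<q. ent (F \<section> t) i l * ent (G \<section> (k - t)) l j * z ^ k)"
      using sF by (simp add: fps_mult_nth ent_sum atLeast0AtMost ent_mult[of p q] fshaped_def sum_distrib_right)
    also have "\<dots> = (\<Sum>t\<le>k. \<Sum>l<q. a i l t * b l j (k - t))"
    proof (intro sum.cong refl)
      fix t l assume "t \<in> {..k}"
      then have "z ^ k = z ^ t * z ^ (k - t)" by (simp flip: power_add)
      then show "ent (F \<section> t) i l * ent (G \<section> (k - t)) l j * z ^ k = a i l t * b l j (k - t)"
        by (simp add: a_def b_def)
    qed
    also have "\<dots> = (\<Sum>l<q. \<Sum>t\<le>k. a i l t * b l j (k - t))" by (rule sum.swap)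
    finally show ?thesis .
  qed
  show "fconv z (F * G)"
    unfolding fconv_def
  proof (intro allI)
    fix i j
    have s: "summable (\<lambda>k. \<Sum>l<q. \<Sum>t\<le>k. norm (a i l t) * norm (b l j (k - t)))"
      by (intro summable_sum sums_summable[OF Cauchy_product_sums]) (simp_all add: sa sb)
    show "summable (\<lambda>k. norm (ent ((F * G) \<section> k) i j * z ^ k))"
    proof (rule summable_comparison_test'[OF s, of 0])
      fix k
      show "norm (norm (ent ((F * G) \<section> k) i j * z ^ k)) \<le> (\<Sum>l<q. \<Sum>t\<le>k. norm (a i l t) * norm (b l j (k - t)))"
        unfolding e by (auto intro!: sum_norm_le simp: norm_mult)
    qed
  qed
  show "fev p s z (F * G) = fev p q z F * fev q s z G"
  proof (rule fmat_eq_shapedI[of p s])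
    fix i j assume ij: "i < p" "j < s"
    have "(\<lambda>k. \<Sum>l<q. \<Sum>t\<le>k. a i l t * b l j (k - t)) sums (\<Sum>l<q. (\<Sum>k. a i l k) * (\<Sum>k. b l j k))"
      by (intro sums_sum Cauchy_product_sums sa sb)
    then have "(\<Sum>k. ent ((F * G) \<section> k) i j * z ^ k) = (\<Sum>l<q. (\<Sum>k. a i l k) * (\<Sum>k. b l j k))"
      by (simp add: e sums_unique[symmetric])
    then show "ent (fev p s z (F * G)) i j = ent (fev p q z F * fev q s z G) i j"
      using ij by (simp add: ent_mult[of p q] fev_def a_def b_def)
  qed (auto intro: shaped_mult)
qed

lemma fev_const: "shaped p q x \<Longrightarrow> fev p q z (fps_const x) = x"
  by (subst fev_poly[of 0]) (auto simp: fdeg_intros)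

lemma fev_mon: "shaped p q x \<Longrightarrow> fev p q z (fmon n x) = sc (z ^ n) x"
  by (subst fev_poly[of n]) (auto simp: fdeg_intros if_distrib[of "sc _"] cong: if_cong)

text \<open>\<open>inverse (cnj z)\<close> is the reflection of \<open>z\<close> in the unit circle.
  On the circle it is \<open>z\<close> itself, and the reversed polynomials become adjoints.\<close>

lemma adj_fev_frev:
  assumes "fdeg n F" "fshaped p q F" "z \<noteq> 0"
  shows "fev q p z (frev n F) = sc (z ^ n) (adj (fev p q (inverse (cnj z)) F))"
proof -
  have "fev q p z (frev n F) = (\<Sum>k\<le>n. sc (z ^ k) (adj (F \<section> (n - k))))"
    using assms by (subst fev_poly[of n]) (auto simp: fdeg_intros)
  also have "\<dots> = (\<Sum>k\<le>n. sc (z ^ (n - k)) (adj (F \<section> k)))"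
    by (subst sum.atLeastAtMost_rev[of _ 0, simplified atLeast0AtMost]) simp
  also have "\<dots> = (\<Sum>k\<le>n. sc (z ^ n) (sc (inverse z ^ k) (adj (F \<section> k))))"
  proof (rule sum.cong)
    fix k assume "k \<in> {..n}"
    then have "z ^ n = z ^ (n - k) * z ^ k" by (simp flip: power_add)
    then show "sc (z ^ (n - k)) (adj (F \<section> k)) = sc (z ^ n) (sc (inverse z ^ k) (adj (F \<section> k)))"
      using assms(3) by (simp add: power_inverse mult.assoc)
  qed simp
  also have "\<dots> = sc (z ^ n) (adj (fev p q (inverse (cnj z)) F))"
    using assms by (subst fev_poly[of n]) (auto simp: adj_sum sc_sum)
  finally show ?thesis .
qed

section \<open>The resolvent matrix\<close>

lemmas [trans] = feq_trans

lemma frev_fmon: "frev (n + n) (fmon n x) = fmon n (adj x)"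
  by (auto simp: fps_eq_iff)

text \<open>Products with a reversed polynomial encode correlations: coefficient
  \<open>N + d\<close> is the correlation of the two coefficient sequences at lag
  \<open>d\<close>.\<close>

lemma frev_mult_top:
  assumes "fdeg N H"
  shows "(frev N G * H) \<section> (N + d) = (\<Sum>j\<le>N. adj (G \<section> j) * H \<section> (j + d))"
proof -
  have "(frev N G * H) \<section> (N + d) = (\<Sum>i\<le>N + d. frev N G \<section> i * H \<section> (N + d - i))"
    by (simp add: fps_mult_nth atLeast0AtMost)
  also have "\<dots> = (\<Sum>i\<le>N. frev N G \<section> i * H \<section> (N + d - i))"
    by (rule sum.mono_neutral_right) auto
  also have "\<dots> = (\<Sum>i\<le>N. adj (G \<section> (N - i)) * H \<section> ((N - i) + d))"
    by (intro sum.cong) auto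
  also have "\<dots> = (\<Sum>j\<le>N. adj (G \<section> j) * H \<section> (j + d))"
    by (subst sum.atLeastAtMost_rev[of _ 0, simplified atLeast0AtMost]) (auto intro!: sum.cong)
  finally show ?thesis .
qed

text \<open>Nonnegativity at all pairs \<open>x\<close>, \<open>S * x\<close> is
  \<open>J\<close>-contractivity of \<open>S\<close>.\<close>

definition jform :: "fmat \<Rightarrow> fmat \<Rightarrow> fmat \<Rightarrow> real" where
  "jform J x y = Re (ip x (J * x)) - Re (ip y (J * y))"

text \<open>The form of \<open>J\<^bsub>[N]\<^esub> - S\<^sub>N\<^sup>* J\<^bsub>[N]\<^esub> S\<^sub>N\<close>, \<open>S\<^sub>N\<close> being the block Toeplitz matrix of \<open>f\<close>.\<close>

definition toeplitz_psd :: "nat \<Rightarrow> fmat \<Rightarrow> fmat fps \<Rightarrow> bool" where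
  "toeplitz_psd m J f \<longleftrightarrow>
    (\<forall>N g. fshaped m 1 g \<longrightarrow> 0 \<le> (\<Sum>k\<le>N. jform J (g \<section> k) ((f * g) \<section> k)))"

text \<open>With \<open>r = R\<^bsup>-1/2\<^esup>\<close> and \<open>l = L\<^bsup>-1/2\<^esup>\<close> the four polynomials are \<open>al = \<pi> r\<close>, \<open>ga = \<rho> r\<close>,
  \<open>be = J \<tau>~ l\<close> and \<open>de = J \<sigma>~ l\<close>; the factor \<open>w\<close> of the resolvent matrix is kept outside of \<open>be\<close> and \<open>de\<close>.\<close>

locale resolvent =
  fixes m n :: nat and J :: fmat and f al be ga de :: "fmat fps" and r ri l li :: fmat
  assumes J: "shaped m m J" "adj J = J" "J * J = idm m"
    and f: "fshaped m m f"
    and fsh4: "fshaped m m al" "fshaped m m be" "fshaped m m ga" "fshaped m m de"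
    and deg4: "fdeg n al" "fdeg n be" "fdeg n ga" "fdeg n de"
    and r: "inverse_pair m r ri" "adj r = r" and l: "inverse_pair m l li" "adj l = l"
    and ga0: "ga \<section> 0 = r" and ben: "be \<section> n = J * l"
    and c1: "feq (Suc n) al (f * ga)"
    and c2: "feq (Suc n) (be - f * de) (fmon n li)"
    and c3: "feq (Suc n) (frev n ga * fps_const J - frev n al * fps_const J * f) (fmon n ri)"
    and c4: "feq (Suc n) (frev n be * fps_const J * f) (frev n de * fps_const J)"
    and pform: "\<And>x. (\<And>k. shaped m 1 (x k)) \<Longrightarrow>
      0 \<le> (\<Sum>k\<le>n. jform J (x k) (\<Sum>i=k..n. adj (f \<section> (i - k)) * x i))"
begin

abbreviation "E \<equiv> idm m"
abbreviation "Jc \<equiv> fps_const J"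
abbreviation "gar \<equiv> frev n ga"
abbreviation "alr \<equiv> frev n al"
abbreviation "ber \<equiv> frev n be"
abbreviation "der \<equiv> frev n de"

lemma frev_J_right: "fdeg k F \<Longrightarrow> frev k (F * Jc) = Jc * frev k F"
  using frev_mult[of k F 0 Jc] J by (simp add: fdeg_intros frev_const)

lemma frev_sandwich:
  assumes "fdeg a F" "fdeg b G"
  shows "frev (a + b) (F * Jc * G) = frev b G * Jc * frev a F"
proof -
  have "fdeg (a + 0) (F * Jc)" by (intro fdeg_mult fdeg_intros assms)
  with frev_mult[of a "F * Jc" b G] assms show ?thesis
    by (simp add: frev_J_right mult.assoc)
qed

lemma fdeg_sandwich: "fdeg a F \<Longrightarrow> fdeg b G \<Longrightarrow> fdeg (a + b) (F * Jc * G)"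
  using fdeg_mult[of a "F * Jc" b G] fdeg_mult[of a F 0 Jc] by (simp add: fdeg_intros)

text \<open>Modulo order \<open>n + 1\<close> one may replace \<open>al\<close> by
  \<open>f * ga\<close> and apply \<open>c3\<close>; what remains is the monomial with coefficient
  \<open>ri * r\<close>. The left side is its own reversal, so the congruence already determines all
  its coefficients.\<close>

lemma id1: "gar * Jc * ga - alr * Jc * al = fmon n E"
proof (rule frev_eqI[OF _ _ refl refl])
  show "fdeg (n + n) (gar * Jc * ga - alr * Jc * al)" "fdeg (n + n) (fmon n E)"
    by (intro fdeg_intros fdeg_sandwich deg4) (auto simp: fdeg_def)
  have "feq (Suc n) (gar * Jc * ga - alr * Jc * al) (gar * Jc * ga - alr * Jc * (f * ga))"
    by (intro feq_diff feq_refl feq_mult_right c1)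
  also have "\<dots> = (gar * Jc - alr * Jc * f) * ga"
    by (simp add: algebra_simps)
  also have "feq (Suc n) \<dots> (fmon n ri * ga)"
    by (intro feq_mult_left c3)
  also have "feq (Suc n) \<dots> (fmon n E)"
    using r ga0 by (auto simp: feq_def fmon_mult_nth inverse_pair_def)
  finally show eq: "feq (Suc n) (gar * Jc * ga - alr * Jc * al) (fmon n E)" .
  have "frev (n + n) (gar * Jc * ga - alr * Jc * al) = gar * Jc * ga - alr * Jc * al"
    by (simp add: frev_diff frev_sandwich fdeg_intros deg4 frev_frev)
  then show "feq n (frev (n + n) (gar * Jc * ga - alr * Jc * al)) (frev (n + n) (fmon n E))"
    using feq_mono[OF eq] by (simp add: frev_fmon)
qed

text \<open>The counterpart of \<open>id1\<close> for the second column: inserting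
  \<open>f * de\<close> splits the expression into a part governed by \<open>c2\<close> and one that
  vanishes by \<open>c4\<close>.\<close>

lemma id2: "ber * Jc * be - der * Jc * de = fmon n E"
proof (rule frev_eqI[OF _ _ refl refl])
  show "fdeg (n + n) (ber * Jc * be - der * Jc * de)" "fdeg (n + n) (fmon n E)"
    by (intro fdeg_intros fdeg_sandwich deg4) (auto simp: fdeg_def)
  have "ber * Jc * be - der * Jc * de = ber * Jc * (be - f * de) + (ber * Jc * f - der * Jc) * de"
    by (simp add: algebra_simps)
  also have "feq (Suc n) \<dots> (ber * Jc * fmon n li + 0 * de)"
    by (intro feq_add feq_mult_left feq_mult_right c2) (use c4 in \<open>auto simp: feq_def\<close>)
  also have "feq (Suc n) \<dots> (fmon n E)"
  proof -
    \<comment> \<open>The lowest coefficient of \<open>ber\<close> is \<open>l * J\<close>, the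
      adjoint of \<open>be \<section> n\<close>.\<close>
    have "l * J * J * li = l * (J * J) * li" by (simp add: mult.assoc)
    also have "\<dots> = E" using l by (simp add: J inverse_pair_def shaped_def)
    finally have "l * J * J * li = E" .
    then show ?thesis
      using ben l J by (auto simp: feq_def mult_fmon_nth mult_fps_const_nth less_Suc_eq)
  qed
  finally show eq: "feq (Suc n) (ber * Jc * be - der * Jc * de) (fmon n E)" .
  have "frev (n + n) (ber * Jc * be - der * Jc * de) = ber * Jc * be - der * Jc * de"
    by (simp add: frev_diff frev_sandwich fdeg_intros deg4 frev_frev)
  then show "feq n (frev (n + n) (ber * Jc * be - der * Jc * de)) (frev (n + n) (fmon n E))"
    using feq_mono[OF eq] by (simp add: frev_fmon)
qed

text \<open>The two identities are reversals of each other, so they are proved together: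
  \<open>c1\<close> and \<open>c4\<close> give the lower coefficients of the first,
  \<open>c2\<close> and \<open>c3\<close> those of the second. The latter hold only modulo order
  \<open>n\<close>, where the monomials of \<open>li\<close> and \<open>ri\<close> are not yet seen,
  and this is exactly what \<open>frev_eqI\<close> asks of the reversal.\<close>

lemma id3: "ber * Jc * al = der * Jc * ga"
  and id4: "alr * Jc * be = gar * Jc * de"
proof -
  have rev: "frev (n + n) (ber * Jc * al - der * Jc * ga) = alr * Jc * be - gar * Jc * de"
    by (simp add: frev_diff frev_sandwich fdeg_intros deg4 frev_frev)
  have "ber * Jc * al - der * Jc * ga = 0"
  proof (rule frev_eqI[OF _ _ rev frev_0])
    show "fdeg (n + n) (ber * Jc * al - der * Jc * ga)" "fdeg (n + n) (0 :: fmat fps)"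
      by (intro fdeg_intros fdeg_sandwich deg4)+
    have "feq (Suc n) (ber * Jc * al - der * Jc * ga) (ber * Jc * (f * ga) - der * Jc * ga)"
      by (intro feq_diff feq_refl feq_mult_right c1)
    also have "\<dots> = (ber * Jc * f - der * Jc) * ga"
      by (simp add: algebra_simps)
    also have "feq (Suc n) \<dots> (0 * ga)"
      by (intro feq_mult_left) (use c4 in \<open>auto simp: feq_def\<close>)
    finally show "feq (Suc n) (ber * Jc * al - der * Jc * ga) 0"
      by simp
    have "alr * Jc * be - gar * Jc * de = alr * Jc * (be - f * de) - (gar * Jc - alr * Jc * f) * de"
      by (simp add: algebra_simps)
    also have "feq n \<dots> (alr * Jc * 0 - 0 * de)"
      by (intro feq_diff feq_mult_left feq_mult_right) (use c2 c3 in \<open>auto simp: feq_def\<close>)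
    finally show "feq n (alr * Jc * be - gar * Jc * de) 0"
      by simp
  qed
  then show "ber * Jc * al = der * Jc * ga" "alr * Jc * be = gar * Jc * de"
    using rev by (auto simp: frev_0)
qed

section \<open>Action of the resolvent matrix on pairs of columns and preservation of
  correlations\<close>

definition "lower a b = ga * a + fsh (de * b)"
definition "upper a b = al * a + fsh (be * b)"
definition "corr a b i j = ip (lower a b \<section> i) (J * lower a b \<section> j) - ip (upper a b \<section> i) (J * upper a b \<section> j)"

context
  fixes M :: nat and a b :: "fmat fps"
  assumes ab: "fshaped m 1 a" "fshaped m 1 b" "fdeg M a" "fdeg M b"
begin


lemma pair_shaped: "fshaped m 1 (lower a b)" "fshaped m 1 (upper a b)"
  unfolding lower_def upper_def by (intro fshaped_intros fshaped_mult[of m m] fsh4 ab)+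

lemma pair_deg: "fdeg (Suc (n + M)) (lower a b)" "fdeg (Suc (n + M)) (upper a b)"
  unfolding lower_def upper_def top_def
  by (intro fdeg_intros(2,5) fdeg_mono[OF fdeg_mult[OF _ ab(3)], of n _ "Suc (n + M)"] fdeg_mult deg4 ab; simp)+

lemma pair_rev:
  "frev (Suc (n + M)) (lower a b) = fsh (frev M a * gar) + frev M b * der"
  "frev (Suc (n + M)) (upper a b) = fsh (frev M a * alr) + frev M b * ber"
  unfolding lower_def upper_def top_def
  using fdeg_mult[OF deg4(1) ab(3)] fdeg_mult[OF deg4(3) ab(3)]
  by (simp_all only: frev_add frev_Suc_fsh frev_Suc frev_mult deg4 ab)

text \<open>The isometry property in reciprocal form: \<open>id1\<close> and \<open>id2\<close> give
  the diagonal terms, and the mixed terms cancel by \<open>id3\<close> and \<open>id4\<close>. The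
  shifts record the extra factor of the variable on the \<open>be\<close>, \<open>de\<close>
  column.\<close>

lemma pair_isometry:
  "frev (Suc (n + M)) (lower a b) * Jc * (lower a b) - frev (Suc (n + M)) (upper a b) * Jc * (upper a b) =
    fsh (frev M a * fmon n E * a) - fsh (frev M b * fmon n E * b)"
proof -
  have expand: "(fsh (a' * G') + b' * D') * Jc * (G * a + fsh (D * b)) =
      fsh (a' * (G' * Jc * G) * a) + fsh (fsh (a' * (G' * Jc * D) * b)) + b' * (D' * Jc * G) * a + fsh (b' * (D' * Jc * D) * b)"
    for a' b' G D G' D'
    by (simp only: distrib_left distrib_right mult.assoc fsh_mult_left fsh_mult_right fsh_simps add_ac)
  have e: "gar * Jc * ga = fmon n E + alr * Jc * al" "der * Jc * de = ber * Jc * be - fmon n E"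
    using id1 id2 by (simp_all add: algebra_simps)
  show ?thesis
    unfolding pair_rev unfolding lower_def upper_def expand e id3 id4
    by (simp add: distrib_left distrib_right left_diff_distrib right_diff_distrib fsh_simps)
qed

text \<open>Coefficient \<open>Suc (n + M) + d\<close> of \<open>pair_isometry\<close>: correlations
  of the output, measured with \<open>J\<close>, equal those of the input. Lag 0 yields
  contractivity of the parameter; positive lags enter the Christoffel-Darboux sum.\<close>

lemma autocorrelation:
  "(\<Sum>j\<le>(Suc (n + M)). corr a b j (j + d)) = 
    (\<Sum>j\<le>M. ip (a \<section> j) (a \<section> (j + d)) - ip (b \<section> j) (b \<section> (j + d)))"
proof -
  have deg: "fdeg (Suc (n + M)) (Jc * (lower a b))" "fdeg (Suc (n + M)) (Jc * (upper a b))"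
    using fdeg_mult[of 0 Jc "Suc (n + M)"] pair_deg by (simp_all add: fdeg_intros)
  have "(\<Sum>j\<le>(Suc (n + M)). adj ((lower a b) \<section> j) * (J * (lower a b) \<section> (j + d))) - (\<Sum>j\<le>(Suc (n + M)). adj ((upper a b) \<section> j) * (J * (upper a b) \<section> (j + d)))
    = (frev (Suc (n + M)) (lower a b) * Jc * (lower a b) - frev (Suc (n + M)) (upper a b) * Jc * (upper a b)) \<section> ((Suc (n + M)) + d)"
    by (simp only: mult.assoc fps_sub_nth frev_mult_top[OF deg(1)] frev_mult_top[OF deg(2)] fps_const_mult_nth)
  also have "\<dots> = (frev M a * (fmon n E * a)) \<section> (n + M + d) - (frev M b * (fmon n E * b)) \<section> (n + M + d)"
    unfolding pair_isometry by (simp add: top_def mult.assoc)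
  also have "(frev M a * (fmon n E * a)) \<section> (n + M + d) = (frev M a * a) \<section> (M + d) * idm 1"
  proof -
    \<comment> \<open>The idempotent cannot be dropped in a ring without unit; it is moved to the
      right as \<open>idm 1\<close>, where it does not affect the entry
      \<open>(0, 0)\<close>.\<close>
    have "fmon n E * a = a * fmon n (idm 1)"
      using ab by (auto simp: fps_eq_iff fmon_mult_nth mult_fmon_nth fshaped_def shaped_def)
    then have "frev M a * (fmon n E * a) = frev M a * a * fmon n (idm 1)" by (simp add: mult.assoc)
    then show ?thesis by (simp add: mult_fmon_nth add.assoc)
  qed
  also have "(frev M b * (fmon n E * b)) \<section> (n + M + d) = (frev M b * b) \<section> (M + d) * idm 1"
  proof -
    have "fmon n E * b = b * fmon n (idm 1)"
      using ab by (auto simp: fps_eq_iff fmon_mult_nth mult_fmon_nth fshaped_def shaped_def)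
    then have "frev M b * (fmon n E * b) = frev M b * b * fmon n (idm 1)" by (simp add: mult.assoc)
    then show ?thesis by (simp add: mult_fmon_nth add.assoc)
  qed
  finally show ?thesis
    unfolding frev_mult_top[OF ab(3)] frev_mult_top[OF ab(4)] corr_def ip_def sum_subtractf ent_sum[symmetric]
    by (drule_tac f = "\<lambda>x. ent x 0 0" in arg_cong) (simp add: idm_right)
qed

end

end

section \<open>The Schur parameter of an interpolating power series\<close>

lemma toeplitz_psdD: "toeplitz_psd m J f \<Longrightarrow> fshaped m 1 g \<Longrightarrow> 0 \<le> (\<Sum>k\<le>N. jform J (g \<section> k) ((f * g) \<section> k))"
  by (simp add: toeplitz_psd_def)

definition fcut :: "nat \<Rightarrow> fmat fps \<Rightarrow> fmat fps" where
  "fcut n F = Abs_fps (\<lambda>k. if k \<le> n then F \<section> k else 0)"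

lemma fcut_nth [simp]: "fcut n F \<section> k = (if k \<le> n then F \<section> k else 0)"
  by (simp add: fcut_def)

lemma fcut_props: "fdeg n (fcut n F)" "feq (Suc n) (fcut n F) F" "fshaped p q F \<Longrightarrow> fshaped p q (fcut n F)"
  by (auto simp: fdeg_def feq_def fshaped_def)

context resolvent
begin

text \<open>Rewrite the equation as \<open>f * ga - al = fsh ((be - f * de) * S)\<close>. By
  \<open>c1\<close> the left side starts at order \<open>n + 1\<close>; by \<open>c2\<close> the
  factor \<open>be - f * de\<close> starts at order \<open>n\<close> with coefficient
  \<open>li\<close>. After cancelling \<open>n + 1\<close> powers the divisor has an invertible
  constant coefficient.\<close>

lemma schur_parameter_exists:
  obtains S where "fshaped m m S" "f * (ga + fsh (de * S)) = al + fsh (be * S)"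
proof -
  define v where "v = Abs_fps (\<lambda>k. (be - f * de) \<section> (n + k))"
  define u where "u = Abs_fps (\<lambda>k. (f * ga - al) \<section> (Suc n + k))"
  have sb: "fshaped m m (be - f * de)" "fshaped m m (f * ga - al)"
    by (intro fshaped_intros fshaped_mult[of m m] fsh4 f)+
  then have s: "fshaped m m v" "fshaped m m u"
    by (auto simp: v_def u_def fshaped_def)
  have v: "be - f * de = fmon n E * v"
    using c2 fshaped_idm_nth[OF sb(1)]
    by (auto simp: fps_eq_iff feq_def fmon_mult_nth v_def simp del: fps_sub_nth)
  have u: "f * ga - al = fsh (fmon n E * u)"
  proof (rule fps_ext)
    fix k
    show "(f * ga - al) \<section> k = fsh (fmon n E * u) \<section> k"
    proof (cases "k < Suc n")
      case True
      then show ?thesis using c1 by (auto simp: feq_def fsh_nth fmon_mult_nth)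
    next
      case False
      then have "fsh (fmon n E * u) \<section> k = E * (f * ga - al) \<section> (Suc n + (k - 1 - n))" "Suc n + (k - 1 - n) = k"
        by (auto simp: fsh_nth fmon_mult_nth u_def simp del: fps_sub_nth)
      then show ?thesis using fshaped_idm_nth[OF sb(2)] by simp
    qed
  qed
  have "v \<section> 0 = li" using c2 by (simp add: v_def feq_def)
  with l have "inverse_pair m (v \<section> 0) l" by (simp add: inverse_pair_sym)
  from fps_left_division[OF this s] obtain S where S: "fshaped m m S" "v * S = u" by metis
  have "f * ga - al = fsh ((be - f * de) * S)"
    unfolding u v mult.assoc S(2) ..
  then have "f * (ga + fsh (de * S)) = al + fsh (be * S)"
    by (simp add: algebra_simps fsh_mult_right fsh_simps mult.assoc)
  with S(1) that show thesis by blast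
qed

text \<open>Feed \<open>a\<close> and \<open>S * a\<close>, both cut at degree \<open>M\<close>,
  into the resolvent matrix. Up to the degree of the output, \<open>f\<close> maps
  \<open>lower\<close> to \<open>upper\<close>, so the Toeplitz form of \<open>f\<close> at
  \<open>lower\<close> is the lag 0 correlation of the input, which is the difference of the two
  sums.\<close>

lemma schur_parameter_contractive:
  assumes S: "fshaped m m S" "f * (ga + fsh (de * S)) = al + fsh (be * S)"
    and T: "toeplitz_psd m J f" and a: "fshaped m 1 a"
  shows "(\<Sum>k\<le>M. nrm2 ((S * a) \<section> k)) \<le> (\<Sum>k\<le>M. nrm2 (a \<section> k))"
proof -
  define a' where "a' = fcut M a"
  define b' where "b' = fcut M (S * a)"
  have ab: "fshaped m 1 a'" "fshaped m 1 b'" "fdeg M a'" "fdeg M b'"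
    using a fshaped_mult[OF S(1) a] by (auto simp: a'_def b'_def fcut_props)
  have "feq (Suc M) (S * a') b'"
    unfolding a'_def b'_def
    using feq_mult_right[OF fcut_props(2)[of M a], of S] fcut_props(2)[of M "S * a"]
    by (metis feq_sym feq_trans)
  then have S0: "feq (Suc M) (S * a' - b') 0" by (auto simp: feq_def)
  \<comment> \<open>The degree bound of \<open>lower\<close> and \<open>upper\<close>. The error
    below has order \<open>n\<close> from \<open>be - f * de\<close>, \<open>M + 1\<close> from the
    cut and 1 from the shift, so it vanishes at all indices up to \<open>N\<close>.\<close>
  define N where "N = Suc (n + M)"
  have "f * lower a' b' - upper a' b' = (f * ga - al) * a' - fsh ((be - f * de) * b')"
    by (simp add: lower_def upper_def algebra_simps fsh_mult_right fsh_simps)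
  also have "f * ga - al = fsh ((be - f * de) * S)"
    using S(2) by (simp add: algebra_simps fsh_mult_right fsh_simps)
  finally have "f * lower a' b' - upper a' b' = fsh ((be - f * de) * (S * a' - b'))"
    by (simp add: fsh_mult_left fsh_simps right_diff_distrib mult.assoc)
  moreover have "feq (Suc (Suc (n + M))) (fsh ((be - f * de) * (S * a' - b'))) 0"
  proof -
    have "((be - f * de) * (S * a' - b')) \<section> k = 0" if "k \<le> n + M" for k
      unfolding fps_mult_nth
    proof (intro sum.neutral ballI)
      fix i assume i: "i \<in> {0..k}"
      show "(be - f * de) \<section> i * (S * a' - b') \<section> (k - i) = 0"
      proof (cases "i < n")
        case True
        then have "(be - f * de) \<section> i = 0" using c2 unfolding feq_def by force
        then show ?thesis by simp
      next
        case False
        then have "k - i < Suc M" using that i by auto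
        then have "(S * a' - b') \<section> (k - i) = 0" using S0 unfolding feq_def by force
        then show ?thesis by simp
      qed
    qed
    then show ?thesis by (auto simp: feq_def fsh_nth)
  qed
  ultimately have "(f * lower a' b' - upper a' b') \<section> k = 0" if "k \<le> N" for k
    using that by (simp add: feq_def N_def)
  then have eq: "(f * lower a' b') \<section> k = upper a' b' \<section> k" if "k \<le> N" for k
    using that by simp
  have "0 \<le> (\<Sum>k\<le>N. jform J (lower a' b' \<section> k) ((f * lower a' b') \<section> k))"
    by (rule toeplitz_psdD[OF T pair_shaped(1)[OF ab]])
  also have "\<dots> = Re (\<Sum>k\<le>N. corr a' b' k (k + 0))"
    by (simp add: eq jform_def corr_def)
  also have "\<dots> = (\<Sum>k\<le>M. nrm2 (a' \<section> k)) - (\<Sum>k\<le>M. nrm2 (b' \<section> k))"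
    unfolding N_def autocorrelation[OF ab] by (simp add: nrm2_def sum_subtractf)
  finally show ?thesis by (simp add: a'_def b'_def)
qed

text \<open>The Christoffel-Darboux argument: \<open>uG i\<close> and \<open>uF i\<close> are the values at \<open>z\<close> of the \<open>i\<close>-fold
  backward shifts of the two components.\<close>

lemma J_expansive:
  assumes x: "shaped m 1 x" and y: "shaped m 1 y" and z: "cmod z \<le> 1"
  shows "nrm2 x - nrm2 y \<le> jform J (fev m 1 z (lower (fps_const x) (fps_const y)))
    (fev m 1 z (upper (fps_const x) (fps_const y)))"
proof -
  define N where "N = Suc n"
  define G where "G = lower (fps_const x) (fps_const y)"
  define F where "F = upper (fps_const x) (fps_const y)"
  have xy: "fshaped m 1 (fps_const x)" "fshaped m 1 (fps_const y)" "fdeg 0 (fps_const x)" "fdeg 0 (fps_const y)"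
    using x y by (auto simp: fdeg_intros)
  have sGF: "fshaped m 1 G" "fshaped m 1 F" and dGF: "fdeg N G" "fdeg N F"
    using pair_shaped[OF xy] pair_deg[OF xy] by (auto simp: G_def F_def N_def)
  define uG where "uG i = (\<Sum>k\<le>N. sc (z ^ k) (G \<section> (i + k)))" for i
  define uF where "uF i = (\<Sum>k\<le>N. sc (z ^ k) (F \<section> (i + k)))" for i
  define C where "C = corr (fps_const x) (fps_const y)"
  have C: "C i j = ip (G \<section> i) (J * G \<section> j) - ip (F \<section> i) (J * F \<section> j)" for i j
    by (simp add: C_def corr_def G_def F_def)
  \<comment> \<open>The input is constant, so its correlations at positive lags vanish.\<close>
  have auto: "(\<Sum>j\<le>N. C j (j + d)) = (if d = 0 then of_real (nrm2 x - nrm2 y) else 0)" for d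
    unfolding C_def N_def using autocorrelation[OF xy, of d] by (simp add: ip_simps ip_self_real)
  have fevG: "fev m 1 z G = uG 0" "fev m 1 z F = uF 0"
    using sGF dGF by (simp_all add: fev_poly uG_def uF_def)
  have shift: "(\<Sum>k\<le>N. sc (z ^ k) (H \<section> (i + k))) = H \<section> i + sc z (\<Sum>k\<le>N. sc (z ^ k) (H \<section> (Suc i + k)))"
    if "fdeg N H" for H i
  proof -
    have "(\<Sum>k\<le>N. sc (z ^ k) (H \<section> (i + k))) = (\<Sum>k\<le>Suc N. sc (z ^ k) (H \<section> (i + k)))"
      using that by (simp add: fdeg_def)
    also have "\<dots> = H \<section> i + sc z (\<Sum>k\<le>N. sc (z ^ k) (H \<section> (Suc i + k)))"
      by (subst sum.atMost_Suc_shift) (simp add: sc_sum)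
    finally show ?thesis .
  qed
  have uG_Suc: "uG i = G \<section> i + sc z (uG (Suc i))" and uF_Suc: "uF i = F \<section> i + sc z (uF (Suc i))" for i
    unfolding uG_def uF_def by (rule shift[OF dGF(1)], rule shift[OF dGF(2)])
  have u_zero: "uG i = 0" "uF i = 0" if "N < i" for i
    using dGF that by (auto simp: uG_def uF_def fdeg_def intro!: sum.neutral)
  define q where "q i = jform J (uG i) (uF i)" for i
  define c where "c i = ip (G \<section> i) (J * uG (Suc i)) - ip (F \<section> i) (J * uF (Suc i))" for i
  \<comment> \<open>The \<open>J\<close>-form is expanded along
    \<open>uG i = G \<section> i + sc z (uG (Suc i))\<close>. After summation over \<open>i\<close>
    the mixed terms collect correlations of positive lag only and disappear.\<close>
  have q_step: "q i = Re (C i i) + 2 * Re (z * c i) + (cmod z)\<^sup>2 * q (Suc i)" for i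
  proof -
    have aux: "Re (ip (a + sc z b) (J * (a + sc z b))) =
        Re (ip a (J * a)) + 2 * Re (z * ip a (J * b)) + (cmod z)\<^sup>2 * Re (ip b (J * b))" for a b
    proof -
      have "ip b (J * a) = cnj (ip a (J * b))" by (rule herm_ip_cnj[OF J(2)])
      moreover have "z * cnj z = of_real ((cmod z)\<^sup>2)" by (rule complex_norm_square[symmetric])
      ultimately have "ip (a + sc z b) (J * (a + sc z b)) =
          ip a (J * a) + (z * ip a (J * b) + cnj (z * ip a (J * b))) + of_real ((cmod z)\<^sup>2) * ip b (J * b)"
        by (simp add: distrib_left ip_simps sc_mult_right)
      then show ?thesis by simp
    qed
    show ?thesis
      unfolding q_def jform_def uG_Suc[of i] uF_Suc[of i] aux C c_def
      by (simp add: algebra_simps)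
  qed
  have "(\<Sum>i\<le>N. c i) = (\<Sum>i\<le>N. \<Sum>k\<le>N. z ^ k * C i (i + Suc k))"
    by (simp add: c_def C uG_def uF_def sum_distrib_left ip_sum_right ip_simps sc_mult_right right_diff_distrib sum_subtractf)
  also have "\<dots> = (\<Sum>k\<le>N. z ^ k * (\<Sum>i\<le>N. C i (i + Suc k)))"
    by (subst sum.swap) (simp add: sum_distrib_left)
  also have "\<dots> = 0" by (simp only: auto) simp
  finally have c0: "(\<Sum>i\<le>N. c i) = 0" .
  have "(\<Sum>i\<le>N. q i) = Re (\<Sum>i\<le>N. C i (i + 0)) + 2 * Re (z * (\<Sum>i\<le>N. c i)) + (cmod z)\<^sup>2 * (\<Sum>i\<le>N. q (Suc i))"
    by (subst q_step) (simp add: sum.distrib sum_distrib_left)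
  then have "(\<Sum>i\<le>N. q i) = nrm2 x - nrm2 y + (cmod z)\<^sup>2 * (\<Sum>i\<le>N. q (Suc i))"
    unfolding auto c0 by simp
  moreover have "q 0 + (\<Sum>i\<le>N. q (Suc i)) = (\<Sum>i\<le>N. q i) + q (Suc N)"
    by (simp only: sum.atMost_Suc_shift[symmetric] sum.atMost_Suc)
  moreover have qN: "q (Suc N) = 0" by (simp add: q_def u_zero jform_def ip_simps)
  ultimately have q0: "q 0 = nrm2 x - nrm2 y - (1 - (cmod z)\<^sup>2) * (\<Sum>i\<le>N. q (Suc i))"
    by (simp add: algebra_simps)
  \<comment> \<open>A reversed reading of \<open>c3\<close> and \<open>c4\<close>. The case
    \<open>i = 0\<close> would be coefficient \<open>n + 1\<close>, beyond the reach of these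
    congruences.\<close>
  have rel: "J * G \<section> i = (\<Sum>t\<le>n. adj (f \<section> t) * (J * F \<section> (i + t)))" if "1 \<le> i" for i
  proof (cases "i \<le> N")
    case False
    then show ?thesis using dGF by (simp add: fdeg_def)
  next
    case True
    define k where "k = N - i"
    have k: "k \<le> n" "N - k = i" "k \<le> N" using that True by (auto simp: k_def N_def)
    have Fz: "F \<section> (i + t) = 0" if "k < t" for t
      using dGF(2) that k by (auto simp: fdeg_def)
    have "frev N G * Jc - frev N F * Jc * f =
        fsh (fps_const (adj x) * (gar * Jc - alr * Jc * f)) + fps_const (adj y) * (der * Jc - ber * Jc * f)"
      unfolding G_def F_def N_def pair_rev[OF xy, simplified]
      by (simp add: frev_const distrib_right fsh_mult_left fsh_simps right_diff_distrib mult.assoc)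
    moreover have "feq (Suc n) \<dots> (fsh (fps_const (adj x) * 0) + fps_const (adj y) * 0)"
      by (intro feq_add feq_fsh feq_mult_right) (use c3 c4 in \<open>auto simp: feq_def\<close>)
    ultimately have "(frev N G * Jc - frev N F * Jc * f) \<section> k = 0"
      using k by (simp add: feq_def fsh_simps)
    then have "adj (G \<section> i) * J = (\<Sum>j\<le>k. adj (F \<section> (N - j)) * J * f \<section> (k - j))"
      using k unfolding fps_sub_nth fps_mult_nth[of "frev N F * Jc"] mult_fps_const_nth atLeast0AtMost by simp
    also have "\<dots> = (\<Sum>t\<le>k. adj (F \<section> (i + t)) * J * f \<section> t)"
      by (rule sum.reindex_bij_witness[of _ "\<lambda>t. k - t" "\<lambda>j. k - j"]) (use k in auto)
    also have "\<dots> = (\<Sum>t\<le>n. adj (F \<section> (i + t)) * J * f \<section> t)"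
      by (rule sum.mono_neutral_left) (use k Fz in \<open>auto simp: not_le\<close>)
    finally have "adj (adj (G \<section> i) * J) = adj (\<Sum>t\<le>n. adj (F \<section> (i + t)) * J * f \<section> t)" by simp
    then show ?thesis by (simp add: adj_sum J mult.assoc)
  qed
  have rel_u: "J * uG i = (\<Sum>t\<le>n. adj (f \<section> t) * (J * uF (i + t)))" if "1 \<le> i" for i
  proof -
    have "J * uG i = (\<Sum>k\<le>N. sc (z ^ k) (\<Sum>t\<le>n. adj (f \<section> t) * (J * F \<section> (i + k + t))))"
      using that by (simp add: uG_def sum_distrib_left sc_mult_right rel)
    also have "\<dots> = (\<Sum>t\<le>n. \<Sum>k\<le>N. sc (z ^ k) (adj (f \<section> t) * (J * F \<section> (i + k + t))))"
      unfolding sc_sum by (rule sum.swap)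
    also have "\<dots> = (\<Sum>t\<le>n. adj (f \<section> t) * (J * uF (i + t)))"
      by (simp add: uF_def sum_distrib_left sc_mult_right add_ac)
    finally show ?thesis .
  qed
  have suF: "shaped m 1 (uF i)" "shaped m 1 (uG i)" for i
    using sGF unfolding uF_def uG_def by (auto intro!: shaped_sum simp: fshaped_def)
  have JJ: "ip (J * a) (J * (J * a)) = ip a (J * a)" if "shaped m 1 a" for a
    using that by (simp add: ip_mult_left J flip: mult.assoc) (simp add: mult.assoc shaped_left[OF J(1)] J(3) shaped_left shaped_left_assoc[OF J(1)])
  \<comment> \<open>By \<open>rel_u\<close> the adjoint Toeplitz sum of the columns
    \<open>J * uF (Suc k)\<close> is \<open>J * uG (Suc k)\<close>. The form in \<open>pform\<close>
    is thus minus the sum of the \<open>q (Suc i)\<close>, and this fixes the sign of the remainder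
    in \<open>q0\<close>.\<close>
  have "0 \<le> (\<Sum>k\<le>n. jform J (J * uF (Suc k)) (\<Sum>i=k..n. adj (f \<section> (i - k)) * (J * uF (Suc i))))"
    by (rule pform) (use J suF in auto)
  also have "\<dots> = (\<Sum>k\<le>n. - q (Suc k))"
  proof (rule sum.cong)
    fix k assume "k \<in> {..n}"
    then have k: "k \<le> n" by simp
    have "(\<Sum>i=k..n. adj (f \<section> (i - k)) * (J * uF (Suc i))) = (\<Sum>t\<le>n - k. adj (f \<section> t) * (J * uF (Suc k + t)))"
      using k by (intro sum.reindex_bij_witness[of _ "\<lambda>t. t + k" "\<lambda>i. i - k"]) auto
    also have "\<dots> = (\<Sum>t\<le>n. adj (f \<section> t) * (J * uF (Suc k + t)))"
    proof (rule sum.mono_neutral_left)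
      have "uF (Suc k + t) = 0" if "n - k < t" for t
        using that k by (intro u_zero) (simp add: N_def)
      then show "\<forall>t\<in>{..n} - {..n - k}. adj (f \<section> t) * (J * uF (Suc k + t)) = 0" by (simp add: not_le)
    qed auto
    also have "\<dots> = J * uG (Suc k)" by (rule rel_u[symmetric]) simp
    finally show "jform J (J * uF (Suc k)) (\<Sum>i=k..n. adj (f \<section> (i - k)) * (J * uF (Suc i))) = - q (Suc k)"
      by (simp add: jform_def q_def JJ suF)
  qed simp
  also have "\<dots> = - (\<Sum>i\<le>N. q (Suc i))"
    using qN by (simp add: N_def sum_negf)
  finally have "(\<Sum>i\<le>N. q (Suc i)) \<le> 0" by simp
  moreover have "0 \<le> 1 - (cmod z)\<^sup>2" using z by (simp add: power_le_one)
  ultimately have "(1 - (cmod z)\<^sup>2) * (\<Sum>i\<le>N. q (Suc i)) \<le> 0" by (simp add: mult_nonneg_nonpos)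
  then have "nrm2 x - nrm2 y \<le> q 0" unfolding q0 by simp
  then show ?thesis
    unfolding q_def fevG[symmetric] by (simp add: G_def F_def)
qed

end

section \<open>Bessel inequality for contractive symbols\<close>

abbreviation circ :: "real \<Rightarrow> real \<Rightarrow> complex" where
  "circ r t \<equiv> of_real r * exp (2 * of_real pi * \<i> * of_real t)"

lemma circ_norm: "0 \<le> r \<Longrightarrow> cmod (circ r t) = r"
proof -
  have "exp (2 * of_real pi * \<i> * of_real t) = cis (2 * pi * t)"
    by (simp add: cis_conv_exp mult_ac)
  then show "0 \<le> r \<Longrightarrow> ?thesis" by (simp add: norm_mult)
qed

lemma circle_mean_value:
  assumes "g holomorphic_on ball 0 1" "0 < r" "r < 1"
  shows "((\<lambda>t. g (circ r t)) has_integral g 0) {0..1}"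
proof -
  have "g holomorphic_on cball 0 r"
    using assms by (auto intro: holomorphic_on_subset)
  then have "((\<lambda>u. g u / (u - 0)) has_contour_integral 2 * complex_of_real pi * \<i> * g 0) (circlepath 0 r)"
    using assms by (intro Cauchy_integral_circlepath_simple) auto
  then have "((\<lambda>t. g (circlepath 0 r t) / circlepath 0 r t * vector_derivative (circlepath 0 r) (at t within {0..1}))
      has_integral 2 * complex_of_real pi * \<i> * g 0) {0..1}"
    by (simp add: has_contour_integral_def)
  then have "((\<lambda>t. 2 * complex_of_real pi * \<i> * g (circ r t)) has_integral 2 * complex_of_real pi * \<i> * g 0) {0..1}"
  proof (rule has_integral_eq[rotated])
    fix t :: real assume "t \<in> {0..1}"
    moreover have "circlepath 0 r t = circ r t" by (simp add: circlepath)
    ultimately show "g (circlepath 0 r t) / circlepath 0 r t * vector_derivative (circlepath 0 r) (at t within {0..1}) =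
        2 * complex_of_real pi * \<i> * g (circ r t)"
      using assms by (simp add: vector_derivative_circlepath01)
  qed
  from has_integral_mult_right[OF this, of "inverse (2 * complex_of_real pi * \<i>)"]
  show ?thesis by (simp add: field_simps)
qed

lemma continuous_on_circ:
  assumes "continuous_on (ball 0 1) g" "0 < r" "r < 1"
  shows "continuous_on {0..1} (\<lambda>t. g (circ r t))"
  by (rule continuous_on_compose2[OF assms(1)]) (use assms circ_norm[of r] in \<open>auto intro!: continuous_intros\<close>)

definition circ_avg :: "real \<Rightarrow> (complex \<Rightarrow> real) \<Rightarrow> real" where
  "circ_avg r g = integral {0..1} (\<lambda>t. g (circ r t))"

lemma circ_integrable:
  fixes g :: "complex \<Rightarrow> real"
  assumes "continuous_on (ball 0 1) g" "0 < r" "r < 1"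
  shows "(\<lambda>t. g (circ r t)) integrable_on {0..1}"
  using continuous_on_circ[OF assms] by (rule integrable_continuous_real)

lemma circ_avg_add:
  assumes "continuous_on (ball 0 1) g" "continuous_on (ball 0 1) h" "0 < r" "r < 1"
  shows "circ_avg r (\<lambda>z. g z + h z) = circ_avg r g + circ_avg r h"
  unfolding circ_avg_def by (intro integral_add circ_integrable assms)

lemma circ_avg_mono:
  assumes "continuous_on (ball 0 1) g" "continuous_on (ball 0 1) h" "0 < r" "r < 1"
    "\<And>z. cmod z < 1 \<Longrightarrow> g z \<le> h z"
  shows "circ_avg r g \<le> circ_avg r h"
  unfolding circ_avg_def
  by (intro integral_le circ_integrable assms) (use assms circ_norm[of r] in auto)

lemma circ_avg_sum:
  assumes "finite A" "\<And>a. a \<in> A \<Longrightarrow> continuous_on (ball 0 1) (g a)" "0 < r" "r < 1"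
  shows "circ_avg r (\<lambda>z. \<Sum>a\<in>A. g a z) = (\<Sum>a\<in>A. circ_avg r (g a))"
  unfolding circ_avg_def by (rule integral_sum) (use assms circ_integrable in auto)

text \<open>On the circle of radius \<open>r\<close> one has \<open>cnj z = r^2 / z\<close>, which
  turns the integrand into a holomorphic function divisible by the variable; its mean is its value 0
  at the origin.\<close>

lemma circ_orthogonal:
  fixes c :: "nat \<Rightarrow> complex" and N :: nat
  assumes psi: "psi holomorphic_on ball 0 1" and r: "0 < r" "r < 1"
  defines "p \<equiv> \<lambda>z. \<Sum>k\<le>N. c k * z ^ k"
  shows "circ_avg r (\<lambda>z. Re (cnj (p z) * (z ^ Suc N * psi z))) = 0"
proof -
  define x where "x = (\<lambda>z. \<Sum>k\<le>N. cnj (c k) * of_real (r ^ (2 * k)) * z ^ (Suc N - k) * psi z)"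
  have "x holomorphic_on ball 0 1" unfolding x_def by (intro holomorphic_intros psi)
  from circle_mean_value[OF this r] have "((\<lambda>t. x (circ r t)) has_integral 0) {0..1}"
  proof -
    have "x 0 = 0" unfolding x_def by (intro sum.neutral) (auto simp: power_0_left)
    then show "((\<lambda>t. x (circ r t)) has_integral x 0) {0..1} \<Longrightarrow> ?thesis" by simp
  qed
  moreover have "x z = cnj (p z) * (z ^ Suc N * psi z)" if "cmod z = r" for z
  proof -
    have zz: "cnj z * z = of_real (r\<^sup>2)"
      using that by (metis complex_norm_square mult.commute)
    have "cnj (p z) * (z ^ Suc N * psi z) = (\<Sum>k\<le>N. cnj (c k) * cnj z ^ k * (z ^ Suc N * psi z))"
      by (simp add: p_def sum_distrib_right)
    also have "\<dots> = x z"
      unfolding x_def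
    proof (rule sum.cong)
      fix k assume "k \<in> {..N}"
      then have "z ^ Suc N = z ^ k * z ^ (Suc N - k)" by (simp flip: power_add)
      then have "cnj z ^ k * z ^ Suc N = (cnj z * z) ^ k * z ^ (Suc N - k)"
        by (simp only: power_mult_distrib mult.assoc)
      also have "(cnj z * z) ^ k = of_real (r ^ (2 * k))"
        by (simp add: zz power_mult)
      finally show "cnj (c k) * cnj z ^ k * (z ^ Suc N * psi z) =
          cnj (c k) * of_real (r ^ (2 * k)) * z ^ (Suc N - k) * psi z"
        by (simp only: mult.assoc[symmetric]) (simp only: mult.assoc)
    qed simp
    finally show ?thesis ..
  qed
  ultimately have "((\<lambda>t. cnj (p (circ r t)) * (circ r t ^ Suc N * psi (circ r t))) has_integral 0) {0..1}"
    using r circ_norm[of r] by (simp cong: has_integral_cong)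
  from has_integral_linear[OF this bounded_linear_Re] show ?thesis
    unfolding circ_avg_def by (simp add: o_def integral_unique)
qed

lemma circ_avg_add_tail:
  fixes c :: "nat \<Rightarrow> complex" and N :: nat
  assumes psi: "psi holomorphic_on ball 0 1" and r: "0 < r" "r < 1"
  defines "p \<equiv> \<lambda>z. \<Sum>k\<le>N. c k * z ^ k"
  shows "circ_avg r (\<lambda>z. (cmod (p z + z ^ Suc N * psi z))\<^sup>2) =
    circ_avg r (\<lambda>z. (cmod (p z))\<^sup>2) + circ_avg r (\<lambda>z. (cmod (z ^ Suc N * psi z))\<^sup>2)"
proof -
  have cpsi: "continuous_on (ball 0 1) psi" using psi by (rule holomorphic_on_imp_continuous_on)
  have cp: "continuous_on (ball 0 1) p" unfolding p_def by (intro continuous_intros)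
  have e: "(cmod (a + b))\<^sup>2 = (cmod a)\<^sup>2 + (cmod b)\<^sup>2 + (Re (cnj a * b) + Re (cnj a * b))" for a b
    unfolding cmod_power2 by (simp add: power2_eq_square algebra_simps)
  have c: "continuous_on (ball 0 1) (\<lambda>z. (cmod (p z))\<^sup>2)" "continuous_on (ball 0 1) (\<lambda>z. (cmod (z ^ Suc N * psi z))\<^sup>2)"
    "continuous_on (ball 0 1) (\<lambda>z. Re (cnj (p z) * (z ^ Suc N * psi z)))"
    by (intro continuous_intros cp cpsi)+
  have o: "circ_avg r (\<lambda>z. Re (cnj (p z) * (z ^ Suc N * psi z))) = 0"
    unfolding p_def by (rule circ_orthogonal[OF psi r])
  show ?thesis
    unfolding e by (simp only: circ_avg_add[OF _ _ r] c continuous_on_add o)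
qed

text \<open>The finite Parseval identity, by splitting off the top monomial, which is orthogonal to
  the lower ones.\<close>

lemma circ_avg_poly:
  assumes r: "0 < r" "r < 1"
  shows "circ_avg r (\<lambda>z. (cmod (\<Sum>k\<le>N. c k * z ^ k))\<^sup>2) = (\<Sum>k\<le>N. (cmod (c k))\<^sup>2 * r ^ (2 * k))"
proof (induction N)
  case 0
  then show ?case by (simp add: circ_avg_def)
next
  case (Suc N)
  have "circ_avg r (\<lambda>z. (cmod (z ^ Suc N * c (Suc N)))\<^sup>2) = (cmod (c (Suc N)))\<^sup>2 * r ^ (2 * Suc N)"
    using r by (simp add: circ_avg_def norm_mult norm_power circ_norm power_mult_distrib mult.commute flip: power_mult del: power_Suc mult_Suc_right)
  moreover have "circ_avg r (\<lambda>z. (cmod ((\<Sum>k\<le>N. c k * z ^ k) + z ^ Suc N * c (Suc N)))\<^sup>2) =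
     circ_avg r (\<lambda>z. (cmod (\<Sum>k\<le>N. c k * z ^ k))\<^sup>2) + circ_avg r (\<lambda>z. (cmod (z ^ Suc N * c (Suc N)))\<^sup>2)"
    by (rule circ_avg_add_tail[OF _ r]) auto
  ultimately show ?case using Suc by (simp add: mult.commute[of _ "c (Suc N)"] del: power_Suc)
qed

lemma holomorphic_power_series_split:
  assumes "phi holomorphic_on ball 0 1"
  obtains psi where "psi holomorphic_on ball 0 1"
    "\<And>z. cmod z < 1 \<Longrightarrow> phi z = (\<Sum>k\<le>N. fps_expansion phi 0 \<section> k * z ^ k) + z ^ Suc N * psi z"
proof -
  define P where "P = fps_expansion phi 0"
  have hol: "phi holomorphic_on eball 0 1" using assms by (simp add: one_ereal_def)
  have rad: "fps_conv_radius P \<ge> 1"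
    unfolding P_def by (rule conv_radius_fps_expansion[OF hol])
  define psi where "psi = eval_fps (fps_shift (Suc N) P)"
  have rad': "fps_conv_radius (fps_shift (Suc N) P) \<ge> 1" using rad by simp
  have "psi holomorphic_on eball 0 1"
    unfolding psi_def by (rule holomorphic_on_eval_fps) (auto intro!: less_le_trans[OF _ rad])
  moreover have "phi z = (\<Sum>k\<le>N. P \<section> k * z ^ k) + z ^ Suc N * psi z" if z: "cmod z < 1" for z
  proof -
    have zr: "ereal (norm z) < fps_conv_radius P" "ereal (norm z) < fps_conv_radius (fps_shift (Suc N) P)"
      using z rad rad' by (metis ereal_less(3) less_le_trans)+
    have "phi z = eval_fps P z"
      unfolding P_def using eval_fps_expansion[OF hol, of z] z by simp
    also have "\<dots> = (\<Sum>k. P \<section> (k + Suc N) * z ^ (k + Suc N)) + (\<Sum>k<Suc N. P \<section> k * z ^ k)"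
      unfolding eval_fps_def by (rule suminf_split_initial_segment[OF summable_fps[OF zr(1)]])
    also have "(\<Sum>k. P \<section> (k + Suc N) * z ^ (k + Suc N)) = (\<Sum>k. z ^ Suc N * (fps_shift (Suc N) P \<section> k * z ^ k))"
      by (simp add: power_add mult_ac)
    also have "\<dots> = z ^ Suc N * psi z"
      unfolding psi_def eval_fps_def by (rule suminf_mult[OF summable_fps[OF zr(2)]])
    finally show ?thesis by (simp add: lessThan_Suc_atMost)
  qed
  ultimately show thesis using that[of psi] by (simp add: P_def one_ereal_def)
qed

lemma bessel_inequality:
  assumes phi: "phi holomorphic_on ball 0 1" and r: "0 < r" "r < 1"
  shows "(\<Sum>k\<le>N. (cmod (fps_expansion phi 0 \<section> k))\<^sup>2 * r ^ (2 * k)) \<le> circ_avg r (\<lambda>z. (cmod (phi z))\<^sup>2)"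
proof -
  define p where "p = (\<lambda>z. \<Sum>k\<le>N. fps_expansion phi 0 \<section> k * z ^ k)"
  obtain psi where psi: "psi holomorphic_on ball 0 1" "\<And>z. cmod z < 1 \<Longrightarrow> phi z = p z + z ^ Suc N * psi z"
    unfolding p_def using holomorphic_power_series_split[OF phi, of N] by metis
  have "circ_avg r (\<lambda>z. (cmod (phi z))\<^sup>2) = circ_avg r (\<lambda>z. (cmod (p z + z ^ Suc N * psi z))\<^sup>2)"
    unfolding circ_avg_def using r circ_norm[of r] by (intro integral_cong) (simp add: psi(2))
  also have "\<dots> = circ_avg r (\<lambda>z. (cmod (p z))\<^sup>2) + circ_avg r (\<lambda>z. (cmod (z ^ Suc N * psi z))\<^sup>2)"
    unfolding p_def by (rule circ_avg_add_tail[OF psi(1) r])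
  also have "\<dots> \<ge> circ_avg r (\<lambda>z. (cmod (p z))\<^sup>2)"
  proof -
    have "continuous_on (ball 0 1) (\<lambda>z. (cmod (z ^ Suc N * psi z))\<^sup>2)"
      by (intro continuous_intros holomorphic_on_imp_continuous_on[OF psi(1)])
    from integral_nonneg[OF circ_integrable[OF this r]] show ?thesis by (simp add: circ_avg_def)
  qed
  finally show ?thesis by (simp add: p_def circ_avg_poly[OF r])
qed

text \<open>On circles of radius \<open>r < 1\<close> the left side is bounded by Bessel and the
  right side is exact by Parseval, being polynomial. The limit \<open>r\<close> to 1 removes the
  weights.\<close>

lemma contractive_coefficients:
  fixes phi :: "nat \<Rightarrow> complex \<Rightarrow> complex"
  assumes phi: "\<And>i. i < m \<Longrightarrow> phi i holomorphic_on ball 0 1"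
    and le: "\<And>z. cmod z < 1 \<Longrightarrow> (\<Sum>i<m. (cmod (phi i z))\<^sup>2) \<le> (\<Sum>i<m. (cmod (\<Sum>k\<le>N. c i k * z ^ k))\<^sup>2)"
  shows "(\<Sum>i<m. \<Sum>k\<le>N. (cmod (fps_expansion (phi i) 0 \<section> k))\<^sup>2) \<le> (\<Sum>i<m. \<Sum>k\<le>N. (cmod (c i k))\<^sup>2)"
proof -
  have cphi: "continuous_on (ball 0 1) (\<lambda>z. (cmod (phi i z))\<^sup>2)" if "i < m" for i
    by (intro continuous_intros holomorphic_on_imp_continuous_on phi that)
  have cp: "continuous_on (ball 0 1) (\<lambda>z. (cmod (\<Sum>k\<le>N. c i k * z ^ k))\<^sup>2)" for i
    by (intro continuous_intros)
  have "(\<Sum>i<m. \<Sum>k\<le>N. (cmod (fps_expansion (phi i) 0 \<section> k))\<^sup>2 * r ^ (2 * k)) \<le>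
      (\<Sum>i<m. \<Sum>k\<le>N. (cmod (c i k))\<^sup>2 * r ^ (2 * k))" if r: "0 < r" "r < 1" for r
  proof -
    have "(\<Sum>i<m. \<Sum>k\<le>N. (cmod (fps_expansion (phi i) 0 \<section> k))\<^sup>2 * r ^ (2 * k)) \<le>
        (\<Sum>i<m. circ_avg r (\<lambda>z. (cmod (phi i z))\<^sup>2))"
      by (intro sum_mono bessel_inequality r phi) auto
    also have "\<dots> = circ_avg r (\<lambda>z. \<Sum>i<m. (cmod (phi i z))\<^sup>2)"
      by (rule circ_avg_sum[symmetric]) (use cphi r in auto)
    also have "\<dots> \<le> circ_avg r (\<lambda>z. \<Sum>i<m. (cmod (\<Sum>k\<le>N. c i k * z ^ k))\<^sup>2)"
      by (rule circ_avg_mono[OF _ _ r le]) (intro continuous_on_sum cphi cp; simp)+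
    also have "\<dots> = (\<Sum>i<m. circ_avg r (\<lambda>z. (cmod (\<Sum>k\<le>N. c i k * z ^ k))\<^sup>2))"
      by (rule circ_avg_sum) (use cp r in auto)
    finally show ?thesis by (simp add: circ_avg_poly[OF r])
  qed
  then have ev: "\<forall>\<^sub>F r in at_left (1::real). (\<Sum>i<m. \<Sum>k\<le>N. (cmod (fps_expansion (phi i) 0 \<section> k))\<^sup>2 * r ^ (2 * k)) \<le>
      (\<Sum>i<m. \<Sum>k\<le>N. (cmod (c i k))\<^sup>2 * r ^ (2 * k))"
    using eventually_at_left_real[of 0 "1::real"] by (auto elim: eventually_mono)
  have "((\<lambda>r. \<Sum>i<m. \<Sum>k\<le>N. x i k * r ^ (2 * k)) \<longlongrightarrow> (\<Sum>i<m. \<Sum>k\<le>N. x i k * 1 ^ (2 * k))) (at_left (1::real))"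
    for x :: "nat \<Rightarrow> nat \<Rightarrow> real"
    by (intro tendsto_intros)
  from tendsto_le[OF _ this this ev] show ?thesis by simp
qed

section \<open>Taylor expansions of matrix functions\<close>

definition has_fexp :: "(complex \<Rightarrow> fmat) \<Rightarrow> fmat fps \<Rightarrow> bool" where
  "has_fexp F P \<longleftrightarrow> (\<forall>i j. (\<lambda>z. ent (F z) i j) has_fps_expansion Abs_fps (\<lambda>k. ent (P \<section> k) i j))"

lemma has_fexp_const: "has_fexp (\<lambda>_. x) (fps_const x)"
proof -
  have "Abs_fps (\<lambda>k. ent (fps_const x \<section> k) i j) = fps_const (ent x i j)" for i j
    by (rule fps_ext) simp
  then show ?thesis by (simp add: has_fexp_def has_fps_expansion_const)
qed

lemma has_fexp_add:
  assumes "has_fexp F P" "has_fexp G Q"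
  shows "has_fexp (\<lambda>z. F z + G z) (P + Q)"
  unfolding has_fexp_def
proof (intro allI)
  fix i j
  have "Abs_fps (\<lambda>k. ent ((P + Q) \<section> k) i j) = Abs_fps (\<lambda>k. ent (P \<section> k) i j) + Abs_fps (\<lambda>k. ent (Q \<section> k) i j)"
    by (rule fps_ext) simp
  then show "(\<lambda>z. ent (F z + G z) i j) has_fps_expansion Abs_fps (\<lambda>k. ent ((P + Q) \<section> k) i j)"
    using assms by (simp add: has_fexp_def has_fps_expansion_add)
qed

lemma has_fexp_mult:
  assumes "has_fexp F P" "has_fexp G Q" "\<And>z. shaped p q (F z)" "fshaped p q P"
  shows "has_fexp (\<lambda>z. F z * G z) (P * Q)"
  unfolding has_fexp_def
proof (intro allI)
  fix i j
  have "Abs_fps (\<lambda>k. ent ((P * Q) \<section> k) i j) = (\<Sum>l<q. Abs_fps (\<lambda>k. ent (P \<section> k) i l) * Abs_fps (\<lambda>k. ent (Q \<section> k) l j))"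
  proof (rule fps_ext)
    fix k
    have "ent ((P * Q) \<section> k) i j = (\<Sum>t=0..k. \<Sum>l<q. ent (P \<section> t) i l * ent (Q \<section> (k - t)) l j)"
      using assms(4) by (simp add: fps_mult_nth ent_sum ent_mult[of p q] fshaped_def)
    then show "Abs_fps (\<lambda>k. ent ((P * Q) \<section> k) i j) \<section> k =
        (\<Sum>l<q. Abs_fps (\<lambda>k. ent (P \<section> k) i l) * Abs_fps (\<lambda>k. ent (Q \<section> k) l j)) \<section> k"
      by (simp add: fps_sum_nth fps_mult_nth) (rule sum.swap)
  qed
  moreover have "(\<lambda>z. \<Sum>l<q. ent (F z) i l * ent (G z) l j) has_fps_expansion
      (\<Sum>l<q. Abs_fps (\<lambda>k. ent (P \<section> k) i l) * Abs_fps (\<lambda>k. ent (Q \<section> k) l j))"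
    using assms(1,2) by (intro has_fps_expansion_sum has_fps_expansion_mult) (auto simp: has_fexp_def)
  ultimately show "(\<lambda>z. ent (F z * G z) i j) has_fps_expansion Abs_fps (\<lambda>k. ent ((P * Q) \<section> k) i j)"
    by (simp add: ent_mult[OF assms(3)])
qed

lemma has_fexp_unique:
  assumes "has_fexp F P" "has_fexp F Q"
  shows "P = Q"
proof (rule fps_ext, rule fmat_eqI)
  fix k i j
  have "Abs_fps (\<lambda>k. ent (P \<section> k) i j) = Abs_fps (\<lambda>k. ent (Q \<section> k) i j)"
    using assms unfolding has_fexp_def by (meson fps_expansion_unique_complex)
  from arg_cong[OF this, of "\<lambda>A. A \<section> k"] show "ent (P \<section> k) i j = ent (Q \<section> k) i j" by simp
qed

lemma has_fexp_cong:
  assumes "eventually (\<lambda>z. F z = G z) (nhds 0)"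
  shows "has_fexp F P \<longleftrightarrow> has_fexp G P"
  unfolding has_fexp_def
  by (intro all_cong1 has_fps_expansion_cong refl eventually_mono[OF assms]) auto

lemma has_fexp_eventually_eq:
  assumes "has_fexp F P" "has_fexp G P"
  shows "eventually (\<lambda>z. ent (F z) i j = ent (G z) i j) (nhds 0)"
proof -
  have "eventually (\<lambda>z. eval_fps (Abs_fps (\<lambda>k. ent (P \<section> k) i j)) z = ent (F z) i j) (nhds 0)"
    "eventually (\<lambda>z. eval_fps (Abs_fps (\<lambda>k. ent (P \<section> k) i j)) z = ent (G z) i j) (nhds 0)"
    using assms by (auto simp: has_fexp_def has_fps_expansion_def)
  then show ?thesis by eventually_elim simp
qed

lemma fconv_radius:
  assumes "\<And>z. cmod z < 1 \<Longrightarrow> fconv z P"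
  shows "1 \<le> fps_conv_radius (Abs_fps (\<lambda>k. ent (P \<section> k) i j))"
proof -
  have "1 \<le> conv_radius (\<lambda>k. ent (P \<section> k) i j)"
  proof (rule conv_radius_geI_ex')
    fix r :: real assume "0 < r" "ereal r < 1"
    then show "summable (\<lambda>k. ent (P \<section> k) i j * of_real r ^ k)"
      by (intro fconv_summable assms) simp
  qed
  then show ?thesis by (simp add: fps_conv_radius_def)
qed

lemma fev_holomorphic:
  assumes "\<And>z. cmod z < 1 \<Longrightarrow> fconv z P"
  shows "(\<lambda>z. ent (fev p q z P) i j) holomorphic_on ball 0 1"
proof (cases "i < p \<and> j < q")
  case True
  have "ereal (cmod z) < fps_conv_radius (Abs_fps (\<lambda>k. ent (P \<section> k) i j))" if "cmod z < 1" for z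
    by (rule less_le_trans[OF _ fconv_radius[OF assms]]) (use that in simp_all)
  then have "(\<lambda>z. eval_fps (Abs_fps (\<lambda>k. ent (P \<section> k) i j)) z) holomorphic_on ball 0 1"
    by (intro holomorphic_on_eval_fps) auto
  then show ?thesis using True by (simp add: fev_def eval_fps_def)
next
  case False
  then have "(\<lambda>z. ent (fev p q z P) i j) = (\<lambda>_. 0)" by (auto simp: fev_def)
  then show ?thesis by simp
qed

lemma has_fexp_fev:
  assumes "\<And>z. cmod z < 1 \<Longrightarrow> fconv z P" "fshaped p q P"
  shows "has_fexp (\<lambda>z. fev p q z P) P"
  unfolding has_fexp_def
proof (intro allI)
  fix i j
  show "(\<lambda>z. ent (fev p q z P) i j) has_fps_expansion Abs_fps (\<lambda>k. ent (P \<section> k) i j)"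
  proof (cases "i < p \<and> j < q")
    case True
    have "0 < fps_conv_radius (Abs_fps (\<lambda>k. ent (P \<section> k) i j))"
      by (rule less_le_trans[OF _ fconv_radius[OF assms(1)]]) simp_all
    then show ?thesis
      using True by (simp add: has_fps_expansion_def fev_def eval_fps_def)
  next
    case False
    then have "ent (P \<section> k) i j = 0" for k
      using assms(2) by (auto simp: fshaped_def shaped_iff)
    then have "Abs_fps (\<lambda>k. ent (P \<section> k) i j) = 0" by (simp add: fps_eq_iff)
    moreover have "(\<lambda>z. ent (fev p q z P) i j) = (\<lambda>_. 0)" using False by (auto simp: fev_def)
    ultimately show ?thesis by (simp add: has_fps_expansion_0)
  qed
qed

definition ftay :: "nat \<Rightarrow> (complex \<Rightarrow> complex mat) \<Rightarrow> fmat fps" where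
  "ftay m f = Abs_fps (\<lambda>k. to_f (taylor_coeff m f k))"

lemma ftay_shaped: "fshaped m m (ftay m f)"
  by (auto simp: fshaped_def ftay_def taylor_coeff_def intro!: shaped_to_f')

lemma hol_pts_subset: "hol_pts m f \<subseteq> unit_disk"
  by (auto simp: hol_pts_def)

lemma open_analytic_points: "open {w. g analytic_on {w}}"
proof (rule openI)
  fix z assume "z \<in> {w. g analytic_on {w}}"
  then obtain S where S: "open S" "z \<in> S" "g holomorphic_on S" by (auto simp: analytic_at)
  then have "S \<subseteq> {w. g analytic_on {w}}" by (auto simp: analytic_at)
  with S show "\<exists>e>0. ball z e \<subseteq> {w. g analytic_on {w}}" by (meson openE order_trans)
qed

lemma hol_pts_open: "open (hol_pts m f)"
proof -
  have "hol_pts m f = unit_disk \<inter> (\<Inter>i\<in>{..<m}. \<Inter>j\<in>{..<m}. {w. (\<lambda>z. f z $$ (i, j)) analytic_on {w}})"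
    by (auto simp: hol_pts_def)
  then show ?thesis by (auto intro!: open_Int open_INT open_analytic_points)
qed

lemma hol_pts_holomorphic:
  assumes "\<And>z. f z \<in> carrier_mat m m"
  shows "(\<lambda>z. ent (to_f (f z)) i j) holomorphic_on hol_pts m f"
proof (cases "i < m \<and> j < m")
  case True
  have "(\<lambda>z. f z $$ (i, j)) analytic_on hol_pts m f"
    using True by (subst analytic_on_analytic_at) (auto simp: hol_pts_def)
  moreover have "(\<lambda>z. ent (to_f (f z)) i j) = (\<lambda>z. f z $$ (i, j))"
    using True carrier_matD[OF assms] by auto
  ultimately show ?thesis by (simp add: analytic_imp_holomorphic)
next
  case False
  then have "(\<lambda>z. ent (to_f (f z)) i j) = (\<lambda>_. 0)"
    using carrier_matD[OF assms] by auto
  then show ?thesis by simp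
qed

lemma has_fexp_ftay:
  assumes c: "\<And>z. f z \<in> carrier_mat m m" and 0: "0 \<in> hol_pts m f"
  shows "has_fexp (\<lambda>z. to_f (f z)) (ftay m f)"
  unfolding has_fexp_def
proof (intro allI)
  fix i j
  have e: "(\<lambda>z. ent (to_f (f z)) i j) has_fps_expansion fps_expansion (\<lambda>z. ent (to_f (f z)) i j) 0"
    by (rule has_fps_expansion_fps_expansion[OF hol_pts_open 0 hol_pts_holomorphic[OF c]])
  have "fps_expansion (\<lambda>z. ent (to_f (f z)) i j) 0 = Abs_fps (\<lambda>k. ent (ftay m f \<section> k) i j)"
  proof (cases "i < m \<and> j < m")
    case True
    then have "(\<lambda>z. ent (to_f (f z)) i j) = (\<lambda>z. f z $$ (i, j))"
      using carrier_matD[OF c] by auto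
    then show ?thesis using True
      by (simp add: fps_expansion_def ftay_def taylor_coeff_def)
  next
    case False
    then have z: "(\<lambda>z. ent (to_f (f z)) i j) = (\<lambda>_. 0)"
      using carrier_matD[OF c] by auto
    have "(\<lambda>_. 0) has_fps_expansion fps_expansion (\<lambda>z. ent (to_f (f z)) i j) 0"
      using e unfolding z .
    then have "fps_expansion (\<lambda>z. ent (to_f (f z)) i j) 0 = 0"
      using fps_expansion_unique_complex has_fps_expansion_0 by blast
    moreover have "Abs_fps (\<lambda>k. ent (ftay m f \<section> k) i j) = 0"
      using False ftay_shaped[of m f] by (auto simp: fps_eq_iff fshaped_def shaped_iff)
    ultimately show ?thesis by simp
  qed
  with e show "(\<lambda>z. ent (to_f (f z)) i j) has_fps_expansion Abs_fps (\<lambda>k. ent (ftay m f \<section> k) i j)" by simp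
qed

lemma det_holomorphic:
  fixes M :: "complex \<Rightarrow> complex mat"
  assumes "\<And>z. M z \<in> carrier_mat k k" "\<And>i j. i < k \<Longrightarrow> j < k \<Longrightarrow> (\<lambda>z. M z $$ (i, j)) holomorphic_on U"
  shows "(\<lambda>z. Determinant.det (M z)) holomorphic_on U"
proof -
  have "(\<lambda>z. Determinant.det (M z)) =
      (\<lambda>z. \<Sum>p\<in>{p. p permutes {0..<k}}. signof p * (\<Prod>i=0..<k. M z $$ (i, p i)))"
    by (intro ext) (simp add: det_def'[OF assms(1)])
  moreover have "(\<lambda>z. \<Sum>p\<in>{p. p permutes {0..<k}}. signof p * (\<Prod>i=0..<k. M z $$ (i, p i))) holomorphic_on U"
    by (intro holomorphic_intros assms(2)) (auto simp: permutes_in_image dest: permutes_in_image)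
  ultimately show ?thesis by simp
qed

lemma adj_mat_holomorphic:
  assumes "\<And>i j. (\<lambda>z. ent (X z) i j) holomorphic_on U"
  shows "(\<lambda>z. ent (to_f (adj_mat (to_m m m (X z)))) i j) holomorphic_on U"
proof (cases "i < m \<and> j < m")
  case True
  define M where "M z = mat_delete (to_m m m (X z)) j i" for z
  have "(\<lambda>z. Determinant.det (M z)) holomorphic_on U"
  proof (rule det_holomorphic[where k = "m - 1"])
    show "M z \<in> carrier_mat (m - 1) (m - 1)" for z
      by (simp add: M_def mat_delete_def)
    fix a b assume "a < m - 1" "b < m - 1"
    then have "(\<lambda>z. M z $$ (a, b)) = (\<lambda>z. ent (X z) (if a < j then a else Suc a) (if b < i then b else Suc b))"
      by (auto simp: M_def mat_delete_def)
    then show "(\<lambda>z. M z $$ (a, b)) holomorphic_on U" by (simp only: assms)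
  qed
  then have "(\<lambda>z. (-1) ^ (j + i) * Determinant.det (M z)) holomorphic_on U"
    by (intro holomorphic_intros)
  moreover have "(\<lambda>z. ent (to_f (adj_mat (to_m m m (X z)))) i j) = (\<lambda>z. (-1) ^ (j + i) * Determinant.det (M z))"
    using True by (auto simp: adj_mat_def cofactor_def M_def)
  ultimately show ?thesis by simp
next
  case False
  then have "(\<lambda>z. ent (to_f (adj_mat (to_m m m (X z)))) i j) = (\<lambda>_. 0)"
    by (auto simp: adj_mat_def)
  then show ?thesis by simp
qed

lemma mult_holomorphic:
  assumes "\<And>z. shaped p q (F z)" "\<And>i j. (\<lambda>z. ent (F z) i j) holomorphic_on U"
    "\<And>i j. (\<lambda>z. ent (G z) i j) holomorphic_on U"
  shows "(\<lambda>z. ent (F z * G z) i j) holomorphic_on U"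
  unfolding ent_mult[OF assms(1)] by (intro holomorphic_intros assms)

text \<open>Riemann's theorem at each missing point, with boundedness in place of any knowledge of
  the singularity. Defining \<open>h\<close> by \<open>Lim\<close> at all missing points at once
  makes the local extensions agree.\<close>

lemma bounded_holomorphic_extension:
  assumes g: "g holomorphic_on H" and H: "open H" "H \<subseteq> ball 0 1"
    and iso: "\<And>p. p \<in> ball 0 1 \<Longrightarrow> \<not> p islimpt (ball 0 1 - H)"
    and bd: "\<And>z. z \<in> H \<Longrightarrow> cmod (g z) \<le> B"
  obtains h where "h holomorphic_on ball 0 1" "\<And>z. z \<in> H \<Longrightarrow> h z = g z"
proof -
  define h where "h z = (if z \<in> H then g z else Lim (at z) g)" for z
  have "h analytic_on {p}" if p: "p \<in> ball 0 1" for p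
  proof (cases "p \<in> H")
    case True
    have "h holomorphic_on H"
      using g by (rule holomorphic_transform) (simp add: h_def)
    with True H show ?thesis by (metis analytic_at analytic_on_open)
  next
    case False
    obtain T where T: "open T" "p \<in> T" "\<And>y. y \<in> ball 0 1 - H \<Longrightarrow> y \<in> T \<Longrightarrow> y = p"
      using iso[OF p] by (auto simp: islimpt_def)
    define U where "U = T \<inter> ball 0 1"
    have U: "open U" "p \<in> U" "U - {p} \<subseteq> H" using T p by (auto simp: U_def)
    have ev: "eventually (\<lambda>z. z \<in> U - {p}) (at p)"
      using U by (intro eventually_at_in_open)
    have "\<exists>g1. g1 holomorphic_on U \<and> (\<forall>z\<in>U - {p}. g1 z = g z)"
    proof (subst holomorphic_on_extend_bounded)
      show "g holomorphic_on U - {p}" using g U(3) by (rule holomorphic_on_subset)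
      show "p \<in> interior U" using U by (simp add: interior_open)
      show "\<exists>B. \<forall>\<^sub>F z in at p. cmod (g z) \<le> B"
        by (rule exI[of _ B], rule eventually_mono[OF ev]) (use U bd in blast)
    qed
    then obtain g1 where g1: "g1 holomorphic_on U" "\<And>z. z \<in> U - {p} \<Longrightarrow> g1 z = g z" by auto
    have "isCont g1 p"
      using g1(1) U by (metis continuous_on_eq_continuous_at holomorphic_on_imp_continuous_on)
    then have "(g1 \<longlongrightarrow> g1 p) (at p)" by (simp add: isCont_def)
    moreover have "eventually (\<lambda>z. g1 z = g z) (at p)" using ev by (rule eventually_mono) (rule g1)
    ultimately have "(g \<longlongrightarrow> g1 p) (at p)" by (rule Lim_transform_eventually)
    then have "Lim (at p) g = g1 p" by (intro tendsto_Lim) auto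
    then have "h holomorphic_on U"
      using False U g1(2) by (intro holomorphic_transform[OF g1(1)]) (auto simp: h_def)
    with U show ?thesis by (metis analytic_at analytic_on_open)
  qed
  then have "h analytic_on ball 0 1" by (subst analytic_on_analytic_at) auto
  then have "h holomorphic_on ball 0 1" by (rule analytic_imp_holomorphic)
  with that show thesis by (simp add: h_def)
qed

section \<open>The Potapov-Ginzburg transform\<close>

locale signature =
  fixes m :: nat and J :: fmat
  assumes sJ: "shaped m m J" and hJ: "adj J = J" and JJ: "J * J = idm m"
begin

text \<open>The projections onto the eigenspaces of \<open>J\<close> define the Potapov-Ginzburg transform, which turns
  \<open>J\<close>-contractive matrices into contractive ones.\<close>

definition "Pp = sc (1/2) (idm m + J)"
definition "Pm = sc (1/2) (idm m - J)"

lemma P_shaped: "shaped m m Pp" "shaped m m Pm"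
  using sJ by (auto simp: Pp_def Pm_def)

lemma P_adj: "adj Pp = Pp" "adj Pm = Pm"
  using hJ by (auto simp: Pp_def Pm_def)

lemma P_sum: "Pp + Pm = idm m" "Pp - Pm = J"
  by (auto intro!: fmat_eqI simp: Pp_def Pm_def field_simps)

lemma idm_J: "idm m * J = J" "J * idm m = J" "idm m * idm m = idm m"
  using sJ by (auto simp: shaped_def intro!: fmat_eqI simp: idm_left)

lemma P_mult: "Pp * Pp = Pp" "Pm * Pm = Pm" "Pp * Pm = 0" "Pm * Pp = 0"
  by (auto intro!: fmat_eqI simp: Pp_def Pm_def sc_mult_left sc_mult_right distrib_left distrib_right
      left_diff_distrib right_diff_distrib idm_J JJ field_simps)

text \<open>\<open>Pp\<close> and \<open>Pm\<close> are complementary orthogonal projections with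
  difference \<open>J\<close>, so exchanging the \<open>Pm\<close> parts of \<open>u\<close> and
  \<open>v\<close> converts the indefinite defect into a difference of norms.\<close>

lemma pg_identity:
  "nrm2 (Pm * v + Pp * u) - nrm2 (Pp * v + Pm * u) = jform J u v"
proof -
  have n: "nrm2 (Pp * x) = Re (ip x (Pp * x))" "nrm2 (Pm * x) = Re (ip x (Pm * x))" for x
    unfolding nrm2_def ip_mult_left P_adj mult.assoc[symmetric] P_mult by (rule refl)+
  have o: "ip (Pm * x) (Pp * y) = 0" "ip (Pp * x) (Pm * y) = 0" for x y
    unfolding ip_mult_left P_adj mult.assoc[symmetric] P_mult by (simp_all add: ip_simps)
  have "ip x ((Pp - Pm) * x) = ip x (Pp * x) - ip x (Pm * x)" for x
    unfolding left_diff_distrib ip_simps ..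
  then have "ip x (J * x) = ip x (Pp * x) - ip x (Pm * x)" for x
    unfolding P_sum(2) .
  then show ?thesis
    by (simp add: nrm2_add n o jform_def)
qed

lemma split_zero:
  assumes "Pm * v + Pp * u = 0" "Pp * v + Pm * u = 0" "shaped m 1 u"
  shows "u = 0"
proof -
  have "Pp * (Pm * v + Pp * u) + Pm * (Pp * v + Pm * u) = (Pp + Pm) * u"
    unfolding distrib_left distrib_right mult.assoc[symmetric] P_mult by simp
  then show ?thesis
    using assms by (simp add: P_sum(1) shaped_left)
qed

text \<open>Injectivity of the denominator of the transform: if the first component vanishes,
  nonnegativity forces the second to vanish as well, and the two together determine
  \<open>u\<close>.\<close>

lemma jform_zero_pg:
  assumes "0 \<le> jform J u v" "Pm * v + Pp * u = 0" "shaped m 1 u" "shaped m 1 v"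
  shows "u = 0"
proof -
  have s: "shaped m 1 (Pp * v + Pm * u)"
    using P_shaped assms by (auto intro: shaped_mult)
  have "nrm2 (Pp * v + Pm * u) \<le> 0" using assms pg_identity[of v u] by simp
  then have "nrm2 (Pp * v + Pm * u) = 0" using nrm2_nonneg[of "Pp * v + Pm * u"] by linarith
  then have "Pp * v + Pm * u = 0" using nrm2_eq_0_iff[OF s] by simp
  with split_zero assms show ?thesis by blast
qed

end

lemma jform_psdf:
  assumes "psdf m (J - adj a * J * a)" "shaped m 1 u"
  shows "0 \<le> jform J u (a * u)"
proof -
  have "ip u ((J - adj a * J * a) * u) = ip u (J * u) - ip (a * u) (J * (a * u))"
    by (simp add: left_diff_distrib ip_simps ip_mult_left mult.assoc)
  then show ?thesis using assms by (auto simp: psdf_def jform_def)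
qed

lemma psdf_jform:
  assumes "shaped m m J" "adj J = J" "shaped m m a" "\<And>u. shaped m 1 u \<Longrightarrow> 0 \<le> jform J u (a * u)"
  shows "psdf m (J - adj a * J * a)"
proof -
  have "ip u ((J - adj a * J * a) * u) = ip u (J * u) - ip (a * u) (J * (a * u))" for u
    by (simp add: left_diff_distrib ip_simps ip_mult_left mult.assoc)
  then show ?thesis using assms by (auto simp: psdf_def jform_def mult.assoc intro!: shaped_mult)
qed

lemma nrm2_continuous_bound:
  assumes "\<And>i j. (\<lambda>z. ent (s z) i j) holomorphic_on ball 0 1" "\<And>z. shaped m m (s z)"
    and H: "\<And>p. p \<in> ball 0 1 \<Longrightarrow> \<not> p islimpt (ball 0 1 - H)"
    and le: "\<And>z. z \<in> H \<Longrightarrow> nrm2 (s z * x) \<le> C" and x: "shaped m 1 x" and p: "p \<in> ball 0 1"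
  shows "nrm2 (s p * x) \<le> C"
proof -
  have sx: "shaped m 1 (s z * x)" for z using assms(2) x by (rule shaped_mult)
  have "continuous_on (ball 0 1) (\<lambda>z. nrm2 (s z * x))"
    unfolding nrm2_eq[OF sx] ent_mult[OF assms(2)]
    by (intro continuous_intros holomorphic_on_imp_continuous_on assms(1))
  then have "((\<lambda>z. nrm2 (s z * x)) \<longlongrightarrow> nrm2 (s p * x)) (at p)"
    using p by (metis continuous_on_eq_continuous_at isCont_def open_ball)
  moreover have "eventually (\<lambda>z. nrm2 (s z * x) \<le> C) (at p)"
  proof -
    have "eventually (\<lambda>z. z \<notin> ball 0 1 - H) (at p)"
      using H[OF p] by (simp add: islimpt_iff_eventually)
    moreover have "eventually (\<lambda>z. z \<in> ball 0 1 - {p}) (at p)"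
      using p by (intro eventually_at_in_open) auto
    ultimately show ?thesis by eventually_elim (use le in auto)
  qed
  ultimately show ?thesis by (rule tendsto_upperbound) simp
qed

lemma shaped_adj_mat: "shaped m m (to_f (adj_mat (to_m m m x)))"
  using adj_mat(1)[of "to_m m m x" m] by auto

text \<open>The transform \<open>s0\<close> of \<open>f\<close> is contractive at the holomorphy
  points of \<open>f\<close>, hence bounded, and extends to a contractive holomorphic
  \<open>s\<close> on the disk. By \<open>pg_identity\<close> the Toeplitz form of \<open>f\<close>
  at \<open>g\<close> becomes the norm defect of multiplication by the series \<open>S\<close> of
  \<open>s\<close> at a transformed column \<open>k\<close>, to which the Bessel inequality
  applies.\<close>

lemma (in signature) PJ0_toeplitz_psd:
  assumes c: "\<And>z. f z \<in> carrier_mat m m" and H0: "0 \<in> hol_pts m f"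
    and iso: "\<And>p. p \<in> ball 0 1 \<Longrightarrow> \<not> p islimpt (ball 0 1 - hol_pts m f)"
    and contr: "\<And>z. z \<in> hol_pts m f \<Longrightarrow> psdf m (J - adj (to_f (f z)) * J * to_f (f z))"
  shows "toeplitz_psd m J (ftay m f)"
proof -
  define H where "H = hol_pts m f"
  define F where "F z = to_f (f z)" for z
  have sF: "shaped m m (F z)" for z using c by (auto simp: F_def)
  define B where "B z = Pm * F z + Pp" for z
  define T where "T z = Pp * F z + Pm" for z
  have sB: "shaped m m (B z)" and sT: "shaped m m (T z)" for z
    using P_shaped sF by (auto simp: B_def T_def intro!: shaped_intros shaped_mult)
  define d where "d z = Determinant.det (to_m m m (B z))" for z
  \<comment> \<open>Written with the adjugate instead of an inverse, so that holomorphy is visible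
    entry by entry.\<close>
  define s0 where "s0 z = T z * sc (inverse (d z)) (to_f (adj_mat (to_m m m (B z))))" for z
  have jf: "0 \<le> jform J u (F z * u)" if "z \<in> H" "shaped m 1 u" for z u
    using jform_psdf[OF contr] that by (simp add: H_def F_def)
  have BT: "nrm2 (B z * u) - nrm2 (T z * u) = jform J u (F z * u)" for z u
    using pg_identity[of "F z * u" u] by (simp add: B_def T_def distrib_right mult.assoc)
  have d0: "d z \<noteq> 0" if "z \<in> H" for z
  proof
    assume "d z = 0"
    then obtain u where u: "shaped m 1 u" "u \<noteq> 0" "B z * u = 0"
      using det_zero_kernel[OF sB, of z] by (auto simp: d_def)
    then show False
      using jform_zero_pg[OF jf[OF that u(1)]] shaped_mult[OF sF u(1)]
      by (simp add: B_def distrib_right mult.assoc)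
  qed
  have s0B: "s0 z * B z = T z" if z: "z \<in> H" for z
  proof -
    obtain b where "inverse_pair m (B z) b" "s0 z = T z * b"
      unfolding s0_def d_def
      by (rule det_nonzero_inverse_pair[OF sB d0[OF z, unfolded d_def]]) simp
    then show ?thesis using sT[of z] by (simp add: inverse_pair_def mult.assoc shaped_right)
  qed
  have ss0: "shaped m m (s0 z)" for z
    unfolding s0_def by (intro shaped_mult[OF sT] shaped_intros shaped_adj_mat)
  have s0c: "nrm2 (s0 z * x) \<le> nrm2 x" if z: "z \<in> H" and x: "shaped m 1 x" for z x
  proof -
    obtain b where b: "inverse_pair m (B z) b"
      by (rule det_nonzero_inverse_pair[OF sB d0[OF z, unfolded d_def]])
    define u where "u = b * x"
    have u: "shaped m 1 u" "B z * u = x"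
      using b x by (auto simp: u_def inverse_pair_def shaped_left simp flip: mult.assoc intro: shaped_mult)
    have "s0 z * x = T z * u" unfolding u(2)[symmetric] s0B[OF z, symmetric] by (simp add: mult.assoc)
    then show ?thesis using BT[of z u] jf[OF z u(1)] u(2) by simp
  qed
  have Fhol: "(\<lambda>z. ent (F z) i j) holomorphic_on H" for i j
    unfolding F_def H_def by (rule hol_pts_holomorphic[OF c])
  have Bhol: "(\<lambda>z. ent (B z) i j) holomorphic_on H" and Thol: "(\<lambda>z. ent (T z) i j) holomorphic_on H" for i j
    unfolding B_def T_def ent_add
    by (intro holomorphic_intros mult_holomorphic[of m m] Fhol P_shaped)+
  have dhol: "d holomorphic_on H"
    unfolding d_def by (rule det_holomorphic[where k = m]) (simp_all add: Bhol)
  have s0hol: "(\<lambda>z. ent (s0 z) i j) holomorphic_on H" for i j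
    unfolding s0_def
    by (rule mult_holomorphic[OF sT Thol], unfold ent_sc, intro holomorphic_intros adj_mat_holomorphic Bhol dhol)
       (use d0 in auto)
  have bd: "cmod (ent (s0 z) i j) \<le> 1" if z: "z \<in> H" for z i j
  proof (cases "i < m \<and> j < m")
    case True
    define e where "e = mk m 1 (\<lambda>k _. if k = j then 1 else 0)"
    have se: "shaped m 1 e" by (auto simp: e_def)
    have "ent (s0 z * e) i 0 = ent (s0 z) i j"
      using True by (simp add: ent_mult[OF ss0] e_def if_distrib[of "\<lambda>c. _ * c"] cong: if_cong)
    moreover have "(cmod (ent (s0 z * e) i 0))\<^sup>2 \<le> nrm2 (s0 z * e)"
      unfolding nrm2_eq[OF shaped_mult[OF ss0 se]] by (rule member_le_sum) (use True in auto)
    moreover have "nrm2 (s0 z * e) \<le> nrm2 e" by (rule s0c[OF z se])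
    moreover have "nrm2 e = 1"
      using True unfolding nrm2_eq[OF se] by (simp add: e_def if_distrib[of cmod] if_distrib[of "\<lambda>x. x\<^sup>2"] cong: if_cong)
    ultimately have "(cmod (ent (s0 z) i j))\<^sup>2 \<le> 1" by simp
    then show ?thesis by (simp add: power_le_one_iff)
  next
    case False
    then show ?thesis using ss0[of z] by (auto simp: shaped_iff)
  qed
  have ex: "\<exists>h. h holomorphic_on ball 0 1 \<and> (\<forall>z\<in>H. h z = ent (s0 z) i j)" for i j
  proof (rule bounded_holomorphic_extension[OF s0hol[of i j] _ _ _ bd])
    show "open H" "H \<subseteq> ball 0 1" unfolding H_def by (rule hol_pts_open, rule hol_pts_subset)
    show "\<not> p islimpt (ball 0 1 - H)" if "p \<in> ball 0 1" for p
      unfolding H_def by (rule iso[OF that])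
  qed blast+
  define h where "h i j = (SOME h. h holomorphic_on ball 0 1 \<and> (\<forall>z\<in>H. h z = ent (s0 z) i j))" for i j
  have h: "h i j holomorphic_on ball 0 1" "\<And>z. z \<in> H \<Longrightarrow> h i j z = ent (s0 z) i j" for i j
    using someI_ex[OF ex[of i j]] by (auto simp: h_def)
  define s where "s z = mk m m (\<lambda>i j. h i j z)" for z
  have ss: "shaped m m (s z)" for z by (auto simp: s_def)
  have shol: "(\<lambda>z. ent (s z) i j) holomorphic_on ball 0 1" for i j
    using h(1) by (cases "i < m \<and> j < m") (auto simp: s_def)
  have sH: "s z = s0 z" if "z \<in> H" for z
    by (rule fmat_eq_shapedI[OF ss ss0]) (simp add: s_def h(2)[OF that])
  have sc: "nrm2 (s z * x) \<le> nrm2 x" if "z \<in> ball 0 1" "shaped m 1 x" for z x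
  proof (rule nrm2_continuous_bound[OF shol ss _ _ that(2,1), of H])
    show "\<And>p. p \<in> ball 0 1 \<Longrightarrow> \<not> p islimpt (ball 0 1 - H)" unfolding H_def by (rule iso)
    show "nrm2 (s z * x) \<le> nrm2 x" if "z \<in> H" for z
      using s0c[OF that \<open>shaped m 1 x\<close>] sH[OF that] by simp
  qed
  define S where "S = Abs_fps (\<lambda>k. mk m m (\<lambda>i j. fps_expansion (\<lambda>z. ent (s z) i j) 0 \<section> k))"
  have sS: "fshaped m m S" by (auto simp: S_def fshaped_def)
  have sexp: "has_fexp s S"
    unfolding has_fexp_def
  proof (intro allI)
    fix i j
    have e: "(\<lambda>z. ent (s z) i j) has_fps_expansion fps_expansion (\<lambda>z. ent (s z) i j) 0"
      by (rule has_fps_expansion_fps_expansion[OF _ _ shol]) auto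
    have "Abs_fps (\<lambda>k. ent (S \<section> k) i j) = fps_expansion (\<lambda>z. ent (s z) i j) 0"
    proof (cases "i < m \<and> j < m")
      case False
      then have z: "(\<lambda>z. ent (s z) i j) = (\<lambda>_. 0)" by (auto simp: s_def)
      have "(\<lambda>_. 0) has_fps_expansion fps_expansion (\<lambda>z. ent (s z) i j) 0" using e unfolding z .
      then have "fps_expansion (\<lambda>z. ent (s z) i j) 0 = 0"
        using fps_expansion_unique_complex has_fps_expansion_0 by blast
      then show ?thesis using False by (auto simp: fps_eq_iff S_def)
    qed (simp add: fps_eq_iff S_def)
    with e show "(\<lambda>z. ent (s z) i j) has_fps_expansion Abs_fps (\<lambda>k. ent (S \<section> k) i j)" by simp
  qed
  define P where "P = ftay m f"
  have sP: "fshaped m m P" unfolding P_def by (rule ftay_shaped)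
  have Fexp: "has_fexp F P"
    unfolding F_def P_def by (rule has_fexp_ftay[OF c H0])
  have cP: "has_fexp (\<lambda>z. Pm * F z + Pp) (fps_const Pm * P + fps_const Pp)"
    "has_fexp (\<lambda>z. Pp * F z + Pm) (fps_const Pp * P + fps_const Pm)"
    by (rule has_fexp_add[OF has_fexp_mult[OF has_fexp_const Fexp, of m m] has_fexp_const]; simp add: P_shaped)+
  have "has_fexp (\<lambda>z. s z * B z) (S * (fps_const Pm * P + fps_const Pp))"
    using cP(1) by (intro has_fexp_mult[OF sexp _ ss sS]) (simp add: B_def)
  moreover have "eventually (\<lambda>z. s z * B z = T z) (nhds 0)"
  proof -
    have "eventually (\<lambda>z. z \<in> H) (nhds 0)"
      using hol_pts_open H0 unfolding H_def by (rule eventually_nhds_in_open)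
    then show ?thesis by eventually_elim (simp add: sH s0B)
  qed
  ultimately have "has_fexp T (S * (fps_const Pm * P + fps_const Pp))"
    using has_fexp_cong[of "\<lambda>z. s z * B z" T] by simp
  moreover have "has_fexp T (fps_const Pp * P + fps_const Pm)"
    using cP(2) by (simp add: T_def[abs_def])
  ultimately have SB: "S * (fps_const Pm * P + fps_const Pp) = fps_const Pp * P + fps_const Pm"
    by (rule has_fexp_unique)
  show ?thesis
    unfolding toeplitz_psd_def P_def[symmetric]
  proof (intro allI impI)
    fix N g assume g: "fshaped m 1 g"
    define k where "k = (fps_const Pm * P + fps_const Pp) * g"
    have sk: "fshaped m 1 k"
      unfolding k_def by (intro fshaped_mult[of m m] fshaped_intros sP g P_shaped)
    have Sk: "S * k = (fps_const Pp * P + fps_const Pm) * g"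
      unfolding k_def SB[symmetric] by (simp add: mult.assoc)
    have coeff: "jform J (g \<section> i) ((P * g) \<section> i) = nrm2 (k \<section> i) - nrm2 ((S * k) \<section> i)" for i
      unfolding Sk unfolding k_def distrib_right mult.assoc fps_add_nth fps_const_mult_nth pg_identity ..
    \<comment> \<open>The first coefficients of \<open>S * k\<close> depend only on those of
      \<open>k\<close>. Cutting turns the column into a polynomial, as the Parseval side of
      \<open>contractive_coefficients\<close> requires.\<close>
    define k' where "k' = fcut N k"
    have sk': "fshaped m 1 k'" "fdeg N k'" unfolding k'_def by (simp_all add: fcut_props sk)
    have Sk': "(S * k') \<section> i = (S * k) \<section> i" if "i \<le> N" for i
      using feq_mult_right[OF fcut_props(2)[of N k], of S] that by (simp add: feq_def k'_def)
    define phi where "phi i z = ent (s z * fev m 1 z k') i 0" for i z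
    have kv: "\<And>z. fconv z k'" using sk'(2) by (rule fconv_poly)
    have phol: "phi i holomorphic_on ball 0 1" for i
      unfolding phi_def by (intro mult_holomorphic[OF ss shol] fev_holomorphic kv)
    have "has_fexp (\<lambda>z. s z * fev m 1 z k') (S * k')"
      by (rule has_fexp_mult[OF sexp has_fexp_fev[OF kv sk'(1)] ss sS])
    then have "phi i has_fps_expansion Abs_fps (\<lambda>k. ent ((S * k') \<section> k) i 0)" for i
      by (simp add: has_fexp_def phi_def[abs_def])
    moreover have "phi i has_fps_expansion fps_expansion (phi i) 0" for i
      by (rule has_fps_expansion_fps_expansion[OF _ _ phol]) auto
    ultimately have fe: "fps_expansion (phi i) 0 = Abs_fps (\<lambda>k. ent ((S * k') \<section> k) i 0)" for i
      using fps_expansion_unique_complex by blast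
    have kev: "ent (fev m 1 z k') i 0 = (\<Sum>k\<le>N. ent (k' \<section> k) i 0 * z ^ k)" for z i
      using sk' by (simp add: fev_poly ent_sum mult.commute)
    have "(\<Sum>i<m. \<Sum>k\<le>N. (cmod (fps_expansion (phi i) 0 \<section> k))\<^sup>2) \<le> (\<Sum>i<m. \<Sum>k\<le>N. (cmod (ent (k' \<section> k) i 0))\<^sup>2)"
    proof (rule contractive_coefficients[OF phol])
      fix z :: complex assume "cmod z < 1"
      then have "nrm2 (s z * fev m 1 z k') \<le> nrm2 (fev m 1 z k')"
        by (intro sc) auto
      then show "(\<Sum>i<m. (cmod (phi i z))\<^sup>2) \<le> (\<Sum>i<m. (cmod (\<Sum>k\<le>N. ent (k' \<section> k) i 0 * z ^ k))\<^sup>2)"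
        by (simp add: nrm2_eq[OF shaped_mult[OF ss fev_shaped]] nrm2_eq[OF fev_shaped] phi_def kev)
    qed
    then have "(\<Sum>k\<le>N. \<Sum>i<m. (cmod (ent ((S * k') \<section> k) i 0))\<^sup>2) \<le> (\<Sum>k\<le>N. \<Sum>i<m. (cmod (ent (k' \<section> k) i 0))\<^sup>2)"
      unfolding fe by (subst (1 2) sum.swap) simp
    then have "(\<Sum>k\<le>N. nrm2 ((S * k') \<section> k)) \<le> (\<Sum>k\<le>N. nrm2 (k' \<section> k))"
      using fshaped_nth[OF fshaped_mult[OF sS sk'(1)]] fshaped_nth[OF sk'(1)] by (simp add: nrm2_eq[of m 1])
    moreover have "(\<Sum>i\<le>N. nrm2 ((S * k') \<section> i)) = (\<Sum>i\<le>N. nrm2 ((S * k) \<section> i))"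
      by (rule sum.cong) (simp_all add: Sk')
    moreover have "(\<Sum>i\<le>N. nrm2 (k' \<section> i)) = (\<Sum>i\<le>N. nrm2 (k \<section> i))"
      by (rule sum.cong) (simp_all add: k'_def)
    ultimately have "(\<Sum>i\<le>N. nrm2 ((S * k) \<section> i)) \<le> (\<Sum>i\<le>N. nrm2 (k \<section> i))"
      by simp
    then show "0 \<le> (\<Sum>i\<le>N. jform J (g \<section> i) ((P * g) \<section> i))"
      by (simp add: coeff sum_subtractf)
  qed
qed

section \<open>Parametrization of the interpolants\<close>

lemma nrm2_sum_bound:
  assumes "\<And>k. shaped m 1 (b k)"
  shows "nrm2 (\<Sum>k\<le>M. sc (c k) (b k)) \<le> (\<Sum>k\<le>M. (cmod (c k))\<^sup>2) * (\<Sum>k\<le>M. nrm2 (b k))"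
proof -
  have s: "shaped m 1 (\<Sum>k\<le>M. sc (c k) (b k))" by (intro shaped_sum shaped_intros assms)
  have "nrm2 (\<Sum>k\<le>M. sc (c k) (b k)) = (\<Sum>i<m. (cmod (\<Sum>k\<le>M. c k * ent (b k) i 0))\<^sup>2)"
    by (simp add: nrm2_eq[OF s] ent_sum)
  also have "\<dots> \<le> (\<Sum>i<m. (\<Sum>k\<le>M. (cmod (c k))\<^sup>2) * (\<Sum>k\<le>M. (cmod (ent (b k) i 0))\<^sup>2))"
  proof (rule sum_mono)
    fix i
    have "cmod (\<Sum>k\<le>M. c k * ent (b k) i 0) \<le> (\<Sum>k\<le>M. cmod (c k) * cmod (ent (b k) i 0))"
      by (rule order_trans[OF norm_sum]) (simp add: norm_mult)
    then have "(cmod (\<Sum>k\<le>M. c k * ent (b k) i 0))\<^sup>2 \<le> (\<Sum>k\<le>M. cmod (c k) * cmod (ent (b k) i 0))\<^sup>2"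
      by (rule power_mono) simp
    also have "\<dots> \<le> (\<Sum>k\<le>M. (cmod (c k))\<^sup>2) * (\<Sum>k\<le>M. (cmod (ent (b k) i 0))\<^sup>2)"
      by (rule Cauchy_Schwarz_ineq_sum)
    finally show "(cmod (\<Sum>k\<le>M. c k * ent (b k) i 0))\<^sup>2 \<le> (\<Sum>k\<le>M. (cmod (c k))\<^sup>2) * (\<Sum>k\<le>M. (cmod (ent (b k) i 0))\<^sup>2)" .
  qed
  also have "\<dots> = (\<Sum>k\<le>M. (cmod (c k))\<^sup>2) * (\<Sum>k\<le>M. nrm2 (b k))"
    by (simp add: nrm2_eq[OF assms] sum_distrib_left[symmetric]) (rule disjI2, rule sum.swap)
  finally show ?thesis .
qed

text \<open>A contractive analytic function given by its series: every finite section of its lower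
  triangular Toeplitz operator is a contraction.\<close>

locale schur_series =
  fixes m :: nat and S :: "fmat fps"
  assumes sS: "fshaped m m S"
    and contractive: "\<And>M a. fshaped m 1 a \<Longrightarrow> (\<Sum>k\<le>M. nrm2 ((S * a) \<section> k)) \<le> (\<Sum>k\<le>M. nrm2 (a \<section> k))"
begin

lemma coeff_bound: "cmod (ent (S \<section> k) i j) \<le> 1"
proof (cases "i < m \<and> j < m")
  case True
  define e where "e = mk m 1 (\<lambda>k _. if k = j then 1 else 0)"
  have se: "shaped m 1 e" by (auto simp: e_def)
  have sk: "shaped m m (S \<section> k)" using sS by (simp add: fshaped_def)
  have "ent (S \<section> k * e) i 0 = ent (S \<section> k) i j"
    using True by (simp add: ent_mult[OF sk] e_def if_distrib[of "\<lambda>c. _ * c"] cong: if_cong)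
  moreover have "(cmod (ent (S \<section> k * e) i 0))\<^sup>2 \<le> nrm2 (S \<section> k * e)"
    unfolding nrm2_eq[OF shaped_mult[OF sk se]] by (rule member_le_sum) (use True in auto)
  moreover have "nrm2 (S \<section> k * e) \<le> (\<Sum>t\<le>k. nrm2 ((S * fps_const e) \<section> t))"
    unfolding mult_fps_const_nth by (rule member_le_sum) auto
  moreover have "\<dots> \<le> (\<Sum>t\<le>k. nrm2 (fps_const e \<section> t))"
    by (rule contractive) (use se in auto)
  moreover have "\<dots> = nrm2 e" by (simp add: if_distrib[of nrm2] cong: if_cong)
  moreover have "nrm2 e = 1"
    using True unfolding nrm2_eq[OF se] by (simp add: e_def if_distrib[of cmod] if_distrib[of "\<lambda>x. x\<^sup>2"] cong: if_cong)
  ultimately have "(cmod (ent (S \<section> k) i j))\<^sup>2 \<le> 1" by simp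
  then show ?thesis by (simp add: power_le_one_iff)
next
  case False
  then show ?thesis using sS by (auto simp: fshaped_def shaped_iff)
qed

lemma conv: "cmod z < 1 \<Longrightarrow> fconv z S"
  unfolding fconv_def
proof (intro allI)
  fix i j assume z: "cmod z < 1"
  show "summable (\<lambda>k. norm (ent (S \<section> k) i j * z ^ k))"
  proof (rule summable_comparison_test')
    show "summable (\<lambda>k. cmod z ^ k)" using z by (simp add: summable_geometric)
    show "norm (norm (ent (S \<section> k) i j * z ^ k)) \<le> cmod z ^ k" for k
      using coeff_bound[of k i j] by (simp add: norm_mult norm_power mult_left_le_one_le)
  qed
qed

text \<open>Test \<open>S\<close> on the kernel column with coefficients
  \<open>sc (cnj z ^ k) u\<close>. At \<open>z\<close> this column has the value
  \<open>u / (1 - t)\<close>, while Cauchy-Schwarz and contractivity each contribute a geometric sum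
  to the bound on the value of \<open>S * a\<close>; the factors \<open>1 / (1 - t)\<close>
  cancel.\<close>

lemma value_contr:
  assumes z: "cmod z < 1"
  shows "contr m (fev m m z S)"
  unfolding contr_def
proof (intro conjI allI impI)
  fix u assume u: "shaped m 1 u"
  define t where "t = (cmod z)\<^sup>2"
  have t: "0 \<le> t" "t < 1" using z by (auto simp: t_def abs_square_less_1)
  have zz: "cnj z ^ k * z ^ k = of_real (t ^ k)" for k
  proof -
    have "cnj z * z = of_real t" unfolding t_def by (metis complex_norm_square mult.commute)
    then show ?thesis by (simp flip: power_mult_distrib)
  qed
  define a where "a = Abs_fps (\<lambda>k. sc (cnj z ^ k) u)"
  have sa: "fshaped m 1 a" using u by (auto simp: a_def fshaped_def)
  have terms: "ent (a \<section> k) i j * z ^ k = ent u i j * of_real t ^ k" for i j k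
    using zz[of k] by (simp add: a_def mult_ac)
  have ca: "fconv z a"
    unfolding fconv_def terms using t by (auto simp: norm_mult norm_power summable_geometric intro!: summable_mult)
  have geo: "(\<Sum>k. of_real t ^ k) = (1 / (1 - of_real t) :: complex)"
    using t by (intro suminf_geometric) simp
  have "(\<Sum>k. ent u i j * of_real t ^ k) = ent u i j * (1 / (1 - of_real t))" for i j
    unfolding geo[symmetric] using t by (intro suminf_mult) (simp add: summable_geometric)
  then have eva: "fev m 1 z a = sc (of_real (1 / (1 - t))) u"
    by (intro fmat_eq_shapedI[of m 1]) (use u in \<open>auto simp: fev_def terms\<close>)
  define b where "b = S * a"
  have sb: "shaped m 1 (b \<section> k)" for k
    using fshaped_mult[OF sS sa] by (simp add: b_def fshaped_def)
  have cb: "fconv z b" unfolding b_def by (rule fconv_mult[OF sS conv[OF z] ca])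
  have evb: "fev m 1 z b = sc (of_real (1 / (1 - t))) (fev m m z S * u)"
    unfolding b_def fev_mult[OF sS conv[OF z] ca] eva sc_mult_right ..
  have part: "nrm2 (\<Sum>k\<le>M. sc (z ^ k) (b \<section> k)) \<le> (1 / (1 - t))\<^sup>2 * nrm2 u" for M
  proof -
    have g: "(\<Sum>k\<le>M. t ^ k) \<le> 1 / (1 - t)"
      using t sum_le_suminf[of "\<lambda>k. t ^ k" "{..M}"] by (simp add: summable_geometric suminf_geometric)
    have "nrm2 (\<Sum>k\<le>M. sc (z ^ k) (b \<section> k)) \<le> (\<Sum>k\<le>M. (cmod (z ^ k))\<^sup>2) * (\<Sum>k\<le>M. nrm2 (b \<section> k))"
      by (rule nrm2_sum_bound[OF sb])
    also have "(\<Sum>k\<le>M. (cmod (z ^ k))\<^sup>2) = (\<Sum>k\<le>M. t ^ k)"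
      by (simp add: t_def norm_power power_mult[symmetric] mult.commute)
    also have "(\<Sum>k\<le>M. t ^ k) * (\<Sum>k\<le>M. nrm2 (b \<section> k)) \<le> (\<Sum>k\<le>M. t ^ k) * (\<Sum>k\<le>M. nrm2 (a \<section> k))"
      unfolding b_def using t by (intro mult_left_mono contractive sa sum_nonneg) auto
    also have "(\<Sum>k\<le>M. nrm2 (a \<section> k)) = (\<Sum>k\<le>M. t ^ k) * nrm2 u"
      by (simp add: a_def nrm2_sc t_def norm_power power_mult[symmetric] mult.commute sum_distrib_left)
    also have "(\<Sum>k\<le>M. t ^ k) * ((\<Sum>k\<le>M. t ^ k) * nrm2 u) \<le> 1 / (1 - t) * (1 / (1 - t) * nrm2 u)"
      using g t by (intro mult_mono) (auto intro!: sum_nonneg mult_nonneg_nonneg)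
    finally show ?thesis by (simp add: power2_eq_square)
  qed
  have "(\<lambda>M. nrm2 (\<Sum>k\<le>M. sc (z ^ k) (b \<section> k))) \<longlonglongrightarrow> nrm2 (fev m 1 z b)"
  proof -
    have s: "shaped m 1 (\<Sum>k\<le>M. sc (z ^ k) (b \<section> k))" for M by (intro shaped_sum shaped_intros sb)
    have "(\<lambda>M. \<Sum>k\<le>M. ent (b \<section> k) i 0 * z ^ k) \<longlonglongrightarrow> ent (fev m 1 z b) i 0" if "i < m" for i
      using summable_LIMSEQ'[OF fconv_summable[OF cb]] that by (simp add: fev_def)
    then show ?thesis
      unfolding nrm2_eq[OF s] nrm2_eq[OF fev_shaped] ent_sum ent_sc
      by (intro tendsto_sum tendsto_power tendsto_norm) (simp add: mult.commute)
  qed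
  from LIMSEQ_le_const2[OF this] part have "nrm2 (fev m 1 z b) \<le> (1 / (1 - t))\<^sup>2 * nrm2 u" by blast
  moreover have "nrm2 (fev m 1 z b) = (1 / (1 - t))\<^sup>2 * nrm2 (fev m m z S * u)"
    unfolding evb nrm2_sc norm_of_real power2_abs ..
  ultimately show "nrm2 (fev m m z S * u) \<le> nrm2 u" using t by simp
qed simp

end

text \<open>Only the first \<open>n + 1\<close> coefficients of \<open>f\<close> enter the axioms,
  so the given data can be exchanged for the full Taylor series of an interpolant, or for a
  polynomial.\<close>

lemma resolvent_cong:
  assumes "resolvent m n J f al be ga de r ri l li" "feq (Suc n) f g" "fshaped m m g"
  shows "resolvent m n J g al be ga de r ri l li"
proof -
  interpret resolvent m n J f al be ga de r ri l li by fact
  note e = feq_sym[OF assms(2)]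
  have co: "g \<section> k = f \<section> k" if "k \<le> n" for k using assms(2) that by (simp add: feq_def)
  show ?thesis
  proof
    show "feq (Suc n) al (g * ga)" by (rule feq_trans[OF c1 feq_mult_left[OF assms(2)]])
    show "feq (Suc n) (be - g * de) (fmon n li)"
      by (rule feq_trans[OF feq_diff[OF feq_refl feq_mult_left[OF e]] c2])
    show "feq (Suc n) (gar * Jc - alr * Jc * g) (fmon n ri)"
      by (rule feq_trans[OF feq_diff[OF feq_refl feq_mult_right[OF e]] c3])
    show "feq (Suc n) (ber * Jc * g) (der * Jc)"
      by (rule feq_trans[OF feq_mult_right[OF e] c4])
    fix x :: "nat \<Rightarrow> fmat" assume "\<And>k. shaped m 1 (x k)"
    from pform[of x, OF this]
    moreover have "(\<Sum>i=k..n. adj (g \<section> (i - k)) * x i) = (\<Sum>i=k..n. adj (f \<section> (i - k)) * x i)" for k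
      by (intro sum.cong) (auto simp: co)
    ultimately show "0 \<le> (\<Sum>k\<le>n. jform J (x k) (\<Sum>i=k..n. adj (g \<section> (i - k)) * x i))"
      by simp
  qed (fact assms(3) J fsh4 deg4 r l ga0 ben)+
qed

lemma fmat_limit_eq:
  assumes "\<And>i j. ((\<lambda>z. ent (X z) i j) \<longlongrightarrow> ent x i j) (at p)" "\<And>i j. ((\<lambda>z. ent (Y z) i j) \<longlongrightarrow> ent y i j) (at p)"
    "eventually (\<lambda>z. X z = Y z) (at (p::complex))"
  shows "x = y"
proof (rule fmat_eqI)
  fix i j
  have "eventually (\<lambda>z. ent (X z) i j = ent (Y z) i j) (at p)"
    using assms(3) by (rule eventually_mono) simp
  with assms(1)[of i j] have "((\<lambda>z. ent (Y z) i j) \<longlongrightarrow> ent x i j) (at p)"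
    by (rule Lim_transform_eventually)
  with assms(2)[of i j] show "ent x i j = ent y i j"
    by (intro tendsto_unique[of "at p"]) auto
qed

section \<open>From an interpolant to its parameter\<close>

context resolvent
begin

abbreviation "gv z \<equiv> fev m m z ga"
abbreviation "av z \<equiv> fev m m z al"
abbreviation "bv z \<equiv> fev m m z be"
abbreviation "dv z \<equiv> fev m m z de"

lemma conv4: "fconv z al" "fconv z be" "fconv z ga" "fconv z de"
  using deg4 by (auto intro: fconv_poly)

lemma hol4: "(\<lambda>z. ent (av z) i j) holomorphic_on U" "(\<lambda>z. ent (bv z) i j) holomorphic_on U"
  "(\<lambda>z. ent (gv z) i j) holomorphic_on U" "(\<lambda>z. ent (dv z) i j) holomorphic_on U"
  unfolding fev_poly[OF deg4(1) fsh4(1)] fev_poly[OF deg4(2) fsh4(2)] fev_poly[OF deg4(3) fsh4(3)]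
    fev_poly[OF deg4(4) fsh4(4)] ent_sum ent_sc by (intro holomorphic_intros)+

text \<open>Denominator and numerator of the linear fractional transform of \<open>K\<close>.\<close>

abbreviation "dK K z \<equiv> gv z + sc z (dv z * K)"
abbreviation "nK K z \<equiv> av z + sc z (bv z * K)"

lemma shaped_dK_nK: "shaped m m K \<Longrightarrow> shaped m m (dK K z)" "shaped m m K \<Longrightarrow> shaped m m (nK K z)"
  by (auto intro!: shaped_intros shaped_mult[of m m])

lemma fev_pair:
  assumes S: "fshaped m m S" "fconv z S"
  shows "fev m m z (ga + fsh (de * S)) = dK (fev m m z S) z" "fev m m z (al + fsh (be * S)) = nK (fev m m z S) z"
    "fconv z (ga + fsh (de * S))" "fconv z (al + fsh (be * S))"
  using conv4[of z] S by (simp_all add: fev_add fev_fsh fev_mult[OF fsh4(4)] fev_mult[OF fsh4(2)] fconv_add fconv_fsh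
      fconv_mult[OF fsh4(4)] fconv_mult[OF fsh4(2)])

text \<open>The case of \<open>J_expansive\<close> with second input \<open>K * x\<close>: the norm
  defect of the contraction \<open>K\<close> bounds the \<open>J\<close>-defect of the transform
  from below.\<close>

lemma J_expansive_value:
  assumes x: "shaped m 1 x" and K: "contr m K" and z: "cmod z \<le> 1"
  shows "0 \<le> jform J (dK K z * x) (nK K z * x)"
proof -
  have sK: "shaped m m K" using K by (simp add: contr_def)
  have sKx: "shaped m 1 (K * x)" using sK x by (rule shaped_mult)
  have cc: "fconv z (fps_const y)" for y by (rule fconv_poly[OF fdeg_intros(7)])
  have v: "fev m 1 z (P * fps_const y) = fev m m z P * y" "fconv z (P * fps_const y)"
    if "fshaped m m P" "fconv z P" "shaped m 1 y" for P y
    using fev_mult[OF that(1,2) cc, where s = 1] fconv_mult[OF that(1,2) cc] that(3) by (simp_all add: fev_const)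
  have "fev m 1 z (lower (fps_const x) (fps_const (K * x))) = dK K z * x"
    unfolding lower_def using fsh4 conv4[of z] x sKx
    by (simp add: fev_add fev_fsh v fconv_fsh distrib_right sc_mult_left mult.assoc)
  moreover have "fev m 1 z (upper (fps_const x) (fps_const (K * x))) = nK K z * x"
    unfolding upper_def using fsh4 conv4[of z] x sKx
    by (simp add: fev_add fev_fsh v fconv_fsh distrib_right sc_mult_left mult.assoc)
  moreover have "nrm2 (K * x) \<le> nrm2 x" using K x by (simp add: contr_def)
  ultimately show ?thesis using J_expansive[OF x sKx z] by simp
qed

text \<open>The formal parameter of the Taylor series of \<open>F\<close> converges in the disk to
  \<open>K\<close>. The equation holds near 0 by uniqueness of expansions and then, by analytic
  continuation, on the connected open set of holomorphy points.\<close>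

lemma PJ0_parametrized:
  assumes c: "\<And>z. F z \<in> carrier_mat m m" and H0: "0 \<in> hol_pts m F"
    and iso: "\<And>p. p \<in> ball 0 1 \<Longrightarrow> \<not> p islimpt (ball 0 1 - hol_pts m F)"
    and contr: "\<And>z. z \<in> hol_pts m F \<Longrightarrow> psdf m (J - adj (to_f (F z)) * J * to_f (F z))"
    and tay: "feq (Suc n) f (ftay m F)"
  obtains K where "\<And>z i j. (\<lambda>z. ent (K z) i j) holomorphic_on ball 0 1"
    "\<And>z. z \<in> ball 0 1 \<Longrightarrow> contr m (K z)"
    "\<And>z. z \<in> hol_pts m F \<Longrightarrow> to_f (F z) * dK (K z) z = nK (K z) z"
proof -
  define H where "H = hol_pts m F"
  interpret sg: signature m J using J by unfold_locales
  interpret R: resolvent m n J "ftay m F" al be ga de r ri l li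
    by (rule resolvent_cong[OF resolvent_axioms tay ftay_shaped])
  obtain S where S: "fshaped m m S" "ftay m F * (ga + fsh (de * S)) = al + fsh (be * S)"
    using R.schur_parameter_exists by metis
  interpret Sc: schur_series m S
    using R.schur_parameter_contractive[OF S sg.PJ0_toeplitz_psd[OF c H0 iso contr]] S(1)
    by unfold_locales
  define K where "K z = fev m m z S" for z
  have hol: "(\<lambda>z. ent (K z) i j) holomorphic_on ball 0 1" for i j
    unfolding K_def by (rule fev_holomorphic[OF Sc.conv])
  have "has_fexp (\<lambda>z. fev m m z (ga + fsh (de * S))) (ga + fsh (de * S))"
    "has_fexp (\<lambda>z. fev m m z (al + fsh (be * S))) (al + fsh (be * S))"
    by (rule has_fexp_fev; use fev_pair(3,4)[OF S(1) Sc.conv] S(1) fsh4 in \<open>auto intro!: fshaped_intros fshaped_mult[of m m]\<close>)+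
  moreover from this(1) have "has_fexp (\<lambda>z. to_f (F z) * fev m m z (ga + fsh (de * S))) (al + fsh (be * S))"
    unfolding S(2)[symmetric] using c by (intro has_fexp_mult[OF has_fexp_ftay[OF c H0] _ _ ftay_shaped]) auto
  ultimately have ev: "eventually (\<lambda>z. ent (to_f (F z) * fev m m z (ga + fsh (de * S))) i j = ent (fev m m z (al + fsh (be * S))) i j) (nhds 0)" for i j
    by (intro has_fexp_eventually_eq)
  have dKhol: "(\<lambda>z. ent (dK (K z) z) i j) holomorphic_on ball 0 1" "(\<lambda>z. ent (nK (K z) z) i j) holomorphic_on ball 0 1" for i j
    unfolding ent_add ent_sc by (intro holomorphic_intros mult_holomorphic[of m m] hol4 hol fev_shaped)+
  have Hsub: "H \<subseteq> ball 0 1" unfolding H_def by (rule hol_pts_subset)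
  have conH: "connected H"
  proof -
    have "connected (ball 0 1 - (ball (0::complex) 1 - H))"
      by (rule sparse_imp_connected) (use iso in \<open>auto simp: sparse_in_open H_def\<close>)
    moreover have "ball 0 1 - (ball 0 1 - H) = H" using Hsub by auto
    ultimately show ?thesis by simp
  qed
  have eq: "to_f (F z) * dK (K z) z = nK (K z) z" if z: "z \<in> H" for z
  proof (rule fmat_eqI)
    fix i j
    have sF: "shaped m m (to_f (F z))" for z using c by auto
    have "eventually (\<lambda>z. z \<in> H) (nhds 0)"
      unfolding H_def by (rule eventually_nhds_in_open[OF hol_pts_open H0])
    with ev[of i j] have "eventually (\<lambda>z. z \<in> H \<and> ent (to_f (F z) * dK (K z) z) i j = ent (nK (K z) z) i j) (nhds 0)"
    proof eventually_elim
      case (elim z)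
      then have "cmod z < 1" using Hsub by auto
      with elim show ?case using fev_pair(1,2)[OF S(1) Sc.conv] by (simp add: K_def)
    qed
    then obtain V where V: "open V" "0 \<in> V" "\<And>z. z \<in> V \<Longrightarrow> z \<in> H \<and> ent (to_f (F z) * dK (K z) z) i j = ent (nK (K z) z) i j"
      by (auto simp: eventually_nhds)
    have h1: "(\<lambda>z. ent (to_f (F z) * dK (K z) z) i j) holomorphic_on H"
    proof (rule mult_holomorphic)
      show "shaped m m (to_f (F z))" for z by (rule sF)
      show "(\<lambda>z. ent (to_f (F z)) i j) holomorphic_on H" for i j
        unfolding H_def by (rule hol_pts_holomorphic[OF c])
      show "(\<lambda>z. ent (dK (K z) z) i j) holomorphic_on H" for i j
        by (rule holomorphic_on_subset[OF dKhol(1) Hsub])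
    qed
    have h2: "(\<lambda>z. ent (nK (K z) z) i j) holomorphic_on H"
      by (rule holomorphic_on_subset[OF dKhol(2) Hsub])
    show "ent (to_f (F z) * dK (K z) z) i j = ent (nK (K z) z) i j"
      by (rule analytic_continuation_open[OF V(1) hol_pts_open[of m F, folded H_def] _ conH _ h1 h2 _ z])
         (use V in auto)
  qed
  show thesis
    by (rule that[of K]) (use hol Sc.value_contr eq in \<open>auto simp: K_def H_def\<close>)
qed

end

section \<open>From a constant parameter to an interpolant\<close>

lemma fmat_isCont_mult:
  assumes "\<And>z. shaped p q (F z)" "\<And>i j. isCont (\<lambda>z. ent (F z) i j) a" "\<And>i j. isCont (\<lambda>z. ent (G z) i j) a"
  shows "isCont (\<lambda>z. ent (F z * G z) i j) a"
  unfolding ent_mult[OF assms(1)] by (intro continuous_intros assms)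

context resolvent
begin

text \<open>The transform is a matrix of quotients of entire functions. \<open>remove_sings\<close>
  assigns the right values at removable singularities, so that each entry is holomorphic or has a
  pole at every point, as \<open>mero_disk\<close> demands. Contractivity follows from
  \<open>J_expansive_value\<close> where the determinant is nonzero and by continuity at the
  remaining holomorphy points.\<close>

lemma constant_parameter:
  assumes K: "contr m K"
  obtains F where "mero_disk m F" "0 \<in> hol_pts m F"
    "\<And>z. z \<in> hol_pts m F \<Longrightarrow> psdf m (J - adj (to_f (F z)) * J * to_f (F z))"
    "feq (Suc n) f (ftay m F)"
    "\<And>z. z \<in> hol_pts m F \<Longrightarrow> to_f (F z) * dK K z = nK K z"
proof -
  have sK: "shaped m m K" using K by (simp add: contr_def)
  note sdn = shaped_dK_nK[OF sK]
  define d where "d z = Determinant.det (to_m m m (dK K z))" for z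
  define q where "q i j z = ent (nK K z * to_f (adj_mat (to_m m m (dK K z)))) i j / d z" for i j z
  define F where "F z = mat m m (\<lambda>(i, j). remove_sings (q i j) z)" for z
  have c: "F z \<in> carrier_mat m m" for z by (simp add: F_def)
  have sF: "shaped m m (to_f (F z))" for z using c by auto
  have Fent: "(\<lambda>z. F z $$ (i, j)) = remove_sings (q i j)" if "i < m" "j < m" for i j
    using that by (auto simp: F_def)
  have hol: "(\<lambda>z. ent (dK K z) i j) holomorphic_on U" "(\<lambda>z. ent (nK K z) i j) holomorphic_on U" for i j U
    unfolding ent_add ent_sc by (intro holomorphic_intros mult_holomorphic[of m m] hol4 fev_shaped)+
  have hold: "d holomorphic_on U" for U
    unfolding d_def by (rule det_holomorphic[where k = m]) (simp_all only: to_m_carrier to_m_index hol)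
  have holn: "(\<lambda>z. ent (nK K z * to_f (adj_mat (to_m m m (dK K z)))) i j) holomorphic_on U" for i j U
    by (rule mult_holomorphic[OF sdn(2) hol(2)]) (rule adj_mat_holomorphic[OF hol(1)])
  have g0: "dK K 0 = r"
  proof -
    have "gv 0 = ga \<section> 0"
      using fsh4 by (simp add: fev_poly[OF deg4(3)] power_0_left if_distrib[of "\<lambda>c. sc c _"] cong: if_cong)
    then show ?thesis by (simp add: ga0)
  qed
  have d0: "d 0 \<noteq> 0"
    unfolding d_def g0 using inverse_pair_det[OF r(1)] by auto
  \<comment> \<open>The determinant is an entire function whose value at 0 is the nonzero
    determinant of \<open>r\<close>, so its zeros are isolated.\<close>
  have dnz: "eventually (\<lambda>z. d z \<noteq> 0) (at p)" for p
    by (rule eventually_mono[OF non_zero_neighbour_alt[OF hold[of UNIV] open_UNIV connected_UNIV UNIV_I UNIV_I d0]]) simp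
  have and_: "d analytic_on A" "(\<lambda>z. ent (nK K z * to_f (adj_mat (to_m m m (dK K z)))) i j) analytic_on A" for i j A
    using analytic_on_subset[OF iffD2[OF analytic_on_open[OF open_UNIV]] subset_UNIV] hold holn by blast+
  have qan: "q i j analytic_on {z}" if "d z \<noteq> 0" for i j z
    unfolding q_def by (rule analytic_on_divide[OF and_(2,1)]) (use that in simp)
  have mer: "q i j meromorphic_on UNIV" for i j
    unfolding q_def by (rule meromorphic_on_divide; rule analytic_on_imp_meromorphic_on; rule and_)
  have nice: "remove_sings (q i j) nicely_meromorphic_on UNIV" for i j
    by (rule remove_sings_nicely_meromorphic[OF mer])
  have FD: "to_f (F z) * dK K z = nK K z" if z: "d z \<noteq> 0" for z
  proof -
    obtain b where b: "inverse_pair m (dK K z) b" "b = sc (inverse (d z)) (to_f (adj_mat (to_m m m (dK K z))))"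
      unfolding d_def by (rule det_nonzero_inverse_pair[OF sdn(1) z[unfolded d_def]])
    have sb: "shaped m m b" using b(1) by (simp add: inverse_pair_def)
    have "to_f (F z) = nK K z * b"
    proof (rule fmat_eq_shapedI[OF sF shaped_mult[OF sdn(2) sb]])
      fix i j assume "i < m" "j < m"
      then have "ent (to_f (F z)) i j = q i j z"
        using Fent[of i j] c[of z] remove_sings_at_analytic[OF qan[OF z]] by (simp add: F_def)
      then show "ent (to_f (F z)) i j = ent (nK K z * b) i j"
        by (simp add: q_def b(2) sc_mult_right divide_inverse mult.commute)
    qed
    then show ?thesis
      using b(1) sdn(2)[of z] by (simp add: inverse_pair_def mult.assoc shaped_right)
  qed
  have holpt: "z \<in> hol_pts m F" if "z \<in> ball 0 1" "d z \<noteq> 0" for z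
  proof -
    have "remove_sings (q i j) analytic_on {z}" for i j
      using qan[OF that(2)] by (rule remove_sings_analytic_on)
    then show ?thesis using that(1) by (auto simp: hol_pts_def Fent)
  qed
  have H0: "0 \<in> hol_pts m F" by (rule holpt) (simp_all add: d0)
  have iso: "\<not> p islimpt (ball 0 1 - hol_pts m F)" if p: "p \<in> ball 0 1" for p
  proof -
    have "eventually (\<lambda>z. z \<in> ball 0 1 - {p}) (at p)" using p by (intro eventually_at_in_open) auto
    with dnz[of p] have "eventually (\<lambda>z. z \<notin> ball 0 1 - hol_pts m F) (at p)"
      by eventually_elim (auto intro: holpt)
    then show ?thesis by (simp add: islimpt_iff_eventually)
  qed
  have mero: "mero_disk m F"
    unfolding mero_disk_def
  proof (intro conjI allI ballI impI)
    fix p i j assume "i < m" "j < m"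
    show "(\<lambda>z. F z $$ (i, j)) analytic_on {p} \<or> filterlim (\<lambda>z. F z $$ (i, j)) at_infinity (at p)"
      unfolding Fent[OF \<open>i < m\<close> \<open>j < m\<close>] is_pole_def[symmetric]
      using nicely_meromorphic_on_imp_analytic_at[OF nice UNIV_I] by blast
  qed (use c iso in auto)
  have contF: "isCont (\<lambda>z. ent (to_f (F z)) i j) p" if "p \<in> hol_pts m F" for i j p
    using holomorphic_on_imp_continuous_on[OF hol_pts_holomorphic[OF c]] that
    by (simp only: continuous_on_eq_continuous_at[OF hol_pts_open])
  have contdn: "isCont (\<lambda>z. ent (dK K z) i j) p" "isCont (\<lambda>z. ent (nK K z) i j) p" for i j p
    using holomorphic_on_imp_continuous_on[OF hol(1), of UNIV i j] holomorphic_on_imp_continuous_on[OF hol(2), of UNIV i j]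
    unfolding continuous_on_eq_continuous_at[OF open_UNIV] by blast+
  have eq: "to_f (F p) * dK K p = nK K p" if p: "p \<in> hol_pts m F" for p
  proof (rule fmat_limit_eq)
    show "((\<lambda>z. ent (to_f (F z) * dK K z) i j) \<longlongrightarrow> ent (to_f (F p) * dK K p) i j) (at p)" for i j
      using fmat_isCont_mult[OF sF contF[OF p] contdn(1)] by (simp only: isCont_def)
    show "((\<lambda>z. ent (nK K z) i j) \<longlongrightarrow> ent (nK K p) i j) (at p)" for i j
      using contdn(2) by (simp only: isCont_def)
    show "eventually (\<lambda>z. to_f (F z) * dK K z = nK K z) (at p)"
      using dnz by (rule eventually_mono) (rule FD)
  qed
  have psd: "psdf m (J - adj (to_f (F p)) * J * to_f (F p))" if p: "p \<in> hol_pts m F" for p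
  proof (rule psdf_jform[OF J(1,2) sF])
    fix u assume u: "shaped m 1 u"
    have p1: "p \<in> ball 0 1" by (rule subsetD[OF hol_pts_subset p])
    have sFu: "shaped m 1 (to_f (F z) * u)" for z by (rule shaped_mult[OF sF u])
    have sJF: "shaped m 1 (J * (to_f (F z) * u))" for z by (rule shaped_mult[OF J(1) sFu])
    have je: "jform J u (to_f (F z) * u) = Re (ip u (J * u)) - Re (\<Sum>i<m. cnj (ent (to_f (F z) * u) i 0) * ent (J * (to_f (F z) * u)) i 0)" for z
      unfolding jform_def ip_eq[OF sFu] ..
    have cu: "isCont (\<lambda>z. ent (to_f (F z) * u) i j) p" for i j
      by (rule fmat_isCont_mult[OF sF contF[OF p]]) simp
    have cJ: "isCont (\<lambda>z. ent (J * (to_f (F z) * u)) i j) p" for i j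
      by (rule fmat_isCont_mult[OF J(1) _ cu]) simp
    have "((\<lambda>z. jform J u (to_f (F z) * u)) \<longlongrightarrow> jform J u (to_f (F p) * u)) (at p)"
      unfolding je by (intro tendsto_intros cu[unfolded isCont_def] cJ[unfolded isCont_def])
    moreover have "eventually (\<lambda>z. 0 \<le> jform J u (to_f (F z) * u)) (at p)"
    proof -
      have "eventually (\<lambda>z. z \<in> ball 0 1 - {p}) (at p)" using p1 by (intro eventually_at_in_open) auto
      with dnz[of p] show ?thesis
      proof eventually_elim
        case (elim z)
        then obtain b where b: "inverse_pair m (dK K z) b"
          using det_nonzero_inverse_pair[OF sdn(1), of z] unfolding d_def by blast
        define x where "x = b * u"
        have x: "shaped m 1 x" "dK K z * x = u"
          using b u by (auto simp: x_def inverse_pair_def shaped_left simp flip: mult.assoc intro: shaped_mult)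
        have "0 \<le> jform J (dK K z * x) (nK K z * x)"
          using elim by (intro J_expansive_value x K) auto
        also have "nK K z * x = to_f (F z) * u"
          unfolding FD[OF elim(1), symmetric] mult.assoc x(2) ..
        finally show ?case unfolding x(2) .
      qed
    qed
    ultimately show "0 \<le> jform J u (to_f (F p) * u)" by (rule tendsto_lowerbound) simp
  qed
  have tay: "feq (Suc n) f (ftay m F)"
  proof -
    define D where "D = ga + fsh (de * fps_const K)"
    define N where "N = al + fsh (be * fps_const K)"
    have sc: "fshaped m m (fps_const K)" "\<And>z. fconv z (fps_const K)" using sK by (auto intro: fconv_poly fdeg_intros(7))
    have v: "fev m m z D = dK K z" "fev m m z N = nK K z" for z
      unfolding D_def N_def fev_pair(1,2)[OF sc] by (simp_all add: fev_const sK)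
    have "has_fexp (\<lambda>z. fev m m z D) D" "has_fexp (\<lambda>z. fev m m z N) N"
      unfolding D_def N_def
      by (rule has_fexp_fev; use fev_pair(3,4)[OF sc] sc fsh4 in \<open>auto intro!: fshaped_intros fshaped_mult[of m m]\<close>)+
    then have h: "has_fexp (dK K) D" "has_fexp (nK K) N" unfolding v .
    have "has_fexp (\<lambda>z. to_f (F z) * dK K z) (ftay m F * D)"
      by (rule has_fexp_mult[OF has_fexp_ftay[OF c H0] h(1) sF ftay_shaped])
    moreover have "eventually (\<lambda>z. to_f (F z) * dK K z = nK K z) (nhds 0)"
      using eventually_nhds_in_open[OF hol_pts_open H0] by (rule eventually_mono) (rule eq)
    ultimately have "has_fexp (nK K) (ftay m F * D)" using has_fexp_cong[of "\<lambda>z. to_f (F z) * dK K z" "nK K"] by simp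
    with h(2) have FDN: "ftay m F * D = N" by (metis has_fexp_unique)
    \<comment> \<open>\<open>f * ga - al\<close> has order \<open>n + 1\<close>;
      \<open>f * de - be\<close> has order \<open>n\<close>, raised by one through the shift. Hence
      the parameter does not influence the first \<open>n + 1\<close> coefficients.\<close>
    have "feq (Suc n) (f * D) N"
    proof -
      have "f * D - N = (f * ga - al) + fsh (f * de * fps_const K - be * fps_const K)"
        by (simp add: D_def N_def distrib_left fsh_mult_right fsh_simps mult.assoc)
      moreover have "feq (Suc n) \<dots> (0 + fsh (0 * fps_const K))"
      proof (rule feq_add)
        show "feq (Suc n) (f * ga - al) 0" using c1 by (simp add: feq_def)
        have "feq n (f * de * fps_const K - be * fps_const K) (0 * fps_const K)"
          unfolding left_diff_distrib[symmetric]
        proof (rule feq_mult_left)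
          have "(be - f * de) \<section> k = 0" if "k < n" for k using c2 that by (simp add: feq_def)
          then show "feq n (f * de - be) 0" by (simp add: feq_def)
        qed
        then show "feq (Suc n) (fsh (f * de * fps_const K - be * fps_const K)) (fsh (0 * fps_const K))"
          by (rule feq_fsh)
      qed
      ultimately have "feq (Suc n) (f * D - N) 0" by (simp add: fsh_simps)
      then show ?thesis by (simp add: feq_def)
    qed
    then have eqD: "feq (Suc n) (f * D) (ftay m F * D)" by (simp only: FDN)
    have "inverse_pair m (D \<section> 0) ri" using r(1) by (simp add: D_def ga0)
    from this f ftay_shaped eqD show ?thesis by (rule feq_right_cancel)
  qed
  show thesis by (rule that[of F]) (fact mero H0 psd tay eq)+
qed

end

section \<open>Square roots of positive matrices\<close>

definition unit_col :: "nat \<Rightarrow> nat \<Rightarrow> fmat" where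
  "unit_col m j = mk m 1 (\<lambda>k _. if k = j then 1 else 0)"

lemma unit_col_shaped [simp, intro]: "shaped m 1 (unit_col m j)"
  by (simp add: unit_col_def)

lemma mult_unit_col: "shaped p m x \<Longrightarrow> j < m \<Longrightarrow> ent (x * unit_col m j) i 0 = ent x i j"
  by (simp add: ent_mult unit_col_def if_distrib[of "\<lambda>c. _ * c"] cong: if_cong)

lemma nrm2_unit_col: "j < m \<Longrightarrow> nrm2 (unit_col m j) = 1"
  unfolding nrm2_eq[OF unit_col_shaped]
  by (simp add: unit_col_def if_distrib[of cmod] if_distrib[of "\<lambda>x. x\<^sup>2"] cong: if_cong)

lemma ent_le_nrm2_col:
  assumes "shaped m m x" "i < m" "j < m"
  shows "(cmod (ent x i j))\<^sup>2 \<le> nrm2 (x * unit_col m j)"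
proof -
  have "(cmod (ent (x * unit_col m j) i 0))\<^sup>2 \<le> nrm2 (x * unit_col m j)"
    unfolding nrm2_eq[OF shaped_mult[OF assms(1) unit_col_shaped]] by (rule member_le_sum) (use assms in auto)
  then show ?thesis using assms by (simp add: mult_unit_col)
qed

lemma ip_unit_col:
  assumes "shaped m m y" "j < m"
  shows "ip (unit_col m j) (y * unit_col m j) = ent y j j"
proof -
  have "ip (unit_col m j) (y * unit_col m j) = (\<Sum>i<m. cnj (ent (unit_col m j) i 0) * ent y i j)"
    unfolding ip_eq[OF unit_col_shaped] using assms by (simp add: mult_unit_col)
  also have "\<dots> = (\<Sum>i<m. if i = j then ent y i j else 0)"
    by (rule sum.cong) (auto simp: unit_col_def)
  finally show ?thesis using assms by simp
qed

text \<open>The binomial series of \<open>(1 + b)\<^bsup>1/4\<^esup>\<close> yields a Hermitian root whose square is a positive square root of \<open>1 + b\<close>.\<close>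

definition fpow_fps :: "fmat \<Rightarrow> nat \<Rightarrow> complex fps \<Rightarrow> fmat fps" where
  "fpow_fps b m g = Abs_fps (\<lambda>k. sc (g \<section> k) (((*) b ^^ k) (idm m)))"

context
  fixes m :: nat and b :: fmat and q :: real
  assumes b: "shaped m m b" and hb: "adj b = b" and q: "0 \<le> q" "q < 1"
    and bd: "\<And>x. shaped m 1 x \<Longrightarrow> nrm2 (b * x) \<le> q\<^sup>2 * nrm2 x"
begin

abbreviation "bp k \<equiv> ((*) b ^^ k) (idm m)"

lemma bp_shaped: "shaped m m (bp k)"
  using b by (induction k) (auto intro: shaped_mult)

lemma bp_add: "bp i * bp j = bp (i + j)"
proof (induction i)
  case 0
  then show ?case using bp_shaped[of j] by (simp add: shaped_left)
next
  case (Suc i)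
  then show ?case by (simp add: mult.assoc)
qed

lemma bp_adj: "adj (bp k) = bp k"
proof (induction k)
  case (Suc k)
  have b1: "bp 1 = b" using b by (simp add: One_nat_def shaped_right)
  have "adj (bp (Suc k)) = adj (bp k) * adj b" by simp
  also have "\<dots> = bp k * bp 1" by (simp only: Suc hb b1)
  also have "\<dots> = bp (Suc k)" by (simp only: bp_add Suc_eq_plus1)
  finally show ?case .
qed simp

lemma bp_bound: "shaped m 1 x \<Longrightarrow> nrm2 (bp k * x) \<le> q ^ (2 * k) * nrm2 x"
proof (induction k)
  case (Suc k)
  have "nrm2 (b * (bp k * x)) \<le> q\<^sup>2 * nrm2 (bp k * x)"
    by (rule bd) (rule shaped_mult[OF bp_shaped Suc.prems])
  also have "\<dots> \<le> q\<^sup>2 * (q ^ (2 * k) * nrm2 x)" using Suc by (intro mult_left_mono) auto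
  finally show ?case by (simp add: mult.assoc power2_eq_square)
qed (simp add: shaped_left)

lemma bp_entry: "cmod (ent (bp k) i j) \<le> q ^ k"
proof (cases "i < m \<and> j < m")
  case True
  then have "(cmod (ent (bp k) i j))\<^sup>2 \<le> nrm2 (bp k * unit_col m j)"
    using ent_le_nrm2_col[OF bp_shaped] by blast
  also have "\<dots> \<le> q ^ (2 * k) * nrm2 (unit_col m j)" by (rule bp_bound) simp
  also have "\<dots> = (q ^ k)\<^sup>2" using True by (simp only: nrm2_unit_col power_even_eq mult_1_right)
  finally show ?thesis by (rule power2_le_imp_le) (use q in simp)
next
  case False
  then show ?thesis using bp_shaped[of k] q by (auto simp: shaped_iff)
qed

lemma fpow_fps_mult: "fpow_fps b m g * fpow_fps b m h = fpow_fps b m (g * h)"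
proof (rule fps_ext)
  fix k
  have "(fpow_fps b m g * fpow_fps b m h) \<section> k = (\<Sum>i=0..k. sc (g \<section> i * h \<section> (k - i)) (bp i * bp (k - i)))"
    unfolding fps_mult_nth fpow_fps_def by (simp add: sc_mult_left sc_mult_right mult.commute)
  also have "\<dots> = (\<Sum>i=0..k. sc (g \<section> i * h \<section> (k - i)) (bp k))"
    by (intro sum.cong) (simp_all add: bp_add)
  also have "\<dots> = sc (\<Sum>i=0..k. g \<section> i * h \<section> (k - i)) (bp k)"
    by (rule fmat_eqI) (simp add: ent_sum sum_distrib_right)
  finally show "(fpow_fps b m g * fpow_fps b m h) \<section> k = fpow_fps b m (g * h) \<section> k"
    by (simp add: fpow_fps_def fps_mult_nth)
qed

lemma fpow_fps_shaped: "fshaped m m (fpow_fps b m g)"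
  using bp_shaped by (auto simp: fpow_fps_def fshaped_def)

lemma fourth_root_one_plus:
  obtains T where "shaped m m T" "adj T = T" "T * T * (T * T) = idm m + b"
proof -
  define g where "g = fps_binomial (1 / 4 :: complex)"
  have g4: "g * g * (g * g) = 1 + fps_X"
    unfolding g_def fps_binomial_add_mult[symmetric] by (simp add: fps_binomial_1)
  have gr: "g \<section> k = of_real (1 / 4 gchoose k)" for k
    by (simp add: g_def gbinomial_prod_rev)
  \<comment> \<open>Consecutive coefficients have a ratio of modulus at most 1, so the decay of the
    powers of \<open>b\<close> alone gives convergence.\<close>
  have gb: "\<bar>(1 / 4 :: real) gchoose k\<bar> \<le> 1" for k
  proof (induction k)
    case (Suc k)
    have "(1 / 4 :: real) gchoose Suc k = (1 / 4 gchoose k) * ((1 / 4 - real k) / real (Suc k))"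
      by (simp add: gbinomial_factors gbinomial_prod_rev field_simps)
    moreover have "\<bar>(1 / 4 - real k) / real (Suc k)\<bar> \<le> 1" by (simp add: abs_if field_simps)
    ultimately show ?case using Suc by (simp only: abs_mult mult_le_one abs_ge_zero)
  qed simp
  define P where "P = fpow_fps b m g"
  have sP: "fshaped m m P" unfolding P_def by (rule fpow_fps_shaped)
  have cP: "fconv 1 P"
    unfolding fconv_def
  proof (intro allI)
    fix i j
    show "summable (\<lambda>k. norm (ent (P \<section> k) i j * 1 ^ k))"
    proof (rule summable_comparison_test')
      show "summable (\<lambda>k. q ^ k)" using q by (simp add: summable_geometric)
      fix k
      have "norm (g \<section> k) \<le> 1" using gb[of k] by (simp add: gr norm_of_real)
      then show "norm (norm (ent (P \<section> k) i j * 1 ^ k)) \<le> q ^ k"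
        using bp_entry[of k i j] q mult_mono[of "norm (g \<section> k)" 1 "cmod (ent (bp k) i j)" "q ^ k"]
        by (simp add: P_def fpow_fps_def norm_mult)
    qed
  qed
  define T where "T = fev m m 1 P"
  have cPP: "fconv 1 (P * P)" "fshaped m m (P * P)" using fconv_mult[OF sP cP cP] fshaped_mult[OF sP sP] by auto
  have "T * T * (T * T) = fev m m 1 (P * P * (P * P))"
    unfolding T_def by (simp add: fev_mult[OF sP cP cP] fev_mult[OF cPP(2,1,1)])
  also have "P * P * (P * P) = fpow_fps b m (1 + fps_X)"
    unfolding P_def fpow_fps_mult g4 ..
  also have "fev m m 1 \<dots> = (\<Sum>k\<le>1. sc (1 ^ k) (fpow_fps b m (1 + fps_X) \<section> k))"
    by (rule fev_poly[OF _ fpow_fps_shaped]) (auto simp: fdeg_def fpow_fps_def fps_X_def)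
  also have "\<dots> = idm m + b"
    using b by (simp add: fpow_fps_def One_nat_def shaped_right)
  finally have "T * T * (T * T) = idm m + b" .
  moreover have "adj T = T"
  proof (rule fmat_eq_shapedI)
    show "shaped m m (adj T)" "shaped m m T" by (auto simp: T_def)
    fix i j assume ij: "i < m" "j < m"
    have "cnj (ent (P \<section> k) j i) = ent (P \<section> k) i j" for k
      using arg_cong[OF bp_adj[of k], of "\<lambda>x. ent x i j"] by (simp add: P_def fpow_fps_def gr)
    moreover have "(\<lambda>k. cnj (ent (P \<section> k) j i)) sums cnj (\<Sum>k. ent (P \<section> k) j i)"
      using summable_sums[OF fconv_summable[OF cP, of j i]] by (simp add: sums_cnj)
    ultimately have "cnj (\<Sum>k. ent (P \<section> k) j i) = (\<Sum>k. ent (P \<section> k) i j)"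
      by (simp add: sums_iff)
    then show "ent (adj T) i j = ent T i j" using ij by (simp add: T_def fev_def)
  qed
  ultimately show thesis using that[of T] by (simp add: T_def)
qed

end

text \<open>Scaling by an upper bound \<open>C\<close> puts the form of \<open>b = 1 - a / C\<close>
  between 0 and \<open>q = 1 - e / C\<close>, which is below 1. Cauchy-Schwarz for the form of
  \<open>b\<close> turns this into an operator bound, and the root of \<open>1 - b\<close> is scaled
  back by \<open>sqrt C\<close>.\<close>

lemma pdf_sqrt_exists:
  assumes a: "pdf m a"
  obtains s where "pdf m s" "s * s = a"
proof -
  have sa: "shaped m m a" "adj a = a" using a by (auto simp: pdf_def)
  obtain e where e: "e > 0" "\<And>x. shaped m 1 x \<Longrightarrow> e * nrm2 x \<le> Re (ip x (a * x))"
    using pdf_lower_bound[OF a] by metis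
  obtain C0 where C0: "C0 > 0" "\<And>x. shaped m 1 x \<Longrightarrow> nrm2 (a * x) \<le> C0 * nrm2 x"
    using nrm2_mult_bound[OF sa(1)] by metis
  \<comment> \<open>\<open>sqrt C0\<close> bounds the form from above; adding \<open>e\<close> makes
    \<open>e < C\<close> immediate, so that \<open>q\<close> is nonnegative.\<close>
  define C where "C = sqrt C0 + e"
  have C: "C > 0" "e < C" using C0(1) e(1) by (simp_all add: C_def add_pos_pos)
  have up: "Re (ip x (a * x)) \<le> C * nrm2 x" if x: "shaped m 1 x" for x
  proof -
    have "(Re (ip x (a * x)))\<^sup>2 \<le> (cmod (ip x (a * x)))\<^sup>2" by (simp add: cmod_power2)
    also have "\<dots> \<le> nrm2 x * nrm2 (a * x)" using x sa by (intro ip_Cauchy_Schwarz shaped_mult) auto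
    also have "\<dots> \<le> nrm2 x * (C0 * nrm2 x)" by (intro mult_left_mono C0 x) simp
    also have "\<dots> = (sqrt C0 * nrm2 x)\<^sup>2" using C0(1) by (simp add: power2_eq_square)
    finally have "Re (ip x (a * x)) \<le> sqrt C0 * nrm2 x"
      by (rule power2_le_imp_le) (use C0(1) in simp)
    also have "\<dots> \<le> C * nrm2 x" using e by (intro mult_right_mono) (auto simp: C_def)
    finally show ?thesis .
  qed
  define q where "q = 1 - e / C"
  have q: "0 \<le> q" "q < 1" using C e by (auto simp: q_def)
  define b where "b = idm m - sc (of_real (1 / C)) a"
  have b: "shaped m m b" "adj b = b" using sa by (auto simp: b_def)
  have bq: "0 \<le> Re (ip x (b * x))" "Re (ip x (b * x)) \<le> q * nrm2 x" if x: "shaped m 1 x" for x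
  proof -
    have eq: "Re (ip x (b * x)) = nrm2 x - Re (ip x (a * x)) / C"
      using x by (simp add: b_def left_diff_distrib ip_simps sc_mult_left shaped_left nrm2_def)
    show "0 \<le> Re (ip x (b * x))" "Re (ip x (b * x)) \<le> q * nrm2 x"
      unfolding eq q_def using up[OF x] e(2)[OF x] C by (simp_all add: field_simps)
  qed
  have pb: "psdf m b" using b bq by (simp add: psdf_def)
  have bd: "nrm2 (b * x) \<le> q\<^sup>2 * nrm2 x" if x: "shaped m 1 x" for x
  proof (cases "nrm2 (b * x) = 0")
    case False
    then have n: "nrm2 (b * x) > 0" using nrm2_nonneg[of "b * x"] by linarith
    have bx: "shaped m 1 (b * x)" using b x by (auto intro: shaped_mult)
    have "(nrm2 (b * x))\<^sup>2 = (cmod (ip (b * x) (b * x)))\<^sup>2" by (simp add: ip_self_real)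
    also have "\<dots> \<le> Re (ip (b * x) (b * (b * x))) * Re (ip x (b * x))"
      by (rule psdf_Cauchy_Schwarz[OF pb bx x])
    also have "\<dots> \<le> (q * nrm2 (b * x)) * (q * nrm2 x)"
      using bq[OF bx] bq[OF x] q by (intro mult_mono) auto
    finally have "nrm2 (b * x) * nrm2 (b * x) \<le> (q\<^sup>2 * nrm2 x) * nrm2 (b * x)"
      by (simp add: power2_eq_square mult_ac)
    then show ?thesis using n by simp
  qed (use q in simp)
  have nb: "shaped m m (- b)" "adj (- b) = - b" using b by auto
  obtain T where T: "shaped m m T" "adj T = T" "T * T * (T * T) = idm m + - b"
  proof (rule fourth_root_one_plus[OF nb q])
    fix x assume "shaped m 1 x"
    then show "nrm2 (- b * x) \<le> q\<^sup>2 * nrm2 x" using bd by (simp add: nrm2_minus)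
  qed blast
  define s where "s = sc (of_real (sqrt C)) (T * T)"
  have s: "shaped m m s" "adj s = s" using T by (auto simp: s_def intro: shaped_mult)
  have ss: "s * s = a"
  proof -
    have "s * s = sc (of_real (sqrt C) * of_real (sqrt C)) (T * T * (T * T))"
      by (simp add: s_def sc_mult_left sc_mult_right)
    also have "complex_of_real (sqrt C) * of_real (sqrt C) = of_real C"
      using C by (simp flip: of_real_mult)
    also have "T * T * (T * T) = sc (of_real (1 / C)) a" unfolding T(3) by (simp add: b_def)
    finally show ?thesis using C by simp
  qed
  have "0 < Re (ip x (s * x))" if x: "shaped m 1 x" "x \<noteq> 0" for x
  proof -
    have Tx: "shaped m 1 (T * x)" using T x by (auto intro: shaped_mult)
    have "T * x \<noteq> 0"
    proof
      assume "T * x = 0"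
      then have "s * x = 0" by (simp add: s_def sc_mult_left mult.assoc)
      then have "a * x = 0" by (simp add: ss[symmetric] mult.assoc)
      then show False using a x unfolding pdf_def by (metis ip_simps(8) less_irrefl zero_complex.sel(1))
    qed
    then have "nrm2 (T * x) > 0" using nrm2_eq_0_iff[OF Tx] nrm2_nonneg[of "T * x"] by linarith
    moreover have "ip x (s * x) = of_real (sqrt C) * ip (T * x) (T * x)"
      by (simp add: s_def sc_mult_left ip_simps ip_mult_left T(2) mult.assoc)
    ultimately show ?thesis using C by (simp add: ip_self_real)
  qed
  then have "pdf m s" using s by (simp add: pdf_def)
  with ss that show thesis by blast
qed

lemma trace_commute:
  assumes "shaped m m x" "shaped m m y"
  shows "(\<Sum>i<m. ent (x * y) i i) = (\<Sum>i<m. ent (y * x) i i)"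
  unfolding ent_mult[OF assms(1)] ent_mult[OF assms(2)]
  by (subst sum.swap) (simp add: mult.commute)

text \<open>With \<open>X = S - T\<close> one has \<open>S X + X T = 0\<close>, so \<open>X S X\<close> and \<open>X T X\<close> have opposite traces.\<close>

lemma pdf_sqrt_unique:
  assumes s: "pdf m s" and t: "psdf m t" and eq: "s * s = t * t"
  shows "s = t"
proof -
  have sh: "shaped m m s" "shaped m m t" "adj s = s" "adj t = t" using s t by (auto simp: pdf_def psdf_def)
  define x where "x = s - t"
  have sx: "shaped m m x" "adj x = x" using sh by (auto simp: x_def)
  have xsx: "shaped m m (x * s * x)" "shaped m m (x * t * x)" "shaped m m (x * x * t)" "shaped m m (t * x)"
    using sx sh by (auto intro!: shaped_mult[of m m])
  have "s * x + x * t = 0" by (simp add: x_def algebra_simps eq)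
  then have "x * (s * x + x * t) = 0" by simp
  then have "x * s * x + x * (x * t) = 0" by (simp add: distrib_left mult.assoc)
  then have "(\<Sum>i<m. ent (x * s * x + x * (x * t)) i i) = 0" by simp
  then have "(\<Sum>i<m. ent (x * s * x) i i) + (\<Sum>i<m. ent (x * (x * t)) i i) = 0"
    by (simp add: sum.distrib)
  also have "(\<Sum>i<m. ent (x * (x * t)) i i) = (\<Sum>i<m. ent ((x * t) * x) i i)"
    by (rule trace_commute[OF sx(1) shaped_mult[OF sx(1) sh(2)]])
  finally have tr: "(\<Sum>i<m. ent (x * s * x) i i) + (\<Sum>i<m. ent (x * t * x) i i) = 0" .
  have d: "ent (x * a * x) i i = ip (x * unit_col m i) (a * (x * unit_col m i))" if "i < m" "shaped m m (x * a * x)" for a i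
    using ip_unit_col[OF that(2,1)] by (simp add: ip_mult_left sx(2) mult.assoc)
  have c: "shaped m 1 (x * unit_col m i)" for i using sx by (auto intro: shaped_mult)
  have nn: "0 \<le> Re (ent (x * s * x) i i)" "0 \<le> Re (ent (x * t * x) i i)" if "i < m" for i
    using that d[OF that xsx(1)] d[OF that xsx(2)] pdf_psdf[OF s] t c by (auto simp: psdf_def)
  have "(\<Sum>i<m. Re (ent (x * s * x) i i)) + (\<Sum>i<m. Re (ent (x * t * x) i i)) = 0"
    using arg_cong[OF tr, of Re] by simp
  moreover have "0 \<le> (\<Sum>i<m. Re (ent (x * t * x) i i))" "0 \<le> (\<Sum>i<m. Re (ent (x * s * x) i i))"
    using nn by (auto intro: sum_nonneg)
  ultimately have "(\<Sum>i<m. Re (ent (x * s * x) i i)) = 0" by linarith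
  then have z: "Re (ent (x * s * x) i i) = 0" if "i < m" for i
    using nn that by (subst (asm) sum_nonneg_eq_0_iff) auto
  have "x * unit_col m i = 0" if "i < m" for i
  proof (rule ccontr)
    assume "x * unit_col m i \<noteq> 0"
    with s c have "0 < Re (ip (x * unit_col m i) (s * (x * unit_col m i)))" by (simp add: pdf_def)
    with z[OF that] d[OF that xsx(1)] show False by simp
  qed
  then have "ent x k i = 0" if "k < m" "i < m" for k i
    using mult_unit_col[OF sx(1), of i k] that by simp
  then have "x = 0" by (intro fmat_eq_shapedI[OF sx(1)]) auto
  then show ?thesis by (simp add: x_def)
qed

text \<open>\<open>msqrt\<close> is a definite description among positive semidefinite roots, so
  uniqueness must hold against semidefinite competitors; this is why \<open>pdf_sqrt_unique\<close>
  compares a definite root with a semidefinite one.\<close>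

lemma msqrt_pdf:
  assumes A: "A \<in> carrier_mat m m" and p: "pdf m (to_f A)"
  shows "msqrt A \<in> carrier_mat m m" "pdf m (to_f (msqrt A))" "to_f (msqrt A) * to_f (msqrt A) = to_f A"
proof -
  obtain s where s: "pdf m s" "s * s = to_f A" using pdf_sqrt_exists[OF p] by metis
  have ss: "shaped m m s" using s by (simp add: pdf_def)
  have "msqrt A = to_m m m s"
    unfolding msqrt_def
  proof (rule the_equality)
    have "to_m m m s * to_m m m s = A"
      using to_m_mult[OF ss ss] s(2) to_m_to_f[OF A] by simp
    then show "psd (to_m m m s) \<and> dim_row (to_m m m s) = dim_row A \<and> to_m m m s * to_m m m s = A"
      using A s ss by (simp add: psd_iff[of _ m] pdf_psdf)
  next
    fix S assume S: "psd S \<and> dim_row S = dim_row A \<and> S * S = A"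
    then have "psd S" by simp
    then have "S \<in> carrier_mat (dim_row S) (dim_row S)" unfolding psd_def hermitian_def by blast
    moreover have "dim_row S = m" using S A by auto
    ultimately have Sc: "S \<in> carrier_mat m m" by simp
    then have "psdf m (to_f S)" using psd_iff[OF Sc] S by blast
    moreover have "to_f S * to_f S = s * s" using S to_f_mult[of S S] Sc s(2) by simp
    ultimately have "s = to_f S" by (intro pdf_sqrt_unique[OF s(1)]) simp_all
    then show "S = to_m m m s" using to_m_to_f[OF Sc] by simp
  qed
  then show "msqrt A \<in> carrier_mat m m" "pdf m (to_f (msqrt A))" "to_f (msqrt A) * to_f (msqrt A) = to_f A"
    using s ss by simp_all
qed

section \<open>The linear fractional transform at a point\<close>

definition blk :: "nat \<Rightarrow> fmat \<Rightarrow> fmat \<Rightarrow> fmat \<Rightarrow> fmat \<Rightarrow> fmat" where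
  "blk m a b c d = to_f (four_block_mat (to_m m m a) (to_m m m b) (to_m m m c) (to_m m m d))"

lemma blk_shaped [simp]: "shaped (m + m) (m + m) (blk m a b c d)"
  unfolding blk_def by (rule shaped_to_f') simp

lemma to_m_blk: "to_m (m + m) (m + m) (blk m a b c d) = four_block_mat (to_m m m a) (to_m m m b) (to_m m m c) (to_m m m d)"
  unfolding blk_def by (rule to_m_to_f) simp

lemma blk_mult:
  assumes "shaped m m a" "shaped m m b" "shaped m m c" "shaped m m d"
    "shaped m m a'" "shaped m m b'" "shaped m m c'" "shaped m m d'"
  shows "blk m a b c d * blk m a' b' c' d' = blk m (a * a' + b * c') (a * b' + b * d') (c * a' + d * c') (c * b' + d * d')"
proof -
  have "blk m a b c d * blk m a' b' c' d' =
      to_f (four_block_mat (to_m m m a) (to_m m m b) (to_m m m c) (to_m m m d) *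
        four_block_mat (to_m m m a') (to_m m m b') (to_m m m c') (to_m m m d'))"
    unfolding blk_def by (subst to_f_mult) simp_all
  also have "\<dots> = blk m (a * a' + b * c') (a * b' + b * d') (c * a' + d * c') (c * b' + d * d')"
    by (subst mult_four_block_mat[of _ m m _ m _ m _ _ m _ m])
       (use assms in \<open>simp_all add: blk_def to_m_add to_m_mult\<close>)
  finally show ?thesis .
qed

lemma blk_idm: "blk m (idm m) 0 0 (idm m) = idm (m + m)"
  unfolding blk_def to_m_idm to_m_0 four_block_one_mat to_f_one ..

lemma ent_blk:
  assumes "i < m" "j < m"
  shows "ent (blk m a b c d) i j = ent a i j" "ent (blk m a b c d) i (m + j) = ent b i j"
    "ent (blk m a b c d) (m + i) j = ent c i j" "ent (blk m a b c d) (m + i) (m + j) = ent d i j"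
  using assms by (simp_all add: blk_def)

lemma blk_inject:
  assumes "blk m a b c d = blk m a' b' c' d'"
    "shaped m m a" "shaped m m b" "shaped m m c" "shaped m m d"
    "shaped m m a'" "shaped m m b'" "shaped m m c'" "shaped m m d'"
  shows "a = a'" "b = b'" "c = c'" "d = d'"
  using assms by (intro fmat_eq_shapedI[of m m]; metis ent_blk)+

lemma blk_adj:
  assumes "shaped m m a" "shaped m m b" "shaped m m c" "shaped m m d"
  shows "adj (blk m a b c d) = blk m (adj a) (adj c) (adj b) (adj d)"
  by (rule fmat_eq_shapedI[OF shaped_intros(8)[OF blk_shaped] blk_shaped]) (auto simp: blk_def)

text \<open>A left inverse of a square matrix is also a right inverse. Read in blocks, the four
  identities for one order of the factors yield the four for the other order.\<close>

lemma block_inverse: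
  assumes s: "shaped m m a" "shaped m m b" "shaped m m c" "shaped m m d"
    "shaped m m p" "shaped m m q" "shaped m m r" "shaped m m s"
    and e: "p * a + q * c = idm m" "p * b + q * d = 0" "r * a + s * c = 0" "r * b + s * d = idm m"
  shows "a * p + b * r = idm m" "a * q + b * s = 0" "c * p + d * r = 0" "c * q + d * s = idm m"
proof -
  have "blk m p q r s * blk m a b c d = idm (m + m)"
    unfolding blk_mult[OF s(5-8,1-4)] e blk_idm ..
  then have "inverse_pair (m + m) (blk m p q r s) (blk m a b c d)"
    by (intro left_inverse_imp_inverse_pair) simp_all
  then have "blk m a b c d * blk m p q r s = blk m (idm m) 0 0 (idm m)"
    by (simp add: inverse_pair_def blk_idm)
  then have eq: "blk m (a * p + b * r) (a * q + b * s) (c * p + d * r) (c * q + d * s) = blk m (idm m) 0 0 (idm m)"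
    unfolding blk_mult[OF s] .
  show "a * p + b * r = idm m" "a * q + b * s = 0" "c * p + d * r = 0" "c * q + d * s = idm m"
    by (rule blk_inject[OF eq]; use s in \<open>auto intro!: shaped_intros shaped_mult[of m m]\<close>)+
qed

abbreviation fdet :: "nat \<Rightarrow> fmat \<Rightarrow> complex" where
  "fdet m a \<equiv> Determinant.det (to_m m m a)"

lemma fdet_mult: "shaped m m a \<Longrightarrow> shaped m m b \<Longrightarrow> fdet m (a * b) = fdet m a * fdet m b"
  by (simp add: to_m_mult det_mult[of _ m])

lemma fdet_idm: "fdet m (idm m) = 1"
  by (simp add: to_m_idm)

lemma fdet_adj: "fdet m (adj a) = cnj (fdet m a)"
proof -
  have "to_m m m (adj a) = transpose_mat (map_mat cnj (to_m m m a))"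
    by (rule eq_matI) auto
  moreover have "Determinant.det (map_mat cnj (to_m m m a)) = cnj (fdet m a)"
    by (simp add: det_def'[of _ m])
  ultimately show ?thesis by (simp add: det_transpose[of _ m])
qed

lemma fdet_blk_triangular:
  assumes "shaped m m a" "shaped m m b" "shaped m m d"
  shows "fdet (m + m) (blk m a b 0 d) = fdet m a * fdet m d" "fdet (m + m) (blk m a 0 b d) = fdet m a * fdet m d"
  unfolding to_m_blk to_m_0
  by (subst det_four_block_mat_lower_left_zero[of _ m _ m]; simp)
     (subst det_four_block_mat_upper_right_zero[of _ m _ m]; simp)

text \<open>Both determinants arise from the block matrix with rows \<open>(1, a)\<close> and
  \<open>(b, 1)\<close>, once by a lower and once by an upper triangular elimination.\<close>

lemma sylvester_det:
  assumes s: "shaped m m a" "shaped m m b"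
  shows "fdet m (idm m - a * b) = fdet m (idm m - b * a)"
proof -
  have sh: "shaped m m (idm m - a * b)" "shaped m m (idm m - b * a)" "shaped m m (idm m)" "shaped m m 0"
    using s by (auto intro!: shaped_intros shaped_mult[of m m])
  have i: "idm m * idm m = idm m" "idm m * a = a" "idm m * b = b" "a * idm m = a" "b * idm m = b"
    using s by (auto simp: shaped_def intro!: fmat_eqI simp: idm_left)
  have "blk m (idm m) 0 b (idm m) * blk m (idm m) a 0 (idm m - b * a) = blk m (idm m) a b (idm m)"
    using s sh by (simp add: blk_mult i right_diff_distrib flip: mult.assoc)
  moreover have "blk m (idm m) a 0 (idm m) * blk m (idm m - a * b) 0 b (idm m) = blk m (idm m) a b (idm m)"
    using s sh by (simp add: blk_mult i right_diff_distrib flip: mult.assoc)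
  ultimately have "fdet (m + m) (blk m (idm m) 0 b (idm m)) * fdet (m + m) (blk m (idm m) a 0 (idm m - b * a)) =
      fdet (m + m) (blk m (idm m) a 0 (idm m)) * fdet (m + m) (blk m (idm m - a * b) 0 b (idm m))"
    by (simp flip: fdet_mult)
  then show ?thesis
    using s sh by (simp add: fdet_blk_triangular fdet_idm)
qed

lemma contr_adj: "contr m k \<Longrightarrow> contr m (adj k)"
  unfolding contr_def
proof (intro conjI allI impI)
  assume k: "shaped m m k \<and> (\<forall>x. shaped m 1 x \<longrightarrow> nrm2 (k * x) \<le> nrm2 x)"
  then show "shaped m m (adj k)" by auto
  fix x assume x: "shaped m 1 x"
  define y where "y = adj k * x"
  have y: "shaped m 1 y" unfolding y_def using k x by (auto intro: shaped_mult)
  have ky: "shaped m 1 (k * y)" using k y by (auto intro: shaped_mult)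
  have "(nrm2 y)\<^sup>2 = (cmod (ip (k * y) x))\<^sup>2"
  proof -
    have "ip (k * y) x = ip y y" by (simp add: ip_mult_left y_def)
    then show ?thesis by (simp add: ip_self_real)
  qed
  also have "\<dots> \<le> nrm2 (k * y) * nrm2 x" by (rule ip_Cauchy_Schwarz[OF ky x])
  also have "\<dots> \<le> nrm2 y * nrm2 x" using k y by (intro mult_right_mono) auto
  finally have "nrm2 y * nrm2 y \<le> nrm2 y * nrm2 x" by (simp add: power2_eq_square)
  then show "nrm2 (adj k * x) \<le> nrm2 x"
    using nrm2_nonneg[of y] nrm2_nonneg[of x] unfolding y_def[symmetric]
    by (cases "nrm2 y = 0") (auto simp: less_le)
qed

lemma col_outer:
  assumes "shaped m 1 q" "shaped m 1 x"
  shows "p * (adj q * x) = sc (ip q x) (p * idm 1)"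
proof -
  have "shaped 1 1 (adj q * x)" using assms by (auto intro: shaped_mult)
  then have "adj q * x = sc (ip q x) (idm 1)"
    by (intro fmat_eq_shapedI[of 1 1]) (auto simp: ip_def)
  then show ?thesis by (simp add: sc_mult_right)
qed

text \<open>The contraction is \<open>p * adj q\<close> divided by \<open>nrm2 q\<close>. It
  supplies the constant parameters that make a denominator singular.\<close>

lemma rank_one_contr:
  assumes p: "shaped m 1 p" and q: "shaped m 1 q" and le: "nrm2 p \<le> nrm2 q"
  obtains k where "contr m k" "k * q = p"
proof (cases "nrm2 q = 0")
  case True
  then have "q = 0" "p = 0" using assms nrm2_eq_0_iff nrm2_nonneg[of p] by (simp, metis order_antisym)
  then show thesis using that[of 0] by (simp add: contr_def)
next
  case False
  then have n: "nrm2 q > 0" using nrm2_nonneg[of q] by linarith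
  define k where "k = sc (of_real (1 / nrm2 q)) (p * adj q)"
  have sk: "shaped m m k" unfolding k_def using p q by (auto intro: shaped_mult)
  have kx: "k * x = sc (of_real (1 / nrm2 q) * ip q x) p" if "shaped m 1 x" for x
    using col_outer[OF q that, of p] p by (simp add: k_def sc_mult_left mult.assoc shaped_right)
  have "nrm2 (k * x) \<le> nrm2 x" if x: "shaped m 1 x" for x
  proof -
    have "nrm2 (k * x) = (cmod (ip q x))\<^sup>2 / (nrm2 q)\<^sup>2 * nrm2 p"
      using n by (simp add: kx[OF x] nrm2_sc norm_mult norm_divide power_mult_distrib power_divide)
    also have "\<dots> \<le> (nrm2 q * nrm2 x) / (nrm2 q)\<^sup>2 * nrm2 q"
      by (intro mult_mono divide_right_mono ip_Cauchy_Schwarz[OF q x] le) (use n in auto)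
    also have "\<dots> = nrm2 x" using n by (simp add: power2_eq_square)
    finally show ?thesis .
  qed
  then have "contr m k" using sk by (simp add: contr_def)
  moreover have "k * q = p"
  proof -
    have "of_real (1 / nrm2 q) * ip q q = (1::complex)" using n by (simp add: ip_self_real)
    then show ?thesis unfolding kx[OF q] by simp
  qed
  ultimately show thesis by (rule that)
qed

text \<open>The values at \<open>w \<noteq> 0\<close> of the resolvent matrix, with columns \<open>(al, ga)\<close> and \<open>(be, de)\<close>, and of \<open>w\<^sup>n\<close> times
  its inverse.\<close>

locale frame =
  fixes m n :: nat and w :: complex and al be ga de ra pa ta si :: fmat
  assumes s: "shaped m m al" "shaped m m be" "shaped m m ga" "shaped m m de"
      "shaped m m ra" "shaped m m pa" "shaped m m ta" "shaped m m si"
    and w: "w \<noteq> 0"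
    and l1: "ra * ga - pa * al = sc (w ^ n) (idm m)" and l2: "ta * be - si * de = sc (w ^ n) (idm m)"
    and l3: "ta * al = si * ga" and l4: "pa * be = ra * de"
begin

abbreviation "aw \<equiv> (cmod w)\<^sup>2"
abbreviation "W \<equiv> w ^ n"

text \<open>\<open>l1\<close> to \<open>l4\<close> say that a block matrix formed from
  \<open>ra\<close>, \<open>pa\<close>, \<open>si\<close>, \<open>ta\<close> is, up to the factor
  \<open>w^n\<close>, a left inverse of the resolvent matrix; these are the relations that express
  the right inverse.\<close>

lemma right_identities:
  "ga * ra - de * si = sc W (idm m)" "be * ta - al * pa = sc W (idm m)" "ga * pa = de * ta" "al * ra = be * si"
proof -
  define c where "c = inverse W"
  have c: "c * W = 1" using w by (simp add: c_def)
  note b = block_inverse[of m ga de al be "sc c ra" "- sc c pa" "- sc c si" "sc c ta"]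
  have prem: "sc c ra * ga + - sc c pa * al = idm m" "sc c ra * de + - sc c pa * be = 0"
    "- sc c si * ga + sc c ta * al = 0" "- sc c si * de + sc c ta * be = idm m"
  proof -
    have "sc c ra * ga + - sc c pa * al = sc c (ra * ga - pa * al)" "sc c ra * de + - sc c pa * be = sc c (ra * de - pa * be)"
      "- sc c si * ga + sc c ta * al = sc c (ta * al - si * ga)" "- sc c si * de + sc c ta * be = sc c (ta * be - si * de)"
      by (simp_all add: sc_mult_left sc_diff_right)
    then show "sc c ra * ga + - sc c pa * al = idm m" "sc c ra * de + - sc c pa * be = 0"
      "- sc c si * ga + sc c ta * al = 0" "- sc c si * de + sc c ta * be = idm m"
      by (simp_all add: l1 l2 l3 l4 c)
  qed
  note b = b[OF s(3,4,1,2) shaped_intros(5)[OF s(5)] shaped_intros(4)[OF shaped_intros(5)[OF s(6)]]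
      shaped_intros(4)[OF shaped_intros(5)[OF s(8)]] shaped_intros(5)[OF s(7)] prem]
  have "sc c (ga * ra - de * si) = idm m" "sc c (de * ta - ga * pa) = 0" "sc c (al * ra - be * si) = 0" "sc c (be * ta - al * pa) = idm m"
    using b by (simp_all add: sc_mult_right sc_diff_right)
  then have "sc W (sc c (ga * ra - de * si)) = sc W (idm m)" "sc W (sc c (de * ta - ga * pa)) = 0"
    "sc W (sc c (al * ra - be * si)) = 0" "sc W (sc c (be * ta - al * pa)) = sc W (idm m)" by simp_all
  then show "ga * ra - de * si = sc W (idm m)" "be * ta - al * pa = sc W (idm m)" "ga * pa = de * ta" "al * ra = be * si"
    using c by (simp_all add: mult.commute[of W])
qed

text \<open>\<open>Phi\<close>, \<open>Cc\<close> and \<open>Ee\<close> are the coefficients of the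
  quadratic form whose sign decides whether \<open>X\<close> is a value; \<open>Psi\<close> and
  \<open>Mm\<close> are built from the resolvent matrix itself instead of its inverse.\<close>

definition "Phi = adj ta * ta - sc (of_real aw) (adj pa * pa)"
definition "Cc = adj ta * si - sc (of_real aw) (adj pa * ra)"
definition "Ee = adj si * si - sc (of_real aw) (adj ra * ra)"
definition "Psi = ga * adj ga - sc (of_real aw) (de * adj de)"
definition "Mm = al * adj ga - sc (of_real aw) (be * adj de)"

lemma shaped_defs: "shaped m m Phi" "shaped m m Cc" "shaped m m Ee" "shaped m m Psi" "shaped m m Mm"
  unfolding Phi_def Cc_def Ee_def Psi_def Mm_def using s by (auto intro!: shaped_intros(3,5) shaped_mult[of m m])

lemma herm_defs: "adj Phi = Phi" "adj Psi = Psi" "adj Ee = Ee"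
  by (simp_all add: Phi_def Psi_def Ee_def)

text \<open>Multiplied out to avoid inverses, this is the agreement of the left and the right
  formula for the centre of the matrix ball.\<close>

lemma Phi_Mm: "Phi * Mm = Cc * Psi"
proof -
  have e: "ta * (al * x) = si * (ga * x)" "pa * (be * x) = ra * (de * x)" for x
    by (simp_all add: l3 l4 flip: mult.assoc)
  have e2: "ta * (be * x) = si * (de * x) + sc W (idm m * x)" "pa * (al * x) = ra * (ga * x) - sc W (idm m * x)" for x
  proof -
    have "ta * be = si * de + sc W (idm m)" "pa * al = ra * ga - sc W (idm m)"
      using l1 l2 by (auto simp: algebra_simps)
    then show "ta * (be * x) = si * (de * x) + sc W (idm m * x)" "pa * (al * x) = ra * (ga * x) - sc W (idm m * x)"
      by (simp_all add: distrib_right left_diff_distrib sc_mult_left flip: mult.assoc)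
  qed
  have z: "adj ta * adj de = adj pa * adj ga"
    using right_identities(3) by (metis adj_mult)
  have i: "idm m * adj ga = adj ga" "idm m * adj de = adj de" using shaped_left[OF shaped_intros(8)[OF s(3)]] shaped_left[OF shaped_intros(8)[OF s(4)]] by simp_all
  show ?thesis
    unfolding Phi_def Mm_def Cc_def Psi_def
    by (simp add: distrib_left distrib_right left_diff_distrib right_diff_distrib mult.assoc sc_mult_left sc_mult_right
        sc_add_right sc_diff_right e e2 i z)
qed

text \<open>The term left over when the square is completed: combined with \<open>Phi_Mm\<close> it
  says that the Schur complement of the form is a multiple of the inverse of \<open>Psi\<close>. The
  multiple is the squared scalar radius, with \<open>|w|^2\<close> from the outer variable and
  \<open>|w|^(2n)\<close> from the inverse of the resolvent matrix.\<close>

lemma C_Mm: "adj Cc * Mm - Ee * Psi = sc (of_real (cmod w ^ (2 * n + 2))) (idm m)"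
proof -
  have e: "ta * (al * x) = si * (ga * x)" "pa * (be * x) = ra * (de * x)" for x
    by (simp_all add: l3 l4 flip: mult.assoc)
  have e2: "ta * (be * x) = si * (de * x) + sc W (idm m * x)" "pa * (al * x) = ra * (ga * x) - sc W (idm m * x)" for x
  proof -
    have "ta * be = si * de + sc W (idm m)" "pa * al = ra * ga - sc W (idm m)"
      using l1 l2 by (auto simp: algebra_simps)
    then show "ta * (be * x) = si * (de * x) + sc W (idm m * x)" "pa * (al * x) = ra * (ga * x) - sc W (idm m * x)"
      by (simp_all add: distrib_right left_diff_distrib sc_mult_left flip: mult.assoc)
  qed
  have "ga * ra - de * si = sc W (idm m)" by (rule right_identities)
  then have "adj (ga * ra - de * si) = adj (sc W (idm m))" by simp
  then have z: "adj ra * adj ga = adj si * adj de + sc (cnj W) (idm m)"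
    by (simp add: algebra_simps)
  have i: "idm m * adj ga = adj ga" "idm m * adj de = adj de" using shaped_left[OF shaped_intros(8)[OF s(3)]] shaped_left[OF shaped_intros(8)[OF s(4)]] by simp_all
  have "adj Cc * Mm - Ee * Psi = sc (of_real aw * W) (adj ra * adj ga - adj si * adj de)"
    unfolding Ee_def Mm_def Cc_def Psi_def
    by (simp add: distrib_left distrib_right left_diff_distrib right_diff_distrib mult.assoc sc_mult_left sc_mult_right
        sc_add_right sc_diff_right e e2 i) (simp add: algebra_simps sc_add_right)?
  also have "adj ra * adj ga - adj si * adj de = sc (cnj W) (idm m)" by (simp add: z)
  also have "sc (of_real aw * W) (sc (cnj W) (idm m)) = sc (of_real (cmod w ^ (2 * n + 2))) (idm m)"
  proof -
    have "W * cnj W = of_real ((cmod w ^ n)\<^sup>2)" by (metis complex_norm_square norm_power)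
    then have "of_real aw * W * cnj W = of_real (aw * (cmod w ^ n)\<^sup>2)"
      by (simp only: mult.assoc of_real_mult)
    also have "aw * (cmod w ^ n)\<^sup>2 = cmod w ^ (2 * n + 2)"
      unfolding power_add power_even_eq by (rule mult.commute)
    finally show ?thesis by (simp only: sc_simps(4))
  qed
  finally show ?thesis .
qed

text \<open>\<open>Ac X\<close> and \<open>Bc X\<close> are the two block components of the inverse resolvent matrix applied to \<open>(X, I)\<close>.\<close>

definition "Ac X = ra - pa * X"
definition "Bc X = ta * X - si"

lemma form_eq:
  assumes X: "shaped m m X" and u: "shaped m 1 u"
  shows "nrm2 (Bc X * u) - aw * nrm2 (Ac X * u) =
    Re (ip (X * u) (Phi * (X * u))) - 2 * Re (ip (X * u) (Cc * u)) + Re (ip u (Ee * u))"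
proof -
  have b: "nrm2 (Bc X * u) = nrm2 (ta * (X * u)) + nrm2 (si * u) - 2 * Re (ip (ta * (X * u)) (si * u))"
    by (simp add: Bc_def left_diff_distrib mult.assoc nrm2_diff)
  have "nrm2 (Ac X * u) = nrm2 (- (pa * (X * u) - ra * u))" by (simp add: Ac_def left_diff_distrib mult.assoc)
  then have a: "nrm2 (Ac X * u) = nrm2 (pa * (X * u)) + nrm2 (ra * u) - 2 * Re (ip (pa * (X * u)) (ra * u))"
    unfolding nrm2_minus nrm2_diff .
  show ?thesis
    unfolding a b unfolding Phi_def Cc_def Ee_def nrm2_def
    by (simp add: left_diff_distrib ip_simps sc_mult_left ip_mult_left mult.assoc algebra_simps)
qed

text \<open>Multiplying back by the lower row of the resolvent matrix recovers
  \<open>w^n u\<close>.\<close>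

lemma J_zero:
  assumes X: "shaped m m X" and u: "shaped m 1 u" and "Ac X * u = 0" "Bc X * u = 0"
  shows "u = 0"
proof -
  have "ga * Ac X + de * Bc X = (ga * ra - de * si) - (ga * pa - de * ta) * X"
    by (simp add: Ac_def Bc_def algebra_simps)
  then have "ga * Ac X + de * Bc X = sc W (idm m)" by (simp add: right_identities)
  then have "ga * (Ac X * u) + de * (Bc X * u) = sc W (idm m * u)"
    by (metis distrib_right mult.assoc sc_mult_left)
  then have "sc W u = 0" using assms by (simp add: shaped_left)
  then show ?thesis using w by (simp add: sc_eq_0)
qed

text \<open>If \<open>X\<close> is the transform of \<open>k\<close> with denominator
  \<open>D\<close>, then \<open>Ac X * D = w^n\<close> and \<open>Bc X * D = w^(n+1) k\<close>, so
  the inequality is contractivity of \<open>k\<close>. Conversely the inequality makes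
  \<open>Ac X\<close> injective, since a null vector of \<open>Ac X\<close> is then one of
  \<open>Bc X\<close> too and \<open>J_zero\<close> applies; \<open>k\<close> is recovered as the
  quotient.\<close>

lemma lft_iff:
  assumes X: "shaped m m X"
  shows "(\<exists>k. contr m k \<and> X * (ga + sc w (de * k)) = al + sc w (be * k) \<and> (\<exists>d. inverse_pair m (ga + sc w (de * k)) d))
    \<longleftrightarrow> (\<forall>u. shaped m 1 u \<longrightarrow> nrm2 (Bc X * u) \<le> aw * nrm2 (Ac X * u))"
proof
  assume "\<exists>k. contr m k \<and> X * (ga + sc w (de * k)) = al + sc w (be * k) \<and> (\<exists>d. inverse_pair m (ga + sc w (de * k)) d)"
  then obtain k d where k: "contr m k" "X * (ga + sc w (de * k)) = al + sc w (be * k)"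
    and d: "inverse_pair m (ga + sc w (de * k)) d" by blast
  define D where "D = ga + sc w (de * k)"
  have sk: "shaped m m k" using k by (simp add: contr_def)
  have A: "Ac X * D = sc W (idm m)"
  proof -
    have "Ac X * D = ra * D - pa * (X * D)" by (simp add: Ac_def left_diff_distrib mult.assoc)
    also have "\<dots> = (ra * ga - pa * al) + sc w ((ra * de - pa * be) * k)"
      unfolding k(2)[folded D_def] by (simp add: D_def distrib_left left_diff_distrib sc_mult_right sc_diff_right mult.assoc)
    finally show ?thesis by (simp add: l1 l4)
  qed
  have B: "Bc X * D = sc (w * W) k"
  proof -
    have "Bc X * D = ta * (X * D) - si * D" by (simp add: Bc_def left_diff_distrib mult.assoc)
    also have "\<dots> = (ta * al - si * ga) + sc w ((ta * be - si * de) * k)"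
      unfolding k(2)[folded D_def] by (simp add: D_def distrib_left left_diff_distrib sc_mult_right sc_diff_right mult.assoc)
    finally show ?thesis by (simp add: l2 l3 sc_mult_left shaped_left[OF sk])
  qed
  show "\<forall>u. shaped m 1 u \<longrightarrow> nrm2 (Bc X * u) \<le> aw * nrm2 (Ac X * u)"
  proof (intro allI impI)
    fix u assume u: "shaped m 1 u"
    define x where "x = d * u"
    have x: "shaped m 1 x" "D * x = u"
      using d u by (auto simp: x_def D_def inverse_pair_def shaped_left simp flip: mult.assoc intro: shaped_mult)
    have "Ac X * u = sc W x" "Bc X * u = sc (w * W) (k * x)"
    proof -
      have "Ac X * u = (Ac X * D) * x" "Bc X * u = (Bc X * D) * x" using x(2) by (simp_all add: mult.assoc)
      then show "Ac X * u = sc W x" "Bc X * u = sc (w * W) (k * x)"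
        using x(1) by (simp_all add: A B sc_mult_left shaped_left)
    qed
    moreover have "nrm2 (k * x) \<le> nrm2 x" using k x by (simp add: contr_def)
    ultimately show "nrm2 (Bc X * u) \<le> aw * nrm2 (Ac X * u)"
      by (simp add: nrm2_sc norm_mult power_mult_distrib mult_left_mono mult.assoc)
  qed
next
  assume le: "\<forall>u. shaped m 1 u \<longrightarrow> nrm2 (Bc X * u) \<le> aw * nrm2 (Ac X * u)"
  have sA: "shaped m m (Ac X)" and sB: "shaped m m (Bc X)"
    unfolding Ac_def Bc_def using s X by (auto intro!: shaped_intros(3) shaped_mult[of m m])
  obtain b where b: "inverse_pair m (Ac X) b"
  proof (rule kernel_zero_inverse_pair[OF sA])
    fix u assume u: "shaped m 1 u" "Ac X * u = 0"
    then have "nrm2 (Bc X * u) \<le> 0" using le by force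
    then have "nrm2 (Bc X * u) = 0" using nrm2_nonneg[of "Bc X * u"] by linarith
    then have "Bc X * u = 0" using nrm2_eq_0_iff[OF shaped_mult[OF sB u(1)]] by simp
    with J_zero[OF X u] show "u = 0" by blast
  qed blast
  have sb: "shaped m m b" and bA: "b * Ac X = idm m" and Ab: "Ac X * b = idm m" using b by (auto simp: inverse_pair_def)
  define k where "k = sc (inverse w) (Bc X * b)"
  have sk: "shaped m m k" unfolding k_def using sB sb by (auto intro: shaped_mult)
  have kA: "sc w (k * Ac X) = Bc X"
    using w sB by (simp add: k_def sc_mult_left mult.assoc bA shaped_right)
  have "nrm2 (k * x) \<le> nrm2 x" if x: "shaped m 1 x" for x
  proof -
    have bx: "shaped m 1 (b * x)" using sb x by (rule shaped_mult)
    have "nrm2 (k * x) = nrm2 (Bc X * (b * x)) / aw"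
      using w by (simp add: k_def sc_mult_left nrm2_sc mult.assoc norm_inverse power_inverse divide_inverse mult.commute)
    also have "\<dots> \<le> (aw * nrm2 (Ac X * (b * x))) / aw"
      using le bx by (intro divide_right_mono) auto
    also have "Ac X * (b * x) = x" using x Ab by (simp add: shaped_left flip: mult.assoc)
    finally show ?thesis using w by simp
  qed
  then have ck: "contr m k" using sk by (simp add: contr_def)
  define D where "D = ga + sc w (de * k)"
  have sD: "shaped m m D" unfolding D_def using s sk by (auto intro: shaped_mult)
  have DA: "D * Ac X = sc W (idm m)"
  proof -
    have "D * Ac X = ga * Ac X + de * (sc w (k * Ac X))"
      by (simp add: D_def distrib_right sc_mult_left sc_mult_right mult.assoc)
    also have "\<dots> = (ga * ra - de * si) - (ga * pa - de * ta) * X"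
      unfolding kA by (simp add: Ac_def Bc_def algebra_simps)
    finally show ?thesis by (simp add: right_identities)
  qed
  have NA: "(al + sc w (be * k)) * Ac X = sc W X"
  proof -
    have "(al + sc w (be * k)) * Ac X = al * Ac X + be * (sc w (k * Ac X))"
      by (simp add: distrib_right sc_mult_left sc_mult_right mult.assoc)
    also have "\<dots> = (al * ra - be * si) + (be * ta - al * pa) * X"
      unfolding kA by (simp add: Ac_def Bc_def algebra_simps)
    finally show ?thesis by (simp add: right_identities sc_mult_left shaped_left[OF X])
  qed
  have "X * (D * Ac X) = (al + sc w (be * k)) * Ac X"
    using X by (simp add: DA NA sc_mult_right shaped_right)
  then have "X * D * (Ac X * b) = (al + sc w (be * k)) * (Ac X * b)"
    by (metis mult.assoc)
  moreover have "shaped m m (X * D)" "shaped m m (al + sc w (be * k))"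
    using X sD s sk by (auto intro: shaped_mult)
  ultimately have XD: "X * D = al + sc w (be * k)"
    by (simp add: Ab shaped_right)
  have "D * sc (inverse W) (Ac X) = idm m" using w by (simp add: sc_mult_right DA)
  then have "inverse_pair m D (sc (inverse W) (Ac X))"
    by (intro left_inverse_imp_inverse_pair sD shaped_intros sA)
  with ck XD show "\<exists>k. contr m k \<and> X * (ga + sc w (de * k)) = al + sc w (be * k) \<and> (\<exists>d. inverse_pair m (ga + sc w (de * k)) d)"
    unfolding D_def by blast
qed

lemma Psi_form: "shaped m 1 x \<Longrightarrow> Re (ip x (Psi * x)) = nrm2 (adj ga * x) - aw * nrm2 (adj de * x)"
  by (simp add: Psi_def left_diff_distrib ip_simps sc_mult_left nrm2_def ip_mult_left mult.assoc)

lemma Phi_form: "shaped m 1 x \<Longrightarrow> Re (ip x (Phi * x)) = nrm2 (ta * x) - aw * nrm2 (pa * x)"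
  by (simp add: Phi_def left_diff_distrib ip_simps sc_mult_left nrm2_def ip_mult_left mult.assoc)

text \<open>If the form fails at \<open>u\<close>, a rank one contraction \<open>k\<close> maps
  \<open>- pa * u\<close> to \<open>ta * u / w\<close>. By \<open>right_identities\<close> the
  denominator of \<open>k\<close> annihilates \<open>- pa * u\<close>, so this vector is zero and
  with it \<open>ta * u\<close>, which contradicts invertibility of the resolvent matrix.\<close>

lemma Phi_pdf:
  assumes "\<And>k x. contr m k \<Longrightarrow> shaped m 1 x \<Longrightarrow> (ga + sc w (de * k)) * x = 0 \<Longrightarrow> x = 0"
  shows "pdf m Phi"
proof -
  have "0 < Re (ip u (Phi * u))" if u: "shaped m 1 u" "u \<noteq> 0" for u
  proof (rule ccontr)
    assume "\<not> ?thesis"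
    then have le: "nrm2 (ta * u) \<le> aw * nrm2 (pa * u)" using Phi_form[OF u(1)] by linarith
    have sh: "shaped m 1 (pa * u)" "shaped m 1 (ta * u)" using s u by (auto intro: shaped_mult)
    define p where "p = sc (inverse w) (ta * u)"
    define q where "q = - (pa * u)"
    have sp: "shaped m 1 p" "shaped m 1 q" using sh by (auto simp: p_def q_def)
    have "nrm2 p = nrm2 (ta * u) / aw"
      by (simp add: p_def nrm2_sc norm_inverse power_inverse divide_inverse mult.commute)
    also have "\<dots> \<le> nrm2 q" using le w by (simp add: q_def nrm2_minus divide_le_eq mult.commute)
    finally have "nrm2 p \<le> nrm2 q" .
    from rank_one_contr[OF sp this] obtain k where k: "contr m k" "k * q = p" by metis
    have "(ga + sc w (de * k)) * q = ga * q + de * sc w p"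
      by (simp add: distrib_right sc_mult_left sc_mult_right mult.assoc k(2))
    also have "\<dots> = - ((ga * pa - de * ta) * u)"
      using w by (simp add: q_def p_def left_diff_distrib mult.assoc)
    finally have "(ga + sc w (de * k)) * q = 0" by (simp add: right_identities)
    then have q0: "q = 0" by (rule assms[OF k(1) sp(2)])
    then have "p = 0" using k(2) by simp
    then have "ta * u = 0" using w by (simp add: p_def sc_eq_0)
    moreover have "pa * u = 0" using q0 by (simp add: q_def)
    moreover have "(be * ta - al * pa) * u = sc W u"
      using u by (simp add: right_identities sc_mult_left shaped_left)
    ultimately have "sc W u = 0" by (simp add: left_diff_distrib mult.assoc)
    then show False using u w by (simp add: sc_eq_0)
  qed
  then show ?thesis using shaped_defs(1) herm_defs(1) by (simp add: pdf_def)
qed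

text \<open>The rank one argument is carried out on the adjoint denominator, for which
  \<open>Psi\<close> is the natural form. A singular adjoint means a singular denominator, and the
  parameter is the adjoint of the contraction found.\<close>

lemma not_pdf_Psi:
  assumes "\<not> pdf m Psi"
  obtains k x where "contr m k" "shaped m 1 x" "x \<noteq> 0" "(ga + sc w (de * k)) * x = 0"
proof -
  obtain u where u: "shaped m 1 u" "u \<noteq> 0" "\<not> 0 < Re (ip u (Psi * u))"
    using assms shaped_defs(4) herm_defs(2) by (auto simp: pdf_def)
  have le: "nrm2 (adj ga * u) \<le> aw * nrm2 (adj de * u)" using u Psi_form[OF u(1)] by linarith
  define p where "p = - sc (inverse (cnj w)) (adj ga * u)"
  have sp: "shaped m 1 p" "shaped m 1 (adj de * u)" using s u by (auto simp: p_def intro!: shaped_intros(4,5) shaped_mult[of m m])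
  have "nrm2 p = nrm2 (adj ga * u) / aw"
    by (simp add: p_def nrm2_minus nrm2_sc norm_inverse power_inverse divide_inverse mult.commute)
  also have "\<dots> \<le> nrm2 (adj de * u)" using le w by (simp add: divide_le_eq mult.commute)
  finally obtain k where k: "contr m k" "k * (adj de * u) = p" using rank_one_contr[OF sp] by metis
  define D where "D = ga + sc w (de * adj k)"
  have sD: "shaped m m D" using s k by (auto simp: D_def contr_def intro: shaped_mult)
  have "adj D * u = adj ga * u + sc (cnj w) (k * (adj de * u))"
    by (simp add: D_def distrib_right sc_mult_left mult.assoc)
  also have "\<dots> = 0" using w by (simp add: k p_def sc_minus_right)
  finally have Du: "adj D * u = 0" .
  have "fdet m D = 0"
  proof (rule ccontr)
    assume "fdet m D \<noteq> 0"
    then obtain b where b: "inverse_pair m D b" using det_nonzero_inverse_pair[OF sD] by metis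
    then have "adj b * adj D = idm m" by (metis adj_mult adj_simps(7) inverse_pair_def)
    then have "idm m * u = adj b * (adj D * u)" by (simp flip: mult.assoc)
    then show False using Du u by (simp add: shaped_left)
  qed
  then obtain x where "shaped m 1 x" "x \<noteq> 0" "D * x = 0" using det_zero_kernel[OF sD] by metis
  with contr_adj[OF k(1)] that show thesis unfolding D_def by blast
qed

text \<open>Contractivity of \<open>adj k\<close> shows that a nonzero null vector of the adjoint
  denominator would violate positivity of \<open>Psi\<close>.\<close>

lemma pdf_Psi_kernel:
  assumes P: "pdf m Psi" and k: "contr m k" and x: "shaped m 1 x" "(ga + sc w (de * k)) * x = 0"
  shows "x = 0"
proof -
  define D where "D = ga + sc w (de * k)"
  have sD: "shaped m m D" using s k by (auto simp: D_def contr_def intro: shaped_mult)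
  have "shaped m m (adj D)" using sD by auto
  then obtain b where b: "inverse_pair m (adj D) b"
  proof (rule kernel_zero_inverse_pair)
    fix u assume u: "shaped m 1 u" "adj D * u = 0"
    have "adj ga * u = - sc (cnj w) (adj k * (adj de * u))"
      using u(2) by (simp add: D_def distrib_right sc_mult_left mult.assoc eq_neg_iff_add_eq_0)
    then have "nrm2 (adj ga * u) = aw * nrm2 (adj k * (adj de * u))"
      by (simp add: nrm2_minus nrm2_sc)
    also have "\<dots> \<le> aw * nrm2 (adj de * u)"
    proof (rule mult_left_mono)
      have "shaped m 1 (adj de * u)" using shaped_mult[OF shaped_intros(8)[OF s(4)] u(1)] .
      then show "nrm2 (adj k * (adj de * u)) \<le> nrm2 (adj de * u)"
        using contr_adj[OF k] by (simp add: contr_def)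
    qed simp
    finally have "\<not> 0 < Re (ip u (Psi * u))" using Psi_form[OF u(1)] by linarith
    then show "u = 0" using P u by (auto simp: pdf_def)
  qed blast
  have "adj b * D = idm m" using b by (metis adj_mult adj_simps(5,7) inverse_pair_def)
  then have "idm m * x = adj b * (D * x)" by (simp flip: mult.assoc)
  then show ?thesis using x by (simp add: D_def shaped_left)
qed

end

section \<open>Moduli of determinants in the disk\<close>

lemma fdet_sc: "fdet m (sc c a) = c ^ m * fdet m a"
  by (simp add: to_m_sc det_smult)

context resolvent
begin

abbreviation "rav z \<equiv> fev m m z gar * J"
abbreviation "pav z \<equiv> fev m m z alr * J"
abbreviation "tav z \<equiv> fev m m z ber * J"
abbreviation "siv z \<equiv> fev m m z der * J"

lemma fev_triple:
  assumes "fshaped m m F" "fdeg a F" "fshaped m m G" "fdeg b G"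
  shows "fev m m z (F * Jc * G) = fev m m z F * J * fev m m z G" "fconv z (F * Jc * G)"
proof -
  have c: "fconv z F" "fconv z G" "fconv z Jc" using assms by (auto intro: fconv_poly fdeg_intros(7))
  have "fconv z (F * Jc)" "fshaped m m (F * Jc)"
    using fconv_mult[OF assms(1) c(1,3)] assms J(1) by auto
  then show "fev m m z (F * Jc * G) = fev m m z F * J * fev m m z G" "fconv z (F * Jc * G)"
    using fev_mult[OF _ _ c(2)] fconv_mult[OF _ _ c(2)] fev_mult[OF assms(1) c(1,3)] J(1) by (simp_all add: fev_const)
qed

lemma frev4: "fshaped m m gar" "fdeg n gar" "fshaped m m alr" "fdeg n alr" "fshaped m m ber" "fdeg n ber" "fshaped m m der" "fdeg n der"
  using fsh4 by (auto simp: fdeg_intros)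

lemma value_identities:
  "rav z * gv z - pav z * av z = sc (z ^ n) E" "tav z * bv z - siv z * dv z = sc (z ^ n) E"
  "tav z * av z = siv z * gv z" "pav z * bv z = rav z * dv z"
proof -
  note t = fev_triple[OF frev4(1,2)] fev_triple[OF frev4(3,4)] fev_triple[OF frev4(5,6)] fev_triple[OF frev4(7,8)]
  have m: "fev m m z (fmon n E) = sc (z ^ n) E" "fconv z (fmon n E)"
    by (auto intro!: fev_mon fconv_poly fdeg_intros)
  have "gar * Jc * ga = fmon n E + alr * Jc * al" "ber * Jc * be = fmon n E + der * Jc * de"
    using id1 id2 by (simp_all add: algebra_simps)
  then have "fev m m z (gar * Jc * ga) = fev m m z (fmon n E + alr * Jc * al)"
    "fev m m z (ber * Jc * be) = fev m m z (fmon n E + der * Jc * de)" by simp_all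
  then show "rav z * gv z - pav z * av z = sc (z ^ n) E" "tav z * bv z - siv z * dv z = sc (z ^ n) E"
    using fsh4 deg4 by (simp_all add: fev_add m t)
  show "tav z * av z = siv z * gv z" "pav z * bv z = rav z * dv z"
    using arg_cong[OF id3, of "fev m m z"] arg_cong[OF id4, of "fev m m z"] fsh4 deg4 by (simp_all add: t)
qed

lemma value_shaped: "shaped m m (rav z)" "shaped m m (pav z)" "shaped m m (tav z)" "shaped m m (siv z)"
  using J(1) by (auto intro!: shaped_mult[of m m])

lemma frame_at: "z \<noteq> 0 \<Longrightarrow> frame m n z (av z) (bv z) (gv z) (dv z) (rav z) (pav z) (tav z) (siv z)"
  by unfold_locales (simp_all add: value_identities value_shaped)

lemma fev_0:
  assumes "fdeg k F" "fshaped m m F"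
  shows "fev m m 0 F = F \<section> 0"
  using assms by (simp add: fev_poly[of k] power_0_left if_distrib[of "\<lambda>c. sc c _"] cong: if_cong)

lemma values_0: "gv 0 = r" "tav 0 = l"
proof -
  show "gv 0 = r" using fev_0[OF deg4(3) fsh4(3)] ga0 by simp
  have "l * J * J = l * (J * J)" by (simp only: mult.assoc)
  then have "l * J * J = l" using l J by (simp add: inverse_pair_def shaped_def)
  then show "tav 0 = l" using fev_0[OF frev4(6,5)] ben l J by simp
qed

lemma circle_reverse:
  assumes "cmod z = 1" "fdeg n F" "fshaped m m F"
  shows "fev m m z (frev n F) = sc (z ^ n) (adj (fev m m z F))"
proof -
  have z0: "z \<noteq> 0" using assms(1) by auto
  have "z * cnj z = 1" using assms(1) by (simp flip: complex_norm_square)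
  then have "inverse (cnj z) = z" using z0 by (simp add: inverse_eq_divide field_simps)
  then show ?thesis using adj_fev_frev[OF assms(2,3) z0] by simp
qed

text \<open>The determinant of the \<open>2m \<times> 2m\<close> resolvent matrix is \<open>w\<^bsup>nm\<^esup> q(w)\<close> with a polynomial \<open>q\<close> that has no zeros and is
  unimodular on the circle; hence \<open>q\<close> has modulus 1 in the disk.\<close>

lemma fdet_value_modulus:
  assumes w: "cmod w < 1"
  shows "cmod (fdet m (tav w)) = cmod (fdet m (gv w))"
proof -
  \<comment> \<open>Cutting \<open>f\<close> to a polynomial keeps the congruences and makes the
    determinants below polynomials in \<open>z\<close>.\<close>
  define f0 where "f0 = fcut n f"
  have f0: "feq (Suc n) f f0" "fshaped m m f0" "fdeg n f0"
    unfolding f0_def using f by (auto simp: fcut_props intro: feq_sym)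
  interpret R: resolvent m n J f0 al be ga de r ri l li
    by (rule resolvent_cong[OF resolvent_axioms f0(1,2)])
  define v where "v = Abs_fps (\<lambda>k. (be - f0 * de) \<section> (n + k))"
  define u where "u = Abs_fps (\<lambda>k. (f0 * ga - al) \<section> (Suc n + k))"
  have sb: "fshaped m m (be - f0 * de)" "fshaped m m (f0 * ga - al)"
    by (intro fshaped_intros fshaped_mult[of m m] fsh4 f0)+
  have db: "fdeg (n + n) (be - f0 * de)" "fdeg (n + n) (f0 * ga - al)"
    using deg4 f0 by (auto intro!: fdeg_intros(3) fdeg_mult intro: fdeg_mono)
  have uv: "fshaped m m v" "fshaped m m u" "fdeg (n + n) v" "fdeg (n + n) u"
    using sb db by (auto simp: v_def u_def fshaped_def fdeg_def simp del: fps_sub_nth)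
  have veq: "be = f0 * de + fmon n E * v"
  proof (rule fps_ext)
    fix k
    show "be \<section> k = (f0 * de + fmon n E * v) \<section> k"
    proof (cases "k < n")
      case True
      then have "(be - f0 * de) \<section> k = 0" using R.c2 by (simp add: feq_def)
      then show ?thesis using True by (simp add: fmon_mult_nth)
    next
      case False
      then show ?thesis using fshaped_idm_nth[OF sb(1), of k] by (simp add: fmon_mult_nth v_def)
    qed
  qed
  have ueq: "f0 * ga = al + fsh (fmon n E * u)"
  proof (rule fps_ext)
    fix k
    show "(f0 * ga) \<section> k = (al + fsh (fmon n E * u)) \<section> k"
      using R.c1 fshaped_idm_nth[OF sb(2), of k] by (cases "k \<le> n") (auto simp: feq_def fsh_nth fmon_mult_nth u_def)
  qed
  have v0: "v \<section> 0 = li" using R.c2 by (simp add: v_def feq_def)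
  define F where "F z = fev m m z f0" for z
  define V where "V z = fev m m z v" for z
  define U where "U z = fev m m z u" for z
  have sF: "shaped m m (F z)" "shaped m m (V z)" "shaped m m (U z)" for z by (auto simp: F_def V_def U_def)
  have cF: "fconv z f0" "fconv z v" "fconv z u" "fconv z (fmon n E)" for z
    using f0(3) uv by (auto intro: fconv_poly fdeg_intros)
  have mon: "fev m m z (fmon n E * v) = sc (z ^ n) (V z)" "fconv z (fmon n E * v)"
    "fev m m z (fmon n E * u) = sc (z ^ n) (U z)" "fconv z (fmon n E * u)" for z
    using fev_mult[of m m "fmon n E" z] fconv_mult[of m m "fmon n E" z] cF[of z] sF[of z]
    by (simp_all add: fev_mon V_def U_def sc_mult_left shaped_left[OF fev_shaped])
  have fd: "fev m m z (f0 * de) = F z * dv z" "fconv z (f0 * de)" "fev m m z (f0 * ga) = F z * gv z" for z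
    using fev_mult[OF f0(2) cF(1)] fconv_mult[OF f0(2) cF(1)] conv4[of z] by (simp_all add: F_def)
  have bV: "bv z - F z * dv z = sc (z ^ n) (V z)" for z
    using arg_cong[OF veq, of "fev m m z"] by (simp add: fev_add fd mon)
  have aU: "av z - F z * gv z = - sc (z ^ n) (sc z (U z))" for z
    using arg_cong[OF ueq, of "fev m m z"] conv4[of z] by (simp add: fev_add fd mon fev_fsh fconv_fsh mult.commute)
  define Th where "Th z = blk m (gv z) (dv z) (av z) (bv z)" for z
  \<comment> \<open>Subtracting \<open>F z\<close> times the first block row of \<open>Th z\<close>
    from the second leaves a row divisible by \<open>z^n\<close>; \<open>q\<close> is the
    determinant after this power is removed.\<close>
  define q where "q z = fdet (m + m) (blk m (gv z) (dv z) (- sc z (U z)) (V z))" for z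
  have shp: "shaped m m (sc c E)" "shaped m m (- sc z (U z'))" "shaped m m 0" "shaped m m E" "shaped m m (- F z)" "shaped m m (- pav z)" "shaped m m (- siv z)" for z z' c
    using sF value_shaped by (auto intro!: shaped_intros)
  note sv = fev_shaped[of m m]
  have i: "E * x = x" if "shaped m m x" for x using that by (rule shaped_left)
  have ThQ: "fdet (m + m) (Th z) = z ^ (n * m) * q z" for z
  proof -
    have "blk m E 0 (- F z) E * Th z = blk m E 0 0 (sc (z ^ n) E) * blk m (gv z) (dv z) (- sc z (U z)) (V z)"
    proof -
      have "blk m E 0 (- F z) E * Th z = blk m (gv z) (dv z) (av z - F z * gv z) (bv z - F z * dv z)"
        unfolding Th_def by (simp add: blk_mult shp sv i)
      also have "\<dots> = blk m E 0 0 (sc (z ^ n) E) * blk m (gv z) (dv z) (- sc z (U z)) (V z)"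
        unfolding aU bV by (simp add: blk_mult shp sv sF i sc_mult_left sc_mult_right sc_minus_right mult.commute[of z])
      finally show ?thesis .
    qed
    then have "fdet (m + m) (blk m E 0 (- F z) E) * fdet (m + m) (Th z) = fdet (m + m) (blk m E 0 0 (sc (z ^ n) E)) * q z"
      by (simp add: Th_def q_def flip: fdet_mult)
    then show ?thesis
      by (simp add: fdet_blk_triangular shp fdet_idm fdet_sc power_mult)
  qed
  \<comment> \<open>Eliminating the second block column by \<open>right_identities\<close> relates
    the same determinant to those of \<open>tav\<close> and \<open>gv\<close>.\<close>
  have ThT: "fdet (m + m) (Th z) * fdet m (tav z) = fdet m (gv z) * z ^ (n * m)" if z: "z \<noteq> 0" for z
  proof -
    interpret fr: frame m n z "av z" "bv z" "gv z" "dv z" "rav z" "pav z" "tav z" "siv z" by (rule frame_at[OF z])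
    have "gv z * E = gv z" "av z * E = av z" by (simp_all add: shaped_right[OF sv])
    then have "Th z * blk m E (- pav z) 0 (tav z) = blk m (gv z) 0 (av z) (sc (z ^ n) E)"
      unfolding Th_def using fr.right_identities by (simp add: blk_mult shp sv value_shaped)
    then have "fdet (m + m) (Th z) * fdet (m + m) (blk m E (- pav z) 0 (tav z)) = fdet (m + m) (blk m (gv z) 0 (av z) (sc (z ^ n) E))"
      by (simp add: Th_def flip: fdet_mult)
    then show ?thesis
      by (simp add: fdet_blk_triangular shp sv value_shaped fdet_idm fdet_sc power_mult)
  qed
  have qt: "q z * fdet m (tav z) = fdet m (gv z)" if z: "z \<noteq> 0" for z
    using ThT[OF z] z unfolding ThQ by (simp add: mult.assoc mult.commute[of "fdet m (gv z)"])
  have Thnz: "fdet (m + m) (Th z) \<noteq> 0" if z: "z \<noteq> 0" for z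
  proof
    assume a: "fdet (m + m) (Th z) = 0"
    have "blk m (rav z) (- pav z) (- siv z) (tav z) * Th z = blk m (sc (z ^ n) E) 0 0 (sc (z ^ n) E)"
      unfolding Th_def using value_identities[of z] by (simp add: blk_mult shp sv value_shaped)
    then have "fdet (m + m) (blk m (rav z) (- pav z) (- siv z) (tav z)) * fdet (m + m) (Th z) = fdet (m + m) (blk m (sc (z ^ n) E) 0 0 (sc (z ^ n) E))"
      by (simp add: Th_def flip: fdet_mult)
    then show False using a z by (simp add: fdet_blk_triangular shp fdet_sc fdet_idm)
  qed
  have q0: "q 0 = fdet m r * fdet m li"
  proof -
    have "V 0 = li" using fev_0[OF uv(3,1)] v0 by (simp add: V_def)
    then show ?thesis by (simp add: q_def values_0(1)[symmetric] fdet_blk_triangular sv inverse_pair_def l(1)[unfolded inverse_pair_def])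
  qed
  have dr: "fdet m r * fdet m ri = 1" "fdet m l * fdet m li = 1" using r(1) l(1) by (auto intro: inverse_pair_det)
  have qnz: "q z \<noteq> 0" for z
  proof (cases "z = 0")
    case True
    then show ?thesis using q0 dr by auto
  next
    case False
    then show ?thesis using Thnz[OF False] unfolding ThQ by auto
  qed
  have Uhol: "(\<lambda>z. ent (U z) i j) holomorphic_on A" "(\<lambda>z. ent (V z) i j) holomorphic_on A" for i j A
    unfolding U_def V_def fev_poly[OF uv(3,1)] fev_poly[OF uv(4,2)] ent_sum ent_sc by (intro holomorphic_intros)+
  have qhol: "q holomorphic_on A" for A
    unfolding q_def
  proof (rule det_holomorphic[where k = "m + m"])
    fix i j assume ij: "i < m + m" "j < m + m"
    have h: "(\<lambda>z. ent (- sc z (U z)) i j) holomorphic_on A" for i j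
      unfolding ent_minus ent_sc by (intro holomorphic_intros Uhol)
    show "(\<lambda>z. to_m (m + m) (m + m) (blk m (gv z) (dv z) (- sc z (U z)) (V z)) $$ (i, j)) holomorphic_on A"
    proof (cases "i < m"; cases "j < m")
      assume "i < m" "j < m"
      then show ?thesis using ij hol4(3) by (simp add: blk_def)
    next
      assume "i < m" "\<not> j < m"
      then show ?thesis using ij hol4(4) by (simp add: blk_def)
    next
      assume "\<not> i < m" "j < m"
      then show ?thesis using ij h[of "i - m" j] by (simp add: blk_def)
    next
      assume "\<not> i < m" "\<not> j < m"
      then show ?thesis using ij Uhol(2) by (simp add: blk_def)
    qed
  qed simp
  have involution_det: "cmod (fdet (m + m) x) = 1" if "x * x = idm (m + m)" "shaped (m + m) (m + m) x" for x
  proof -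
    have "fdet (m + m) x * fdet (m + m) x = 1"
      using fdet_mult[OF that(2,2)] that(1) by (simp add: fdet_idm)
    then have "(cmod (fdet (m + m) x))\<^sup>2 = 1" by (metis norm_mult norm_one power2_eq_square)
    then show ?thesis by (simp add: power2_eq_1_iff) (metis norm_ge_zero not_one_le_zero neg_0_le_iff_le)
  qed
  \<comment> \<open>On the circle the reversed polynomials are adjoints up to \<open>z^n\<close>. So
    \<open>Th z\<close> carries the signature \<open>diag (J, -J)\<close> into
    \<open>diag (E, -E)\<close>, and both have determinants of modulus 1.\<close>
  have q1: "cmod (q z) = 1" if z: "cmod z = 1" for z
  proof -
    have z0: "z ^ n \<noteq> 0" using z by auto
    have rv: "rav z = sc (z ^ n) (adj (gv z) * J)" "pav z = sc (z ^ n) (adj (av z) * J)"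
      "tav z = sc (z ^ n) (adj (bv z) * J)" "siv z = sc (z ^ n) (adj (dv z) * J)"
      using circle_reverse[OF z] deg4 fsh4 by (simp_all add: sc_mult_left)
    have c: "adj (gv z) * J * gv z - adj (av z) * J * av z = E" "adj (bv z) * J * bv z - adj (dv z) * J * dv z = E"
      "adj (bv z) * J * av z = adj (dv z) * J * gv z" "adj (av z) * J * bv z = adj (gv z) * J * dv z"
      using value_identities[of z] unfolding rv sc_mult_left sc_diff_right[symmetric] sc_cancel[OF z0] by blast+
    have c2: "adj (dv z) * J * dv z - adj (bv z) * J * bv z = - E" unfolding c(2)[symmetric] by simp
    have J': "shaped m m (- J)" "shaped m m J" using J by auto
    have "blk m J 0 0 (- J) * Th z = blk m (J * gv z) (J * dv z) (- J * av z) (- J * bv z)"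
      unfolding Th_def using J' by (simp add: blk_mult shp sv)
    moreover have "adj (Th z) = blk m (adj (gv z)) (adj (av z)) (adj (dv z)) (adj (bv z))"
      unfolding Th_def by (rule blk_adj) simp_all
    ultimately have "adj (Th z) * (blk m J 0 0 (- J) * Th z) = blk m E 0 0 (- E)"
      using J' c c2 by (simp add: blk_mult shaped_mult[OF _ sv] shaped_intros(8) mult.assoc)
    then have "fdet (m + m) (adj (Th z)) * (fdet (m + m) (blk m J 0 0 (- J)) * fdet (m + m) (Th z)) = fdet (m + m) (blk m E 0 0 (- E))"
      by (subst fdet_mult[symmetric], simp add: Th_def, simp add: Th_def, subst fdet_mult[symmetric])
         (auto simp: Th_def intro!: shaped_mult[of "m + m" "m + m"])
    moreover have "cmod (fdet (m + m) (blk m J 0 0 (- J))) = 1"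
      by (rule involution_det) (use J J' in \<open>simp_all add: blk_mult shp blk_idm\<close>)
    moreover have "cmod (fdet (m + m) (blk m E 0 0 (- E))) = 1"
      by (rule involution_det) (simp_all add: blk_mult shp blk_idm i)
    ultimately have "(cmod (fdet (m + m) (Th z)))\<^sup>2 = 1"
      by (metis complex_mod_cnj fdet_adj mult_1 norm_mult power2_eq_square)
    then have "cmod (fdet (m + m) (Th z)) = 1"
      by (simp add: power2_eq_1_iff) (metis norm_ge_zero not_one_le_zero neg_0_le_iff_le)
    then show ?thesis unfolding ThQ using z by (simp add: norm_mult norm_power)
  qed
  \<comment> \<open>The maximum modulus principle for \<open>q\<close> and, as \<open>q\<close> has
    no zeros, for its inverse.\<close>
  have le: "cmod (q w) \<le> 1" "cmod (inverse (q w)) \<le> 1"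
  proof -
    show "cmod (q w) \<le> 1"
      by (rule maximum_modulus_frontier[of q "ball 0 1"])
         (use w q1 in \<open>auto simp: qhol intro!: holomorphic_on_imp_continuous_on\<close>)
    show "cmod (inverse (q w)) \<le> 1"
      by (rule maximum_modulus_frontier[of "\<lambda>z. inverse (q z)" "ball 0 1"])
         (use w q1 qnz in \<open>auto simp: norm_inverse intro!: holomorphic_on_imp_continuous_on holomorphic_on_inverse qhol\<close>)
  qed
  have q1w: "cmod (q w) = 1"
    using le qnz[of w] by (simp add: norm_inverse inverse_le_1_iff)
  show ?thesis
  proof (cases "w = 0")
    case True
    \<comment> \<open>The quotient relation \<open>qt\<close> needs \<open>z \<noteq> 0\<close>; at
      the origin the constant coefficient \<open>li\<close> of \<open>v\<close> gives the
      claim.\<close>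
    have "cmod (fdet m r) * cmod (fdet m li) = 1" using q1w q0 True by (simp add: norm_mult)
    moreover have "cmod (fdet m l) * cmod (fdet m li) = 1" using dr(2) by (metis norm_mult norm_one)
    ultimately have "cmod (fdet m r) = cmod (fdet m l)" by (metis mult_cancel_right zero_neq_one mult_zero_right)
    then show ?thesis using True values_0 by simp
  next
    case False
    from qt[OF this] have "cmod (q w) * cmod (fdet m (tav w)) = cmod (fdet m (gv w))" by (metis norm_mult)
    then show ?thesis using q1w by simp
  qed
qed

end

section \<open>Block Toeplitz matrices\<close>

lemma sum_blocks: "(\<Sum>r<m * N. f r) = (\<Sum>j<N. \<Sum>p<m. f (m * j + p))" for f :: "nat \<Rightarrow> 'a::comm_monoid_add"
proof -
  have "(\<Sum>p\<in>{j * m..<j * m + m}. f p) = (\<Sum>p<m. f (m * j + p))" for j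
    by (rule sum.reindex_bij_witness[of _ "\<lambda>p. m * j + p" "\<lambda>r. r - m * j"]) (auto simp: mult.commute)
  then show ?thesis using sum.nat_group[of f m N] by (simp add: mult.commute)
qed

text \<open>Block columns are handled as sequences of blocks, so that block Toeplitz matrices become
  convolutions.\<close>

definition bl :: "nat \<Rightarrow> nat \<Rightarrow> fmat \<Rightarrow> nat \<Rightarrow> fmat" where
  "bl m q x k = mk m q (\<lambda>i j. ent x (m * k + i) j)"

definition stack :: "nat \<Rightarrow> nat \<Rightarrow> nat \<Rightarrow> (nat \<Rightarrow> fmat) \<Rightarrow> fmat" where
  "stack m q N g = mk (m * N) q (\<lambda>i j. ent (g (i div m)) (i mod m) j)"

lemma bl_shaped [simp, intro]: "shaped m q (bl m q x k)"
  by (simp add: bl_def)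

lemma stack_shaped [simp, intro]: "shaped (m * N) q (stack m q N g)"
  by (simp add: stack_def)

lemma block_index_less: "i < N \<Longrightarrow> p < m \<Longrightarrow> m * i + p < m * (N::nat)"
proof -
  assume "i < N" "p < m"
  then have "m * i + p < m * Suc i" by simp
  also have "\<dots> \<le> m * N" using \<open>i < N\<close> by (intro mult_le_mono2) simp
  finally show ?thesis .
qed

lemma block_index_exists:
  assumes "r < m * (N::nat)"
  obtains i p where "r = m * i + p" "i < N" "p < m"
proof
  have "m > 0" using assms by (cases m) auto
  then show "r = m * (r div m) + r mod m" "r mod m < m" by auto
  show "r div m < N" using assms \<open>m > 0\<close> by (simp add: less_mult_imp_div_less mult.commute)
qed

lemma bl_stack:
  assumes "k < N" "\<And>i. shaped m q (g i)"
  shows "bl m q (stack m q N g) k = g k"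
  by (rule fmat_eq_shapedI[OF bl_shaped assms(2)])
     (use block_index_less[OF assms(1)] in \<open>auto simp: bl_def stack_def\<close>)

lemma bl_eqI:
  assumes "shaped (m * N) q x" "shaped (m * N) q y" "\<And>k. k < N \<Longrightarrow> bl m q x k = bl m q y k"
  shows "x = y"
proof (rule fmat_eq_shapedI[OF assms(1,2)])
  fix r j assume r: "r < m * N" "j < q"
  obtain i p where ip: "r = m * i + p" "i < N" "p < m" using block_index_exists[OF r(1)] .
  have "ent (bl m q x i) p j = ent (bl m q y i) p j" by (simp add: assms(3)[OF ip(2)])
  then show "ent x r j = ent y r j" using ip r by (simp add: bl_def)
qed

lemma bl_add: "bl m q (x + y) k = bl m q x k + bl m q y k"
  and bl_0: "bl m q 0 k = 0"
  by (auto intro!: fmat_eqI simp: bl_def)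

lemma bl_mult_right:
  assumes "shaped (m * N) q x" "shaped q s y" "k < N"
  shows "bl m s (x * y) k = bl m q x k * y"
proof (rule fmat_eq_shapedI[of m s])
  fix i j assume "i < m" "j < s"
  then show "ent (bl m s (x * y) k) i j = ent (bl m q x k * y) i j"
    unfolding ent_mult[OF bl_shaped] by (simp add: bl_def ent_mult[OF assms(1)])
qed (use assms in \<open>auto intro: shaped_mult\<close>)

lemma block_row_mult:
  assumes X: "shaped p (m * N) X" and B: "\<And>j. shaped p m (B j)"
    and e: "\<And>i j q. i < p \<Longrightarrow> j < N \<Longrightarrow> q < m \<Longrightarrow> ent X i (m * j + q) = ent (B j) i q"
    and x: "shaped (m * N) c x"
  shows "X * x = (\<Sum>j<N. B j * bl m c x j)"
proof (rule fmat_eq_shapedI[of p c])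
  show "shaped p c (X * x)" using X x by (rule shaped_mult)
  show "shaped p c (\<Sum>j<N. B j * bl m c x j)" by (intro shaped_sum shaped_mult[OF B]) simp
  fix i k assume ik: "i < p" "k < c"
  have "ent (X * x) i k = (\<Sum>j<N. \<Sum>q<m. ent X i (m * j + q) * ent x (m * j + q) k)"
    unfolding ent_mult[OF X] by (rule sum_blocks)
  also have "\<dots> = (\<Sum>j<N. \<Sum>q<m. ent (B j) i q * ent (bl m c x j) q k)"
    using ik by (intro sum.cong) (auto simp: e bl_def)
  finally show "ent (X * x) i k = ent (\<Sum>j<N. B j * bl m c x j) i k"
    by (simp add: ent_sum ent_mult[OF B])
qed

lemma block_op_mult:
  assumes X: "shaped (m * N) (m * N) X" and B: "\<And>i j. shaped m m (B i j)"
    and e: "\<And>i j p q. i < N \<Longrightarrow> j < N \<Longrightarrow> p < m \<Longrightarrow> q < m \<Longrightarrow> ent X (m * i + p) (m * j + q) = ent (B i j) p q"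
    and x: "shaped (m * N) c x" and i: "i < N"
  shows "bl m c (X * x) i = (\<Sum>j<N. B i j * bl m c x j)"
proof -
  have "bl m c (X * x) i = bl m (m * N) X i * x"
    by (rule bl_mult_right[OF X x i])
  also have "\<dots> = (\<Sum>j<N. B i j * bl m c x j)"
    by (rule block_row_mult[OF bl_shaped B _ x])
       (use i e block_index_less in \<open>auto simp: bl_def\<close>)
  finally show ?thesis .
qed

lemma ip_blocks:
  assumes x: "shaped (m * N) 1 x"
  shows "ip x y = (\<Sum>k<N. ip (bl m 1 x k) (bl m 1 y k))"
  unfolding ip_eq[OF x] sum_blocks ip_eq[OF bl_shaped] by (simp add: bl_def)

text \<open>The actions of the block Toeplitz matrix of \<open>a\<close> and of its adjoint on a
  sequence of blocks; the size \<open>N\<close> is visible only in the adjoint.\<close>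

definition toep_lower :: "(nat \<Rightarrow> fmat) \<Rightarrow> (nat \<Rightarrow> fmat) \<Rightarrow> nat \<Rightarrow> fmat" where
  "toep_lower a g k = (\<Sum>j\<le>k. a (k - j) * g j)"

definition toep_upper :: "nat \<Rightarrow> (nat \<Rightarrow> fmat) \<Rightarrow> (nat \<Rightarrow> fmat) \<Rightarrow> nat \<Rightarrow> fmat" where
  "toep_upper N a g k = (\<Sum>j=k..N. adj (a (j - k)) * g j)"

lemma toep_lower_eq_sum: "k < N \<Longrightarrow> (\<Sum>j<N. (if j \<le> k then a (k - j) else 0) * g j) = toep_lower a g k" for g :: "nat \<Rightarrow> fmat"
  unfolding toep_lower_def by (rule sum.mono_neutral_cong_right) auto

lemma toep_upper_eq_sum: "k \<le> N \<Longrightarrow> (\<Sum>j<Suc N. (if k \<le> j then adj (a (j - k)) else 0) * g j) = toep_upper N a g k" for g :: "nat \<Rightarrow> fmat"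
  unfolding toep_upper_def by (rule sum.mono_neutral_cong_right) auto

lemma toep_adjoint:
  "(\<Sum>k\<le>N. adj (g k) * toep_upper N a h k) = (\<Sum>k\<le>N. adj (toep_lower a g k) * h k)"
proof -
  have "(\<Sum>k\<le>N. adj (g k) * toep_upper N a h k) = (\<Sum>k\<le>N. \<Sum>j\<le>N. if k \<le> j then adj (a (j - k) * g k) * h j else 0)"
  proof (rule sum.cong)
    fix k assume "k \<in> {..N}"
    have "adj (g k) * toep_upper N a h k = (\<Sum>j=k..N. adj (a (j - k) * g k) * h j)"
      by (simp add: toep_upper_def sum_distrib_left mult.assoc)
    also have "\<dots> = (\<Sum>j\<le>N. if k \<le> j then adj (a (j - k) * g k) * h j else 0)"
      by (rule sum.mono_neutral_cong_left) auto
    finally show "adj (g k) * toep_upper N a h k = (\<Sum>j\<le>N. if k \<le> j then adj (a (j - k) * g k) * h j else 0)" .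
  qed simp
  also have "\<dots> = (\<Sum>j\<le>N. \<Sum>k\<le>N. if k \<le> j then adj (a (j - k) * g k) * h j else 0)" by (rule sum.swap)
  also have "\<dots> = (\<Sum>j\<le>N. adj (toep_lower a g j) * h j)"
  proof (rule sum.cong)
    fix j assume "j \<in> {..N}"
    then have "(\<Sum>k\<le>N. if k \<le> j then adj (a (j - k) * g k) * h j else 0) = (\<Sum>k\<le>j. adj (a (j - k) * g k) * h j)"
      by (intro sum.mono_neutral_cong_right) auto
    then show "(\<Sum>k\<le>N. if k \<le> j then adj (a (j - k) * g k) * h j else 0) = adj (toep_lower a g j) * h j"
      by (simp add: toep_lower_def adj_sum sum_distrib_right)
  qed simp
  finally show ?thesis .
qed

text \<open>The Potapov-Ginzburg transform \<open>s = T * b\<close> of \<open>S\<close> is a strict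
  contraction, and \<open>D = C * s\<close> for the pair \<open>C\<close>, \<open>D\<close>
  belonging to the adjoint side. So the defect \<open>C * adj C - D * adj D\<close> inherits
  positivity from the strict contractivity of \<open>adj s\<close>.\<close>

lemma (in signature) pdf_adjoint:
  assumes S: "shaped m m S" and Q: "pdf m (J - adj S * J * S)"
  shows "pdf m (J - S * J * adj S)"
proof -
  define B where "B = Pm * S + Pp"
  define T where "T = Pp * S + Pm"
  define C where "C = Pp - S * Pm"
  define D where "D = S * Pp - Pm"
  have sh: "shaped m m B" "shaped m m T" "shaped m m C" "shaped m m D"
    using S P_shaped by (auto simp: B_def T_def C_def D_def intro!: shaped_intros(2,3) shaped_mult[of m m])
  have jpos: "0 < jform J u (S * u)" if "shaped m 1 u" "u \<noteq> 0" for u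
  proof -
    have "ip u ((J - adj S * J * S) * u) = ip u (J * u) - ip (S * u) (J * (S * u))"
      by (simp add: left_diff_distrib ip_simps ip_mult_left mult.assoc)
    then show ?thesis using Q that by (auto simp: pdf_def jform_def)
  qed
  have BT: "nrm2 (B * u) - nrm2 (T * u) = jform J u (S * u)" for u
    using pg_identity[of "S * u" u] by (simp add: B_def T_def distrib_right mult.assoc)
  obtain b where b: "inverse_pair m B b"
  proof (rule kernel_zero_inverse_pair[OF sh(1)])
    fix u assume u: "shaped m 1 u" "B * u = 0"
    show "u = 0"
    proof (rule ccontr)
      assume "u \<noteq> 0"
      then show False using jpos[OF u(1)] BT[of u] u(2) nrm2_nonneg[of "T * u"] by simp
    qed
  qed blast
  have sb: "shaped m m b" "B * b = idm m" "b * B = idm m" using b by (auto simp: inverse_pair_def)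
  define s where "s = T * b"
  have ss: "shaped m m s" unfolding s_def using sh sb by (auto intro: shaped_mult)
  have strict: "nrm2 (s * x) < nrm2 x" if x: "shaped m 1 x" "x \<noteq> 0" for x
  proof -
    have bx: "shaped m 1 (b * x)" using sb x by (auto intro: shaped_mult)
    have Bb: "B * (b * x) = x" using sb x by (simp add: shaped_left flip: mult.assoc)
    then have "b * x \<noteq> 0" using x by auto
    with jpos[OF bx this] BT[of "b * x"] Bb show ?thesis by (simp add: s_def mult.assoc)
  qed
  have "C * T = D * B"
  proof -
    have "(Pp + Pm) * S = S * (Pp + Pm)" unfolding P_sum(1) using S by (simp add: shaped_def)
    then have "Pp * S - S * Pm = S * Pp - Pm * S" by (simp add: distrib_left distrib_right algebra_simps)
    moreover have "C * T = (Pp * Pp) * S + Pp * Pm - S * (Pm * Pp) * S - S * (Pm * Pm)"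
      "D * B = S * (Pp * Pm) * S + S * (Pp * Pp) - (Pm * Pm) * S - Pm * Pp"
      by (simp_all add: C_def D_def T_def B_def algebra_simps)
    ultimately show ?thesis by (simp add: P_mult)
  qed
  then have "C * s = D" using sh sb by (simp add: s_def shaped_right mult.assoc flip: mult.assoc[of C T])
  then have Ds: "adj D = adj s * adj C" by (metis adj_mult)
  have CD: "C * adj C - D * adj D = J - S * J * adj S"
  proof -
    have c: "C * adj C = Pp + S * Pm * adj S" "D * adj D = S * Pp * adj S + Pm"
    proof -
      have "C * adj C = Pp * Pp - Pp * Pm * adj S - S * (Pm * Pp) + S * (Pm * Pm) * adj S"
        "D * adj D = S * (Pp * Pp) * adj S - S * (Pp * Pm) - Pm * Pp * adj S + Pm * Pm"
        by (simp_all add: C_def D_def P_adj algebra_simps)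
      then show "C * adj C = Pp + S * Pm * adj S" "D * adj D = S * Pp * adj S + Pm" by (simp_all add: P_mult)
    qed
    have "C * adj C - D * adj D = (Pp - Pm) - S * (Pp - Pm) * adj S"
      unfolding c by (simp add: right_diff_distrib left_diff_distrib)
    then show ?thesis unfolding P_sum(2) .
  qed
  have "0 < Re (ip y ((J - S * J * adj S) * y))" if y: "shaped m 1 y" "y \<noteq> 0" for y
  proof -
    define v where "v = adj C * y"
    have sv: "shaped m 1 v" "shaped m 1 (adj s * v)" unfolding v_def using sh ss y by (auto intro: shaped_mult)
    have form: "Re (ip y ((J - S * J * adj S) * y)) = nrm2 v - nrm2 (adj s * v)"
      unfolding CD[symmetric]
      by (simp add: left_diff_distrib ip_simps mult.assoc Ds v_def nrm2_def ip_mult_left) (metis Ds adj_mult adj_simps(5) mult.assoc)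
    have v0: "v \<noteq> 0"
    proof
      assume "v = 0"
      then have "adj C * y = 0" "adj D * y = 0" by (simp_all add: v_def Ds mult.assoc)
      then have "Pm * (- (adj S * y)) + Pp * y = 0" "Pp * (- (adj S * y)) + Pm * y = 0"
        by (simp_all add: C_def D_def P_adj left_diff_distrib mult.assoc)
      from split_zero[OF this y(1)] y(2) show False by simp
    qed
    have nv: "nrm2 v > 0" using v0 nrm2_eq_0_iff[OF sv(1)] nrm2_nonneg[of v] by linarith
    define t where "t = adj s * v"
    have "nrm2 t < nrm2 v"
    proof (cases "t = 0")
      case False
      have st: "shaped m 1 t" "shaped m 1 (s * t)" using sv ss by (auto simp: t_def intro: shaped_mult)
      have nt: "nrm2 t > 0" using False nrm2_eq_0_iff[OF st(1)] nrm2_nonneg[of t] by linarith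
      have "ip (s * t) v = ip t t" by (simp add: ip_mult_left t_def)
      then have "nrm2 t * nrm2 t = (cmod (ip (s * t) v))\<^sup>2" by (simp add: ip_self_real power2_eq_square)
      also have "\<dots> \<le> nrm2 (s * t) * nrm2 v" by (rule ip_Cauchy_Schwarz[OF st(2) sv(1)])
      also have "\<dots> < nrm2 t * nrm2 v" using strict[OF st(1) False] nv by simp
      finally show ?thesis using nt by simp
    qed (use nv in simp)
    then show ?thesis unfolding form t_def by simp
  qed
  moreover have "shaped m m (J - S * J * adj S)" "adj (J - S * J * adj S) = J - S * J * adj S"
    using S sJ hJ by (auto simp: mult.assoc intro!: shaped_intros(3) shaped_mult[of m m])
  ultimately show ?thesis by (simp add: pdf_def)
qed

text \<open>\<open>V\<close> solves a linear system with matrix \<open>J - adj S * J * S\<close>.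
  Unfolding it gives the first relation, and inserting this shows that
  \<open>J - S * J * adj S\<close> sends \<open>J * (y + S * V)\<close> to \<open>y\<close>. The
  inverses behind the polynomials and behind \<open>L\<close> and \<open>R\<close> are thereby
  replaced by relations that can be read block by block.\<close>

lemma (in signature) woodbury:
  assumes S: "shaped m m S" and y: "shaped m q y"
    and Q: "inverse_pair m (J - adj S * J * S) Qinv" and P: "inverse_pair m (J - S * J * adj S) Pinv"
  defines "V \<equiv> Qinv * (adj S * (J * y))"
  shows "J * V = adj S * (J * (y + S * V))" "Pinv * y = J * (y + S * V)"
proof -
  have sV: "shaped m q V" unfolding V_def using Q S sJ y by (auto simp: inverse_pair_def intro!: shaped_mult[of m m])
  have "(J - adj S * J * S) * V = adj S * (J * y)"
    unfolding V_def using Q S sJ y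
    by (simp add: inverse_pair_def shaped_left shaped_mult[of m m] flip: mult.assoc)
       (metis mult.assoc shaped_intros(8) shaped_left shaped_left_assoc)
  then show JV: "J * V = adj S * (J * (y + S * V))"
    by (simp add: left_diff_distrib distrib_left mult.assoc algebra_simps)
  define x where "x = J * (y + S * V)"
  have sx: "shaped m q x" unfolding x_def using sJ y S sV by (auto intro!: shaped_intros(2) shaped_mult[of m m])
  have JJx: "J * (J * z) = z" if "shaped m q z" for z
    using that JJ by (simp add: shaped_left flip: mult.assoc)
  have "(J - S * J * adj S) * x = J * x - S * (J * (adj S * x))"
    by (simp add: left_diff_distrib mult.assoc)
  also have "adj S * x = J * V" using JV by (simp add: x_def)
  also have "J * (J * V) = V" by (rule JJx[OF sV])
  also have "J * x = y + S * V" unfolding x_def by (rule JJx) (use y S sV in \<open>auto intro!: shaped_intros(2) shaped_mult[of m m]\<close>)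
  finally have "(J - S * J * adj S) * x = y" by simp
  then have "Pinv * y = (Pinv * (J - S * J * adj S)) * x" by (simp add: mult.assoc)
  also have "\<dots> = x" using P sx by (simp add: inverse_pair_def shaped_left)
  finally show "Pinv * y = J * (y + S * V)" by (simp add: x_def)
qed

declare mult_Suc_right [simp del]

lemma madj_dims [simp]: "dim_row (madj A) = dim_col A" "dim_col (madj A) = dim_row A"
  by (simp_all add: madj_def)

lemma toep_lower_cong: "(\<And>j. j \<le> k \<Longrightarrow> g j = h j) \<Longrightarrow> toep_lower a g k = toep_lower a h k"
  unfolding toep_lower_def by (intro sum.cong) auto

lemma toep_upper_cong: "(\<And>j. k \<le> j \<Longrightarrow> j \<le> N \<Longrightarrow> g j = h j) \<Longrightarrow> toep_upper N a g k = toep_upper N a h k"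
  unfolding toep_upper_def by (intro sum.cong) auto

lemma toep_lower_mult_right: "toep_lower a g k * x = toep_lower a (\<lambda>j. g j * x) k"
  by (simp add: toep_lower_def sum_distrib_right mult.assoc)

lemma toep_upper_mult_right: "toep_upper N a g k * x = toep_upper N a (\<lambda>j. g j * x) k"
  by (simp add: toep_upper_def sum_distrib_right mult.assoc)

section \<open>The Toeplitz matrices of a strict Potapov sequence\<close>

locale potapov =
  fixes m n :: nat and Jm :: "complex mat" and A :: "nat \<Rightarrow> complex mat"
  assumes m0: "0 < m" and sig: "signature_mat m Jm" and strict: "strict_J_Potapov m Jm n A"
begin

definition "J = to_f Jm"
definition "a k = (if k \<le> n then to_f (A k) else 0)"

lemma Jm: "Jm \<in> carrier_mat m m" "madj Jm = Jm" "Jm * Jm = 1\<^sub>m m"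
  using sig by (auto simp: signature_mat_def)

lemma J: "shaped m m J" "adj J = J" "J * J = idm m"
proof -
  show "shaped m m J" using Jm(1) by (auto simp: J_def)
  show "adj J = J" unfolding J_def to_f_madj[symmetric] Jm(2) ..
  show "J * J = idm m" unfolding J_def using Jm by (simp add: to_f_one flip: to_f_mult)
qed

lemma A_carrier: "k \<le> n \<Longrightarrow> A k \<in> carrier_mat m m"
  using strict by (auto simp: strict_J_Potapov_def)

lemma a_shaped: "shaped m m (a k)"
  using A_carrier by (auto simp: a_def)

definition "S k = to_f (Smat m A k)"
definition "Jb k = to_f (Jblk m Jm k)"
definition "Q k = Jb k - adj (S k) * Jb k * S k"
definition "P k = Jb k - S k * Jb k * adj (S k)"

lemma carriers: "Smat m A k \<in> carrier_mat (m * Suc k) (m * Suc k)" "Jblk m Jm k \<in> carrier_mat (m * Suc k) (m * Suc k)"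
  by (simp_all add: Smat_def Jblk_def Suc_eq_plus1[symmetric])

lemma big_shaped: "shaped (m * Suc k) (m * Suc k) (S k)" "shaped (m * Suc k) (m * Suc k) (Jb k)"
  unfolding S_def Jb_def by (intro shaped_to_f' carriers)+

lemma S_block:
  assumes "k \<le> n" "i < Suc k" "j < Suc k" "p < m" "q < m"
  shows "ent (S k) (m * i + p) (m * j + q) = ent (if j \<le> i then a (i - j) else 0) p q"
proof -
  have ij: "i - j \<le> n" using assms by simp
  show ?thesis
    using assms ij block_index_less[OF assms(2,4)] block_index_less[OF assms(3,5)] A_carrier[OF ij]
    by (simp add: S_def Smat_def a_def Suc_eq_plus1[symmetric])
qed

lemma Jb_block:
  assumes "i < Suc k" "j < Suc k" "p < m" "q < m"
  shows "ent (Jb k) (m * i + p) (m * j + q) = ent (if i = j then J else 0) p q"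
  using assms block_index_less[OF assms(1,3)] block_index_less[OF assms(2,4)] Jm
  by (simp add: Jb_def Jblk_def J_def Suc_eq_plus1[symmetric])

lemma S_mult:
  assumes "k \<le> n" "shaped (m * Suc k) q x" "i \<le> k"
  shows "bl m q (S k * x) i = toep_lower a (bl m q x) i"
proof -
  have "bl m q (S k * x) i = (\<Sum>j<Suc k. (if j \<le> i then a (i - j) else 0) * bl m q x j)"
    by (rule block_op_mult[OF big_shaped(1) _ S_block[OF assms(1)] assms(2)]) (use assms a_shaped in auto)
  also have "\<dots> = toep_lower a (bl m q x) i"
    using assms(3) by (intro toep_lower_eq_sum) simp
  finally show ?thesis .
qed

lemma S_adj_mult:
  assumes "k \<le> n" "shaped (m * Suc k) q x" "i \<le> k"
  shows "bl m q (adj (S k) * x) i = toep_upper k a (bl m q x) i"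
proof -
  have "bl m q (adj (S k) * x) i = (\<Sum>j<Suc k. (if i \<le> j then adj (a (j - i)) else 0) * bl m q x j)"
  proof (rule block_op_mult[OF _ _ _ assms(2)])
    show "shaped (m * Suc k) (m * Suc k) (adj (S k))" using big_shaped(1) by auto
    fix i j p q assume "i < Suc k" "j < Suc k" "p < m" "q < m"
    then show "ent (adj (S k)) (m * i + p) (m * j + q) = ent (if i \<le> j then adj (a (j - i)) else 0) p q"
      using S_block[OF assms(1), of j i q p] by simp
  qed (use assms a_shaped in auto)
  also have "\<dots> = toep_upper k a (bl m q x) i"
    using assms(3) by (intro toep_upper_eq_sum)
  finally show ?thesis .
qed

lemma Jb_mult:
  assumes "shaped (m * Suc k) q x" "i \<le> k"
  shows "bl m q (Jb k * x) i = J * bl m q x i"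
proof -
  have "bl m q (Jb k * x) i = (\<Sum>j<Suc k. (if i = j then J else 0) * bl m q x j)"
    by (rule block_op_mult[OF big_shaped(2) _ Jb_block assms(1)]) (use assms J in auto)
  also have "\<dots> = (\<Sum>j<Suc k. if j = i then J * bl m q x i else 0)" by (intro sum.cong) auto
  finally show ?thesis using assms by simp
qed

lemma signature_big: "signature (m * Suc k) (Jb k)"
proof
  show "shaped (m * Suc k) (m * Suc k) (Jb k)" by (rule big_shaped)
  show "Jb k * Jb k = idm (m * Suc k)"
  proof (rule bl_eqI[of m "Suc k" "m * Suc k"])
    fix i assume "i < Suc k"
    then have i: "i \<le> k" by simp
    have "Jb k * Jb k = Jb k * (Jb k * idm (m * Suc k))" by (simp only: shaped_right[OF big_shaped(2)])
    also have "bl m (m * Suc k) \<dots> i = J * (J * bl m (m * Suc k) (idm (m * Suc k)) i)"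
      using i by (simp add: Jb_mult shaped_mult[OF big_shaped(2)])
    also have "\<dots> = bl m (m * Suc k) (idm (m * Suc k)) i"
      by (simp add: J shaped_left[OF bl_shaped] flip: mult.assoc)
    finally show "bl m (m * Suc k) (Jb k * Jb k) i = bl m (m * Suc k) (idm (m * Suc k)) i" .
  qed (use big_shaped in \<open>auto intro: shaped_mult\<close>)
  show "adj (Jb k) = Jb k"
  proof (rule fmat_eq_shapedI[of "m * Suc k" "m * Suc k"])
    fix r c assume rc: "r < m * Suc k" "c < m * Suc k"
    obtain i p where i: "r = m * i + p" "i < Suc k" "p < m" using block_index_exists[OF rc(1)] .
    obtain j q where j: "c = m * j + q" "j < Suc k" "q < m" using block_index_exists[OF rc(2)] .
    have "cnj (ent J q p) = ent J p q" using arg_cong[OF J(2), of "\<lambda>x. ent x p q"] by simp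
    then show "ent (adj (Jb k)) r c = ent (Jb k) r c"
      using Jb_block[OF i(2) j(2) i(3) j(3)] Jb_block[OF j(2) i(2) j(3) i(3)] by (simp add: i(1) j(1))
  qed (use big_shaped in auto)
qed

lemma Q_form:
  assumes k: "k \<le> n" and x: "shaped (m * Suc k) 1 x"
  shows "Re (ip x (Q k * x)) = (\<Sum>i\<le>k. jform J (bl m 1 x i) (toep_lower a (bl m 1 x) i))"
proof -
  have Sx: "shaped (m * Suc k) 1 (S k * x)" using big_shaped(1) x by (rule shaped_mult)
  have "ip x (Q k * x) = ip x (Jb k * x) - ip (S k * x) (Jb k * (S k * x))"
    by (simp add: Q_def left_diff_distrib ip_simps ip_mult_left mult.assoc)
  also have "\<dots> = (\<Sum>i<Suc k. ip (bl m 1 x i) (J * bl m 1 x i)) -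
      (\<Sum>i<Suc k. ip (toep_lower a (bl m 1 x) i) (J * toep_lower a (bl m 1 x) i))"
    unfolding ip_blocks[OF x] ip_blocks[OF Sx] using k x Sx by (simp add: Jb_mult S_mult del: sum.lessThan_Suc)
  finally show ?thesis
    by (simp add: jform_def sum_subtractf flip: lessThan_Suc_atMost)
qed

lemma P_form:
  assumes k: "k \<le> n" and x: "shaped (m * Suc k) 1 x"
  shows "Re (ip x (P k * x)) = (\<Sum>i\<le>k. jform J (bl m 1 x i) (toep_upper k a (bl m 1 x) i))"
proof -
  have Sx: "shaped (m * Suc k) 1 (adj (S k) * x)" using shaped_intros(8)[OF big_shaped(1)] x by (rule shaped_mult)
  have "ip x (P k * x) = ip x (Jb k * x) - ip (adj (S k) * x) (Jb k * (adj (S k) * x))"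
    by (simp add: P_def left_diff_distrib ip_simps ip_mult_left mult.assoc)
  also have "\<dots> = (\<Sum>i<Suc k. ip (bl m 1 x i) (J * bl m 1 x i)) -
      (\<Sum>i<Suc k. ip (toep_upper k a (bl m 1 x) i) (J * toep_upper k a (bl m 1 x) i))"
    unfolding ip_blocks[OF x] ip_blocks[OF Sx] using k x Sx by (simp add: Jb_mult S_adj_mult del: sum.lessThan_Suc)
  finally show ?thesis
    by (simp add: jform_def sum_subtractf flip: lessThan_Suc_atMost)
qed

lemma Q_shaped: "shaped (m * Suc k) (m * Suc k) (Q k)" "shaped (m * Suc k) (m * Suc k) (P k)"
  "adj (Q k) = Q k" "adj (P k) = P k"
proof -
  interpret sg: signature "m * Suc k" "Jb k" by (rule signature_big)
  show "shaped (m * Suc k) (m * Suc k) (Q k)" "shaped (m * Suc k) (m * Suc k) (P k)"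
    unfolding Q_def P_def
    by (rule shaped_intros(3)[OF big_shaped(2) shaped_mult[OF shaped_mult[OF shaped_intros(8)[OF big_shaped(1)] big_shaped(2)] big_shaped(1)]],
        rule shaped_intros(3)[OF big_shaped(2) shaped_mult[OF shaped_mult[OF big_shaped(1) big_shaped(2)] shaped_intros(8)[OF big_shaped(1)]]])
  show "adj (Q k) = Q k" "adj (P k) = P k" by (simp_all add: Q_def P_def sg.hJ mult.assoc)
qed

lemma to_f_QP: "to_f (Qmat m Jm A k) = Q k" "to_f (Pmat m Jm A k) = P k"
  using carriers[of k] by (simp_all add: Qmat_def Pmat_def Q_def P_def S_def Jb_def to_f_diff to_f_mult to_f_madj)

lemma QP_carrier: "Qmat m Jm A k \<in> carrier_mat (m * Suc k) (m * Suc k)" "Pmat m Jm A k \<in> carrier_mat (m * Suc k) (m * Suc k)"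
  using carriers[of k] by (auto simp: Qmat_def Pmat_def)

lemma Q_pdf: "pdf (m * Suc n) (Q n)"
proof -
  have "posdef (Qmat m Jm A n)" using strict by (simp add: strict_J_Potapov_def Qmat_def)
  then show ?thesis using posdef_iff[OF QP_carrier(1)[of n]] by (simp add: to_f_QP)
qed

lemma Q_seq:
  assumes g: "\<And>i. shaped m 1 (g i)" and nz: "i \<le> n" "g i \<noteq> 0"
  shows "0 < (\<Sum>i\<le>n. jform J (g i) (toep_lower a g i))"
proof -
  define x where "x = stack m 1 (Suc n) g"
  have b: "bl m 1 x i = g i" if "i \<le> n" for i unfolding x_def using that g by (intro bl_stack) auto
  have sx: "shaped (m * Suc n) 1 x" by (auto simp: x_def)
  have "x \<noteq> 0" using b[OF nz(1)] nz(2) bl_0 by metis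
  then have "0 < Re (ip x (Q n * x))" using Q_pdf sx by (simp add: pdf_def)
  also have "\<dots> = (\<Sum>i\<le>n. jform J (g i) (toep_lower a g i))"
    unfolding Q_form[OF order_refl sx]
    by (intro sum.cong refl arg_cong2[of _ _ _ _ "jform J"] toep_lower_cong) (simp_all add: b)
  finally show ?thesis .
qed

text \<open>Prepending a zero block to a column shifts its Toeplitz image by one block, so the form
  of order \<open>k\<close> is a restriction of the form of order \<open>k + 1\<close>. Hence
  descending induction from \<open>n\<close>.\<close>

lemma Q_pdf_le: "k \<le> n \<Longrightarrow> pdf (m * Suc k) (Q k)"
proof (induction "n - k" arbitrary: k)
  case 0
  then show ?case using Q_pdf by simp
next
  case (Suc d)
  have IH: "pdf (m * Suc (Suc k)) (Q (Suc k))" using Suc by (intro Suc.hyps) auto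
  have "0 < Re (ip x (Q k * x))" if x: "shaped (m * Suc k) 1 x" "x \<noteq> 0" for x
  proof -
    define g where "g = bl m 1 x"
    define g' where "g' i = (if i = 0 then 0 else g (i - 1))" for i
    define y where "y = stack m 1 (Suc (Suc k)) g'"
    have sg: "shaped m 1 (g' i)" for i by (auto simp: g'_def g_def)
    have b: "bl m 1 y i = g' i" if "i \<le> Suc k" for i unfolding y_def using that sg by (intro bl_stack) auto
    have sy: "shaped (m * Suc (Suc k)) 1 y" unfolding y_def by (rule stack_shaped)
    have "\<exists>i\<le>k. g i \<noteq> 0"
      using x bl_eqI[of m "Suc k" 1 x 0] by (auto simp: g_def bl_0 less_Suc_eq_le)
    then obtain i where "i \<le> k" "g i \<noteq> 0" by blast
    then have "bl m 1 y (Suc i) \<noteq> 0" by (simp add: b g'_def)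
    then have "y \<noteq> 0" using bl_0 by metis
    then have "0 < Re (ip y (Q (Suc k) * y))" using IH sy by (simp add: pdf_def)
    also have "\<dots> = (\<Sum>i\<le>Suc k. jform J (g' i) (toep_lower a g' i))"
    proof -
      have "Suc k \<le> n" using Suc.hyps(2) by simp
      from Q_form[OF this sy] show ?thesis
        by (elim trans, intro sum.cong refl arg_cong2[of _ _ _ _ "jform J"] toep_lower_cong) (simp_all add: b)
    qed
    also have "\<dots> = (\<Sum>i\<le>k. jform J (g i) (toep_lower a g i))"
    proof -
      have "toep_lower a g' (Suc i) = toep_lower a g i" for i
        unfolding toep_lower_def by (subst sum.atMost_Suc_shift) (simp add: g'_def)
      moreover have "jform J (g' 0) (toep_lower a g' 0) = 0"
        by (simp add: g'_def toep_lower_def jform_def ip_simps)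
      ultimately show ?thesis by (subst sum.atMost_Suc_shift) (simp add: g'_def)
    qed
    also have "\<dots> = Re (ip x (Q k * x))" unfolding g_def using Suc.prems x by (simp add: Q_form)
    finally show ?thesis .
  qed
  then show ?case using Q_shaped[of k] by (simp add: pdf_def)
qed

text \<open>Strictness is given for \<open>Q\<close> and is carried over to \<open>P\<close> by
  \<open>pdf_adjoint\<close> with the block signature \<open>Jb k\<close>.\<close>

lemma P_pdf_le: "k \<le> n \<Longrightarrow> pdf (m * Suc k) (P k)"
  unfolding P_def by (rule signature.pdf_adjoint[OF signature_big big_shaped(1) Q_pdf_le[unfolded Q_def]])

lemma P_seq:
  assumes g: "\<And>i. shaped m 1 (g i)" and nz: "i \<le> n" "g i \<noteq> 0"
  shows "0 < (\<Sum>i\<le>n. jform J (g i) (toep_upper n a g i))"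
proof -
  define x where "x = stack m 1 (Suc n) g"
  have b: "bl m 1 x i = g i" if "i \<le> n" for i unfolding x_def using that g by (intro bl_stack) auto
  have sx: "shaped (m * Suc n) 1 x" by (auto simp: x_def)
  have "x \<noteq> 0" using b[OF nz(1)] nz(2) bl_0 by metis
  then have "0 < Re (ip x (P n * x))" using P_pdf_le[of n] sx by (simp add: pdf_def)
  also have "\<dots> = (\<Sum>i\<le>n. jform J (g i) (toep_upper n a g i))"
    unfolding P_form[OF order_refl sx]
    by (intro sum.cong refl arg_cong2[of _ _ _ _ "jform J"] toep_upper_cong) (simp_all add: b)
  finally show ?thesis .
qed

text \<open>\<open>rho k\<close> and \<open>pis k\<close> are the coefficients of \<open>w\<^sup>k\<close> in \<open>\<rho>\<close> and \<open>\<pi>\<close>, while \<open>tau k\<close> and \<open>sgm k\<close> are the adjoints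
  of the coefficients of \<open>w\<^bsup>n-k\<^esup>\<close> in \<open>\<tau>\<close> and \<open>\<sigma>\<close>.\<close>

definition "Vv = to_f (Vmat m Jm A n)"
definition "Xx = adj (to_f (Wmat m Jm A n))"
definition "rho i = (if i = 0 then idm m else if i \<le> n then bl m m Vv (i - 1) else 0)"
definition "pis = toep_lower a rho"
definition "tau i = (if i = n then idm m else if i < n then bl m m Xx i else 0)"
definition "sgm = toep_upper n a tau"

lemma seq_shaped: "shaped m m (rho i)" "shaped m m (pis i)" "shaped m m (tau i)" "shaped m m (sgm i)"
proof -
  show r: "shaped m m (rho i)" "shaped m m (tau i)" for i by (auto simp: rho_def tau_def)
  show "shaped m m (pis i)" "shaped m m (sgm i)"
    unfolding pis_def sgm_def toep_lower_def toep_upper_def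
    using a_shaped r by (auto intro!: shaped_sum shaped_mult[of m m])
qed

end

section \<open>Block relations for the coefficients of the four polynomials\<close>

lemma toep_upper_Suc: "toep_upper (Suc k) a h (Suc i) = toep_upper k a (\<lambda>j. h (Suc j)) i"
  unfolding toep_upper_def by (simp only: sum.shift_bounds_cl_Suc_ivl diff_Suc_Suc)

lemma toep_upper_0: "toep_upper (Suc k) a h 0 = adj (a 0) * h 0 + (\<Sum>j<Suc k. adj (a (Suc j)) * h (Suc j))"
  unfolding toep_upper_def by (simp only: atLeast0AtMost sum.atMost_Suc_shift lessThan_Suc_atMost diff_zero)

lemma toep_upper_last: "i \<le> k \<Longrightarrow> toep_upper (Suc k) a h i = toep_upper k a h i + adj (a (Suc k - i)) * h (Suc k)"
  unfolding toep_upper_def by simp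

lemma toep_lower_Suc: "toep_lower a h (Suc i) = a (Suc i) * h 0 + toep_lower a (\<lambda>j. h (Suc j)) i"
  unfolding toep_lower_def by (simp only: sum.atMost_Suc_shift diff_Suc_Suc diff_zero)

lemma toep_lower_last: "toep_lower a h (Suc k) = (\<Sum>j<Suc k. a (Suc k - j) * h j) + a 0 * h (Suc k)"
  unfolding toep_lower_def by (simp add: lessThan_Suc_atMost)

context potapov
begin

lemma inverses:
  assumes "k \<le> n"
  obtains Qi Pi' where "inverse_pair (m * Suc k) (Q k) Qi" "inverse_pair (m * Suc k) (P k) Pi'" "adj Qi = Qi" "adj Pi' = Pi'"
    "minv (Qmat m Jm A k) \<in> carrier_mat (m * Suc k) (m * Suc k)" "to_f (minv (Qmat m Jm A k)) = Qi"
    "minv (Pmat m Jm A k) \<in> carrier_mat (m * Suc k) (m * Suc k)" "to_f (minv (Pmat m Jm A k)) = Pi'"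
proof -
  obtain Qi where Qi: "inverse_pair (m * Suc k) (Q k) Qi" "pdf (m * Suc k) Qi"
    using pdf_inverse[OF Q_pdf_le[OF assms]] by blast
  obtain Pi' where Pi': "inverse_pair (m * Suc k) (P k) Pi'" "pdf (m * Suc k) Pi'"
    using pdf_inverse[OF P_pdf_le[OF assms]] by blast
  show thesis
    using that[OF Qi(1) Pi'(1)] minv_inverse_pair[OF QP_carrier(1) Qi(1)[folded to_f_QP]]
      minv_inverse_pair[OF QP_carrier(2) Pi'(1)[folded to_f_QP]] Qi(2) Pi'(2) by (simp add: pdf_def)
qed

lemma yz_carriers: "yvec m A n \<in> carrier_mat (m * n) m" "zvec m A n \<in> carrier_mat m (m * n)"
  by (simp_all add: yvec_def zvec_def)

lemma y_block: "i < n \<Longrightarrow> bl m m (to_f (yvec m A n)) i = a (Suc i)"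
  by (rule fmat_eq_shapedI[OF bl_shaped a_shaped])
     (use block_index_less[of i n _ m] A_carrier[of "Suc i"] in \<open>auto simp: bl_def yvec_def a_def Suc_eq_plus1[symmetric]\<close>)

lemma z_block: "i < n \<Longrightarrow> bl m m (adj (to_f (zvec m A n))) i = adj (a (n - i))"
  by (rule fmat_eq_shapedI[OF bl_shaped shaped_intros(8)[OF a_shaped]])
     (use block_index_less[of i n _ m] A_carrier[of "n - i"] in \<open>auto simp: bl_def zvec_def a_def\<close>)

text \<open>The matrices behind \<open>V\<close>, \<open>W\<close>, \<open>L\<close> and
  \<open>R\<close> have index \<open>n - 1\<close>, so the case \<open>n = 0\<close> is treated
  apart.\<close>

context
  fixes k assumes nk: "n = Suc k"
begin

lemma kn: "k \<le> n" "n - 1 = k" "n \<noteq> 0" "i < Suc k \<Longrightarrow> i < n" "i \<le> k \<Longrightarrow> i < n" "i \<le> k \<Longrightarrow> Suc i \<le> n"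
    "j \<le> i \<Longrightarrow> i \<le> k \<Longrightarrow> Suc j \<le> n" "i < Suc k \<Longrightarrow> Suc i \<le> n" "i < Suc k \<Longrightarrow> n - i = Suc (k - i)"
  using nk by simp_all

lemma sum_kn: "(\<Sum>i\<le>n. h i) = h 0 + (\<Sum>j<Suc k. h (Suc j))" "(\<Sum>i\<le>n. h i) = (\<Sum>j<Suc k. h j) + h n"
  for h :: "nat \<Rightarrow> fmat"
  unfolding nk lessThan_Suc_atMost by (rule sum.atMost_Suc_shift sum.atMost_Suc)+

lemma toep_kn:
  "toep_upper n b h (Suc i) = toep_upper k b (\<lambda>j. h (Suc j)) i"
  "toep_upper n b h 0 = adj (b 0) * h 0 + (\<Sum>j<Suc k. adj (b (Suc j)) * h (Suc j))"
  "i \<le> k \<Longrightarrow> toep_upper n b h i = toep_upper k b h i + adj (b (n - i)) * h n"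
  "toep_lower b h n = (\<Sum>j<Suc k. b (n - j) * h j) + b 0 * h n"
  unfolding nk by (rule toep_upper_Suc toep_upper_0 toep_upper_last toep_lower_last; assumption?)+

lemma V_relations:
  defines "y \<equiv> to_f (yvec m A n)"
  shows "shaped (m * Suc k) m Vv" "Jb k * Vv = adj (S k) * (Jb k * (y + S k * Vv))"
    "to_f (minv (Pmat m Jm A k)) * y = Jb k * (y + S k * Vv)" "Vmat m Jm A n \<in> carrier_mat (m * Suc k) m"
    "minv (Pmat m Jm A k) \<in> carrier_mat (m * Suc k) (m * Suc k)"
proof -
  have k: "k \<le> n" using nk by simp
  obtain Qi Pi' where i: "inverse_pair (m * Suc k) (Q k) Qi" "inverse_pair (m * Suc k) (P k) Pi'"
    "minv (Qmat m Jm A k) \<in> carrier_mat (m * Suc k) (m * Suc k)" "to_f (minv (Qmat m Jm A k)) = Qi"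
    "minv (Pmat m Jm A k) \<in> carrier_mat (m * Suc k) (m * Suc k)" "to_f (minv (Pmat m Jm A k)) = Pi'"
    using inverses[OF k] by blast
  have yc: "yvec m A n \<in> carrier_mat (m * Suc k) m" using yz_carriers nk by simp
  then have ys: "shaped (m * Suc k) m y" unfolding y_def by auto
  have V: "Vv = Qi * (adj (S k) * (Jb k * y))"
    unfolding Vv_def Vmat_def y_def S_def Jb_def i(4)[symmetric] using nk i(3) carriers[of k] yc
    by (simp add: to_f_mult to_f_madj mult.assoc)
  show "Vmat m Jm A n \<in> carrier_mat (m * Suc k) m"
    unfolding Vmat_def using nk i(3) carriers[of k] yc by (auto intro!: mult_carrier_mat)
  then show "shaped (m * Suc k) m Vv" unfolding Vv_def by auto
  show "Jb k * Vv = adj (S k) * (Jb k * (y + S k * Vv))" "to_f (minv (Pmat m Jm A k)) * y = Jb k * (y + S k * Vv)"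
    using signature.woodbury[OF signature_big big_shaped(1) ys i(1)[unfolded Q_def] i(2)[unfolded P_def]]
    unfolding V[symmetric] i(6) by simp_all
  show "minv (Pmat m Jm A k) \<in> carrier_mat (m * Suc k) (m * Suc k)" by (rule i)
qed

text \<open>The mirror image of \<open>V_relations\<close>: \<open>woodbury\<close> for
  \<open>adj S\<close> in place of \<open>S\<close>, which exchanges \<open>P\<close> and
  \<open>Q\<close>. Taking \<open>Xx\<close> as the adjoint of \<open>W\<close> turns a row relation
  into one for columns.\<close>

lemma X_relations:
  defines "zs \<equiv> adj (to_f (zvec m A n))"
  shows "shaped (m * Suc k) m Xx" "Jb k * Xx = S k * (Jb k * (zs + adj (S k) * Xx))"
    "to_f (minv (Qmat m Jm A k)) * zs = Jb k * (zs + adj (S k) * Xx)" "Wmat m Jm A n \<in> carrier_mat m (m * Suc k)"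
    "minv (Qmat m Jm A k) \<in> carrier_mat (m * Suc k) (m * Suc k)"
proof -
  have k: "k \<le> n" using nk by simp
  obtain Qi Pi' where i: "inverse_pair (m * Suc k) (Q k) Qi" "inverse_pair (m * Suc k) (P k) Pi'"
    "minv (Qmat m Jm A k) \<in> carrier_mat (m * Suc k) (m * Suc k)" "to_f (minv (Qmat m Jm A k)) = Qi"
    "minv (Pmat m Jm A k) \<in> carrier_mat (m * Suc k) (m * Suc k)" "to_f (minv (Pmat m Jm A k)) = Pi'" "adj Pi' = Pi'"
    using inverses[OF k] by metis
  interpret sg: signature "m * Suc k" "Jb k" by (rule signature_big)
  have zc: "zvec m A n \<in> carrier_mat m (m * Suc k)" using yz_carriers nk by simp
  then have zs: "shaped (m * Suc k) m zs" unfolding zs_def by auto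
  have "to_f (Wmat m Jm A n) = adj zs * Jb k * adj (S k) * Pi'"
    unfolding Wmat_def zs_def S_def Jb_def i(6)[symmetric] using nk i(5) carriers[of k] zc
    by (simp add: to_f_mult to_f_madj)
  then have X: "Xx = Pi' * (adj (adj (S k)) * (Jb k * zs))"
    unfolding Xx_def by (simp add: i(7) sg.hJ mult.assoc)
  show "Wmat m Jm A n \<in> carrier_mat m (m * Suc k)"
    unfolding Wmat_def using nk i(5) carriers[of k] zc by (auto intro!: mult_carrier_mat)
  then show "shaped (m * Suc k) m Xx" unfolding Xx_def by auto
  have "inverse_pair (m * Suc k) (Jb k - adj (adj (S k)) * Jb k * adj (S k)) Pi'"
    "inverse_pair (m * Suc k) (Jb k - adj (S k) * Jb k * adj (adj (S k))) Qi"
    using i unfolding Q_def P_def by simp_all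
  from signature.woodbury[OF signature_big shaped_intros(8)[OF big_shaped(1)] zs this]
  show "Jb k * Xx = S k * (Jb k * (zs + adj (S k) * Xx))" "to_f (minv (Qmat m Jm A k)) * zs = Jb k * (zs + adj (S k) * Xx)"
    unfolding X[symmetric] i(4) by simp_all
  show "minv (Qmat m Jm A k) \<in> carrier_mat (m * Suc k) (m * Suc k)" by (rule i)
qed

lemma y_shaped: "shaped (m * Suc k) m (to_f (yvec m A n))" "shaped (m * Suc k) m (adj (to_f (zvec m A n)))"
  using yz_carriers nk by auto

lemma pis_block: "i \<le> k \<Longrightarrow> bl m m (to_f (yvec m A n) + S k * Vv) i = pis (Suc i)"
proof -
  assume i: "i \<le> k"
  have "bl m m (to_f (yvec m A n) + S k * Vv) i = a (Suc i) + toep_lower a (bl m m Vv) i"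
    unfolding bl_add y_block[OF kn(5)[OF i]] S_mult[OF kn(1) V_relations(1) i] ..
  moreover have "toep_lower a (bl m m Vv) i = toep_lower a (\<lambda>j. rho (Suc j)) i"
    by (rule toep_lower_cong) (simp add: rho_def kn(7)[OF _ i])
  moreover have "a (Suc i) * rho 0 = a (Suc i)"
    unfolding rho_def by (simp add: shaped_right[OF a_shaped])
  ultimately show ?thesis
    unfolding pis_def toep_lower_Suc by simp
qed

lemma sgm_block: "i \<le> k \<Longrightarrow> bl m m (adj (to_f (zvec m A n)) + adj (S k) * Xx) i = sgm i"
proof -
  assume i: "i \<le> k"
  have "bl m m (adj (to_f (zvec m A n)) + adj (S k) * Xx) i = adj (a (n - i)) + toep_upper k a (bl m m Xx) i"
    unfolding bl_add z_block[OF kn(5)[OF i]] S_adj_mult[OF kn(1) X_relations(1) i] ..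
  moreover have "toep_upper k a (bl m m Xx) i = toep_upper k a tau i"
    by (rule toep_upper_cong) (use kn(5) in \<open>auto simp: tau_def\<close>)
  moreover have "toep_upper n a tau i = toep_upper k a tau i + adj (a (n - i)) * tau n"
    by (rule toep_kn(3)[OF i])
  moreover have "adj (a (n - i)) * tau n = adj (a (n - i))"
    unfolding tau_def by (simp add: shaped_right[OF shaped_intros(8)[OF a_shaped]])
  ultimately show ?thesis
    unfolding sgm_def by (simp add: add.commute)
qed

lemma rho_relation_Suc: "i \<le> k \<Longrightarrow> J * rho (Suc i) = toep_upper n a (\<lambda>j. J * pis j) (Suc i)"
proof -
  assume i: "i \<le> k"
  have k: "k \<le> n" using nk by simp
  note ys = y_shaped(1)
  define t where "t = to_f (yvec m A n) + S k * Vv"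
  have st: "shaped (m * Suc k) m t" unfolding t_def using ys shaped_mult[OF big_shaped(1) V_relations(1)] by auto
  have "J * rho (Suc i) = bl m m (Jb k * Vv) i"
    using i Jb_mult[OF V_relations(1) i] by (simp add: rho_def kn(6))
  also have "\<dots> = toep_upper k a (bl m m (Jb k * t)) i"
    unfolding V_relations(2) t_def[symmetric] by (rule S_adj_mult[OF k shaped_mult[OF big_shaped(2) st] i])
  also have "\<dots> = toep_upper k a (\<lambda>j. J * pis (Suc j)) i"
    by (rule toep_upper_cong) (simp add: Jb_mult[OF st] pis_block[folded t_def])
  also have "\<dots> = toep_upper n a (\<lambda>j. J * pis j) (Suc i)"
    unfolding toep_kn(1) ..
  finally show ?thesis .
qed

lemma tau_relation_le: "i \<le> k \<Longrightarrow> J * tau i = toep_lower a (\<lambda>j. J * sgm j) i"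
proof -
  assume i: "i \<le> k"
  have k: "k \<le> n" using nk by simp
  define t where "t = adj (to_f (zvec m A n)) + adj (S k) * Xx"
  have st: "shaped (m * Suc k) m t" unfolding t_def
    using y_shaped(2) shaped_mult[OF shaped_intros(8)[OF big_shaped(1)] X_relations(1)] by auto
  have "J * tau i = bl m m (Jb k * Xx) i"
    using kn(5)[OF i] Jb_mult[OF X_relations(1) i] by (simp add: tau_def)
  also have "\<dots> = toep_lower a (bl m m (Jb k * t)) i"
    unfolding X_relations(2) t_def[symmetric] by (rule S_mult[OF k shaped_mult[OF big_shaped(2) st] i])
  also have "\<dots> = toep_lower a (\<lambda>j. J * sgm j) i"
    by (rule toep_lower_cong) (use i in \<open>simp add: Jb_mult[OF st] sgm_block[folded t_def]\<close>)
  finally show ?thesis .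
qed

text \<open>By \<open>V_relations\<close> the subtracted term applies \<open>adj y\<close> to
  \<open>J * (y + S * V)\<close>, where the blocks of \<open>y + S * V\<close> are the coefficients
  \<open>pis\<close> from index 1 on. Together with the \<open>a 0\<close> term this is block 0 of
  the adjoint Toeplitz action.\<close>

lemma R_Suc:
  "to_f (Rmat m Jm A n) = J - toep_upper n a (\<lambda>j. J * pis j) 0" "Rmat m Jm A n \<in> carrier_mat m m"
proof -
  define y where "y = to_f (yvec m A n)"
  have sy: "shaped (m * Suc k) m y" using y_shaped by (simp add: y_def)
  define t where "t = y + S k * Vv"
  have st: "shaped (m * Suc k) m t" unfolding t_def using sy shaped_mult[OF big_shaped(1) V_relations(1)] by auto
  have yc: "yvec m A n \<in> carrier_mat (m * Suc k) m" using yz_carriers nk by simp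
  have A0: "A 0 \<in> carrier_mat m m" "to_f (A 0) = a 0" using A_carrier by (auto simp: a_def)
  show "Rmat m Jm A n \<in> carrier_mat m m"
    unfolding Rmat_def using nk Jm(1) A0 yc V_relations(5) by auto
  have "adj y * (Jb k * t) = (\<Sum>j<Suc k. adj (a (Suc j)) * bl m m (Jb k * t) j)"
  proof (rule block_row_mult)
    show "shaped m (m * Suc k) (adj y)" using sy by auto
    show "shaped m m (adj (a (Suc j)))" for j using a_shaped by auto
    show "shaped (m * Suc k) m (Jb k * t)" by (rule shaped_mult[OF big_shaped(2) st])
    fix i j q assume i: "i < m" "j < Suc k" "q < m"
    have "ent (a (Suc j)) q i = ent (bl m m y j) q i" using kn(4)[OF i(2)] by (simp add: y_block y_def)
    then show "ent (adj y) i (m * j + q) = ent (adj (a (Suc j))) i q" using i by (simp add: bl_def)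
  qed
  also have "\<dots> = (\<Sum>j<Suc k. adj (a (Suc j)) * (J * pis (Suc j)))"
    by (intro sum.cong refl) (simp add: less_Suc_eq_le Jb_mult[OF st] pis_block[folded y_def, folded t_def])
  finally have yt: "adj y * (Jb k * t) = (\<Sum>j<Suc k. adj (a (Suc j)) * (J * pis (Suc j)))" .
  have p0: "pis 0 = a 0" using a_shaped[of 0] by (simp add: pis_def toep_lower_def rho_def shaped_right[OF a_shaped])
  have "to_f (Rmat m Jm A n) = J - adj (a 0) * J * a 0 - adj y * (to_f (minv (Pmat m Jm A k)) * y)"
    using kn(3) Jm(1) A0 yc V_relations(5)
    by (simp add: Rmat_def kn(2) to_f_diff to_f_mult to_f_madj J_def y_def mult.assoc)
  also have "\<dots> = J - toep_upper n a (\<lambda>j. J * pis j) 0"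
    unfolding V_relations(3)[folded y_def, folded t_def] yt toep_kn(2) p0 by (simp add: mult.assoc algebra_simps)
  finally show "to_f (Rmat m Jm A n) = J - toep_upper n a (\<lambda>j. J * pis j) 0" .
qed

lemma L_Suc:
  "to_f (Lmat m Jm A n) = J - toep_lower a (\<lambda>j. J * sgm j) n" "Lmat m Jm A n \<in> carrier_mat m m"
proof -
  define zs where "zs = adj (to_f (zvec m A n))"
  have sz: "shaped (m * Suc k) m zs" using y_shaped by (simp add: zs_def)
  define t where "t = zs + adj (S k) * Xx"
  have st: "shaped (m * Suc k) m t" unfolding t_def
    using sz shaped_mult[OF shaped_intros(8)[OF big_shaped(1)] X_relations(1)] by auto
  have zc: "zvec m A n \<in> carrier_mat m (m * Suc k)" using yz_carriers nk by simp
  have A0: "A 0 \<in> carrier_mat m m" "to_f (A 0) = a 0" using A_carrier by (auto simp: a_def)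
  show "Lmat m Jm A n \<in> carrier_mat m m"
    unfolding Lmat_def using nk Jm(1) A0 zc X_relations(5) by auto
  have "adj zs * (Jb k * t) = (\<Sum>j<Suc k. a (n - j) * bl m m (Jb k * t) j)"
  proof (rule block_row_mult)
    show "shaped m (m * Suc k) (adj zs)" using sz by auto
    show "shaped m m (a (n - j))" for j by (rule a_shaped)
    show "shaped (m * Suc k) m (Jb k * t)" by (rule shaped_mult[OF big_shaped(2) st])
    fix i j q assume i: "i < m" "j < Suc k" "q < m"
    have "ent (adj (a (n - j))) q i = ent (bl m m zs j) q i" using kn(4)[OF i(2)] by (simp add: z_block zs_def)
    then have "cnj (ent (a (n - j)) i q) = ent zs (m * j + q) i" using i by (simp add: bl_def)
    then show "ent (adj zs) i (m * j + q) = ent (a (n - j)) i q" by (metis complex_cnj_cnj ent_adj)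
  qed
  also have "\<dots> = (\<Sum>j<Suc k. a (n - j) * (J * sgm j))"
    by (intro sum.cong refl) (simp add: less_Suc_eq_le Jb_mult[OF st] sgm_block[folded zs_def, folded t_def])
  finally have zt: "adj zs * (Jb k * t) = (\<Sum>j<Suc k. a (n - j) * (J * sgm j))" .
  have sn: "sgm n = adj (a 0)" by (simp add: sgm_def toep_upper_def tau_def shaped_right[OF shaped_intros(8)[OF a_shaped]])
  have "to_f (Lmat m Jm A n) = J - a 0 * J * adj (a 0) - adj zs * (to_f (minv (Qmat m Jm A k)) * zs)"
    using kn(3) Jm(1) A0 zc X_relations(5)
    by (simp add: Lmat_def kn(2) to_f_diff to_f_mult to_f_madj J_def zs_def mult.assoc)
  also have "\<dots> = J - toep_lower a (\<lambda>j. J * sgm j) n"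
    unfolding X_relations(3)[folded zs_def, folded t_def] zt unfolding toep_kn(4) sn by (simp add: mult.assoc algebra_simps)
  finally show "to_f (Lmat m Jm A n) = J - toep_lower a (\<lambda>j. J * sgm j) n" .
qed

lemma erow_mult:
  assumes "shaped (m * Suc k) q x"
  shows "to_f (erow m k w) * x = (\<Sum>j<Suc k. sc (w ^ j) (bl m q x j))"
proof -
  have "to_f (erow m k w) * x = (\<Sum>j<Suc k. sc (w ^ j) (idm m) * bl m q x j)"
  proof (rule block_row_mult[OF _ _ _ assms])
    show "shaped m (m * Suc k) (to_f (erow m k w))" by (rule shaped_to_f') (simp add: erow_def Suc_eq_plus1[symmetric])
    fix i j q assume i: "i < m" "j < Suc k" "q < m"
    then show "ent (to_f (erow m k w)) i (m * j + q) = ent (sc (w ^ j) (idm m)) i q"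
      using block_index_less[OF i(2,3)] by (simp add: erow_def Suc_eq_plus1[symmetric])
  qed auto
  then show ?thesis by (simp add: sc_mult_left shaped_left[OF bl_shaped])
qed

lemma ecol_mult:
  assumes "shaped (m * Suc k) q x"
  shows "adj x * to_f (ecol m k w) = (\<Sum>j<Suc k. sc (w ^ (k - j)) (adj (bl m q x j)))"
proof -
  have "adj (to_f (ecol m k w)) * x = (\<Sum>j<Suc k. sc (cnj w ^ (k - j)) (idm m) * bl m q x j)"
  proof (rule block_row_mult[OF _ _ _ assms])
    show "shaped m (m * Suc k) (adj (to_f (ecol m k w)))"
      by (rule shaped_intros(8)[OF shaped_to_f']) (simp add: ecol_def Suc_eq_plus1[symmetric])
    fix i j q assume i: "i < m" "j < Suc k" "q < m"
    then show "ent (adj (to_f (ecol m k w))) i (m * j + q) = ent (sc (cnj w ^ (k - j)) (idm m)) i q"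
      using block_index_less[OF i(2,3)] by (simp add: ecol_def Suc_eq_plus1[symmetric])
  qed auto
  then have "adj (adj (to_f (ecol m k w)) * x) = adj (\<Sum>j<Suc k. sc (cnj w ^ (k - j)) (bl m q x j))"
    by (simp add: sc_mult_left shaped_left[OF bl_shaped])
  then show ?thesis by (simp add: adj_sum)
qed

lemma ecol_carrier: "erow m k w \<in> carrier_mat m (m * Suc k)" "ecol m k w \<in> carrier_mat (m * Suc k) m"
  by (simp_all add: erow_def ecol_def Suc_eq_plus1[symmetric])

lemma funs_Suc:
  "to_f (rho_fun m Jm A n w) = (\<Sum>i\<le>n. sc (w ^ i) (rho i))" "rho_fun m Jm A n w \<in> carrier_mat m m"
  "to_f (pi_fun m Jm A n w) = (\<Sum>i\<le>n. sc (w ^ i) (pis i))" "pi_fun m Jm A n w \<in> carrier_mat m m"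
  "to_f (tau_fun m Jm A n w) = (\<Sum>i\<le>n. sc (w ^ (n - i)) (adj (tau i)))" "tau_fun m Jm A n w \<in> carrier_mat m m"
  "to_f (sigma_fun m Jm A n w) = (\<Sum>i\<le>n. sc (w ^ (n - i)) (adj (sgm i)))" "sigma_fun m Jm A n w \<in> carrier_mat m m"
proof -
  note n0 = kn(3,2)
  note V = V_relations(1,4) and X = X_relations(1,4)
  have yc: "yvec m A n \<in> carrier_mat (m * Suc k) m" "zvec m A n \<in> carrier_mat m (m * Suc k)" using yz_carriers nk by simp_all
  have A0: "A 0 \<in> carrier_mat m m" "to_f (A 0) = a 0" using A_carrier by (auto simp: a_def)
  note c = carriers[of k] ecol_carrier[of w]
  have SV: "shaped (m * Suc k) m (to_f (yvec m A n) + S k * Vv)"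
    using y_shaped(1) shaped_mult[OF big_shaped(1) V(1)] by auto
  have SX: "shaped (m * Suc k) m (adj (to_f (zvec m A n)) + adj (S k) * Xx)"
    using y_shaped(2) shaped_mult[OF shaped_intros(8)[OF big_shaped(1)] X(1)] by auto
  show "rho_fun m Jm A n w \<in> carrier_mat m m" "pi_fun m Jm A n w \<in> carrier_mat m m"
    "tau_fun m Jm A n w \<in> carrier_mat m m" "sigma_fun m Jm A n w \<in> carrier_mat m m"
    unfolding rho_fun_def pi_fun_def tau_fun_def sigma_fun_def using n0 V X yc A0 c by auto
  have "to_f (rho_fun m Jm A n w) = idm m + sc w (to_f (erow m k w) * Vv)"
    unfolding rho_fun_def using n0 V(2) c by (simp add: to_f_add to_f_smult to_f_mult to_f_one Vv_def)
  also have "\<dots> = (\<Sum>i\<le>n. sc (w ^ i) (rho i))"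
    unfolding erow_mult[OF V(1)] sum_kn(1) sc_sum
    by (intro arg_cong2[of _ _ _ _ "(+)"] sum.cong) (simp_all add: rho_def kn(8))
  finally show "to_f (rho_fun m Jm A n w) = (\<Sum>i\<le>n. sc (w ^ i) (rho i))" .
  have p0: "pis 0 = a 0" by (simp add: pis_def toep_lower_def rho_def shaped_right[OF a_shaped])
  have "to_f (pi_fun m Jm A n w) = a 0 + sc w (to_f (erow m k w) * (to_f (yvec m A n) + S k * Vv))"
    unfolding pi_fun_def using n0 V(2) c yc A0 by (simp add: to_f_add to_f_smult to_f_mult Vv_def S_def)
  also have "\<dots> = (\<Sum>i\<le>n. sc (w ^ i) (pis i))"
    unfolding erow_mult[OF SV] sum_kn(1) sc_sum
    by (intro arg_cong2[of _ _ _ _ "(+)"] sum.cong) (simp_all add: p0 pis_block)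
  finally show "to_f (pi_fun m Jm A n w) = (\<Sum>i\<le>n. sc (w ^ i) (pis i))" .
  have "to_f (tau_fun m Jm A n w) = sc w (adj Xx * to_f (ecol m k w)) + idm m"
    unfolding tau_fun_def using n0 X(2) c by (simp add: to_f_add to_f_smult to_f_mult to_f_one Xx_def sc_mult_right)
  also have "\<dots> = (\<Sum>i\<le>n. sc (w ^ (n - i)) (adj (tau i)))"
    unfolding ecol_mult[OF X(1)] sum_kn(2) sc_sum
    by (intro arg_cong2[of _ _ _ _ "(+)"] sum.cong) (use kn(4) in \<open>auto simp: tau_def kn(9)\<close>)
  finally show "to_f (tau_fun m Jm A n w) = (\<Sum>i\<le>n. sc (w ^ (n - i)) (adj (tau i)))" .
  have s0: "sgm n = adj (a 0)" by (simp add: sgm_def toep_upper_def tau_def shaped_right[OF shaped_intros(8)[OF a_shaped]])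
  have "to_f (sigma_fun m Jm A n w) = sc w (adj (adj (to_f (zvec m A n)) + adj (S k) * Xx) * to_f (ecol m k w)) + a 0"
    unfolding sigma_fun_def using n0 X(2) c yc A0
    by (simp add: to_f_add to_f_smult to_f_mult Xx_def S_def sc_mult_right add.commute)
  also have "\<dots> = (\<Sum>i\<le>n. sc (w ^ (n - i)) (adj (sgm i)))"
    unfolding ecol_mult[OF SX] sum_kn(2) sc_sum
    by (intro arg_cong2[of _ _ _ _ "(+)"] sum.cong) (simp_all add: s0 sgm_block kn(9))
  finally show "to_f (sigma_fun m Jm A n w) = (\<Sum>i\<le>n. sc (w ^ (n - i)) (adj (sgm i)))" .
qed

end

lemma A0: "A 0 \<in> carrier_mat m m" "to_f (A 0) = a 0"
  using A_carrier by (auto simp: a_def)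

lemma ends: "pis 0 = a 0" "sgm n = adj (a 0)" "rho 0 = idm m" "tau n = idm m"
  by (simp_all add: pis_def toep_lower_def rho_def sgm_def toep_upper_def tau_def shaped_right[OF a_shaped]
        shaped_right[OF shaped_intros(8)[OF a_shaped]])

lemma funs:
  "to_f (rho_fun m Jm A n w) = (\<Sum>i\<le>n. sc (w ^ i) (rho i))" "rho_fun m Jm A n w \<in> carrier_mat m m"
  "to_f (pi_fun m Jm A n w) = (\<Sum>i\<le>n. sc (w ^ i) (pis i))" "pi_fun m Jm A n w \<in> carrier_mat m m"
  "to_f (tau_fun m Jm A n w) = (\<Sum>i\<le>n. sc (w ^ (n - i)) (adj (tau i)))" "tau_fun m Jm A n w \<in> carrier_mat m m"
  "to_f (sigma_fun m Jm A n w) = (\<Sum>i\<le>n. sc (w ^ (n - i)) (adj (sgm i)))" "sigma_fun m Jm A n w \<in> carrier_mat m m"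
proof -
  have "(to_f (rho_fun m Jm A n w) = (\<Sum>i\<le>n. sc (w ^ i) (rho i)) \<and> rho_fun m Jm A n w \<in> carrier_mat m m) \<and>
    (to_f (pi_fun m Jm A n w) = (\<Sum>i\<le>n. sc (w ^ i) (pis i)) \<and> pi_fun m Jm A n w \<in> carrier_mat m m) \<and>
    (to_f (tau_fun m Jm A n w) = (\<Sum>i\<le>n. sc (w ^ (n - i)) (adj (tau i))) \<and> tau_fun m Jm A n w \<in> carrier_mat m m) \<and>
    (to_f (sigma_fun m Jm A n w) = (\<Sum>i\<le>n. sc (w ^ (n - i)) (adj (sgm i))) \<and> sigma_fun m Jm A n w \<in> carrier_mat m m)"
  proof (cases n)
    case 0
    then show ?thesis
      using ends A0 by (simp add: rho_fun_def pi_fun_def tau_fun_def sigma_fun_def to_f_one)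
  next
    case (Suc k)
    then show ?thesis using funs_Suc[OF Suc] by blast
  qed
  then show "to_f (rho_fun m Jm A n w) = (\<Sum>i\<le>n. sc (w ^ i) (rho i))" "rho_fun m Jm A n w \<in> carrier_mat m m"
    "to_f (pi_fun m Jm A n w) = (\<Sum>i\<le>n. sc (w ^ i) (pis i))" "pi_fun m Jm A n w \<in> carrier_mat m m"
    "to_f (tau_fun m Jm A n w) = (\<Sum>i\<le>n. sc (w ^ (n - i)) (adj (tau i)))" "tau_fun m Jm A n w \<in> carrier_mat m m"
    "to_f (sigma_fun m Jm A n w) = (\<Sum>i\<le>n. sc (w ^ (n - i)) (adj (sgm i)))" "sigma_fun m Jm A n w \<in> carrier_mat m m"
    by blast+
qed

lemma RL:
  "to_f (Rmat m Jm A n) = J - toep_upper n a (\<lambda>j. J * pis j) 0" "Rmat m Jm A n \<in> carrier_mat m m"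
  "to_f (Lmat m Jm A n) = J - toep_lower a (\<lambda>j. J * sgm j) n" "Lmat m Jm A n \<in> carrier_mat m m"
proof -
  have "(to_f (Rmat m Jm A n) = J - toep_upper n a (\<lambda>j. J * pis j) 0 \<and> Rmat m Jm A n \<in> carrier_mat m m) \<and>
    (to_f (Lmat m Jm A n) = J - toep_lower a (\<lambda>j. J * sgm j) n \<and> Lmat m Jm A n \<in> carrier_mat m m)"
  proof (cases n)
    case 0
    then show ?thesis
      using ends A0 Jm by (auto simp: Rmat_def Lmat_def toep_upper_def toep_lower_def to_f_diff to_f_mult to_f_madj J_def mult.assoc)
  next
    case (Suc k)
    then show ?thesis using R_Suc[OF Suc] L_Suc[OF Suc] by blast
  qed
  then show "to_f (Rmat m Jm A n) = J - toep_upper n a (\<lambda>j. J * pis j) 0" "Rmat m Jm A n \<in> carrier_mat m m"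
    "to_f (Lmat m Jm A n) = J - toep_lower a (\<lambda>j. J * sgm j) n" "Lmat m Jm A n \<in> carrier_mat m m" by blast+
qed

text \<open>The characteristic block equation: the defect of \<open>rho\<close> is concentrated in
  block 0, with value \<open>R\<close>. Dually, \<open>tau\<close> has its defect \<open>L\<close>
  in block \<open>n\<close>.\<close>

lemma rho_relation: "i \<le> n \<Longrightarrow> J * rho i - toep_upper n a (\<lambda>j. J * pis j) i = (if i = 0 then to_f (Rmat m Jm A n) else 0)"
proof (cases "i = 0")
  case True
  then show ?thesis using J(1) by (simp add: RL ends shaped_right[OF J(1)])
next
  case False
  assume "i \<le> n"
  with False obtain k i' where "n = Suc k" "i = Suc i'" "i' \<le> k" by (cases n; cases i) auto
  then show ?thesis using rho_relation_Suc by simp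
qed

lemma tau_relation: "i \<le> n \<Longrightarrow> J * tau i - toep_lower a (\<lambda>j. J * sgm j) i = (if i = n then to_f (Lmat m Jm A n) else 0)"
proof (cases "i = n")
  case True
  then show ?thesis using J(1) by (simp add: RL ends shaped_right[OF J(1)])
next
  case False
  assume "i \<le> n"
  with False obtain k where "n = Suc k" "i \<le> k" by (cases n) auto
  then show ?thesis using tau_relation_le[of k i] by simp
qed

end

section \<open>Normalized polynomials and the resolvent congruences\<close>

lemma Abs_fps_mult_nth: "(Abs_fps a * G) \<section> k = toep_lower a (fps_nth G) k" for a :: "nat \<Rightarrow> fmat"
  unfolding fps_mult_nth toep_lower_def atLeast0AtMost
  by (rule sum.reindex_bij_witness[of _ "\<lambda>j. k - j" "\<lambda>j. k - j"]) auto

lemma frev_mult_Abs_fps_nth: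
  assumes "k \<le> n" "adj J = J"
  shows "(frev n G * fps_const J * Abs_fps a) \<section> k = adj (toep_upper n a (\<lambda>j. J * G \<section> j) (n - k))"
proof -
  have "(frev n G * fps_const J * Abs_fps a) \<section> k = (\<Sum>i\<le>k. adj (G \<section> (n - i)) * J * a (k - i))"
    using assms(1) by (simp add: fps_mult_nth[of _ "Abs_fps a"] mult_fps_const_nth atLeast0AtMost)
  also have "\<dots> = (\<Sum>j=n-k..n. adj (G \<section> j) * J * a (j - (n - k)))"
    by (rule sum.reindex_bij_witness[of _ "\<lambda>j. n - j" "\<lambda>j. n - j"]) (use assms(1) in auto)
  also have "\<dots> = adj (toep_upper n a (\<lambda>j. J * G \<section> j) (n - k))"
    by (simp add: toep_upper_def adj_sum assms(2) mult.assoc)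
  finally show ?thesis .
qed

context potapov
begin

definition "Rf = to_f (Rmat m Jm A n)"
definition "Lf = to_f (Lmat m Jm A n)"

lemma RLf_shaped: "shaped m m Rf" "shaped m m Lf"
  unfolding Rf_def Lf_def by (intro shaped_to_f' RL)+

text \<open>Pairing \<open>rho_relation\<close> with \<open>rho\<close> keeps only block 0, where
  \<open>rho\<close> is the identity. This exhibits \<open>R\<close> as the Toeplitz form evaluated
  at the block column \<open>rho\<close>, whence its positivity.\<close>

lemma Rf_sum: "Rf = (\<Sum>k\<le>n. adj (rho k) * J * rho k - adj (pis k) * J * pis k)"
proof -
  have "Rf = (\<Sum>k\<le>n. adj (rho k) * (if k = 0 then Rf else 0))"
    by (simp add: if_distrib[of "\<lambda>x. _ * x"] ends shaped_left[OF RLf_shaped(1)] cong: if_cong)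
  also have "\<dots> = (\<Sum>k\<le>n. adj (rho k) * (J * rho k - toep_upper n a (\<lambda>j. J * pis j) k))"
    by (intro sum.cong refl) (simp add: rho_relation Rf_def)
  also have "\<dots> = (\<Sum>k\<le>n. adj (rho k) * J * rho k) - (\<Sum>k\<le>n. adj (rho k) * toep_upper n a (\<lambda>j. J * pis j) k)"
    by (simp add: right_diff_distrib mult.assoc sum_subtractf)
  finally show ?thesis
    by (simp add: toep_adjoint flip: pis_def) (simp add: sum_subtractf mult.assoc)
qed

lemma Lf_sum: "Lf = (\<Sum>k\<le>n. adj (tau k) * J * tau k - adj (sgm k) * J * sgm k)"
proof -
  have "Lf = (\<Sum>k\<le>n. adj (tau k) * (if k = n then Lf else 0))"
    by (simp add: if_distrib[of "\<lambda>x. _ * x"] ends shaped_left[OF RLf_shaped(2)] cong: if_cong)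
  also have "\<dots> = (\<Sum>k\<le>n. adj (tau k) * (J * tau k - toep_lower a (\<lambda>j. J * sgm j) k))"
    by (intro sum.cong refl) (simp add: tau_relation Lf_def)
  also have "\<dots> = (\<Sum>k\<le>n. adj (tau k) * J * tau k) - (\<Sum>k\<le>n. adj (tau k) * toep_lower a (\<lambda>j. J * sgm j) k)"
    by (simp add: right_diff_distrib mult.assoc sum_subtractf)
  also have "(\<Sum>k\<le>n. adj (tau k) * toep_lower a (\<lambda>j. J * sgm j) k) = (\<Sum>k\<le>n. adj (sgm k) * J * sgm k)"
    using arg_cong[OF toep_adjoint[where N = n and g = "\<lambda>j. J * sgm j" and a = a and h = tau], of adj]
    by (simp add: adj_sum J sgm_def mult.assoc)
  finally show ?thesis by (simp add: sum_subtractf)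
qed

lemma RLf_pdf: "pdf m Rf" "pdf m Lf"
proof -
  have "adj Rf = Rf" "adj Lf = Lf"
    unfolding Rf_sum Lf_sum by (simp_all add: adj_sum J mult.assoc)
  moreover have "0 < Re (ip x (Rf * x))" "0 < Re (ip x (Lf * x))" if x: "shaped m 1 x" "x \<noteq> 0" for x
  proof -
    have "Re (ip x (Rf * x)) = (\<Sum>k\<le>n. jform J (rho k * x) (toep_lower a (\<lambda>j. rho j * x) k))"
      unfolding Rf_sum
      by (simp add: sum_distrib_right ip_simps ip_sum_right jform_def left_diff_distrib mult.assoc ip_mult_left
          toep_lower_mult_right[symmetric] pis_def[symmetric])
    also have "\<dots> > 0"
      by (rule Q_seq[of _ 0]) (use x seq_shaped in \<open>auto simp: ends shaped_left intro: shaped_mult\<close>)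
    finally show "0 < Re (ip x (Rf * x))" .
    have "Re (ip x (Lf * x)) = (\<Sum>k\<le>n. jform J (tau k * x) (toep_upper n a (\<lambda>j. tau j * x) k))"
      unfolding Lf_sum
      by (simp add: sum_distrib_right ip_simps ip_sum_right jform_def left_diff_distrib mult.assoc ip_mult_left
          toep_upper_mult_right[symmetric] sgm_def[symmetric])
    also have "\<dots> > 0"
      by (rule P_seq[of _ n]) (use x seq_shaped in \<open>auto simp: ends shaped_left intro: shaped_mult\<close>)
    finally show "0 < Re (ip x (Lf * x))" .
  qed
  ultimately show "pdf m Rf" "pdf m Lf" using RLf_shaped by (simp_all add: pdf_def)
qed

definition "sR = to_f (msqrt (Rmat m Jm A n))"
definition "sL = to_f (msqrt (Lmat m Jm A n))"
definition "r = to_f (minv (msqrt (Rmat m Jm A n)))"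
definition "l = to_f (minv (msqrt (Lmat m Jm A n)))"

lemma sqrt_RL:
  "msqrt (Rmat m Jm A n) \<in> carrier_mat m m" "msqrt (Lmat m Jm A n) \<in> carrier_mat m m"
  "pdf m sR" "pdf m sL" "sR * sR = Rf" "sL * sL = Lf"
  using msqrt_pdf[OF RL(2) RLf_pdf(1)[unfolded Rf_def]] msqrt_pdf[OF RL(4) RLf_pdf(2)[unfolded Lf_def]]
  by (simp_all add: sR_def sL_def Rf_def Lf_def)

lemma rl:
  "inverse_pair m r sR" "inverse_pair m l sL" "pdf m r" "pdf m l" "adj r = r" "adj l = l"
  "minv (msqrt (Rmat m Jm A n)) \<in> carrier_mat m m" "minv (msqrt (Lmat m Jm A n)) \<in> carrier_mat m m"
proof -
  obtain b where b: "inverse_pair m sR b" "pdf m b" using pdf_inverse[OF sqrt_RL(3)] by blast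
  obtain c where c: "inverse_pair m sL c" "pdf m c" using pdf_inverse[OF sqrt_RL(4)] by blast
  have br: "b = r" "c = l" and car: "minv (msqrt (Rmat m Jm A n)) \<in> carrier_mat m m" "minv (msqrt (Lmat m Jm A n)) \<in> carrier_mat m m"
    using minv_inverse_pair[OF sqrt_RL(1) b(1)[unfolded sR_def]] minv_inverse_pair[OF sqrt_RL(2) c(1)[unfolded sL_def]]
    by (simp_all add: r_def l_def)
  show "inverse_pair m r sR" "inverse_pair m l sL" "pdf m r" "pdf m l" "adj r = r" "adj l = l"
    using b c unfolding br by (auto intro: inverse_pair_sym simp: pdf_def)
  show "minv (msqrt (Rmat m Jm A n)) \<in> carrier_mat m m" "minv (msqrt (Lmat m Jm A n)) \<in> carrier_mat m m" by (rule car)+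
qed

lemma rl_shaped: "shaped m m r" "shaped m m l" "shaped m m sR" "shaped m m sL"
  using rl(3,4) sqrt_RL(3,4) by (simp_all add: pdf_def)

lemma RL_mult: "Rf * r = sR" "Lf * l = sL"
proof -
  have "sR * (sR * r) = sR" "sL * (sL * l) = sL"
    using rl(1,2) by (simp_all add: inverse_pair_def shaped_right[OF rl_shaped(3)] shaped_right[OF rl_shaped(4)])
  then show "Rf * r = sR" "Lf * l = sL" by (simp_all add: mult.assoc flip: sqrt_RL(5,6))
qed

lemma RL_inverse: "inverse_pair m Rf (r * r)" "inverse_pair m Lf (l * l)"
proof -
  have "Rf * (r * r) = idm m" "Lf * (l * l) = idm m"
    using rl(1,2) RL_mult by (simp_all add: inverse_pair_def flip: mult.assoc)
  moreover have "(r * r) * Rf = idm m" "(l * l) * Lf = idm m"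
  proof -
    have "r * ((r * sR) * sR) = idm m" "l * ((l * sL) * sL) = idm m"
      using rl(1,2) by (simp_all add: inverse_pair_def shaped_left[OF rl_shaped(3)] shaped_left[OF rl_shaped(4)])
    then show "(r * r) * Rf = idm m" "(l * l) * Lf = idm m" by (simp_all add: mult.assoc flip: sqrt_RL(5,6))
  qed
  ultimately show "inverse_pair m Rf (r * r)" "inverse_pair m Lf (l * l)"
    using RLf_shaped rl_shaped by (auto simp: inverse_pair_def intro: shaped_mult)
qed

lemma minv_RL: "to_f (minv (Rmat m Jm A n)) = r * r" "minv (Rmat m Jm A n) \<in> carrier_mat m m"
  "to_f (minv (Lmat m Jm A n)) = l * l" "minv (Lmat m Jm A n) \<in> carrier_mat m m"
  using minv_inverse_pair[OF RL(2) RL_inverse(1)[unfolded Rf_def]] minv_inverse_pair[OF RL(4) RL_inverse(2)[unfolded Lf_def]]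
  by simp_all

definition "fser = Abs_fps a"
definition "al = Abs_fps (\<lambda>k. if k \<le> n then pis k * r else 0)"
definition "ga = Abs_fps (\<lambda>k. if k \<le> n then rho k * r else 0)"
definition "be = Abs_fps (\<lambda>k. if k \<le> n then J * (tau k * l) else 0)"
definition "de = Abs_fps (\<lambda>k. if k \<le> n then J * (sgm k * l) else 0)"

lemma poly_nth: "k \<le> n \<Longrightarrow> al \<section> k = pis k * r" "k \<le> n \<Longrightarrow> ga \<section> k = rho k * r"
  "k \<le> n \<Longrightarrow> be \<section> k = J * (tau k * l)" "k \<le> n \<Longrightarrow> de \<section> k = J * (sgm k * l)"
  by (simp_all add: al_def ga_def be_def de_def)

lemma poly_fshaped: "fshaped m m al" "fshaped m m be" "fshaped m m ga" "fshaped m m de" "fshaped m m fser"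
  using rl_shaped seq_shaped J(1) a_shaped
  by (auto simp: fshaped_def al_def be_def ga_def de_def fser_def intro!: shaped_mult[of m m])

lemma poly_fdeg: "fdeg n al" "fdeg n be" "fdeg n ga" "fdeg n de"
  by (auto simp: fdeg_def al_def be_def ga_def de_def)

lemma JJ_left: "shaped m q x \<Longrightarrow> J * (J * x) = x"
  by (simp add: J(3) shaped_left flip: mult.assoc)

text \<open>Each congruence is a block equation read on coefficients: in turn the definition of
  \<open>pis\<close>, \<open>tau_relation\<close>, the adjoint of \<open>rho_relation\<close> in
  reversed order, and the definition of \<open>sgm\<close>.\<close>

lemma congruences:
  "feq (Suc n) al (fser * ga)"
  "feq (Suc n) (be - fser * de) (fmon n sL)"
  "feq (Suc n) (frev n ga * fps_const J - frev n al * fps_const J * fser) (fmon n sR)"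
  "feq (Suc n) (frev n be * fps_const J * fser) (frev n de * fps_const J)"
proof -
  have "al \<section> k = (fser * ga) \<section> k" if "k \<le> n" for k
  proof -
    have "(fser * ga) \<section> k = toep_lower a (\<lambda>j. rho j * r) k"
      unfolding fser_def Abs_fps_mult_nth by (rule toep_lower_cong) (use that in \<open>simp add: poly_nth\<close>)
    then show ?thesis using that by (simp add: poly_nth pis_def flip: toep_lower_mult_right)
  qed
  then show "feq (Suc n) al (fser * ga)" by (simp add: feq_def less_Suc_eq_le)
  have "(be - fser * de) \<section> k = fmon n sL \<section> k" if "k \<le> n" for k
  proof -
    have "(fser * de) \<section> k = toep_lower a (\<lambda>j. (J * sgm j) * l) k"
      unfolding fser_def Abs_fps_mult_nth by (rule toep_lower_cong) (use that in \<open>simp add: poly_nth mult.assoc\<close>)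
    then have "(be - fser * de) \<section> k = (J * tau k - toep_lower a (\<lambda>j. J * sgm j) k) * l"
      using that by (simp add: poly_nth mult.assoc left_diff_distrib toep_lower_mult_right)
    then show ?thesis unfolding tau_relation[OF that] by (simp add: RL_mult flip: Lf_def)
  qed
  then show "feq (Suc n) (be - fser * de) (fmon n sL)" by (simp add: feq_def less_Suc_eq_le)
  have "(frev n ga * fps_const J - frev n al * fps_const J * fser) \<section> k = fmon n sR \<section> k" if k: "k \<le> n" for k
  proof -
    have "toep_upper n a (\<lambda>j. J * al \<section> j) (n - k) = toep_upper n a (\<lambda>j. (J * pis j) * r) (n - k)"
      by (rule toep_upper_cong) (simp add: poly_nth mult.assoc)
    then have "(frev n ga * fps_const J - frev n al * fps_const J * fser) \<section> k =
      adj ((J * rho (n - k) - toep_upper n a (\<lambda>j. J * pis j) (n - k)) * r)"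
      unfolding fser_def using k frev_mult_Abs_fps_nth[OF k J(2), of al a]
      by (simp add: mult_fps_const_nth poly_nth left_diff_distrib J mult.assoc toep_upper_mult_right)
    also have "(J * rho (n - k) - toep_upper n a (\<lambda>j. J * pis j) (n - k)) * r = (if n - k = 0 then Rf * r else 0)"
      using rho_relation[of "n - k"] by (simp add: Rf_def)
    finally show ?thesis using k sqrt_RL(3) by (auto simp: RL_mult pdf_def)
  qed
  then show "feq (Suc n) (frev n ga * fps_const J - frev n al * fps_const J * fser) (fmon n sR)"
    by (simp add: feq_def less_Suc_eq_le)
  have "(frev n be * fps_const J * fser) \<section> k = (frev n de * fps_const J) \<section> k" if k: "k \<le> n" for k
  proof -
    have "toep_upper n a (\<lambda>j. J * be \<section> j) (n - k) = toep_upper n a (\<lambda>j. tau j * l) (n - k)"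
      by (rule toep_upper_cong) (simp add: poly_nth JJ_left[OF shaped_mult[OF seq_shaped(3) rl_shaped(2)]])
    also have "\<dots> = sgm (n - k) * l" by (simp add: sgm_def toep_upper_mult_right)
    also have "\<dots> = J * de \<section> (n - k)"
      by (simp add: poly_nth JJ_left[OF shaped_mult[OF seq_shaped(4) rl_shaped(2)]])
    finally show ?thesis
      unfolding fser_def using k frev_mult_Abs_fps_nth[OF k J(2), of be a] by (simp add: mult_fps_const_nth J)
  qed
  then show "feq (Suc n) (frev n be * fps_const J * fser) (frev n de * fps_const J)"
    by (simp add: feq_def less_Suc_eq_le)
qed

lemma resolvent: "resolvent m n J fser al be ga de r sR l sL"
proof
  fix x :: "nat \<Rightarrow> fmat" assume x: "\<And>k. shaped m 1 (x k)"
  have "(\<Sum>i=k..n. adj (fser \<section> (i - k)) * x i) = toep_upper n a x k" for k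
    by (simp add: fser_def toep_upper_def)
  moreover have "0 \<le> (\<Sum>k\<le>n. jform J (x k) (toep_upper n a x k))"
  proof (cases "\<exists>i\<le>n. x i \<noteq> 0")
    case True
    then obtain i where i: "i \<le> n" "x i \<noteq> 0" by blast
    show ?thesis by (rule less_imp_le, rule P_seq[of x i]) (rule x i)+
  next
    case False
    then have "jform J (x k) (toep_upper n a x k) = 0" if "k \<le> n" for k
      using that by (simp add: toep_upper_def jform_def ip_simps)
    then show ?thesis by simp
  qed
  ultimately show "0 \<le> (\<Sum>k\<le>n. jform J (x k) (\<Sum>i=k..n. adj (fser \<section> (i - k)) * x i))" by simp
qed (rule J poly_fshaped poly_fdeg rl congruences |
      simp add: poly_nth ends shaped_left[OF rl_shaped(1)] shaped_left[OF rl_shaped(2)])+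

end

sublocale potapov \<subseteq> res: resolvent m n J fser al be ga de r sR l sL
  by (rule resolvent)

section \<open>Reciprocal polynomials of the statement as values of the resolvent matrix\<close>

lemma foldr_smult_madj:
  assumes "\<And>k. t k \<in> carrier_mat m m"
  shows "to_f (foldr (\<lambda>k acc. c k \<cdot>\<^sub>m madj (t k) + acc) xs (0\<^sub>m m m)) = (\<Sum>k\<leftarrow>xs. sc (c k) (adj (to_f (t k))))
    \<and> foldr (\<lambda>k acc. c k \<cdot>\<^sub>m madj (t k) + acc) xs (0\<^sub>m m m) \<in> carrier_mat m m"
proof (induction xs)
  case (Cons k xs)
  have "c k \<cdot>\<^sub>m madj (t k) \<in> carrier_mat m m" using assms[of k] by auto
  with Cons have "to_f (c k \<cdot>\<^sub>m madj (t k) + foldr (\<lambda>k acc. c k \<cdot>\<^sub>m madj (t k) + acc) xs (0\<^sub>m m m)) =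
      to_f (c k \<cdot>\<^sub>m madj (t k)) + to_f (foldr (\<lambda>k acc. c k \<cdot>\<^sub>m madj (t k) + acc) xs (0\<^sub>m m m))"
    by (intro to_f_add) (auto dest: carrier_matD)
  then show ?case using Cons assms[of k] by (simp add: to_f_smult to_f_madj)
qed (simp add: to_f_zero)

text \<open>\<open>tilde\<close> takes its coefficients from derivatives at 0; uniqueness of
  expansions identifies them with the coefficients of \<open>P\<close>.\<close>

lemma tilde_poly:
  assumes c: "\<And>z. b z \<in> carrier_mat m m" and P: "fdeg n P" "fshaped m m P"
    and e: "\<And>z. to_f (b z) = fev m m z P"
  shows "to_f (tilde m n b w) = fev m m w (frev n P)" "tilde m n b w \<in> carrier_mat m m"
proof -
  have conv: "fconv z P" for z by (rule fconv_poly[OF P(1)])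
  have "(\<lambda>z. b z $$ (i, j)) analytic_on {0}" if "i < m" "j < m" for i j
  proof -
    have "(\<lambda>z. b z $$ (i, j)) = (\<lambda>z. ent (fev m m z P) i j)"
      using carrier_matD[OF c] that by (simp flip: e)
    moreover have "(\<lambda>z. ent (fev m m z P) i j) holomorphic_on ball 0 1"
      by (rule fev_holomorphic[OF conv])
    ultimately show ?thesis unfolding analytic_at by (intro exI[of _ "ball 0 1"]) simp
  qed
  then have 0: "0 \<in> hol_pts m b" by (simp add: hol_pts_def)
  have "ftay m b = P"
    by (rule has_fexp_unique[OF has_fexp_ftay[OF c 0]]) (unfold e, rule has_fexp_fev[OF conv P(2)])
  then have t: "to_f (taylor_coeff m b k) = P \<section> k" for k
    by (simp add: ftay_def fps_eq_iff)
  have tc: "taylor_coeff m b k \<in> carrier_mat m m" for k by (simp add: taylor_coeff_def)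
  note fold = foldr_smult_madj[where c = "\<lambda>k. w ^ (n - k)" and xs = "[0..<Suc n]", OF tc]
  show "tilde m n b w \<in> carrier_mat m m" unfolding tilde_def by (rule fold[THEN conjunct2])
  have "to_f (tilde m n b w) = (\<Sum>k\<leftarrow>[0..<Suc n]. sc (w ^ (n - k)) (adj (P \<section> k)))"
    unfolding tilde_def fold[THEN conjunct1] t ..
  also have "\<dots> = (\<Sum>k\<le>n. sc (w ^ (n - k)) (adj (P \<section> k)))"
    by (simp only: interv_sum_list_conv_sum_set_nat set_upt atLeast0LessThan lessThan_Suc_atMost)
  also have "\<dots> = (\<Sum>k\<le>n. sc (w ^ k) (adj (P \<section> (n - k))))"
    by (rule sum.reindex_bij_witness[of _ "\<lambda>k. n - k" "\<lambda>k. n - k"]) auto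
  also have "\<dots> = fev m m w (frev n P)"
    using P by (subst fev_poly[of n]) (auto simp: fdeg_intros)
  finally show "to_f (tilde m n b w) = fev m m w (frev n P)" .
qed

context potapov
begin

abbreviation "fn_pi \<equiv> pi_fun m Jm A n"
abbreviation "fn_rho \<equiv> rho_fun m Jm A n"
abbreviation "fn_sigma \<equiv> sigma_fun m Jm A n"
abbreviation "fn_tau \<equiv> tau_fun m Jm A n"

lemma tilde_values:
  "to_f (tilde m n fn_rho w) = (\<Sum>k\<le>n. sc (w ^ (n - k)) (adj (rho k)))" "tilde m n fn_rho w \<in> carrier_mat m m"
  "to_f (tilde m n fn_pi w) = (\<Sum>k\<le>n. sc (w ^ (n - k)) (adj (pis k)))" "tilde m n fn_pi w \<in> carrier_mat m m"
  "to_f (tilde m n fn_tau w) = (\<Sum>k\<le>n. sc (w ^ k) (tau k))" "tilde m n fn_tau w \<in> carrier_mat m m"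
  "to_f (tilde m n fn_sigma w) = (\<Sum>k\<le>n. sc (w ^ k) (sgm k))" "tilde m n fn_sigma w \<in> carrier_mat m m"
proof -
  have key: "to_f (tilde m n b w) = (\<Sum>k\<le>n. sc (w ^ (n - k)) (adj (c k))) \<and> tilde m n b w \<in> carrier_mat m m"
    if b: "\<And>z. b z \<in> carrier_mat m m" and c: "\<And>k. shaped m m (c k)" and e: "\<And>z. to_f (b z) = (\<Sum>k\<le>n. sc (z ^ k) (c k))"
    for b c
  proof -
    define P where "P = Abs_fps (\<lambda>k. if k \<le> n then c k else 0)"
    have P: "fdeg n P" "fshaped m m P" using c by (auto simp: P_def fdeg_def fshaped_def)
    have v: "to_f (b z) = fev m m z P" for z
      unfolding e fev_poly[OF P] by (intro sum.cong) (auto simp: P_def)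
    have "fev m m w (frev n P) = (\<Sum>k\<le>n. sc (w ^ k) (adj (P \<section> (n - k))))"
      using P by (subst fev_poly[of n]) (auto simp: fdeg_intros)
    also have "\<dots> = (\<Sum>k\<le>n. sc (w ^ (n - k)) (adj (c k)))"
      by (rule sum.reindex_bij_witness[of _ "\<lambda>k. n - k" "\<lambda>k. n - k"]) (auto simp: P_def)
    finally show ?thesis using tilde_poly[where b = b and w = w, OF b P v] by simp
  qed
  have rev: "(\<Sum>i\<le>n. sc (z ^ (n - i)) (adj (c i))) = (\<Sum>k\<le>n. sc (z ^ k) (adj (c (n - k))))" for z c
    by (rule sum.reindex_bij_witness[of _ "\<lambda>k. n - k" "\<lambda>k. n - k"]) auto
  have rev': "(\<Sum>k\<le>n. sc (w ^ (n - k)) (adj (adj (c (n - k))))) = (\<Sum>k\<le>n. sc (w ^ k) (c k))" for c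
    by (rule sum.reindex_bij_witness[of _ "\<lambda>k. n - k" "\<lambda>k. n - k"]) auto
  show "to_f (tilde m n fn_rho w) = (\<Sum>k\<le>n. sc (w ^ (n - k)) (adj (rho k)))" "tilde m n fn_rho w \<in> carrier_mat m m"
    "to_f (tilde m n fn_pi w) = (\<Sum>k\<le>n. sc (w ^ (n - k)) (adj (pis k)))" "tilde m n fn_pi w \<in> carrier_mat m m"
    using key[OF funs(2) seq_shaped(1) funs(1)] key[OF funs(4) seq_shaped(2) funs(3)] by blast+
  show "to_f (tilde m n fn_tau w) = (\<Sum>k\<le>n. sc (w ^ k) (tau k))" "tilde m n fn_tau w \<in> carrier_mat m m"
    "to_f (tilde m n fn_sigma w) = (\<Sum>k\<le>n. sc (w ^ k) (sgm k))" "tilde m n fn_sigma w \<in> carrier_mat m m"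
    using key[OF funs(6) shaped_intros(8)[OF seq_shaped(3)] funs(5)[unfolded rev]]
      key[OF funs(8) shaped_intros(8)[OF seq_shaped(4)] funs(7)[unfolded rev]] unfolding rev' by blast+
qed

text \<open>The factors \<open>J\<close> inside \<open>be\<close> and \<open>de\<close> cancel
  against the \<open>J\<close> in \<open>tav\<close> and \<open>siv\<close>, which leaves
  \<open>l\<close> times the polynomials of the statement.\<close>

lemma fn_values:
  "res.gv w = to_f (fn_rho w) * r" "res.av w = to_f (fn_pi w) * r"
  "res.bv w = J * (to_f (tilde m n fn_tau w) * l)" "res.dv w = J * (to_f (tilde m n fn_sigma w) * l)"
  "res.tav w = l * to_f (fn_tau w)" "res.siv w = l * to_f (fn_sigma w)"
  "res.rav w = r * (to_f (tilde m n fn_rho w) * J)" "res.pav w = r * (to_f (tilde m n fn_pi w) * J)"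
proof -
  show "res.gv w = to_f (fn_rho w) * r" "res.av w = to_f (fn_pi w) * r"
    "res.bv w = J * (to_f (tilde m n fn_tau w) * l)" "res.dv w = J * (to_f (tilde m n fn_sigma w) * l)"
    unfolding fev_poly[OF poly_fdeg(1) poly_fshaped(1)] fev_poly[OF poly_fdeg(2) poly_fshaped(2)]
      fev_poly[OF poly_fdeg(3) poly_fshaped(3)] fev_poly[OF poly_fdeg(4) poly_fshaped(4)] funs tilde_values
    by (simp_all add: poly_nth sum_distrib_right sum_distrib_left sc_mult_left sc_mult_right)
  have rev: "(\<Sum>k\<le>n. sc (w ^ k) (adj (F \<section> (n - k)))) = (\<Sum>k\<le>n. sc (w ^ (n - k)) (adj (F \<section> k)))" for F
    by (rule sum.reindex_bij_witness[of _ "\<lambda>k. n - k" "\<lambda>k. n - k"]) auto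
  have fr: "fev m m w (frev n F) = (\<Sum>k\<le>n. sc (w ^ (n - k)) (adj (F \<section> k)))" if "fdeg n F" "fshaped m m F" for F
    using that by (subst fev_poly[of n]) (auto simp: fdeg_intros rev)
  have JJ: "l * adj c * J * J = l * adj c" if "shaped m m c" for c
    by (simp add: mult.assoc J(3) shaped_right[OF shaped_intros(8)[OF that]])
  show "res.rav w = r * (to_f (tilde m n fn_rho w) * J)" "res.pav w = r * (to_f (tilde m n fn_pi w) * J)"
    unfolding fr[OF poly_fdeg(1) poly_fshaped(1)] fr[OF poly_fdeg(3) poly_fshaped(3)] tilde_values
    by (simp_all add: poly_nth sum_distrib_right sum_distrib_left sc_mult_left sc_mult_right rl mult.assoc)
  show "res.tav w = l * to_f (fn_tau w)" "res.siv w = l * to_f (fn_sigma w)"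
    unfolding fr[OF poly_fdeg(2) poly_fshaped(2)] fr[OF poly_fdeg(4) poly_fshaped(4)] funs
    by (simp_all add: poly_nth sum_distrib_right sum_distrib_left sc_mult_left sc_mult_right rl J JJ[OF seq_shaped(3)] JJ[OF seq_shaped(4)] flip: mult.assoc)
qed

end

section \<open>The matrix ball\<close>

lemma inverse_pair_mult: "inverse_pair m a b \<Longrightarrow> inverse_pair m c d \<Longrightarrow> inverse_pair m (a * c) (d * b)"
proof -
  assume ab: "inverse_pair m a b" and cd: "inverse_pair m c d"
  have s: "shaped m m a" "shaped m m b" "shaped m m c" "shaped m m d" using ab cd by (auto simp: inverse_pair_def)
  have "a * c * (d * b) = a * ((c * d) * b)" "d * b * (a * c) = d * ((b * a) * c)" by (simp_all add: mult.assoc)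
  then show ?thesis using ab cd s by (auto simp: inverse_pair_def shaped_left[OF s(2)] shaped_left[OF s(3)] intro: shaped_mult)
qed

lemma inverse_pair_cancel: "inverse_pair m a b \<Longrightarrow> shaped m q x \<Longrightarrow> b * (a * x) = x"
  by (simp add: inverse_pair_def shaped_left flip: mult.assoc)

lemma inverse_pair_cancel_right: "inverse_pair m a b \<Longrightarrow> shaped q m x \<Longrightarrow> x * a * b = x"
  by (simp add: inverse_pair_def shaped_right mult.assoc)

lemma inverse_pair_adj: "inverse_pair m a b \<Longrightarrow> inverse_pair m (adj a) (adj b)"
proof -
  assume ab: "inverse_pair m a b"
  then have "adj (b * a) = adj (idm m)" "adj (a * b) = adj (idm m)" unfolding inverse_pair_def by metis+
  then have "adj a * adj b = idm m" "adj b * adj a = idm m" by simp_all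
  with ab show ?thesis by (auto simp: inverse_pair_def)
qed

lemma pdf_congruence:
  assumes g: "inverse_pair m g gi" and a: "shaped m m a"
  shows "pdf m (g * a * adj g) \<longleftrightarrow> pdf m a"
proof -
  have imp: "pdf m (g * a * adj g)" if p: "pdf m a" and g: "inverse_pair m g gi" for g gi a
  proof -
    have sg: "shaped m m g" "shaped m m gi" and sa: "shaped m m a" "adj a = a" using p g by (auto simp: inverse_pair_def pdf_def)
    have "0 < Re (ip x (g * a * adj g * x))" if x: "shaped m 1 x" "x \<noteq> 0" for x
    proof -
      have sx: "shaped m 1 (adj g * x)" using shaped_mult[OF shaped_intros(8)[OF sg(1)] x(1)] .
      have "adj g * x \<noteq> 0"
      proof
        assume "adj g * x = 0"
        then show False using inverse_pair_cancel[OF inverse_pair_adj[OF g] x(1)] x(2) by simp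
      qed
      then have "0 < Re (ip (adj g * x) (a * (adj g * x)))" using p sx by (simp add: pdf_def)
      then show ?thesis by (simp add: ip_mult_left mult.assoc)
    qed
    then show ?thesis using sa shaped_mult[OF shaped_mult[OF sg(1) sa(1)] shaped_intros(8)[OF sg(1)]]
      by (simp add: pdf_def mult.assoc)
  qed
  have "gi * (g * a * adj g) * adj gi = a"
  proof -
    have "gi * (g * a * adj g) * adj gi = (gi * (g * a)) * adj g * adj gi" by (simp only: mult.assoc)
    then show ?thesis
      unfolding inverse_pair_cancel[OF g a] inverse_pair_cancel_right[OF inverse_pair_adj[OF g] a] .
  qed
  then show ?thesis using imp[OF _ g, of a] imp[OF _ inverse_pair_sym[OF g], of "g * a * adj g"] by auto
qed

lemma pdf_square:
  assumes g: "inverse_pair m g gi"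
  shows "pdf m (g * adj g)"
proof -
  have "pdf m (idm m)"
    by (auto simp: pdf_def ip_self_real shaped_left nrm2_eq_0_iff less_le nrm2_nonneg)
  then have "pdf m (g * idm m * adj g)" by (subst pdf_congruence[OF g]) auto
  moreover have "shaped m m g" using g by (simp add: inverse_pair_def)
  ultimately show ?thesis by (simp add: shaped_right)
qed

text \<open>Put \<open>x = gi * de\<close>. Unless \<open>c = 0\<close>, the relation gives
  \<open>pa = x * ta\<close>; in either case the two matrices factor as
  \<open>adj ta * y * ta\<close> and \<open>ga * z * adj ga\<close>, and Sylvester's identity
  equates the determinants of \<open>y\<close> and \<open>z\<close>. The alternative
  \<open>c = 0\<close> admits the origin.\<close>

lemma defect_det:
  assumes s: "shaped m m ga" "shaped m m de" "shaped m m ta" "shaped m m pa" and g: "inverse_pair m ga gi"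
    and e: "c = 0 \<or> ga * pa = de * ta" and d: "cmod (fdet m ta) = cmod (fdet m ga)"
  shows "fdet m (adj ta * ta - sc c (adj pa * pa)) = fdet m (ga * adj ga - sc c (de * adj de))"
proof -
  define x where "x = gi * de"
  have sx: "shaped m m x" using g s by (auto simp: x_def inverse_pair_def intro: shaped_mult)
  have gx: "ga * x = de" unfolding x_def by (rule inverse_pair_cancel[OF inverse_pair_sym[OF g] s(2)])
  have sc_pa: "sc c (adj pa * pa) = sc c (adj ta * (adj x * x) * ta)"
    using e
  proof
    assume "ga * pa = de * ta"
    then have "gi * (ga * pa) = x * ta" by (simp add: x_def mult.assoc)
    then have "pa = x * ta" unfolding inverse_pair_cancel[OF g s(4)] .
    then show ?thesis by (simp add: mult.assoc)
  qed simp
  define y where "y = idm m - sc c (adj x) * x"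
  define z where "z = idm m - x * sc c (adj x)"
  have sy: "shaped m m y" "shaped m m z" unfolding y_def z_def using sx by (auto intro!: shaped_intros(3) shaped_mult[of m m])
  have "adj ta * ta - sc c (adj pa * pa) = adj ta * y * ta"
    unfolding sc_pa by (simp add: y_def right_diff_distrib left_diff_distrib sc_mult_left sc_mult_right mult.assoc
        shaped_left[OF s(3)])
  moreover have "ga * adj ga - sc c (de * adj de) = ga * z * adj ga"
    by (simp add: z_def gx[symmetric] right_diff_distrib left_diff_distrib sc_mult_left sc_mult_right mult.assoc
        shaped_left[OF shaped_intros(8)[OF s(1)]])
  moreover have "fdet m (adj ta * y * ta) = fdet m y * of_real ((cmod (fdet m ta))\<^sup>2)"
    unfolding complex_norm_square using s sy
    by (simp add: fdet_mult[OF shaped_mult[OF shaped_intros(8)[OF s(3)] sy(1)] s(3)] fdet_mult[OF shaped_intros(8)[OF s(3)] sy(1)] fdet_adj)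
  moreover have "fdet m (ga * z * adj ga) = fdet m z * of_real ((cmod (fdet m ga))\<^sup>2)"
    unfolding complex_norm_square using s sy
    by (simp add: fdet_mult[OF shaped_mult[OF s(1) sy(2)] shaped_intros(8)[OF s(1)]] fdet_mult[OF s(1) sy(2)] fdet_adj)
  moreover have "fdet m y = fdet m z"
    unfolding y_def z_def by (rule sylvester_det) (use sx in auto)
  ultimately show ?thesis using d by simp
qed

text \<open>Completing the square around \<open>M = Phi' * Cc\<close>: with \<open>Y = X - M\<close>
  the form is \<open>nrm2 (t1 * (Y * u)) - q^2 * nrm2 (s2 * u)\<close>, where \<open>t1\<close> is
  the root of \<open>Phi\<close> and \<open>C_Mm\<close> supplies the constant term. The sign
  condition says that \<open>t1 * Y * t2 / q\<close> is a contraction.\<close>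

lemma (in frame) ball_iff:
  assumes X: "shaped m m X" and Phi: "inverse_pair m Phi Phi'" and Psi: "inverse_pair m Psi Psi'"
    and s1: "pdf m s1" "s1 * s1 = Phi'" and s2: "pdf m s2" "s2 * s2 = Psi'"
  shows "Mm = Phi' * Cc * Psi"
    "(\<forall>u. shaped m 1 u \<longrightarrow> nrm2 (Bc X * u) \<le> aw * nrm2 (Ac X * u)) \<longleftrightarrow>
      (\<exists>K. contr m K \<and> X = Phi' * Cc + sc (of_real (cmod w ^ (n + 1))) (s1 * K * s2))"
proof -
  obtain t1 where t1: "inverse_pair m s1 t1" "pdf m t1" using pdf_inverse[OF s1(1)] by blast
  obtain t2 where t2: "inverse_pair m s2 t2" "pdf m t2" using pdf_inverse[OF s2(1)] by blast
  have sh: "shaped m m s1" "shaped m m s2" "shaped m m t1" "shaped m m t2" and h: "adj s1 = s1" "adj s2 = s2" "adj t1 = t1" "adj t2 = t2"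
    using s1 s2 t1 t2 by (auto simp: pdf_def)
  have tt: "t1 * t1 = Phi"
    using inverse_pair_mult[OF t1(1) t1(1)] inverse_pair_sym[OF Phi] unfolding s1(2) by (rule inverse_pair_unique)
  define M where "M = Phi' * Cc"
  define q where "q = cmod w ^ (n + 1)"
  have q: "q > 0" using w by (simp add: q_def)
  have sM: "shaped m m M" using Phi shaped_defs(2) by (auto simp: M_def inverse_pair_def intro: shaped_mult)
  have PM: "Phi * M = Cc" unfolding M_def by (rule inverse_pair_cancel[OF inverse_pair_sym[OF Phi] shaped_defs(2)])
  have "Phi' * (Phi * Mm) = Mm" by (rule inverse_pair_cancel[OF Phi shaped_defs(5)])
  then show Mm: "Mm = Phi' * Cc * Psi" unfolding Phi_Mm by (simp only: mult.assoc)
  have "Ee * Psi * Psi' = (adj Cc * M * Psi - sc (of_real (q\<^sup>2)) (idm m)) * Psi'"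
  proof -
    have "cmod w ^ (2 * n + 2) = q\<^sup>2" by (simp add: q_def power_mult[symmetric] algebra_simps)
    then show ?thesis using C_Mm unfolding Mm M_def by (simp add: algebra_simps)
  qed
  moreover have sCM: "shaped m m (adj Cc * M)" using shaped_mult[OF shaped_intros(8)[OF shaped_defs(2)] sM] .
  moreover have sP: "shaped m m Psi'" using Psi by (simp add: inverse_pair_def)
  ultimately have Ee: "Ee = adj Cc * M - sc (of_real (q\<^sup>2)) Psi'"
    by (simp add: inverse_pair_cancel_right[OF Psi shaped_defs(3)] left_diff_distrib inverse_pair_cancel_right[OF Psi sCM]
        sc_mult_left shaped_left[OF sP])
  define Y where "Y = X - M"
  have sY: "shaped m m Y" using X sM by (auto simp: Y_def)
  have form: "nrm2 (Bc X * u) - aw * nrm2 (Ac X * u) = nrm2 (t1 * (Y * u)) - q\<^sup>2 * nrm2 (s2 * u)" if u: "shaped m 1 u" for u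
  proof -
    define p where "p = Y * u"
    define v where "v = M * u"
    have Xu: "X * u = p + v" by (simp add: p_def v_def Y_def left_diff_distrib)
    have Pv: "Phi * v = Cc * u" unfolding v_def by (simp add: PM flip: mult.assoc)
    have 1: "ip v (Phi * p) = ip (Cc * u) p" using herm_defs(1) by (simp add: ip_mult_right Pv)
    have 2: "Re (ip u (Ee * u)) = Re (ip (Cc * u) v) - q\<^sup>2 * Re (ip u (Psi' * u))"
      by (simp add: Ee left_diff_distrib ip_simps sc_mult_left mult.assoc v_def ip_mult_right)
    have 3: "Re (ip (Cc * u) p) = Re (ip p (Cc * u))" "Re (ip (Cc * u) v) = Re (ip v (Cc * u))"
      by (subst ip_cnj[symmetric], simp only: cnj.simps(1))+
    have 4: "nrm2 (t1 * p) = Re (ip p (Phi * p))" "nrm2 (s2 * u) = Re (ip u (Psi' * u))"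
      by (simp_all add: nrm2_def ip_mult_left h tt[symmetric] s2(2)[symmetric] mult.assoc)
    show ?thesis unfolding form_eq[OF X u] Xu p_def[symmetric] 2 4
      by (simp add: distrib_left ip_simps Pv 1 3)
  qed
  show "(\<forall>u. shaped m 1 u \<longrightarrow> nrm2 (Bc X * u) \<le> aw * nrm2 (Ac X * u)) \<longleftrightarrow>
      (\<exists>K. contr m K \<and> X = Phi' * Cc + sc (of_real (cmod w ^ (n + 1))) (s1 * K * s2))"
    (is "?L \<longleftrightarrow> ?R")
  proof
    assume ?R
    then obtain K where K: "contr m K" and XK: "X = M + sc (of_real q) (s1 * K * s2)" unfolding M_def q_def by blast
    have sK: "shaped m m K" using K by (simp add: contr_def)
    show ?L
    proof (intro allI impI)
      fix u assume u: "shaped m 1 u"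
      have su: "shaped m 1 (s2 * u)" "shaped m 1 (K * (s2 * u))" using sh u sK by (auto intro!: shaped_mult[of m m])
      have "t1 * (Y * u) = sc (of_real q) (t1 * (s1 * (K * (s2 * u))))"
        by (simp add: Y_def XK sc_mult_left sc_mult_right mult.assoc)
      also have "\<dots> = sc (of_real q) (K * (s2 * u))" unfolding inverse_pair_cancel[OF t1(1) su(2)] ..
      finally have "nrm2 (t1 * (Y * u)) = q\<^sup>2 * nrm2 (K * (s2 * u))" by (simp add: nrm2_sc)
      also have "\<dots> \<le> q\<^sup>2 * nrm2 (s2 * u)" using K su by (intro mult_left_mono) (auto simp: contr_def)
      finally show "nrm2 (Bc X * u) \<le> aw * nrm2 (Ac X * u)" using form[OF u] by linarith
    qed
  next
    assume L: ?L
    define K where "K = sc (of_real (inverse q)) (t1 * Y * t2)"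
    have "contr m K"
      unfolding contr_def
    proof (intro conjI allI impI)
      show "shaped m m K" unfolding K_def using sh sY by (auto intro!: shaped_intros(5) shaped_mult[of m m])
      fix x assume x: "shaped m 1 x"
      define u where "u = t2 * x"
      have u: "shaped m 1 u" unfolding u_def using sh x by (auto intro: shaped_mult)
      have su: "s2 * u = x" unfolding u_def by (rule inverse_pair_cancel[OF inverse_pair_sym[OF t2(1)] x])
      have "q\<^sup>2 * nrm2 (K * x) = nrm2 (t1 * (Y * u))"
        using q by (simp add: K_def sc_mult_left nrm2_sc u_def mult.assoc power_inverse norm_inverse)
      also have "\<dots> \<le> q\<^sup>2 * nrm2 x" using L form[OF u] u su by force
      finally show "nrm2 (K * x) \<le> nrm2 x" using q by simp
    qed
    moreover have "X = M + sc (of_real q) (s1 * K * s2)"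
    proof -
      have "sc (of_real q) (s1 * K * s2) = s1 * (t1 * Y) * t2 * s2"
        using q by (simp add: K_def sc_mult_left sc_mult_right mult.assoc)
      also have "\<dots> = Y"
        unfolding inverse_pair_cancel[OF inverse_pair_sym[OF t1(1)] sY] by (rule inverse_pair_cancel_right[OF inverse_pair_sym[OF t2(1)] sY])
      finally show ?thesis by (simp add: Y_def)
    qed
    ultimately show ?R unfolding M_def q_def by blast
  qed
qed

text \<open>At \<open>z0\<close> the form has a lower bound \<open>e\<close>; the Frobenius norm of
  \<open>F z - F z0\<close> is continuous in \<open>z\<close>, and a perturbation of norm below
  \<open>e\<close> preserves positivity.\<close>

lemma open_pdf:
  assumes c: "\<And>i j. continuous_on UNIV (\<lambda>z. ent (F z) i j)" and sF: "\<And>z. shaped m m (F z)" and hF: "\<And>z. adj (F z) = F z"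
  shows "open {z :: complex. pdf m (F z)}"
proof (rule openI)
  fix z0 assume "z0 \<in> {z. pdf m (F z)}"
  then obtain e where e: "e > 0" "\<And>x. shaped m 1 x \<Longrightarrow> e * nrm2 x \<le> Re (ip x (F z0 * x))"
    using pdf_lower_bound[of m "F z0"] by auto
  define N where "N z = (\<Sum>i<m. \<Sum>k<m. (cmod (ent (F z) i k - ent (F z0) i k))\<^sup>2)" for z
  have "continuous_on UNIV N" unfolding N_def by (intro continuous_intros c)
  then have "isCont N z0" by (simp add: continuous_on_eq_continuous_at)
  then have "(N \<longlongrightarrow> N z0) (at z0)" by (simp add: isCont_def)
  moreover have "N z0 < e\<^sup>2" using e by (simp add: N_def)
  ultimately have "eventually (\<lambda>z. N z < e\<^sup>2) (at z0)" by (rule order_tendstoD)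
  then obtain d where d: "d > 0" "\<And>z. z \<noteq> z0 \<Longrightarrow> dist z z0 < d \<Longrightarrow> N z < e\<^sup>2"
    by (auto simp: eventually_at)
  have "pdf m (F z)" if "z \<in> ball z0 d" for z
  proof -
    have Nz: "N z < e\<^sup>2"
      using d(2)[of z] that \<open>N z0 < e\<^sup>2\<close> by (cases "z = z0") (auto simp: dist_commute)
    have "0 < Re (ip x (F z * x))" if x: "shaped m 1 x" "x \<noteq> 0" for x
    proof -
      define D where "D = F z - F z0"
      have sD: "shaped m m D" using sF by (auto simp: D_def)
      have nx: "nrm2 x > 0" using x nrm2_eq_0_iff[OF x(1)] nrm2_nonneg[of x] by linarith
      have "nrm2 (D * x) \<le> N z * nrm2 x"
        using nrm2_mult_le[OF sD x(1)] by (simp add: N_def D_def)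
      then have "nrm2 x * nrm2 (D * x) \<le> nrm2 x * (N z * nrm2 x)" using nx by simp
      moreover have "(cmod (ip x (D * x)))\<^sup>2 \<le> nrm2 x * nrm2 (D * x)"
        by (rule ip_Cauchy_Schwarz[OF x(1) shaped_mult[OF sD x(1)]])
      moreover have "nrm2 x * (N z * nrm2 x) < (e * nrm2 x)\<^sup>2"
        using Nz nx by (simp add: power2_eq_square)
      ultimately have "(cmod (ip x (D * x)))\<^sup>2 < (e * nrm2 x)\<^sup>2" by linarith
      moreover have "0 \<le> e * nrm2 x" using e(1) nx by simp
      ultimately have "cmod (ip x (D * x)) < e * nrm2 x" by (rule power2_less_imp_less)
      then have "\<bar>Re (ip x (D * x))\<bar> < e * nrm2 x" using abs_Re_le_cmod[of "ip x (D * x)"] by linarith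
      moreover have "Re (ip x (F z * x)) = Re (ip x (F z0 * x)) + Re (ip x (D * x))"
        by (simp add: D_def left_diff_distrib ip_simps)
      ultimately show ?thesis using e(2)[OF x(1)] by linarith
    qed
    then show ?thesis using sF hF by (simp add: pdf_def)
  qed
  then show "\<exists>d>0. ball z0 d \<subseteq> {z. pdf m (F z)}" using d(1) by blast
qed

section \<open>Holomorphy points and values of all interpolants\<close>

context resolvent
begin

abbreviation "aw z \<equiv> complex_of_real ((cmod z)\<^sup>2)"
definition "PhiR z = adj (tav z) * tav z - sc (aw z) (adj (pav z) * pav z)"
definition "CcR z = adj (tav z) * siv z - sc (aw z) (adj (pav z) * rav z)"
definition "PsiR z = gv z * adj (gv z) - sc (aw z) (dv z * adj (dv z))"
definition "MmR z = av z * adj (gv z) - sc (aw z) (bv z * adj (dv z))"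

definition "interp F \<longleftrightarrow> mero_disk m F \<and> 0 \<in> hol_pts m F \<and>
  (\<forall>z\<in>hol_pts m F. psdf m (J - adj (to_f (F z)) * J * to_f (F z))) \<and> feq (Suc n) f (ftay m F)"


lemma pdf_PsiR_inverse:
  assumes "pdf m (PsiR z)"
  obtains gi where "inverse_pair m (gv z) gi"
proof -
  have "shaped m m (adj (gv z))" by auto
  then obtain b where b: "inverse_pair m (adj (gv z)) b"
  proof (rule kernel_zero_inverse_pair)
    fix u assume u: "shaped m 1 u" "adj (gv z) * u = 0"
    have "Re (ip u (PsiR z * u)) = nrm2 (adj (gv z) * u) - (cmod z)\<^sup>2 * nrm2 (adj (dv z) * u)"
      by (simp add: PsiR_def left_diff_distrib ip_simps sc_mult_left nrm2_def ip_mult_left mult.assoc)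
    then have "\<not> 0 < Re (ip u (PsiR z * u))" using u(2) nrm2_nonneg[of "adj (dv z) * u"] by (simp add: not_less)
    then show "u = 0" using assms u(1) unfolding pdf_def by blast
  qed blast
  from inverse_pair_adj[OF this] that show thesis by simp
qed

text \<open>\<open>PsiR z\<close> is congruent to \<open>1 - x * adj x\<close> with
  \<open>x = sc z (gi * dv z)\<close>. The step to \<open>1 - adj x * x\<close>, the form that the
  spectral norm sees, is \<open>pdf_adjoint\<close> for the trivial signature
  \<open>idm m\<close>.\<close>

lemma pdf_PsiR_iff:
  assumes g: "inverse_pair m (gv z) gi"
  shows "pdf m (PsiR z) \<longleftrightarrow> pdf m (E - adj (sc z (gi * dv z)) * sc z (gi * dv z))"
proof -
  define x where "x = sc z (gi * dv z)"
  have sx: "shaped m m x" "shaped m m (adj x)" using g by (auto simp: x_def inverse_pair_def intro!: shaped_intros(5,8) shaped_mult[of m m])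
  interpret I: signature m "idm m" by unfold_locales (simp_all add: shaped_left[OF shaped_intros(6)])
  have gx: "gv z * x = sc z (dv z)"
    unfolding x_def sc_mult_right by (simp only: inverse_pair_cancel[OF inverse_pair_sym[OF g] fev_shaped])
  have "gv z * (E - x * adj x) * adj (gv z) = gv z * adj (gv z) - (gv z * x) * adj (gv z * x)"
    by (simp add: right_diff_distrib left_diff_distrib mult.assoc shaped_left[OF shaped_intros(8)[OF fev_shaped]])
  also have "\<dots> = PsiR z"
  proof -
    have "cnj z * z = (complex_of_real (cmod z))\<^sup>2" by (metis complex_norm_square mult.commute of_real_power)
    then show ?thesis unfolding gx PsiR_def by (simp add: sc_mult_left sc_mult_right)
  qed
  finally have "pdf m (PsiR z) \<longleftrightarrow> pdf m (E - x * adj x)"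
    using pdf_congruence[OF g, of "E - x * adj x"] sx by (auto intro: shaped_mult)
  also have "\<dots> \<longleftrightarrow> pdf m (E - adj x * x)"
    using I.pdf_adjoint[OF sx(1)] I.pdf_adjoint[OF sx(2)] sx by (auto simp: shaped_right[OF sx(1)] shaped_right[OF sx(2)])
  finally show ?thesis by (simp add: x_def)
qed

lemma PsiR_shaped: "shaped m m (PsiR z)" "adj (PsiR z) = PsiR z"
  by (auto simp: PsiR_def intro!: shaped_intros(3,5) shaped_mult[of m m])

lemma open_pdf_PsiR: "open {z. pdf m (PsiR z)}"
proof (rule open_pdf[OF _ PsiR_shaped])
  fix i j
  have c: "continuous_on UNIV (\<lambda>z. ent (gv z) i j)" "continuous_on UNIV (\<lambda>z. ent (dv z) i j)" for i j
    using hol4 by (blast intro: holomorphic_on_imp_continuous_on)+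
  show "continuous_on UNIV (\<lambda>z. ent (PsiR z) i j)"
    unfolding PsiR_def ent_diff ent_sc ent_mult[OF fev_shaped] ent_adj by (intro continuous_intros c)
qed

lemma PsiR_0: "PsiR 0 = r * r"
  using values_0(1) r(2) by (simp add: PsiR_def)

lemma dK_inverse:
  assumes P: "pdf m (PsiR z)" and k: "contr m k"
  obtains d where "inverse_pair m (dK k z) d"
proof (cases "z = 0")
  case True
  then have "dK k z = r" using values_0(1) by simp
  then show thesis using that r(1) by simp
next
  case False
  interpret fr: frame m n z "av z" "bv z" "gv z" "dv z" "rav z" "pav z" "tav z" "siv z" by (rule frame_at[OF False])
  have P': "pdf m fr.Psi" using P unfolding fr.Psi_def PsiR_def .
  show thesis
    by (rule kernel_zero_inverse_pair[OF shaped_dK_nK(1)])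
       (use k in \<open>auto simp: contr_def intro: that fr.pdf_Psi_kernel[OF P' k]\<close>)
qed

text \<open>Near \<open>w\<close> the interpolant is a quotient whose denominator is invertible at
  \<open>w\<close>. It therefore has a finite limit there, which rules out the pole alternative of
  \<open>mero_disk\<close> and leaves holomorphy.\<close>

lemma interp_hol:
  assumes F: "interp F" and P: "pdf m (PsiR w)" and w: "w \<in> ball 0 1"
  shows "w \<in> hol_pts m F"
proof -
  have c: "F z \<in> carrier_mat m m" for z using F by (simp add: interp_def mero_disk_def)
  have iso: "\<not> p islimpt (ball 0 1 - hol_pts m F)" if "p \<in> ball 0 1" for p
    using F that by (simp add: interp_def mero_disk_def)
  obtain K where K: "\<And>i j. (\<lambda>z. ent (K z) i j) holomorphic_on ball 0 1" "\<And>z. z \<in> ball 0 1 \<Longrightarrow> contr m (K z)"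
    and eq: "\<And>z. z \<in> hol_pts m F \<Longrightarrow> to_f (F z) * dK (K z) z = nK (K z) z"
    by (rule PJ0_parametrized[OF c _ iso]) (use F in \<open>auto simp: interp_def\<close>)
  have sK: "shaped m m (K z)" if "z \<in> ball 0 1" for z using K(2)[OF that] by (simp add: contr_def)
  have hol: "(\<lambda>z. ent (dK (K z) z) i j) holomorphic_on ball 0 1" "(\<lambda>z. ent (nK (K z) z) i j) holomorphic_on ball 0 1" for i j
    unfolding ent_add ent_sc by (intro holomorphic_intros mult_holomorphic[of m m] hol4 fev_shaped K(1))+
  define N where "N z = to_m m m (dK (K z) z)" for z
  define d where "d z = Determinant.det (N z)" for z
  define q where "q i j z = ent (nK (K z) z * to_f (adj_mat (N z))) i j / d z" for i j z
  have hold: "d holomorphic_on ball 0 1"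
    unfolding d_def N_def by (rule det_holomorphic[where k = m]) (simp_all only: to_m_carrier to_m_index hol)
  have sn: "shaped m m (nK (K z) z)" "shaped m m (dK (K z) z)" if "z \<in> ball 0 1" for z
    using shaped_dK_nK[OF sK[OF that]] by auto
  have holn: "(\<lambda>z. ent (nK (K z) z * to_f (adj_mat (N z))) i j) holomorphic_on ball 0 1" for i j
  \<comment> \<open>The shape of \<open>nK (K z) z\<close> is known only inside the disk, so the
    product is expanded into a finite sum first.\<close>
  proof (rule holomorphic_transform)
    show "(\<lambda>z. \<Sum>l<m. ent (nK (K z) z) i l * ent (to_f (adj_mat (N z))) l j) holomorphic_on ball 0 1"
      unfolding N_def by (intro holomorphic_intros hol adj_mat_holomorphic)
  qed (simp add: ent_mult[OF sn(1)])
  obtain b where "inverse_pair m (dK (K w) w) b" using dK_inverse[OF P K(2)[OF w]] .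
  then have dw: "d w \<noteq> 0" using inverse_pair_det unfolding d_def N_def by fastforce
  have cont: "isCont d w" "isCont (q i j) w" for i j
  proof -
    show "isCont d w" using hold w by (metis continuous_on_eq_continuous_at holomorphic_on_imp_continuous_on open_ball)
    then show "isCont (q i j) w" unfolding q_def using dw holn[of i j] w
      by (intro continuous_intros) (auto dest!: holomorphic_on_imp_continuous_on simp: continuous_on_eq_continuous_at)
  qed
  have Fq: "F z $$ (i, j) = q i j z" if z: "z \<in> hol_pts m F" "d z \<noteq> 0" and ij: "i < m" "j < m" for z i j
  proof -
    have zb: "z \<in> ball 0 1" using z(1) by (simp add: hol_pts_def)
    obtain b where b: "inverse_pair m (dK (K z) z) b" "b = sc (inverse (d z)) (to_f (adj_mat (N z)))"
      using det_nonzero_inverse_pair[OF sn(2)[OF zb]] z(2) unfolding d_def N_def by blast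
    have "to_f (F z) = to_f (F z) * dK (K z) z * b"
      by (rule inverse_pair_cancel_right[OF b(1), symmetric]) (use c in auto)
    also have "\<dots> = nK (K z) z * b" by (simp only: eq[OF z(1)])
    finally have "ent (to_f (F z)) i j = q i j z" by (simp add: b(2) q_def sc_mult_right divide_inverse mult.commute)
    then show ?thesis using ij carrier_matD[OF c[of z]] by simp
  qed
  have ev: "eventually (\<lambda>z. z \<in> hol_pts m F \<and> d z \<noteq> 0) (at w)"
  proof -
    have "eventually (\<lambda>z. z \<notin> ball 0 1 - hol_pts m F) (at w)" using iso[OF w] by (simp add: islimpt_iff_eventually)
    moreover have "eventually (\<lambda>z. z \<in> ball 0 1 - {w}) (at w)" using w by (intro eventually_at_in_open) auto
    moreover have "eventually (\<lambda>z. d z \<noteq> 0) (at w)"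
      using cont(1) dw unfolding isCont_def by (rule tendsto_imp_eventually_ne)
    ultimately show ?thesis by eventually_elim auto
  qed
  have "(\<lambda>z. F z $$ (i, j)) analytic_on {w}" if ij: "i < m" "j < m" for i j
  proof -
    have "((\<lambda>z. F z $$ (i, j)) \<longlongrightarrow> q i j w) (at w)"
      by (rule Lim_transform_eventually[OF cont(2)[unfolded isCont_def]]) (use ev in \<open>eventually_elim; simp add: Fq ij\<close>)
    then have "\<not> filterlim (\<lambda>z. F z $$ (i, j)) at_infinity (at w)"
      using not_tendsto_and_filterlim_at_infinity[OF at_neq_bot] by blast
    moreover have "(\<lambda>z. F z $$ (i, j)) analytic_on {w} \<or> filterlim (\<lambda>z. F z $$ (i, j)) at_infinity (at w)"
      using F w ij unfolding interp_def mero_disk_def by blast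
    ultimately show ?thesis by blast
  qed
  then show ?thesis using w by (simp add: hol_pts_def)
qed

lemma interp_parameter:
  assumes k: "contr m k"
  shows "\<exists>F. interp F \<and> (\<forall>z\<in>hol_pts m F. to_f (F z) * dK k z = nK k z)"
proof (rule constant_parameter[OF k])
  fix F assume F: "mero_disk m F" "0 \<in> hol_pts m F"
    "\<And>z. z \<in> hol_pts m F \<Longrightarrow> psdf m (J - adj (to_f (F z)) * J * to_f (F z))"
    "feq (Suc n) f (ftay m F)" and eq: "\<And>z. z \<in> hol_pts m F \<Longrightarrow> to_f (F z) * dK k z = nK k z"
  then have "interp F" unfolding interp_def by (intro conjI ballI)
  with eq show "\<exists>F. interp F \<and> (\<forall>z\<in>hol_pts m F. to_f (F z) * dK k z = nK k z)" by (intro exI conjI ballI)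
qed

text \<open>If \<open>PsiR w\<close> is not positive definite, some constant parameter has a
  denominator with a null vector \<open>x\<close> at \<open>w\<close>. Were its interpolant
  holomorphic there, the numerator would annihilate \<open>x\<close> too, against the left
  invertibility of the resolvent matrix.\<close>

lemma hol_at_iff:
  assumes w: "w \<in> ball 0 1"
  shows "(\<forall>F. interp F \<longrightarrow> w \<in> hol_pts m F) \<longleftrightarrow> pdf m (PsiR w)"
proof
  assume all: "\<forall>F. interp F \<longrightarrow> w \<in> hol_pts m F"
  show "pdf m (PsiR w)"
  proof (cases "w = 0")
    case True
    show ?thesis using pdf_square[OF r(1)] by (simp add: True PsiR_0 r(2))
  next
    case False
    interpret fr: frame m n w "av w" "bv w" "gv w" "dv w" "rav w" "pav w" "tav w" "siv w" by (rule frame_at[OF False])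
    show ?thesis
    proof (rule ccontr)
      assume "\<not> ?thesis"
      then have "\<not> pdf m fr.Psi" unfolding fr.Psi_def PsiR_def .
      then obtain k x where k: "contr m k" and x: "shaped m 1 x" "x \<noteq> 0" "dK k w * x = 0"
        using fr.not_pdf_Psi by blast
      obtain F where F: "interp F" and eq: "\<And>z. z \<in> hol_pts m F \<Longrightarrow> to_f (F z) * dK k z = nK k z"
        using interp_parameter[OF k] by (elim exE conjE) auto
      have "to_f (F w) * (dK k w * x) = nK k w * x"
        using all F eq[of w] by (simp flip: mult.assoc)
      then have n0: "nK k w * x = 0" using x(3) by simp
      have "rav w * (dK k w * x) - pav w * (nK k w * x) =
          (rav w * gv w - pav w * av w) * x + sc w ((rav w * dv w - pav w * bv w) * (k * x))"
        by (simp add: distrib_left distrib_right left_diff_distrib sc_mult_left sc_mult_right sc_diff_right mult.assoc)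
      also have "\<dots> = sc (w ^ n) x" using x(1) by (simp add: fr.l1 fr.l4 sc_mult_left shaped_left)
      finally have "sc (w ^ n) x = 0" using x(3) n0 by simp
      then show False using x(2) False by (simp add: sc_eq_0)
    qed
  qed
qed (use interp_hol w in blast)

text \<open>The value at \<open>w\<close> depends on the parameter only through the contraction
  \<open>K w\<close>, and the constant parameter with this value produces the same matrix.\<close>

lemma value_iff:
  assumes w: "w \<in> ball 0 1" and P: "pdf m (PsiR w)" and X: "shaped m m X"
  shows "(\<exists>F. interp F \<and> to_f (F w) = X) \<longleftrightarrow>
    (\<exists>k. contr m k \<and> X * dK k w = nK k w \<and> (\<exists>d. inverse_pair m (dK k w) d))"
proof
  assume "\<exists>F. interp F \<and> to_f (F w) = X"
  then obtain F where F: "interp F" "to_f (F w) = X" by blast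
  have c: "F z \<in> carrier_mat m m" for z using F by (simp add: interp_def mero_disk_def)
  have iso: "\<not> p islimpt (ball 0 1 - hol_pts m F)" if "p \<in> ball 0 1" for p
    using F that by (simp add: interp_def mero_disk_def)
  obtain K where K: "\<And>z. z \<in> ball 0 1 \<Longrightarrow> contr m (K z)"
    and eq: "\<And>z. z \<in> hol_pts m F \<Longrightarrow> to_f (F z) * dK (K z) z = nK (K z) z"
    by (rule PJ0_parametrized[OF c _ iso]) (use F in \<open>auto simp: interp_def\<close>)
  show "\<exists>k. contr m k \<and> X * dK k w = nK k w \<and> (\<exists>d. inverse_pair m (dK k w) d)"
  proof (rule exI[of _ "K w"], intro conjI K[OF w])
    show "X * dK (K w) w = nK (K w) w" using eq[OF interp_hol[OF F(1) P w]] by (simp only: F(2))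
    obtain d where "inverse_pair m (dK (K w) w) d" using dK_inverse[OF P K[OF w]] .
    then show "\<exists>d. inverse_pair m (dK (K w) w) d" ..
  qed
next
  assume "\<exists>k. contr m k \<and> X * dK k w = nK k w \<and> (\<exists>d. inverse_pair m (dK k w) d)"
  then obtain k d where k: "contr m k" "X * dK k w = nK k w" "inverse_pair m (dK k w) d" by blast
  obtain F where F: "interp F" and eq: "\<And>z. z \<in> hol_pts m F \<Longrightarrow> to_f (F z) * dK k z = nK k z"
    using interp_parameter[OF k(1)] by (elim exE conjE) auto
  have sF: "shaped m m (to_f (F w))" using F by (auto simp: interp_def mero_disk_def)
  have "to_f (F w) = to_f (F w) * dK k w * d" by (rule inverse_pair_cancel_right[OF k(3) sF, symmetric])
  also have "\<dots> = X * dK k w * d" by (simp only: eq[OF interp_hol[OF F P w]] k(2))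
  also have "\<dots> = X" by (rule inverse_pair_cancel_right[OF k(3) X])
  finally show "\<exists>F. interp F \<and> to_f (F w) = X" using F by blast
qed

lemma interp_exists: obtains F where "interp F"
proof -
  have "contr m 0" by (simp add: contr_def nrm2_nonneg)
  from interp_parameter[OF this] show thesis using that by (elim exE conjE)
qed

lemma ball_R:
  assumes w: "w \<in> ball 0 1" "w \<noteq> 0" and P: "pdf m (PsiR w)"
  shows "pdf m (PhiR w)"
    "inverse_pair m (PhiR w) Phi' \<Longrightarrow> inverse_pair m (PsiR w) Psi' \<Longrightarrow> MmR w = Phi' * CcR w * PsiR w"
    "inverse_pair m (PhiR w) Phi' \<Longrightarrow> inverse_pair m (PsiR w) Psi' \<Longrightarrow> pdf m s1 \<Longrightarrow> s1 * s1 = Phi' \<Longrightarrow>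
      pdf m s2 \<Longrightarrow> s2 * s2 = Psi' \<Longrightarrow> shaped m m X \<Longrightarrow>
      (\<exists>F. interp F \<and> to_f (F w) = X) \<longleftrightarrow>
      (\<exists>K. contr m K \<and> X = Phi' * CcR w + sc (of_real (cmod w ^ (n + 1))) (s1 * K * s2))"
proof -
  interpret fr: frame m n w "av w" "bv w" "gv w" "dv w" "rav w" "pav w" "tav w" "siv w" by (rule frame_at[OF w(2)])
  have e: "fr.Phi = PhiR w" "fr.Cc = CcR w" "fr.Psi = PsiR w" "fr.Mm = MmR w"
    by (simp_all only: fr.Phi_def fr.Cc_def fr.Psi_def fr.Mm_def PhiR_def CcR_def PsiR_def MmR_def)
  show "pdf m (PhiR w)" by (rule fr.Phi_pdf[unfolded e]) (rule fr.pdf_Psi_kernel[unfolded e, OF P])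
  show "MmR w = Phi' * CcR w * PsiR w" if a: "inverse_pair m (PhiR w) Phi'" "inverse_pair m (PsiR w) Psi'"
  proof -
    have "Phi' * (PhiR w * MmR w) = MmR w"
      by (rule inverse_pair_cancel[OF a(1)]) (use fr.shaped_defs(5) e in simp)
    then show ?thesis using fr.Phi_Mm unfolding e by (simp add: mult.assoc)
  qed
  show "(\<exists>F. interp F \<and> to_f (F w) = X) \<longleftrightarrow>
      (\<exists>K. contr m K \<and> X = Phi' * CcR w + sc (of_real (cmod w ^ (n + 1))) (s1 * K * s2))"
    if "inverse_pair m (PhiR w) Phi'" "inverse_pair m (PsiR w) Psi'" "pdf m s1" "s1 * s1 = Phi'"
      "pdf m s2" "s2 * s2 = Psi'" "shaped m m X"
    unfolding value_iff[OF w(1) P that(7)] fr.lft_iff[OF that(7)]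
    by (rule fr.ball_iff(2)[unfolded e]) (rule that)+
qed

lemma det_PhiR:
  assumes w: "w \<in> ball 0 1" and P: "pdf m (PsiR w)"
  shows "fdet m (PhiR w) = fdet m (PsiR w)"
proof -
  obtain gi where g: "inverse_pair m (gv w) gi" using pdf_PsiR_inverse[OF P] .
  have "aw w = 0 \<or> gv w * pav w = dv w * tav w"
  proof (cases "w = 0")
    case False
    interpret fr: frame m n w "av w" "bv w" "gv w" "dv w" "rav w" "pav w" "tav w" "siv w" by (rule frame_at[OF False])
    show ?thesis using fr.right_identities(3) by simp
  qed simp
  then show ?thesis
    unfolding PhiR_def PsiR_def
    by (rule defect_det[OF fev_shaped fev_shaped value_shaped(3,2) g _ fdet_value_modulus]) (use w in simp)
qed

end

section \<open>Return to the matrices and functions of the statement\<close>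

context potapov
begin

abbreviation "\<PP> \<equiv> PJ0_int m Jm n A"

lemma PJ0_int_iff: "F \<in> \<PP> \<longleftrightarrow> res.interp F"
proof (cases "mero_disk m F")
  case True
  then have c: "F z \<in> carrier_mat m m" for z by (simp add: mero_disk_def)
  have jc: "J_contractive Jm (F z) \<longleftrightarrow> psdf m (J - adj (to_f (F z)) * J * to_f (F z))" for z
  proof -
    have "Jm - madj (F z) * Jm * F z \<in> carrier_mat m m" using Jm(1) c[of z] by auto
    then show ?thesis
      unfolding J_contractive_def psd_iff using Jm(1) c[of z] by (simp add: psd_iff to_f_diff to_f_mult to_f_madj J_def)
  qed
  have tc: "taylor_coeff m F j = A j \<longleftrightarrow> fser \<section> j = ftay m F \<section> j" if "j \<le> n" for j
  proof -
    have "taylor_coeff m F j \<in> carrier_mat m m" by (simp add: taylor_coeff_def)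
    then have "taylor_coeff m F j = A j \<longleftrightarrow> to_f (A j) = to_f (taylor_coeff m F j)"
      using to_f_inject[OF A_carrier[OF that]] by auto
    then show ?thesis using that by (simp add: fser_def a_def ftay_def)
  qed
  show ?thesis
    using True by (simp add: PJ0_int_def PJ0_def res.interp_def feq_def less_Suc_eq_le jc tc)
qed (simp add: PJ0_int_def PJ0_def res.interp_def)

lemma hol_points: "unit_disk \<inter> \<Inter> {hol_pts m f | f. f \<in> \<PP>} = unit_disk \<inter> {w. pdf m (res.PsiR w)}"
proof -
  have "w \<in> \<Inter> {hol_pts m f | f. res.interp f} \<longleftrightarrow> (\<forall>F. res.interp F \<longrightarrow> w \<in> hol_pts m F)" for w by blast
  then show ?thesis using res.hol_at_iff unfolding PJ0_int_iff by fast
qed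

lemma hol_points_nhd: "open (unit_disk \<inter> {w. pdf m (res.PsiR w)})" "\<exists>e>0. ball 0 e \<subseteq> unit_disk \<inter> {w. pdf m (res.PsiR w)}"
proof -
  show o: "open (unit_disk \<inter> {w. pdf m (res.PsiR w)})"
    by (intro open_Int open_ball res.open_pdf_PsiR)
  have "pdf m (res.PsiR 0)" using pdf_square[OF rl(1)] by (simp add: res.PsiR_0 rl(5))
  then have "0 \<in> unit_disk \<inter> {w. pdf m (res.PsiR w)}" by simp
  then obtain e where "e > 0" "ball 0 e \<subseteq> unit_disk \<inter> {w. pdf m (res.PsiR w)}" by (rule openE[OF o])
  then show "\<exists>e>0. ball 0 e \<subseteq> unit_disk \<inter> {w. pdf m (res.PsiR w)}" by (intro exI conjI)
qed

abbreviation "mu w \<equiv> complex_of_real ((cmod w)\<^sup>2)"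
abbreviation "tpi \<equiv> tilde m n fn_pi"
abbreviation "trho \<equiv> tilde m n fn_rho"
abbreviation "tsigma \<equiv> tilde m n fn_sigma"
abbreviation "ttau \<equiv> tilde m n fn_tau"
abbreviation "Lm \<equiv> Lmat m Jm A n"
abbreviation "Rm \<equiv> Rmat m Jm A n"

definition "Xi w = w \<cdot>\<^sub>m (msqrt Rm * minv (fn_rho w) * Jm * tsigma w * minv (msqrt Lm))"
definition "PhiM w = madj (fn_tau w) * minv Lm * fn_tau w - mu w \<cdot>\<^sub>m (Jm * madj (tpi w) * minv Rm * tpi w * Jm)"
definition "PsiM w = fn_rho w * minv Rm * madj (fn_rho w) - mu w \<cdot>\<^sub>m (Jm * tsigma w * minv Lm * madj (tsigma w) * Jm)"
definition "CcM w = madj (fn_tau w) * minv Lm * fn_sigma w - mu w \<cdot>\<^sub>m (Jm * madj (tpi w) * minv Rm * trho w * Jm)"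
definition "MmM w = fn_pi w * minv Rm * madj (fn_rho w) - mu w \<cdot>\<^sub>m (Jm * ttau w * minv Lm * madj (tsigma w) * Jm)"

lemma matrices:
  "PhiM w \<in> carrier_mat m m" "to_f (PhiM w) = res.PhiR w"
  "PsiM w \<in> carrier_mat m m" "to_f (PsiM w) = res.PsiR w"
  "CcM w \<in> carrier_mat m m" "to_f (CcM w) = res.CcR w"
  "MmM w \<in> carrier_mat m m" "to_f (MmM w) = res.MmR w"
proof -
  note c = Jm(1) funs(2,4,6,8)[of w] tilde_values(2,4,6,8)[of w] minv_RL(2,4)
  note d = c[THEN carrier_matD(1)] c[THEN carrier_matD(2)]
  show "PhiM w \<in> carrier_mat m m" "PsiM w \<in> carrier_mat m m" "CcM w \<in> carrier_mat m m" "MmM w \<in> carrier_mat m m"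
    unfolding PhiM_def PsiM_def CcM_def MmM_def by (rule carrier_matI; simp only: index_minus_mat index_mult_mat index_smult_mat madj_dims d)+
  show "to_f (PhiM w) = res.PhiR w" "to_f (PsiM w) = res.PsiR w" "to_f (CcM w) = res.CcR w" "to_f (MmM w) = res.MmR w"
    by (simp_all add: PhiM_def PsiM_def CcM_def MmM_def res.PhiR_def res.PsiR_def res.CcR_def res.MmR_def fn_values
        to_f_diff to_f_mult to_f_madj to_f_smult d minv_RL rl J J_def[symmetric] mult.assoc)
qed

lemma rho_inverse_iff: "Determinant.det (fn_rho w) \<noteq> 0 \<longleftrightarrow> (\<exists>gi. inverse_pair m (res.gv w) gi)"
proof
  note c = funs(2)[of w]
  assume "Determinant.det (fn_rho w) \<noteq> 0"
  then have "fdet m (to_f (fn_rho w)) \<noteq> 0" using c by (simp add: to_m_to_f)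
  then obtain b where "inverse_pair m (to_f (fn_rho w)) b" by (rule det_nonzero_inverse_pair[OF shaped_to_f'[OF c]])
  then show "\<exists>gi. inverse_pair m (res.gv w) gi" unfolding fn_values using inverse_pair_mult[OF _ rl(1)] by (intro exI)
next
  note c = funs(2)[of w]
  assume "\<exists>gi. inverse_pair m (res.gv w) gi"
  then obtain gi where "inverse_pair m (res.gv w * sR) (r * gi)" using inverse_pair_mult inverse_pair_sym[OF rl(1)] by blast
  moreover have "res.gv w * sR = to_f (fn_rho w)"
    unfolding fn_values by (rule inverse_pair_cancel_right[OF rl(1) shaped_to_f'[OF c]])
  ultimately have "inverse_pair m (to_f (fn_rho w)) (r * gi)" by simp
  from inverse_pair_det[OF this] show "Determinant.det (fn_rho w) \<noteq> 0" using c by (auto simp: to_m_to_f)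
qed

text \<open>In \<open>msqrt Rm * minv (fn_rho w)\<close> the root cancels the factor
  \<open>r\<close> of \<open>gv\<close>; what remains is \<open>w\<close> times the quotient of the
  two lower entries of the resolvent matrix.\<close>

lemma Xi_value:
  assumes g: "inverse_pair m (res.gv w) gi"
  shows "Xi w \<in> carrier_mat m m" "to_f (Xi w) = sc w (gi * res.dv w)"
proof -
  have sgi: "shaped m m gi" using g by (simp add: inverse_pair_def)
  note c0 = funs(2)[of w]
  have "inverse_pair m (res.gv w * sR) (r * gi)" by (rule inverse_pair_mult[OF g inverse_pair_sym[OF rl(1)]])
  moreover have "res.gv w * sR = to_f (fn_rho w)"
    unfolding fn_values by (rule inverse_pair_cancel_right[OF rl(1) shaped_to_f'[OF c0]])
  ultimately have "inverse_pair m (to_f (fn_rho w)) (r * gi)" by simp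
  from minv_inverse_pair[OF c0 this] have i: "minv (fn_rho w) \<in> carrier_mat m m" "to_f (minv (fn_rho w)) = r * gi"
    by simp_all
  note c = Jm(1) tilde_values(8)[of w] sqrt_RL(1) rl(8) i(1)
  note d = c[THEN carrier_matD(1)] c[THEN carrier_matD(2)]
  show "Xi w \<in> carrier_mat m m" unfolding Xi_def by (rule carrier_matI; simp only: index_mult_mat index_smult_mat d)
  have "to_f (Xi w) = sc w (sR * (r * gi) * (J * (to_f (tsigma w) * l)))"
    by (simp add: Xi_def to_f_mult to_f_smult d i(2) J_def sR_def l_def mult.assoc)
  also have "sR * (r * gi) = gi" by (rule inverse_pair_cancel[OF rl(1) sgi])
  finally show "to_f (Xi w) = sc w (gi * res.dv w)" by (simp only: fn_values)
qed

lemma hol_at_criterion: "pdf m (res.PsiR w) \<longleftrightarrow> Determinant.det (fn_rho w) \<noteq> 0 \<and> spec_norm (Xi w) < 1"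
proof (cases "\<exists>gi. inverse_pair m (res.gv w) gi")
  case True
  then obtain gi where g: "inverse_pair m (res.gv w) gi" by blast
  show ?thesis
    unfolding rho_inverse_iff res.pdf_PsiR_iff[OF g] spec_norm_less_1_iff[OF Xi_value(1)[OF g]] Xi_value(2)[OF g]
    using True by blast
next
  case False
  then show ?thesis unfolding rho_inverse_iff using res.pdf_PsiR_inverse by blast
qed

lemma values_at_0: "res.CcR 0 = (l * l) * a 0" "res.MmR 0 = a 0 * (r * r)" "res.PhiR 0 = l * l" "res.PsiR 0 = r * r"
proof -
  have s: "to_f (fn_sigma 0) = a 0" "to_f (fn_pi 0) = a 0"
    unfolding funs by (subst sum.remove[of _ n] sum.remove[of _ 0]; auto simp: ends power_0_left intro!: sum.neutral)+
  show "res.CcR 0 = (l * l) * a 0" "res.MmR 0 = a 0 * (r * r)" "res.PhiR 0 = l * l" "res.PsiR 0 = r * r"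
    unfolding res.CcR_def res.MmR_def res.PhiR_def res.PsiR_def res.values_0
    by (simp_all add: fn_values(2,6) s rl mult.assoc)
qed

lemma value_ball:
  assumes w: "w \<in> ball 0 1" and P: "pdf m (res.PsiR w)" 
  shows "pdf m (res.PhiR w)"
    "inverse_pair m (res.PhiR w) Phi' \<Longrightarrow> inverse_pair m (res.PsiR w) Psi' \<Longrightarrow> res.MmR w = Phi' * res.CcR w * res.PsiR w"
    "inverse_pair m (res.PhiR w) Phi' \<Longrightarrow> inverse_pair m (res.PsiR w) Psi' \<Longrightarrow> pdf m s1 \<Longrightarrow> s1 * s1 = Phi' \<Longrightarrow>
      pdf m s2 \<Longrightarrow> s2 * s2 = Psi' \<Longrightarrow> shaped m m X \<Longrightarrow>
      (\<exists>F. res.interp F \<and> to_f (F w) = X) \<longleftrightarrow>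
      (\<exists>K. contr m K \<and> X = Phi' * res.CcR w + sc (of_real (cmod w ^ (n + 1))) (s1 * K * s2))"
proof -
  have M0: "Phi' * res.CcR 0 = a 0" if "inverse_pair m (res.PhiR 0) Phi'"
    using inverse_pair_cancel[OF that a_shaped] by (simp add: values_at_0)
  show "pdf m (res.PhiR w)"
    using res.ball_R(1)[OF w _ P] pdf_square[OF rl(2)] by (cases "w = 0") (simp_all add: values_at_0 rl)
  show "res.MmR w = Phi' * res.CcR w * res.PsiR w"
    if "inverse_pair m (res.PhiR w) Phi'" "inverse_pair m (res.PsiR w) Psi'"
    using res.ball_R(2)[OF w _ P that] M0 that by (cases "w = 0") (simp_all add: values_at_0(2,4))
  show "(\<exists>F. res.interp F \<and> to_f (F w) = X) \<longleftrightarrow>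
      (\<exists>K. contr m K \<and> X = Phi' * res.CcR w + sc (of_real (cmod w ^ (n + 1))) (s1 * K * s2))"
    if "inverse_pair m (res.PhiR w) Phi'" "inverse_pair m (res.PsiR w) Psi'" "pdf m s1" "s1 * s1 = Phi'"
      "pdf m s2" "s2 * s2 = Psi'" "shaped m m X"
  proof (cases "w = 0")
    case True
    have "to_f (F 0) = a 0" if "res.interp F" for F
    proof -
      have "taylor_coeff m F 0 = A 0" using that by (simp add: PJ0_int_iff[symmetric] PJ0_int_def)
      moreover have "F 0 \<in> carrier_mat m m" using that by (simp add: res.interp_def mero_disk_def)
      then have "taylor_coeff m F 0 = F 0" by (intro eq_matI) (auto simp: taylor_coeff_def)
      ultimately show ?thesis by (simp add: A0)
    qed
    moreover have "\<exists>F. res.interp F" using res.interp_exists by blast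
    moreover have "contr m 0" by (simp add: contr_def nrm2_nonneg)
    ultimately show ?thesis using True M0 that(1) by (auto simp: power_add)
  qed (rule res.ball_R(3)[OF w _ P that])
qed

lemma ball_description:
  assumes w: "w \<in> ball 0 1" and P: "pdf m (res.PsiR w)" 
  defines "M \<equiv> minv (PhiM w) * CcM w"
  shows "posdef (PhiM w)" "posdef (PsiM w)"
    "{f w | f. f \<in> \<PP>} = matrix_ball m M (complex_of_real (cmod w ^ (n + 1)) \<cdot>\<^sub>m msqrt (minv (PhiM w))) (msqrt (minv (PsiM w)))"
    "M = MmM w * minv (PsiM w)" "Determinant.det (minv (PhiM w)) = Determinant.det (minv (PsiM w))"
proof -
  note vb = value_ball[OF w P]
  show "posdef (PhiM w)" "posdef (PsiM w)" using vb(1) P by (simp_all add: posdef_iff[OF matrices(1)] posdef_iff[OF matrices(3)] matrices)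
  obtain Phi' where Phi: "inverse_pair m (res.PhiR w) Phi'" "pdf m Phi'" using pdf_inverse[OF vb(1)] by blast
  obtain Psi' where Psi: "inverse_pair m (res.PsiR w) Psi'" "pdf m Psi'" using pdf_inverse[OF P] by blast
  have LL: "minv (PhiM w) \<in> carrier_mat m m" "to_f (minv (PhiM w)) = Phi'"
    using minv_inverse_pair[OF matrices(1), of w Phi'] Phi(1) by (simp_all add: matrices)
  have RR: "minv (PsiM w) \<in> carrier_mat m m" "to_f (minv (PsiM w)) = Psi'"
    using minv_inverse_pair[OF matrices(3), of w Psi'] Psi(1) by (simp_all add: matrices)
  note s1 = msqrt_pdf[OF LL(1), unfolded LL(2), OF Phi(2)] and s2 = msqrt_pdf[OF RR(1), unfolded RR(2), OF Psi(2)]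
  have M: "M \<in> carrier_mat m m" "to_f M = Phi' * res.CcR w"
    using LL matrices(5,6)[of w] by (auto simp: M_def to_f_mult)
  note c = s1(1) s2(1) M(1)
  note d = c[THEN carrier_matD(1)] c[THEN carrier_matD(2)]
  define q where "q = complex_of_real (cmod w ^ (n + 1))"
  have vi: "(\<exists>F. res.interp F \<and> to_f (F w) = X) \<longleftrightarrow>
      (\<exists>K. contr m K \<and> X = to_f M + sc q (to_f (msqrt (minv (PhiM w))) * K * to_f (msqrt (minv (PsiM w)))))"
    if "shaped m m X" for X
    unfolding M(2) q_def by (rule vb(3)[OF Phi(1) Psi(1) s1(2,3) s2(2,3) that])
  let ?T = "\<lambda>K. M + q \<cdot>\<^sub>m msqrt (minv (PhiM w)) * K * msqrt (minv (PsiM w))"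
  have T: "?T K \<in> carrier_mat m m" "to_f (?T K) = to_f M + sc q (to_f (msqrt (minv (PhiM w))) * to_f K * to_f (msqrt (minv (PsiM w))))"
    if "K \<in> carrier_mat m m" for K
    using that by (auto simp: to_f_add to_f_mult to_f_smult d sc_mult_left intro!: carrier_matI)
  show "{f w | f. f \<in> \<PP>} = matrix_ball m M (complex_of_real (cmod w ^ (n + 1)) \<cdot>\<^sub>m msqrt (minv (PhiM w))) (msqrt (minv (PsiM w)))"
    unfolding q_def[symmetric]
  proof (intro equalityI subsetI)
    fix X assume "X \<in> {f w | f. f \<in> \<PP>}"
    then obtain F where F: "res.interp F" "X = F w" by (auto simp: PJ0_int_iff)
    then have X: "X \<in> carrier_mat m m" by (simp add: res.interp_def mero_disk_def)
    have "\<exists>F. res.interp F \<and> to_f (F w) = to_f X" using F by blast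
    then obtain K where K: "contr m K" "to_f X = to_f M + sc q (to_f (msqrt (minv (PhiM w))) * K * to_f (msqrt (minv (PsiM w))))"
      using vi[OF shaped_to_f'[OF X]] by blast
    have sK: "shaped m m K" using K(1) by (simp add: contr_def)
    have "X = ?T (to_m m m K)"
      by (rule to_f_inject[OF X T(1)[OF to_m_carrier]]) (simp only: T(2)[OF to_m_carrier] K(2) to_f_to_m[OF sK])
    moreover have "spec_norm (to_m m m K) \<le> 1" using K(1) sK by (simp add: spec_norm_le_1_iff[OF to_m_carrier])
    ultimately show "X \<in> matrix_ball m M (q \<cdot>\<^sub>m msqrt (minv (PhiM w))) (msqrt (minv (PsiM w)))"
      unfolding matrix_ball_def using to_m_carrier by blast
  next
    fix X assume "X \<in> matrix_ball m M (q \<cdot>\<^sub>m msqrt (minv (PhiM w))) (msqrt (minv (PsiM w)))"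
    then obtain K where K: "K \<in> carrier_mat m m" "spec_norm K \<le> 1" "X = ?T K" unfolding matrix_ball_def by blast
    have X: "X \<in> carrier_mat m m" using T(1)[OF K(1)] K(3) by simp
    have "contr m (to_f K)" using K(2) by (simp add: spec_norm_le_1_iff[OF K(1)])
    then have "\<exists>K'. contr m K' \<and> to_f X = to_f M + sc q (to_f (msqrt (minv (PhiM w))) * K' * to_f (msqrt (minv (PsiM w))))"
      unfolding K(3) T(2)[OF K(1)] by (intro exI[of _ "to_f K"] conjI refl)
    then have "\<exists>F. res.interp F \<and> to_f (F w) = to_f X" by (rule iffD2[OF vi[OF shaped_to_f'[OF X]]])
    then obtain F where F: "res.interp F" "to_f (F w) = to_f X" by blast
    then have "F w = X" using X by (intro to_f_inject) (auto simp: res.interp_def mero_disk_def)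
    with F show "X \<in> {f w | f. f \<in> \<PP>}" by (auto simp: PJ0_int_iff)
  qed
  have "to_f (MmM w * minv (PsiM w)) = to_f M * res.PsiR w * Psi'"
    using matrices(7,8)[of w] RR vb(2)[OF Phi(1) Psi(1)] by (simp add: to_f_mult M(2))
  also have "\<dots> = to_f M" by (rule inverse_pair_cancel_right[OF Psi(1) shaped_to_f'[OF M(1)]])
  finally show "M = MmM w * minv (PsiM w)"
    using M(1) matrices(7)[of w] RR(1) by (intro to_f_inject) auto
  have "fdet m (res.PhiR w) * fdet m Phi' = 1" "fdet m (res.PsiR w) * fdet m Psi' = 1"
    using Phi(1) Psi(1) by (auto intro: inverse_pair_det)
  moreover have "fdet m (res.PhiR w) = fdet m (res.PsiR w)" by (rule res.det_PhiR[OF w P])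
  ultimately have "fdet m Phi' = fdet m Psi'" by (metis mult_left_cancel mult_zero_left zero_neq_one)
  then show "Determinant.det (minv (PhiM w)) = Determinant.det (minv (PsiM w))"
    using LL(1) RR(1) by (simp flip: LL(2) RR(2) add: to_m_to_f)
qed

end

theorem theorem5p8:
  fixes m n :: nat and J :: "complex mat" and A :: "nat \<Rightarrow> complex mat" and w :: complex
  assumes "0 < m"
    and "signature_mat m J"
    and "strict_J_Potapov m J n A"
    and "w \<in> unit_disk"
  shows
  "let \<pi> = pi_fun m J A n; \<rho> = rho_fun m J A n; \<sigma> = sigma_fun m J A n; \<tau> = tau_fun m J A n;
       L = Lmat m J A n; R = Rmat m J A n;
       \<pi>t = tilde m n \<pi>; \<rho>t = tilde m n \<rho>; \<sigma>t = tilde m n \<sigma>; \<tau>t = tilde m n \<tau>;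
       \<P> = PJ0_int m J n A;
       Hn = unit_disk \<inter> \<Inter> {hol_pts m f | f. f \<in> \<P>};
       Xi = w \<cdot>\<^sub>m (msqrt R * minv (\<rho> w) * J * \<sigma>t w * minv (msqrt L));
       aw = complex_of_real ((cmod w)\<^sup>2);
       \<Phi> = madj (\<tau> w) * minv L * \<tau> w - aw \<cdot>\<^sub>m (J * madj (\<pi>t w) * minv R * \<pi>t w * J);
       \<Psi> = \<rho> w * minv R * madj (\<rho> w) - aw \<cdot>\<^sub>m (J * \<sigma>t w * minv L * madj (\<sigma>t w) * J);
       M = minv \<Phi> * (madj (\<tau> w) * minv L * \<sigma> w - aw \<cdot>\<^sub>m (J * madj (\<pi>t w) * minv R * \<rho>t w * J));
       LL = minv \<Phi>; RR = minv \<Psi>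
   in ((\<forall>f\<in>\<P>. w \<in> hol_pts m f) \<longleftrightarrow> (det (\<rho> w) \<noteq> 0 \<and> spec_norm Xi < 1))
      \<and> open Hn \<and> (\<exists>r>0. ball 0 r \<subseteq> Hn)
      \<and> (w \<in> Hn \<longrightarrow>
           posdef \<Phi> \<and> posdef \<Psi>
           \<and> {f w | f. f \<in> \<P>} = matrix_ball m M (complex_of_real (cmod w ^ (n+1)) \<cdot>\<^sub>m msqrt LL) (msqrt RR)
           \<and> M = (\<pi> w * minv R * madj (\<rho> w) - aw \<cdot>\<^sub>m (J * \<tau>t w * minv L * madj (\<sigma>t w) * J)) * minv \<Psi>)
      \<and> (w \<in> Hn \<longrightarrow> det LL = det RR)"
proof -
  interpret p: potapov m n J A using assms(1-3) by unfold_locales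
  have "(\<forall>f\<in>PJ0_int m J n A. w \<in> hol_pts m f) \<longleftrightarrow> det (rho_fun m J A n w) \<noteq> 0 \<and> spec_norm (p.Xi w) < 1"
    using p.res.hol_at_iff[OF assms(4)] unfolding p.hol_at_criterion Ball_def p.PJ0_int_iff .
  with p.hol_points_nhd p.ball_description[of w] show ?thesis
    unfolding Let_def p.hol_points p.Xi_def p.PhiM_def p.PsiM_def p.CcM_def p.MmM_def by blast
qed

end
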